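(* Let $\mu$ be an integrable probability measure on $\mathbb{R}$ with mean zero. For every $\lambda\geq0$, let $\mu_\lambda$ denote the image of $\mu$ under $y\longmapsto\sqrt{\lambda}\,y$ (so $\mu_1=\mu$). Let $(B_s,s\geq0)$ be a one-dimensional Brownian motion started at $0$ on a filtered probability space $(\Omega,\mathcal{F},(\mathcal{F}_s,s\geq0),\mathbb{P})$ satisfying the usual conditions. For $\lambda\geq 0$ and $(t,x)$ define $$u_\lambda(t,x)=\sup_{\sigma\in\mathcal{T}_B^t}\mathbb{E}\left[v_{\delta_0}(x+B_\sigma)+\left(v_{\mu_\lambda}-v_{\delta_0}\right)(x+B_\sigma)\mathbf{1}_{\sigma<t}\right],$$ where $\mathcal{T}_B^t$ is the set of all $(\mathcal{F}_s)$-stopping times with values in $[0,t]$, and for a probability measure $\nu$, $v_\nu(x)=-\int_{\mathbb{R}}|x-y|\,\nu(dy)$ (so $v_{\delta_0}(x)=-|x|$). For $\lambda>0$ let $r_\lambda$ be the barrier function of the regular Root barrier $R_\lambda$ inducing the Root solution of the Skorokhod embedding problem for $\mu_\lambda$. Then: (i) for every $\lambda>0$, $$u_\lambda(t,x)=\sqrt{\lambda}\,u_1\!\left(\frac{t}{\lambda},\frac{x}{\sqrt{\lambda}}\right)\quad\text{for all }(t,x)\in[0,+\infty]\times[-\infty,+\infty];$$ (ii) the map $(\lambda,x)\longmapsto r_\lambda(x)$ is self-similar in the sense that $$r_\lambda(x)=\lambda\, r_1\!\left(\frac{x}{\sqrt{\lambda}}\right)\quad\text{for all }(\lambda,x)\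in\,]0,+\infty[\,\times[-\infty,+\infty].$$
   Context: Skorokhod embedding problem SEP($\nu$): a stopping time $\tau$ solves SEP($\nu$) if $B_\tau$ has law $\nu$ and $(B_{\tau\wedge t},t\geq0)$ is uniformly integrable. A Root barrier is a closed set $R\subset[0,+\infty]\times[-\infty,+\infty]$ such that (i) $(t,x)\in R$ implies $(s,x)\in R$ for all $s\geq t$, (ii) $(+\infty,x)\in R$ for all $x$, (iii) $[0,+\infty]\times\{-\infty,+\infty\}\subset R$. Its barrier function is $r(x)=\inf\{t\geq0:(t,x)\in R\}$, and $R=\{(t,x):t\geq r(x)\}$. A Root barrier is regular if $r$ vanishes outside $[x_-,x_+]$, where $x_-$ and $x_+$ are the first negative and first positive zeros of $r$. For an integrable centered $\nu$ there exists exactly one regular Root barrier $R$ such that $\tau=\inf\{t\geq0:(t,B_t)\in R\}$ solves SEP($\nu$); for $\nu=\mu_\lambda$ this barrier is $R_\lambda=\{(t,x):u_\lambda(t,x)=v_{\mu_\lambda}(x)\}$ with $u_\lambda$ as in the claim. *)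

theory Defs
  imports "HOL-Probability.Probability"
begin

definition filtration_usual :: "'a measure \<Rightarrow> (real \<Rightarrow> 'a measure) \<Rightarrow> bool" where
  "filtration_usual M F \<longleftrightarrow>
     prob_space M \<and>
     (\<forall>t\<ge>0. subalgebra M (F t)) \<and>
     (\<forall>s t. 0 \<le> s \<longrightarrow> s \<le> t \<longrightarrow> sets (F s) \<subseteq> sets (F t)) \<and>
     \<comment> \<open>right continuity\<close>
     (\<forall>t\<ge>0. sets (F t) = (\<Inter>u\<in>{t<..}. sets (F u))) \<and>
     \<comment> \<open>completeness: F 0 contains all subsets of M-null sets\<close>
     (\<forall>N\<in>null_sets M. \<forall>A. A \<subseteq> N \<longrightarrow> A \<in> sets (F 0))"

definition brownian_motion :: "'a measure \<Rightarrow> (real \<Rightarrow> 'a measure) \<Rightarrow> (real \<Rightarrow> 'a \<Rightarrow> real) \<Rightarrow> bool" where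
  "brownian_motion M F B \<longleftrightarrow>
     (\<forall>t\<ge>0. B t \<in> borel_measurable (F t)) \<and>
     (\<forall>\<omega>\<in>space M. B 0 \<omega> = 0 \<and> continuous_on {0..} (\<lambda>t. B t \<omega>)) \<and>
     (\<forall>s t. 0 \<le> s \<longrightarrow> s < t \<longrightarrow>
        distributed M lborel (\<lambda>\<omega>. B t \<omega> - B s \<omega>) (\<lambda>y. ennreal (normal_density 0 (sqrt (t - s)) y)) \<and>
        (\<forall>A\<in>sets (F s). \<forall>C\<in>sets borel.
           measure M (A \<inter> ((\<lambda>\<omega>. B t \<omega> - B s \<omega>) -` C \<inter> space M))
           = measure M A * measure M ((\<lambda>\<omega>. B t \<omega> - B s \<omega>) -` C \<inter> space M)))"

definition stopping_time_real :: "'a measure \<Rightarrow> (real \<Rightarrow> 'a measure) \<Rightarrow> ('a \<Rightarrow> real) \<Rightarrow> bool" where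
  "stopping_time_real M F \<sigma> \<longleftrightarrow>
     (\<forall>\<omega>\<in>space M. 0 \<le> \<sigma> \<omega>) \<and> (\<forall>s\<ge>0. {\<omega>\<in>space M. \<sigma> \<omega> \<le> s} \<in> sets (F s))"

definition stopping_time_ext :: "'a measure \<Rightarrow> (real \<Rightarrow> 'a measure) \<Rightarrow> ('a \<Rightarrow> ereal) \<Rightarrow> bool" where
  "stopping_time_ext M F \<tau> \<longleftrightarrow>
     (\<forall>\<omega>\<in>space M. 0 \<le> \<tau> \<omega>) \<and> (\<forall>s\<ge>0. {\<omega>\<in>space M. \<tau> \<omega> \<le> ereal s} \<in> sets (F s))"

definition potential :: "real measure \<Rightarrow> real \<Rightarrow> real" where
  "potential \<nu> x = - (\<integral>y. \<bar>x - y\<bar> \<partial>\<nu>)"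

definition scaled_measure :: "real measure \<Rightarrow> real \<Rightarrow> real measure" where
  "scaled_measure \<mu> lam = distr \<mu> borel (\<lambda>y. sqrt lam * y)"

text \<open>Expectation of a nonpositive extended-real random variable (always well defined,
  with values in [-\<infinity>,0]).\<close>
definition expect_nonpos :: "'a measure \<Rightarrow> ('a \<Rightarrow> ereal) \<Rightarrow> ereal" where
  "expect_nonpos M g = - enn2ereal (\<integral>\<^sup>+ \<omega>. e2ennreal (- g \<omega>) \<partial>M)"

text \<open>u_\<lambda>(t,x) for t \<in> [0,+\<infinity>] and real x; stopping times with values in [0,t]
  (for t = +\<infinity> these are the finite stopping times).\<close>
definition u_real :: "'a measure \<Rightarrow> (real \<Rightarrow> 'a measure) \<Rightarrow> (real \<Rightarrow> 'a \<Rightarrow> real) \<Rightarrow>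
    real measure \<Rightarrow> real \<Rightarrow> ereal \<Rightarrow> real \<Rightarrow> ereal" where
  "u_real M F B \<mu> lam t x =
     (SUP \<sigma>\<in>{\<sigma>. stopping_time_real M F \<sigma> \<and> (\<forall>\<omega>\<in>space M. ereal (\<sigma> \<omega>) \<le> t)}.
        expect_nonpos M (\<lambda>\<omega>. ereal (
           potential (return borel 0) (x + B (\<sigma> \<omega>) \<omega>)
           + (potential (scaled_measure \<mu> lam) (x + B (\<sigma> \<omega>) \<omega>)
              - potential (return borel 0) (x + B (\<sigma> \<omega>) \<omega>))
             * indicator {\<omega>. ereal (\<sigma> \<omega>) < t} \<omega>)))"

text \<open>Extension to x \<in> [-\<infinity>,+\<infinity>]: since v_\<nu>(\<plusminus>\<infinity>) = -\<infinity>, u(t,\<plusminus>\<infinity>) = -\<infinity>.\<close>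
definition u_fun :: "'a measure \<Rightarrow> (real \<Rightarrow> 'a measure) \<Rightarrow> (real \<Rightarrow> 'a \<Rightarrow> real) \<Rightarrow>
    real measure \<Rightarrow> real \<Rightarrow> ereal \<Rightarrow> ereal \<Rightarrow> ereal" where
  "u_fun M F B \<mu> lam t x =
     (if \<bar>x\<bar> = \<infinity> then -\<infinity> else u_real M F B \<mu> lam t (real_of_ereal x))"

definition unif_integrable :: "'a measure \<Rightarrow> (real \<Rightarrow> 'a \<Rightarrow> real) \<Rightarrow> bool" where
  "unif_integrable M X \<longleftrightarrow>
     (\<forall>t\<ge>0. integrable M (X t)) \<and>
     (\<forall>e>0. \<exists>K. \<forall>t\<ge>0. (\<integral>\<omega>. \<bar>X t \<omega>\<bar> * indicator {\<omega>. K < \<bar>X t \<omega>\<bar>} \<omega> \<partial>M) < e)"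

definition solves_SEP :: "'a measure \<Rightarrow> (real \<Rightarrow> 'a measure) \<Rightarrow> (real \<Rightarrow> 'a \<Rightarrow> real) \<Rightarrow>
    real measure \<Rightarrow> ('a \<Rightarrow> ereal) \<Rightarrow> bool" where
  "solves_SEP M F B \<nu> \<tau> \<longleftrightarrow>
     stopping_time_ext M F \<tau> \<and>
     (AE \<omega> in M. \<tau> \<omega> < \<infinity>) \<and>
     distr M borel (\<lambda>\<omega>. B (real_of_ereal (\<tau> \<omega>)) \<omega>) = \<nu> \<and>
     unif_integrable M (\<lambda>t \<omega>. B (real_of_ereal (min (\<tau> \<omega>) (ereal t))) \<omega>)"

definition root_barrier :: "(ereal \<times> ereal) set \<Rightarrow> bool" where
  "root_barrier R \<longleftrightarrow>
     closed R \<and> R \<subseteq> {0..} \<times> UNIV \<and>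
     (\<forall>t x s. (t, x) \<in> R \<longrightarrow> t \<le> s \<longrightarrow> (s, x) \<in> R) \<and>
     (\<forall>x. (\<infinity>, x) \<in> R) \<and>
     (\<forall>t\<ge>0. (t, \<infinity>) \<in> R \<and> (t, -\<infinity>) \<in> R)"

definition barrier_fun :: "(ereal \<times> ereal) set \<Rightarrow> ereal \<Rightarrow> ereal" where
  "barrier_fun R x = Inf {t. 0 \<le> t \<and> (t, x) \<in> R}"

definition regular_root_barrier :: "(ereal \<times> ereal) set \<Rightarrow> bool" where
  "regular_root_barrier R \<longleftrightarrow> root_barrier R \<and>
     (let r = barrier_fun R;
          xm = Sup {x. x \<le> 0 \<and> r x = 0};
          xp = Inf {x. 0 \<le> x \<and> r x = 0}
      in \<forall>x. x \<notin> {xm..xp} \<longrightarrow> r x = 0)"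

definition hitting_time :: "(real \<Rightarrow> 'a \<Rightarrow> real) \<Rightarrow> (ereal \<times> ereal) set \<Rightarrow> 'a \<Rightarrow> ereal" where
  "hitting_time B R \<omega> = Inf {ereal s | s. 0 \<le> s \<and> (ereal s, ereal (B s \<omega>)) \<in> R}"

definition root_barrier_fun :: "'a measure \<Rightarrow> (real \<Rightarrow> 'a measure) \<Rightarrow> (real \<Rightarrow> 'a \<Rightarrow> real) \<Rightarrow>
    real measure \<Rightarrow> real \<Rightarrow> ereal \<Rightarrow> ereal" where
  "root_barrier_fun M F B \<mu> lam =
     barrier_fun (THE R. regular_root_barrier R \<and>
                         solves_SEP M F B (scaled_measure \<mu> lam) (hitting_time B R))"

end

theory Submission
  imports Defs
begin

text \<open>
  Existence and uniqueness of the regular Root barrier turn (ii) into the statement that rescaling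
  the barrier for \<open>\<mu>\<close> gives a regular barrier solving the embedding problem for the scaled measure. As
  the probability space need not carry the time-changed Brownian motion with its filtration, scaling
  is transferred through laws: the law of the stopped path is a limit of recursions with Gaussian kernels
  over dyadic grids, and these recursions scale exactly. Uniqueness follows Loynes (the minimum of two
  embeddings is an embedding, and strict convexity makes it equal to both), combined with the
  fact that the path reaches any point outside a regular barrier with positive probability without
  meeting the barrier before. For finite laws existence comes from the minimal barrier that does not
  overcharge an atom; conditional expectations on dyadic cells and compactness of the space of barriers
  give the general case. For (i), \<open>u\<close> is the limit of values of discrete stopping problems,
  given by backward recursions with the same kernels; for infinite horizon it equals
  the supremum of the potential, since every level is hit.
\<close>

section \<open>Brownian increments\<close>

text \<open>Regularity enters the uniqueness proof at one place only: it keeps the segment from 0 to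
  a point outside the barrier clear at time 0, so that the path can rush along it and wait.
  Existence and the comparison of embeddings are carried out for plain Root barriers, and a barrier
  is regularised afterwards, because the path cannot see the part that is added. Hitting times
  depend continuously on the barrier because the path oscillates strictly around its value right
  after a stopping time; this is obtained from optional stopping, in place of the strong Markov
  property. An integrable law need not have a second moment, so tails are controlled by expectations
  of \<open>hyp K\<close>: conditional expectation lowers them, and along the stopped path they
  increase to the terminal value. One bound thus yields finiteness and uniform integrability and
  survives limits. The value function is treated with reversed sign, as an infimum of nonnegative
  integrals, which are defined for every finite stopping time.\<close>

definition gauss :: "real measure" where
  "gauss = density lborel (\<lambda>x. ennreal (std_normal_density x))"

lemma sets_gauss[simp, measurable_cong]: "sets gauss = sets borel" and space_gauss[simp]: "space gauss = UNIV"
  by (auto simp: gauss_def)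

interpretation gauss: prob_space gauss
  unfolding gauss_def by (rule prob_space_normal_density) simp

locale brownian =
  fixes M :: "'a measure" and F :: "real \<Rightarrow> 'a measure" and B :: "real \<Rightarrow> 'a \<Rightarrow> real"
  assumes usual: "filtration_usual M F" and bm: "brownian_motion M F B"

sublocale brownian \<subseteq> prob_space M
  using usual unfolding filtration_usual_def by (elim conjE)

context brownian begin

lemma sub_F: "0 \<le> t \<Longrightarrow> subalgebra M (F t)"
  using usual unfolding filtration_usual_def by (elim conjE allE[where x=t]) simp

lemma space_F: "0 \<le> t \<Longrightarrow> space (F t) = space M"
  and sets_F: "0 \<le> t \<Longrightarrow> A \<in> sets (F t) \<Longrightarrow> A \<in> sets M"
  using sub_F[of t] by (auto simp: subalgebra_def)

lemma F_mono: "0 \<le> s \<Longrightarrow> s \<le> t \<Longrightarrow> A \<in> sets (F s) \<Longrightarrow> A \<in> sets (F t)"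
  using usual unfolding filtration_usual_def by blast

lemma meas_F_mono: "0 \<le> s \<Longrightarrow> s \<le> t \<Longrightarrow> X \<in> measurable (F s) N \<Longrightarrow> X \<in> measurable (F t) N"
  by (auto simp: measurable_def space_F intro: F_mono)

lemma meas_F: "0 \<le> s \<Longrightarrow> X \<in> measurable (F s) N \<Longrightarrow> X \<in> measurable M N"
  by (auto simp: measurable_def space_F intro: sets_F)

lemma B_adapted: "0 \<le> s \<Longrightarrow> s \<le> t \<Longrightarrow> B s \<in> borel_measurable (F t)"
  using bm by (auto simp: brownian_motion_def intro: meas_F_mono)

lemma B_meas: "0 \<le> s \<Longrightarrow> B s \<in> borel_measurable M"
  using B_adapted meas_F by blast

lemma B_0: "\<omega> \<in> space M \<Longrightarrow> B 0 \<omega> = 0"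
  and B_cont: "\<omega> \<in> space M \<Longrightarrow> continuous_on {0..} (\<lambda>t. B t \<omega>)"
  using bm by (auto simp: brownian_motion_def)

lemma B_incr_distributed:
  assumes "0 \<le> s" "s < t"
  shows "distributed M lborel (\<lambda>\<omega>. (B t \<omega> - B s \<omega>) / sqrt (t - s)) std_normal_density"
proof -
  have "distributed M lborel (\<lambda>\<omega>. B t \<omega> - B s \<omega>) (\<lambda>y. ennreal (normal_density 0 (sqrt (t - s)) y))"
    using bm assms unfolding brownian_motion_def by blast
  then show ?thesis
    using assms by (subst (asm) normal_standard_normal_convert) simp_all
qed

text \<open>The product rule for events in the definition of Brownian motion is lifted to generated
  sigma-algebras: that of \<open>X\<close> lies inside \<open>F s\<close>, and that of the increment
  consists of preimages only.\<close>

lemma indep_incr: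
  fixes N :: "real measure"
  assumes "0 \<le> s" "s < t" and X: "X \<in> measurable (F s) N"
  shows "indep_var N X borel (\<lambda>\<omega>. B t \<omega> - B s \<omega>)"
proof -
  note X' = meas_F[OF assms(1) X]
  have Y: "(\<lambda>\<omega>. B t \<omega> - B s \<omega>) \<in> borel_measurable M"
    using B_meas assms by simp
  have sX: "sigma_sets (space M) {X -` A \<inter> space M |A. A \<in> sets N} \<subseteq> sets (F s)"
    using X assms by (intro sets.sigma_sets_subset')
       (auto simp: space_F[symmetric] intro: measurable_sets)
  have sY: "a \<in> sigma_sets (space M) {(\<lambda>\<omega>. B t \<omega> - B s \<omega>) -` A \<inter> space M |A. A \<in> sets borel}
     \<Longrightarrow> \<exists>C\<in>sets borel. a = (\<lambda>\<omega>. B t \<omega> - B s \<omega>) -` C \<inter> space M" for a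
    using sigma_sets_vimage_commute[of "\<lambda>\<omega>. B t \<omega> - B s \<omega>" "space M" UNIV "sets borel"]
    by (auto simp: sets.sigma_sets_eq[of borel, simplified])
  show ?thesis
    unfolding indep_var_eq indep_sets2_eq
  proof (intro conjI X' Y ballI)
    show "sigma_sets (space M) {X -` A \<inter> space M |A. A \<in> sets N} \<subseteq> events"
      using sX sets_F assms by auto
    show "sigma_sets (space M) {(\<lambda>\<omega>. B t \<omega> - B s \<omega>) -` A \<inter> space M |A. A \<in> sets borel} \<subseteq> events"
      using sY measurable_sets[OF Y] by blast
    fix a b assume "a \<in> sigma_sets (space M) {X -` A \<inter> space M |A. A \<in> sets N}"
     "b \<in> sigma_sets (space M) {(\<lambda>\<omega>. B t \<omega> - B s \<omega>) -` A \<inter> space M |A. A \<in> sets borel}"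
    then show "prob (a \<inter> b) = prob a * prob b"
      using sX sY[of b] bm assms by (auto simp: brownian_motion_def)
  qed
qed

lemma distr_incr:
  assumes "0 \<le> s" "s < t"
  shows "distr M borel (\<lambda>\<omega>. B t \<omega> - B s \<omega>) = distr gauss borel (\<lambda>z. sqrt (t - s) * z)"
proof -
  let ?Z = "\<lambda>\<omega>. (B t \<omega> - B s \<omega>) / sqrt (t - s)"
  note D = B_incr_distributed[OF assms]
  have *: "distr M lborel ?Z = gauss"
    using D by (simp add: distributed_def gauss_def)
  have Z: "?Z \<in> measurable M lborel" using D by (simp add: distributed_def)
  have "distr gauss borel (\<lambda>z. sqrt (t - s) * z) = distr M borel ((\<lambda>z. sqrt (t - s) * z) \<circ> ?Z)"
    unfolding *[symmetric] by (intro distr_distr) (use Z in auto)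
  also have "\<dots> = distr M borel (\<lambda>\<omega>. B t \<omega> - B s \<omega>)"
    using assms by (intro distr_cong) (auto simp: o_def)
  finally show ?thesis ..
qed

text \<open>The joint law of the past \<open>X\<close> and the increment is a product, so Fubini
  replaces the increment by a Gaussian variable integrated separately. \<open>N\<close> may be any
  space because later the past is a pair of an indicator and a position.\<close>

lemma nn_integral_incr:
  assumes "0 \<le> s" "s \<le> t" and X: "X \<in> measurable (F s) N" and g: "g \<in> borel_measurable (N \<Otimes>\<^sub>M borel)"
  shows "(\<integral>\<^sup>+\<omega>. g (X \<omega>, B t \<omega> - B s \<omega>) \<partial>M) = (\<integral>\<^sup>+\<omega>. (\<integral>\<^sup>+z. g (X \<omega>, sqrt (t - s) * z) \<partial>gauss) \<partial>M)"
proof (cases "s = t")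
  case True
  then show ?thesis by (simp add: gauss.emeasure_space_1[simplified])
next
  case False
  with assms have st: "s < t" by simp
  let ?Y = "\<lambda>\<omega>. B t \<omega> - B s \<omega>"
  note X' = meas_F[OF assms(1) X]
  have Y: "?Y \<in> borel_measurable M" using B_meas assms by simp
  note [measurable] = X' Y g
  interpret Y: prob_space "distr M borel ?Y" by (rule prob_space_distr) simp
  have X0: "X \<in> measurable (F s) N" by (rule X)
  interpret X: prob_space "distr M N X" by (rule prob_space_distr) (rule X')
  have eq: "distr M (N \<Otimes>\<^sub>M borel) (\<lambda>\<omega>. (X \<omega>, ?Y \<omega>)) = distr M N X \<Otimes>\<^sub>M distr M borel ?Y"
  proof (rule pair_measure_eqI[symmetric])
    fix A C assume A: "A \<in> sets (distr M N X)" and C: "C \<in> sets (distr M borel ?Y)"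
    have A': "X -` A \<inter> space M \<in> sets (F s)"
      using measurable_sets[OF X0, of A] A assms by (simp add: space_F)
    have "(\<lambda>\<omega>. (X \<omega>, ?Y \<omega>)) -` (A \<times> C) \<inter> space M = (X -` A \<inter> space M) \<inter> (?Y -` C \<inter> space M)"
      by auto
    then show "emeasure (distr M N X) A * emeasure (distr M borel ?Y) C
       = emeasure (distr M (N \<Otimes>\<^sub>M borel) (\<lambda>\<omega>. (X \<omega>, ?Y \<omega>))) (A \<times> C)"
      using A C A' bm assms(1) st
      by (simp add: emeasure_distr emeasure_eq_measure ennreal_mult[symmetric] brownian_motion_def)
  qed (auto intro: X.sigma_finite_measure_axioms Y.sigma_finite_measure_axioms)
  have g': "g \<in> borel_measurable (distr M N X \<Otimes>\<^sub>M distr M borel ?Y)"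
    by (subst eq[symmetric]) simp
  have "(\<integral>\<^sup>+\<omega>. g (X \<omega>, ?Y \<omega>) \<partial>M) = (\<integral>\<^sup>+p. g p \<partial>distr M (N \<Otimes>\<^sub>M borel) (\<lambda>\<omega>. (X \<omega>, ?Y \<omega>)))"
    by (subst nn_integral_distr) auto
  also have "\<dots> = (\<integral>\<^sup>+x. (\<integral>\<^sup>+y. g (x, y) \<partial>distr M borel ?Y) \<partial>distr M N X)"
    unfolding eq by (intro Y.nn_integral_fst[symmetric] g')
  also have "\<dots> = (\<integral>\<^sup>+\<omega>. (\<integral>\<^sup>+y. g (X \<omega>, y) \<partial>distr M borel ?Y) \<partial>M)"
    by (intro nn_integral_distr X') simp
  also have "\<dots> = (\<integral>\<^sup>+\<omega>. (\<integral>\<^sup>+z. g (X \<omega>, sqrt (t - s) * z) \<partial>gauss) \<partial>M)"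
    unfolding distr_incr[OF assms(1) st]
    by (intro nn_integral_cong nn_integral_distr) (auto intro: measurable_Pair2[OF g] dest: measurable_space[OF X'])
  finally show ?thesis .
qed

lemma incr_moments:
  assumes *: "0 \<le> s" "s \<le> t"
  shows "integrable M (\<lambda>\<omega>. B t \<omega> - B s \<omega>) \<and> integrable M (\<lambda>\<omega>. (B t \<omega> - B s \<omega>)\<^sup>2) \<and>
    expectation (\<lambda>\<omega>. B t \<omega> - B s \<omega>) = 0 \<and> expectation (\<lambda>\<omega>. (B t \<omega> - B s \<omega>)\<^sup>2) = t - s"
  proof (cases "s = t")
    case True
    show ?thesis unfolding True by simp
  next
    case False
    with * have st: "s < t" by simp
    define Z where "Z = (\<lambda>\<omega>. (B t \<omega> - B s \<omega>) / sqrt (t - s))"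
    have D: "distributed M lborel Z std_normal_density"
      unfolding Z_def by (rule B_incr_distributed[OF *(1) st])
    have Zi: "integrable M (\<lambda>\<omega>. Z \<omega> ^ k)" for k
      using distributed_integrable[OF D, of "\<lambda>x. x ^ k"] integrable_std_normal_moment[of k] by simp
    have Ze: "expectation Z = 0" by (rule standard_normal_distributed_expectation[OF D])
    have Zv: "expectation (\<lambda>\<omega>. (Z \<omega>)\<^sup>2) = 1"
      using standard_normal_distributed_variance[OF D] by (simp add: Ze)
    have eq1: "B t \<omega> - B s \<omega> = sqrt (t - s) * Z \<omega>" for \<omega>
      unfolding Z_def using st by simp
    have eq2: "(B t \<omega> - B s \<omega>)\<^sup>2 = (t - s) * (Z \<omega>)\<^sup>2" for \<omega>
      unfolding eq1 using st by (simp add: power_mult_distrib)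
    have "integrable M (\<lambda>\<omega>. B t \<omega> - B s \<omega>)"
      unfolding eq1 using Zi[of 1] by simp
    moreover have "integrable M (\<lambda>\<omega>. (B t \<omega> - B s \<omega>)\<^sup>2)"
      unfolding eq2 using Zi[of 2] by simp
    moreover have "expectation (\<lambda>\<omega>. B t \<omega> - B s \<omega>) = 0"
      unfolding eq1 using Ze by simp
    moreover have "expectation (\<lambda>\<omega>. (B t \<omega> - B s \<omega>)\<^sup>2) = t - s"
      unfolding eq2 using Zv by simp
    ultimately show ?thesis by (intro conjI)
  qed

lemmas integrable_incr = incr_moments[THEN conjunct1]
lemmas integrable_incr_sq = incr_moments[THEN conjunct2, THEN conjunct1]
lemmas expectation_incr = incr_moments[THEN conjunct2, THEN conjunct2, THEN conjunct1]
lemmas expectation_incr_sq = incr_moments[THEN conjunct2, THEN conjunct2, THEN conjunct2]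

lemma integrable_B: "0 \<le> t \<Longrightarrow> integrable M (B t)"
  using integrable_incr[of 0 t] by (subst (asm) Bochner_Integration.integrable_cong[where g="B t", OF refl]) (auto simp: B_0)

text \<open>Martingale property in product form: independence separates the factor known at time
  \<open>s\<close>, and the increment has mean zero.\<close>

lemma
  assumes "0 \<le> s" "s \<le> t" and X: "X \<in> borel_measurable (F s)" and i: "integrable M (X :: 'a \<Rightarrow> real)"
  shows integrable_mult_incr: "integrable M (\<lambda>\<omega>. X \<omega> * (B t \<omega> - B s \<omega>))"
    and expectation_mult_incr: "expectation (\<lambda>\<omega>. X \<omega> * (B t \<omega> - B s \<omega>)) = 0"
proof -
  have "integrable M (\<lambda>\<omega>. X \<omega> * (B t \<omega> - B s \<omega>)) \<and> expectation (\<lambda>\<omega>. X \<omega> * (B t \<omega> - B s \<omega>)) = 0"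
  proof (cases "s = t")
    case False
    with assms have st: "s < t" by simp
    show ?thesis
      using indep_var_integrable[OF indep_incr[OF assms(1) st X] i integrable_incr]
        indep_var_lebesgue_integral[OF indep_incr[OF assms(1) st X] i integrable_incr]
        expectation_incr[of s t] assms by simp
  qed auto
  then show "integrable M (\<lambda>\<omega>. X \<omega> * (B t \<omega> - B s \<omega>))" "expectation (\<lambda>\<omega>. X \<omega> * (B t \<omega> - B s \<omega>)) = 0"
    by auto
qed

end

section \<open>Stopping times\<close>

text \<open>Rounding goes up: the rounded value of a stopping time is known once it has been
  reached, which rounding down would not give.\<close>

definition dyadic_up :: "nat \<Rightarrow> real \<Rightarrow> real" where
  "dyadic_up n s = real_of_int \<lceil>2 ^ n * s\<rceil> / 2 ^ n"

lemma dyadic_up_ge: "s \<le> dyadic_up n s"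
  unfolding dyadic_up_def by (simp add: pos_le_divide_eq mult.commute)

lemma dyadic_up_le: "dyadic_up n s \<le> s + 1 / 2 ^ n"
proof -
  have "real_of_int \<lceil>2 ^ n * s\<rceil> \<le> 2 ^ n * s + 1" by linarith
  then have "dyadic_up n s \<le> (2 ^ n * s + 1) / 2 ^ n"
    unfolding dyadic_up_def by (rule divide_right_mono) simp
  also have "\<dots> = s + 1 / 2 ^ n" by (simp add: field_simps)
  finally show ?thesis .
qed

lemma dyadic_up_tendsto: "(\<lambda>n. dyadic_up n s) \<longlonglongrightarrow> s"
proof (rule tendsto_sandwich[of "\<lambda>_. s" _ _ "\<lambda>n. s + 1 / 2 ^ n"])
  show "(\<lambda>n. s + 1 / 2 ^ n) \<longlonglongrightarrow> s"
    using tendsto_add[OF tendsto_const[of s] LIMSEQ_divide_realpow_zero[of 2 1]] by simp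
qed (auto simp: dyadic_up_ge dyadic_up_le)

lemma dyadic_up_nat: "0 \<le> s \<Longrightarrow> dyadic_up n s = real (nat \<lceil>2 ^ n * s\<rceil>) / 2 ^ n"
  unfolding dyadic_up_def by simp

lemma continuous_on_LIMSEQ:
  fixes f :: "'b::t2_space \<Rightarrow> 'c::topological_space"
  assumes "continuous_on S f" "x \<in> S" "\<And>n. u n \<in> S" "u \<longlonglongrightarrow> x"
  shows "(\<lambda>n. f (u n)) \<longlonglongrightarrow> f x"
  using assms continuous_on_tendsto_compose[of S f u x sequentially] by auto

text \<open>The rounded time takes countably many values, so evaluation at it is measurable;
  continuity of the paths passes this to the limit.\<close>

lemma borel_measurable_at_time:
  fixes X :: "real \<Rightarrow> 'a \<Rightarrow> real"
  assumes X: "\<And>t. 0 \<le> t \<Longrightarrow> X t \<in> borel_measurable N"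
    and cont: "\<And>\<omega>. \<omega> \<in> space N \<Longrightarrow> continuous_on {0..} (\<lambda>t. X t \<omega>)"
    and \<sigma>: "\<sigma> \<in> borel_measurable N" "\<And>\<omega>. \<omega> \<in> space N \<Longrightarrow> 0 \<le> \<sigma> \<omega>"
  shows "(\<lambda>\<omega>. X (\<sigma> \<omega>) \<omega>) \<in> borel_measurable N"
proof (rule borel_measurable_LIMSEQ_real)
  fix n
  have "(\<lambda>\<omega>. X (real (nat \<lceil>2 ^ n * \<sigma> \<omega>\<rceil>) / 2 ^ n) \<omega>) \<in> borel_measurable N"
    by (rule measurable_compose_countable[where f="\<lambda>k. X (real k / 2 ^ n)"])
       (use X \<sigma>(1) in auto)
  then show "(\<lambda>\<omega>. X (dyadic_up n (\<sigma> \<omega>)) \<omega>) \<in> borel_measurable N"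
    by (subst measurable_cong[where g="\<lambda>\<omega>. X (real (nat \<lceil>2 ^ n * \<sigma> \<omega>\<rceil>) / 2 ^ n) \<omega>"])
       (auto simp: dyadic_up_nat \<sigma>(2))
next
  fix \<omega> assume \<omega>: "\<omega> \<in> space N"
  show "(\<lambda>n. X (dyadic_up n (\<sigma> \<omega>)) \<omega>) \<longlonglongrightarrow> X (\<sigma> \<omega>) \<omega>"
    using \<sigma>(2)[OF \<omega>] order_trans[OF \<sigma>(2)[OF \<omega>] dyadic_up_ge]
    by (intro continuous_on_LIMSEQ[OF cont[OF \<omega>]] dyadic_up_tendsto) auto
qed

text \<open>The target is a closed half-line, so hitting any closed set takes this form after
  composition with a distance function, and the infimum is attained for continuous
  \<open>y\<close>.\<close>

definition first_time :: "(real \<Rightarrow> real) \<Rightarrow> ereal" where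
  "first_time y = Inf {ereal s | s. 0 \<le> s \<and> y s \<le> 0}"

lemma first_time_nonneg: "0 \<le> first_time y"
  unfolding first_time_def by (rule Inf_greatest) auto

text \<open>If \<open>y\<close> is positive on [0, s], continuity at \<open>s\<close> keeps it
  positive a little longer, so the infimum lies strictly beyond \<open>s\<close>.\<close>

lemma first_time_le_iff:
  assumes c: "continuous_on {0..} y" and s: "0 \<le> s"
  shows "first_time y \<le> ereal s \<longleftrightarrow> (\<exists>u\<in>{0..s}. y u \<le> 0)"
proof
  assume L: "first_time y \<le> ereal s"
  show "\<exists>u\<in>{0..s}. y u \<le> 0"
  proof (rule ccontr)
    assume "\<not> ?thesis"
    then have pos: "\<And>u. 0 \<le> u \<Longrightarrow> u \<le> s \<Longrightarrow> 0 < y u" by (auto simp: not_le)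
    have "0 < y s" using pos s by simp
    with c s obtain d where d: "d > 0" "\<And>u. 0 \<le> u \<Longrightarrow> dist u s < d \<Longrightarrow> dist (y u) (y s) < y s"
      unfolding continuous_on_iff by (metis atLeast_iff)
    have pos': "0 < y u" if "0 \<le> u" "u < s + d" for u
      using d(2)[of u] pos[of u] that by (cases "u \<le> s") (auto simp: dist_real_def)
    have "ereal (s + d) \<le> first_time y"
      unfolding first_time_def
    proof (rule Inf_greatest)
      fix z assume "z \<in> {ereal s |s. 0 \<le> s \<and> y s \<le> 0}"
      then obtain v where "z = ereal v" "0 \<le> v" "y v \<le> 0" by auto
      with pos'[of v] show "ereal (s + d) \<le> z" by (auto simp: not_le[symmetric])
    qed
    from order_trans[OF this L] d(1) show False by simp
  qed
next
  assume "\<exists>u\<in>{0..s}. y u \<le> 0"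
  then obtain u where "0 \<le> u" "u \<le> s" "y u \<le> 0" by auto
  then show "first_time y \<le> ereal s"
    unfolding first_time_def by (intro Inf_lower2[of "ereal u"]) auto
qed

lemma first_time_attained:
  assumes c: "continuous_on {0..} y" and s: "first_time y = ereal s"
  shows "y s \<le> 0"
proof -
  have s0: "0 \<le> s" using first_time_nonneg[of y] s by simp
  then obtain u where u: "0 \<le> u" "u \<le> s" "y u \<le> 0"
    using first_time_le_iff[OF c s0] s by auto
  then have "first_time y \<le> ereal u"
    using first_time_le_iff[OF c u(1)] by auto
  with s u have "u = s" by simp
  with u show ?thesis by simp
qed

lemma before_first_time: "0 \<le> u \<Longrightarrow> ereal u < first_time y \<Longrightarrow> 0 < y u"
  unfolding first_time_def by (metis (mono_tags, lifting) Inf_lower mem_Collect_eq not_le)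

context brownian begin

abbreviation "stop_real \<equiv> stopping_time_real M F"
abbreviation "stop_ext \<equiv> stopping_time_ext M F"

lemma stop_real_nonneg: "stop_real \<sigma> \<Longrightarrow> \<omega> \<in> space M \<Longrightarrow> 0 \<le> \<sigma> \<omega>"
  and stop_real_sets: "stop_real \<sigma> \<Longrightarrow> 0 \<le> s \<Longrightarrow> {\<omega>\<in>space M. \<sigma> \<omega> \<le> s} \<in> sets (F s)"
  and stop_ext_nonneg: "stop_ext \<tau> \<Longrightarrow> \<omega> \<in> space M \<Longrightarrow> 0 \<le> \<tau> \<omega>"
  and stop_ext_sets: "stop_ext \<tau> \<Longrightarrow> 0 \<le> s \<Longrightarrow> {\<omega>\<in>space M. \<tau> \<omega> \<le> ereal s} \<in> sets (F s)"
  by (auto simp: stopping_time_real_def stopping_time_ext_def)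

lemma stop_real_le_measurable[measurable (raw)]:
  assumes "stop_real \<sigma>" "0 \<le> s"
  shows "(\<lambda>\<omega>. min (\<sigma> \<omega>) s) \<in> borel_measurable (F s)"
  unfolding borel_measurable_iff_le
proof
  fix a
  have *: "space (F s) = space M" using assms space_F by simp
  consider "a < 0" | "0 \<le> a" "a < s" | "s \<le> a" by linarith
  then show "{w \<in> space (F s). min (\<sigma> w) s \<le> a} \<in> sets (F s)"
  proof cases
    case 1
    have "0 \<le> min (\<sigma> w) s" if "w \<in> space M" for w
      using stop_real_nonneg[OF assms(1) that] assms(2) by simp
    with 1 have "{w \<in> space (F s). min (\<sigma> w) s \<le> a} = {}"
      unfolding * by fastforce
    then show ?thesis by (simp only: sets.empty_sets)
  next
    case 2
    then have eq: "{w \<in> space (F s). min (\<sigma> w) s \<le> a} = {w \<in> space M. \<sigma> w \<le> a}" by (auto simp: *)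
    show ?thesis unfolding eq
      by (rule F_mono[OF 2(1) less_imp_le[OF 2(2)] stop_real_sets[OF assms(1) 2(1)]])
  next
    case 3
    then have "{w \<in> space (F s). min (\<sigma> w) s \<le> a} = space (F s)" by auto
    then show ?thesis by simp
  qed
qed

lemma stop_real_measurable:
  assumes "stop_real \<sigma>" shows "\<sigma> \<in> borel_measurable M"
  unfolding borel_measurable_iff_le
proof
  fix a
  show "{w \<in> space M. \<sigma> w \<le> a} \<in> sets M"
  proof (cases "0 \<le> a")
    case True then show ?thesis using stop_real_sets[OF assms True] sets_F by blast
  next
    case False
    then have "{w \<in> space M. \<sigma> w \<le> a} = {}" using stop_real_nonneg[OF assms] by force
    then show ?thesis by (simp only: sets.empty_sets)
  qed
qed

lemma B_stop_measurable:
  assumes "stop_real \<sigma>" "0 \<le> s"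
  shows "(\<lambda>\<omega>. B (min (\<sigma> \<omega>) s) \<omega>) \<in> borel_measurable (F s)"
proof -
  \<comment> \<open>All values of the path frozen at \<open>s\<close> are known at \<open>s\<close>,
    so evaluation at a random time stays inside \<open>F s\<close>.\<close>
  have "(\<lambda>\<omega>. B (min (min (\<sigma> \<omega>) s) s) \<omega>) \<in> borel_measurable (F s)"
  proof (rule borel_measurable_at_time[where X="\<lambda>t. B (min t s)"])
    fix \<omega> assume "\<omega> \<in> space (F s)"
    then have "\<omega> \<in> space M" using assms space_F by simp
    then show "continuous_on {0..} (\<lambda>t. B (min t s) \<omega>)"
      by (intro continuous_on_compose2[OF B_cont]) (auto intro!: continuous_intros simp: assms)
    show "0 \<le> min (\<sigma> \<omega>) s" using stop_real_nonneg[OF assms(1)] \<open>\<omega> \<in> space M\<close> assms by simp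
  qed (use assms B_adapted stop_real_le_measurable in auto)
  then show ?thesis by simp
qed

lemma B_at_measurable:
  assumes "\<sigma> \<in> borel_measurable M" "\<And>\<omega>. \<omega> \<in> space M \<Longrightarrow> 0 \<le> \<sigma> \<omega>"
  shows "(\<lambda>\<omega>. B (\<sigma> \<omega>) \<omega>) \<in> borel_measurable M"
  by (rule borel_measurable_at_time) (use assms B_meas B_cont in auto)

lemma stop_real_const: "0 \<le> c \<Longrightarrow> stop_real (\<lambda>_. c)"
  unfolding stopping_time_real_def
proof (intro conjI allI impI ballI)
  fix s :: real assume "0 \<le> c" "0 \<le> s"
  then have "space M \<in> sets (F s)" using sets.top[of "F s"] by (simp add: space_F)
  then show "{\<omega> \<in> space M. c \<le> s} \<in> sets (F s)" by (cases "c \<le> s") auto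
qed auto

lemma stop_real_min:
  assumes "stop_real \<sigma>" "stop_real \<rho>" shows "stop_real (\<lambda>\<omega>. min (\<sigma> \<omega>) (\<rho> \<omega>))"
  unfolding stopping_time_real_def
proof (intro conjI allI impI ballI)
  fix s :: real assume s: "0 \<le> s"
  have "{\<omega> \<in> space M. min (\<sigma> \<omega>) (\<rho> \<omega>) \<le> s} = {\<omega>\<in>space M. \<sigma> \<omega> \<le> s} \<union> {\<omega>\<in>space M. \<rho> \<omega> \<le> s}" by auto
  then show "{\<omega> \<in> space M. min (\<sigma> \<omega>) (\<rho> \<omega>) \<le> s} \<in> sets (F s)"
    using assms[THEN stop_real_sets, OF s] by auto
qed (use assms stop_real_nonneg in auto)

lemma stop_real_max:
  assumes "stop_real \<sigma>" "stop_real \<rho>" shows "stop_real (\<lambda>\<omega>. max (\<sigma> \<omega>) (\<rho> \<omega>))"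
  unfolding stopping_time_real_def
proof (intro conjI allI impI ballI)
  fix s :: real assume s: "0 \<le> s"
  have "{\<omega> \<in> space M. max (\<sigma> \<omega>) (\<rho> \<omega>) \<le> s} = {\<omega>\<in>space M. \<sigma> \<omega> \<le> s} \<inter> {\<omega>\<in>space M. \<rho> \<omega> \<le> s}" by auto
  then show "{\<omega> \<in> space M. max (\<sigma> \<omega>) (\<rho> \<omega>) \<le> s} \<in> sets (F s)"
    using assms[THEN stop_real_sets, OF s] by auto
qed (use assms stop_real_nonneg in \<open>auto simp: le_max_iff_disj\<close>)

lemma stop_real_add:
  assumes "stop_real \<sigma>" "0 \<le> e" shows "stop_real (\<lambda>\<omega>. \<sigma> \<omega> + e)"
  unfolding stopping_time_real_def
proof (intro conjI allI impI ballI)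
  fix s :: real assume s: "0 \<le> s"
  show "{\<omega> \<in> space M. \<sigma> \<omega> + e \<le> s} \<in> sets (F s)"
  proof (cases "e \<le> s")
    case True
    have "{\<omega> \<in> space M. \<sigma> \<omega> + e \<le> s} = {\<omega> \<in> space M. \<sigma> \<omega> \<le> s - e}" by auto
    then show ?thesis
      using F_mono[OF _ _ stop_real_sets[OF assms(1), of "s - e"], of s] True assms by simp
  next
    case False
    then have "{\<omega> \<in> space M. \<sigma> \<omega> + e \<le> s} = {}" using stop_real_nonneg[OF assms(1)] by force
    then show ?thesis by (simp only: sets.empty_sets)
  qed
qed (use assms stop_real_nonneg in auto)

lemma stop_ext_trunc:
  assumes "stop_ext \<tau>" "0 \<le> T"
  shows "stop_real (\<lambda>\<omega>. real_of_ereal (min (\<tau> \<omega>) (ereal T)))"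
  unfolding stopping_time_real_def
proof (intro conjI allI impI ballI)
  fix s :: real assume s: "0 \<le> s"
  have eq: "real_of_ereal (min (\<tau> \<omega>) (ereal T)) \<le> s \<longleftrightarrow> \<tau> \<omega> \<le> ereal s \<or> T \<le> s" if "\<omega> \<in> space M" for \<omega>
    using stop_ext_nonneg[OF assms(1) that] by (cases "\<tau> \<omega>") (auto simp: min_def)
  have "{\<omega> \<in> space M. real_of_ereal (min (\<tau> \<omega>) (ereal T)) \<le> s} =
     (if T \<le> s then space (F s) else {\<omega> \<in> space M. \<tau> \<omega> \<le> ereal s})"
    using eq by (auto simp: space_F[OF s])
  then show "{\<omega> \<in> space M. real_of_ereal (min (\<tau> \<omega>) (ereal T)) \<le> s} \<in> sets (F s)"
    using stop_ext_sets[OF assms(1) s] by auto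
next
  fix \<omega> assume "\<omega> \<in> space M"
  then show "0 \<le> real_of_ereal (min (\<tau> \<omega>) (ereal T))"
    using stop_ext_nonneg[OF assms(1)] assms by (auto intro!: real_of_ereal_pos simp: min_def)
qed

lemma stop_ext_min:
  assumes "stop_ext \<sigma>" "stop_ext \<rho>" shows "stop_ext (\<lambda>\<omega>. min (\<sigma> \<omega>) (\<rho> \<omega>))"
  unfolding stopping_time_ext_def
proof (intro conjI allI impI ballI)
  fix s :: real assume s: "0 \<le> s"
  have "{\<omega> \<in> space M. min (\<sigma> \<omega>) (\<rho> \<omega>) \<le> ereal s} = {\<omega>\<in>space M. \<sigma> \<omega> \<le> ereal s} \<union> {\<omega>\<in>space M. \<rho> \<omega> \<le> ereal s}"
    by (auto simp: min_le_iff_disj)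
  then show "{\<omega> \<in> space M. min (\<sigma> \<omega>) (\<rho> \<omega>) \<le> ereal s} \<in> sets (F s)"
    using assms[THEN stop_ext_sets, OF s] by auto
qed (use assms stop_ext_nonneg in auto)

lemma stop_ext_measurable:
  assumes "stop_ext \<tau>" shows "\<tau> \<in> borel_measurable M"
  unfolding borel_measurable_iff_Iic_ereal
proof
  fix a :: ereal
  have "{w \<in> space M. \<tau> w \<le> a} \<in> sets M"
  proof (cases "0 \<le> a")
    case True
    then show ?thesis
    proof (cases a)
      case (real r)
      with True have "0 \<le> r" by simp
      from sets_F[OF this stop_ext_sets[OF assms this]] show ?thesis unfolding real .
    qed auto
  next
    case False
    have "False" if "w \<in> space M" "\<tau> w \<le> a" for w
      using order_trans[OF stop_ext_nonneg[OF assms that(1)] that(2)] False by simp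
    then have "{w \<in> space M. \<tau> w \<le> a} = {}" by blast
    then show ?thesis by (simp only: sets.empty_sets)
  qed
  then show "\<tau> -` {..a} \<inter> space M \<in> sets M"
    by (simp add: vimage_def Int_def conj_commute)
qed

text \<open>By compactness, the path is nonpositive somewhere in [0, s] iff its values at dyadic
  fractions of [0, s] fall below every 1/(m+1). These are countably many events known at time
  \<open>s\<close>, so the hitting event belongs to \<open>F s\<close> itself.\<close>

lemma hit_sets:
  assumes Y: "\<And>u s. 0 \<le> u \<Longrightarrow> u \<le> s \<Longrightarrow> Y u \<in> borel_measurable (F s)"
    and cont: "\<And>\<omega>. \<omega> \<in> space M \<Longrightarrow> continuous_on {0..} (\<lambda>t. Y t \<omega>)" and s: "0 \<le> s"
  shows "{\<omega>\<in>space M. \<exists>u\<in>{0..s}. Y u \<omega> \<le> (0::real)} \<in> sets (F s)"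
proof -
  let ?v = "\<lambda>n j. s * (real j / 2 ^ n)"
  have v: "0 \<le> ?v n j" "j \<le> 2 ^ n \<Longrightarrow> ?v n j \<le> s" for n j
  proof -
    assume "j \<le> 2 ^ n"
    then have "real j / 2 ^ n \<le> 1" by (simp add: divide_le_eq)
    from mult_left_mono[OF this s] show "?v n j \<le> s" by simp
  qed (simp add: s)
  have eq: "{\<omega>\<in>space M. \<exists>u\<in>{0..s}. Y u \<omega> \<le> 0} =
    (\<Inter>m. \<Union>n. \<Union>j\<in>{..2^n}. {\<omega>\<in>space (F s). Y (?v n j) \<omega> < 1 / real (Suc m)})" (is "?L = ?R")
  proof (intro set_eqI iffI)
    fix \<omega> assume "\<omega> \<in> ?L"
    then obtain u where \<omega>: "\<omega> \<in> space M" and u: "0 \<le> u" "u \<le> s" "Y u \<omega> \<le> 0" by auto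
    \<comment> \<open>Rounding down keeps the grid point inside [0, s].\<close>
    let ?j = "\<lambda>n. nat \<lfloor>2 ^ n * (u / s)\<rfloor>"
    have us: "0 \<le> u / s" "u / s \<le> 1" using u s by (auto simp: divide_le_eq_1)
    have jl: "real (?j n) \<le> 2 ^ n * (u / s)" "2 ^ n * (u / s) - 1 \<le> real (?j n)" for n
    proof -
      have "0 \<le> 2 ^ n * (u / s)" using us by (intro mult_nonneg_nonneg) auto
      then have "real (?j n) = of_int \<lfloor>2 ^ n * (u / s)\<rfloor>" by (simp only: of_nat_nat zero_le_floor)
      then show "real (?j n) \<le> 2 ^ n * (u / s)" "2 ^ n * (u / s) - 1 \<le> real (?j n)"
        by linarith+
    qed
    have j2: "?j n \<le> 2 ^ n" for n
    proof -
      have "real (?j n) \<le> 2 ^ n * 1" using jl(1)[of n] us by (meson mult_left_mono order_trans zero_le_numeral zero_le_power)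
      then show ?thesis by (simp add: of_nat_le_iff[symmetric] del: of_nat_le_iff)
    qed
    have lim: "(\<lambda>n. real (?j n) / 2 ^ n) \<longlonglongrightarrow> u / s"
    proof (rule tendsto_sandwich)
      show "\<forall>\<^sub>F n in sequentially. u / s - 1 / 2 ^ n \<le> real (?j n) / 2 ^ n"
        using jl(2) by (auto intro!: always_eventually simp: le_divide_eq algebra_simps)
      show "\<forall>\<^sub>F n in sequentially. real (?j n) / 2 ^ n \<le> u / s"
        using jl(1) by (auto intro!: always_eventually simp: divide_le_eq algebra_simps)
      show "(\<lambda>n. u / s - 1 / 2 ^ n) \<longlonglongrightarrow> u / s"
        using tendsto_diff[OF tendsto_const[of "u / s"] LIMSEQ_divide_realpow_zero[of 2 1]] by simp
    qed auto
    have "(\<lambda>n. ?v n (?j n)) \<longlonglongrightarrow> s * (u / s)" by (intro tendsto_mult tendsto_const lim)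
    also have "s * (u / s) = u" using u s by (cases "s = 0") auto
    finally have "(\<lambda>n. Y (?v n (?j n)) \<omega>) \<longlonglongrightarrow> Y u \<omega>"
      using u s by (intro continuous_on_LIMSEQ[OF cont[OF \<omega>]]) auto
    then have "\<forall>\<^sub>F n in sequentially. Y (?v n (?j n)) \<omega> < 1 / real (Suc m)" for m
      using u(3) by (intro order_tendstoD(2)) (auto intro: le_less_trans)
    then have ex: "\<exists>n. Y (?v n (?j n)) \<omega> < 1 / real (Suc m)" for m
      by (meson eventually_sequentially order_refl)
    show "\<omega> \<in> ?R"
    proof (rule INT_I)
      fix m
      obtain n where n: "Y (?v n (?j n)) \<omega> < 1 / real (Suc m)" using ex by blast
      then show "\<omega> \<in> (\<Union>n. \<Union>j\<in>{..2^n}. {\<omega>\<in>space (F s). Y (?v n j) \<omega> < 1 / real (Suc m)})"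
        using \<omega> j2[of n] space_F[OF s] by (intro UN_I[of n] UN_I[of "?j n"] CollectI conjI) auto
    qed
  next
    fix \<omega> assume R: "\<omega> \<in> ?R"
    then have "\<omega> \<in> space (F s)" by simp
    then have \<omega>: "\<omega> \<in> space M" using space_F[OF s] by simp
    have "\<exists>u\<in>{0..s}. \<forall>v\<in>{0..s}. Y u \<omega> \<le> Y v \<omega>"
      using s by (intro continuous_attains_inf continuous_on_subset[OF cont[OF \<omega>]]) auto
    then obtain u where u: "u \<in> {0..s}" "\<And>v. v \<in> {0..s} \<Longrightarrow> Y u \<omega> \<le> Y v \<omega>" by auto
    have "Y u \<omega> \<le> 0"
    proof (rule ccontr)
      assume "\<not> ?thesis"
      then obtain m where m: "1 / real (Suc m) < Y u \<omega>" using reals_Archimedean[of "Y u \<omega>"]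
        by (auto simp: inverse_eq_divide not_le)
      from R have "\<omega> \<in> (\<Union>n. \<Union>j\<in>{..2^n}. {\<omega>\<in>space (F s). Y (?v n j) \<omega> < 1 / real (Suc m)})"
        by (rule INT_D) simp
      then obtain n j where "j \<le> 2 ^ n" and less: "Y (?v n j) \<omega> < 1 / real (Suc m)" by blast
      then have "?v n j \<in> {0..s}" using v by simp
      from u(2)[OF this] less m show False by linarith
    qed
    with u \<omega> show "\<omega> \<in> ?L" by auto
  qed
  have m: "{\<omega>\<in>space (F s). Y (?v n j) \<omega> < 1 / real (Suc m)} \<in> sets (F s)" if "j \<le> 2 ^ n" for n j m
  proof -
    note [measurable] = Y[OF v(1) v(2), OF that]
    show ?thesis by measurable
  qed
  have "(\<Union>n. \<Union>j\<in>{..2^n}. {\<omega>\<in>space (F s). Y (?v n j) \<omega> < 1 / real (Suc m)}) \<in> sets (F s)" for m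
    by (rule sets.countable_UN, rule image_subsetI, rule sets.finite_UN) (simp_all only: m finite_atMost atMost_iff)
  then show ?thesis unfolding eq
    by (intro sets.countable_INT) blast+
qed

lemma stop_ext_first_time:
  assumes Y: "\<And>u s. 0 \<le> u \<Longrightarrow> u \<le> s \<Longrightarrow> Y u \<in> borel_measurable (F s)"
    and cont: "\<And>\<omega>. \<omega> \<in> space M \<Longrightarrow> continuous_on {0..} (\<lambda>t. Y t \<omega>)"
  shows "stop_ext (\<lambda>\<omega>. first_time (\<lambda>t. Y t \<omega>))"
  unfolding stopping_time_ext_def
proof (intro conjI allI impI ballI first_time_nonneg)
  fix s :: real assume "0 \<le> s"
  then show "{\<omega> \<in> space M. first_time (\<lambda>t. Y t \<omega>) \<le> ereal s} \<in> sets (F s)"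
    using hit_sets[OF Y cont] first_time_le_iff[OF cont] by (simp cong: conj_cong)
qed

end

section \<open>A maximal inequality\<close>

context brownian begin

lemma integrable_indicat: "A \<in> sets M \<Longrightarrow> integrable M (indicat_real A)"
  by (intro integrable_real_indicator) (simp_all add: emeasure_eq_measure)

lemma expectation_incr_sq_indicator:
  assumes "0 \<le> s" "s \<le> t" and A: "A \<in> sets (F s)"
  shows "expectation (\<lambda>\<omega>. indicator A \<omega> * (B t \<omega> - B s \<omega>)\<^sup>2) = (t - s) * prob A"
proof (cases "s = t")
  case False
  then have st: "s < t" using assms by simp
  have AM: "A \<in> sets M" using A assms sets_F by blast
  have X: "indicat_real A \<in> measurable (F s) borel" using A by simp
  have "indep_var borel ((\<lambda>x. x) \<circ> indicat_real A) borel ((\<lambda>x. x\<^sup>2) \<circ> (\<lambda>\<omega>. B t \<omega> - B s \<omega>))"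
    by (intro indep_var_compose[OF indep_incr[OF assms(1) st X]]) auto
  then have i: "indep_var borel (indicat_real A) borel (\<lambda>\<omega>. (B t \<omega> - B s \<omega>)\<^sup>2)"
    by (simp add: o_def)
  have iA: "integrable M (indicat_real A)"
    by (rule integrable_indicat[OF AM])
  have "expectation (\<lambda>\<omega>. indicator A \<omega> * (B t \<omega> - B s \<omega>)\<^sup>2)
      = expectation (indicat_real A) * expectation (\<lambda>\<omega>. (B t \<omega> - B s \<omega>)\<^sup>2)"
    by (rule indep_var_lebesgue_integral[OF i iA integrable_incr_sq[OF assms(1,2)]])
  then show ?thesis using AM expectation_incr_sq[OF assms(1,2)] by (simp add: mult.commute)
qed simp

text \<open>Submartingale property of the squared increment: when the square is expanded around time
  \<open>u\<close>, the cross term has mean zero and the last square is nonnegative.\<close>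

lemma incr_sq_mono:
  assumes su: "0 \<le> s" "s \<le> u" "u \<le> t" and D: "D \<in> sets (F u)"
  shows "expectation (\<lambda>\<omega>. indicator D \<omega> * (B u \<omega> - B s \<omega>)\<^sup>2)
     \<le> expectation (\<lambda>\<omega>. indicator D \<omega> * (B t \<omega> - B s \<omega>)\<^sup>2)"
proof -
  have u0: "0 \<le> u" using su by simp
  have DM: "D \<in> sets M" using sets_F[OF u0 D] .
  let ?X = "\<lambda>\<omega>. 2 * (indicator D \<omega> * (B u \<omega> - B s \<omega>))"
  have Xm: "?X \<in> borel_measurable (F u)" using D B_adapted[of s u] B_adapted[of u u] su by simp
  have Xi: "integrable M ?X"
    using integrable_mult_indicator[OF DM integrable_incr[OF su(1,2)]] by simp
  have "expectation (\<lambda>\<omega>. indicator D \<omega> * (B u \<omega> - B s \<omega>)\<^sup>2)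
     = expectation (\<lambda>\<omega>. indicator D \<omega> * (B u \<omega> - B s \<omega>)\<^sup>2) + expectation (\<lambda>\<omega>. ?X \<omega> * (B t \<omega> - B u \<omega>))"
    using expectation_mult_incr[OF u0 su(3) Xm Xi] by simp
  also have "\<dots> = expectation (\<lambda>\<omega>. indicator D \<omega> * (B u \<omega> - B s \<omega>)\<^sup>2 + ?X \<omega> * (B t \<omega> - B u \<omega>))"
    using integrable_mult_indicator[OF DM integrable_incr_sq[OF su(1,2)]]
    by (intro Bochner_Integration.integral_add[symmetric] integrable_mult_incr[OF u0 su(3) Xm Xi]) simp
  also have "\<dots> \<le> expectation (\<lambda>\<omega>. indicator D \<omega> * (B t \<omega> - B s \<omega>)\<^sup>2)"
  proof (rule integral_mono)
    show "integrable M (\<lambda>\<omega>. indicator D \<omega> * (B u \<omega> - B s \<omega>)\<^sup>2 + ?X \<omega> * (B t \<omega> - B u \<omega>))"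
      using integrable_mult_indicator[OF DM integrable_incr_sq[OF su(1,2)]]
      by (intro Bochner_Integration.integrable_add integrable_mult_incr[OF u0 su(3) Xm Xi]) simp
    show "integrable M (\<lambda>\<omega>. indicat_real D \<omega> * (B t \<omega> - B s \<omega>)\<^sup>2)"
      using integrable_mult_indicator[OF DM integrable_incr_sq[of s t]] su by simp
    fix \<omega>
    have "0 \<le> (B t \<omega> - B u \<omega>)\<^sup>2" by simp
    then show "indicator D \<omega> * (B u \<omega> - B s \<omega>)\<^sup>2 + ?X \<omega> * (B t \<omega> - B u \<omega>)
         \<le> indicator D \<omega> * (B t \<omega> - B s \<omega>)\<^sup>2"
      by (cases "\<omega> \<in> D") (auto simp: power2_eq_square algebra_simps)
  qed
  finally show ?thesis .
qed

text \<open>Kolmogorov's inequality with a past event \<open>A\<close> carried along; the exceedance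
  event is split according to the first index at which it occurs.\<close>

lemma maximal_discrete:
  fixes u :: "nat \<Rightarrow> real"
  assumes s: "0 \<le> s" and u: "\<And>j. s \<le> u j" "\<And>j. u j \<le> t" "mono u" and A: "A \<in> sets (F s)" and d: "0 < d"
  shows "d\<^sup>2 * prob {\<omega>\<in>A. \<exists>j\<le>N::nat. d \<le> \<bar>B (u j) \<omega> - B s \<omega>\<bar>} \<le> (t - s) * prob A"
proof -
  have st: "s \<le> t" using u(1)[of 0] u(2)[of 0] by simp
  have u0: "0 \<le> u j" for j using u(1)[of j] s by simp
  have AM: "A \<in> sets M" using sets_F[OF s A] .
  have AsM: "A \<subseteq> space M" using sets.sets_into_space[OF AM] .
  define E where "E j = {\<omega>\<in>A. d \<le> \<bar>B (u j) \<omega> - B s \<omega>\<bar> \<and> (\<forall>i<j. \<bar>B (u i) \<omega> - B s \<omega>\<bar> < d)}" for j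
  have EF: "E j \<in> sets (F (u j))" for j
  proof -
    have [measurable]: "B s \<in> borel_measurable (F (u j))" "B (u j) \<in> borel_measurable (F (u j))"
      "A \<in> sets (F (u j))"
      using B_adapted s u u0 F_mono[OF s u(1) A] by auto
    have [measurable]: "i \<in> {..<j} \<Longrightarrow> B (u i) \<in> borel_measurable (F (u j))" for i
      using B_adapted[OF u0[of i], of "u j"] monoD[OF u(3), of i j] by simp
    have [measurable]: "{\<omega>\<in>space (F (u j)). \<forall>i\<in>{..<j}. \<bar>B (u i) \<omega> - B s \<omega>\<bar> < d} \<in> sets (F (u j))"
      by measurable
    have "E j = A \<inter> {\<omega>\<in>space (F (u j)). d \<le> \<bar>B (u j) \<omega> - B s \<omega>\<bar>}
       \<inter> {\<omega>\<in>space (F (u j)). \<forall>i\<in>{..<j}. \<bar>B (u i) \<omega> - B s \<omega>\<bar> < d}"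
      using AsM unfolding E_def space_F[OF u0] by auto
    also have "\<dots> \<in> sets (F (u j))" by measurable
    finally show ?thesis .
  qed
  have EM: "E j \<in> sets M" for j using sets_F[OF u0 EF] .
  have sub: "\<exists>j\<le>N. \<omega> \<in> E j" if "\<omega> \<in> A" "j \<le> N" "d \<le> \<bar>B (u j) \<omega> - B s \<omega>\<bar>" for \<omega> j
  proof -
    let ?k = "LEAST k. d \<le> \<bar>B (u k) \<omega> - B s \<omega>\<bar>"
    have "d \<le> \<bar>B (u ?k) \<omega> - B s \<omega>\<bar>" "?k \<le> j" by (rule LeastI, rule that, rule Least_le, rule that)
    moreover have "\<bar>B (u i) \<omega> - B s \<omega>\<bar> < d" if "i < ?k" for i using not_less_Least[OF that] by simp
    ultimately show ?thesis using that unfolding E_def by (intro exI[of _ ?k]) auto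
  qed
  have un: "{\<omega>\<in>A. \<exists>j\<le>N. d \<le> \<bar>B (u j) \<omega> - B s \<omega>\<bar>} = (\<Union>j\<in>{..N}. E j)"
  proof (intro equalityI subsetI)
    fix \<omega> assume "\<omega> \<in> {\<omega>\<in>A. \<exists>j\<le>N. d \<le> \<bar>B (u j) \<omega> - B s \<omega>\<bar>}"
    with sub show "\<omega> \<in> (\<Union>j\<in>{..N}. E j)" by blast
  qed (auto simp: E_def)
  have disj: "disjoint_family_on E {..N}"
    unfolding disjoint_family_on_def E_def
  proof safe
    fix a b :: nat and \<omega> assume "a \<noteq> b" "\<omega> \<in> A" "d \<le> \<bar>B (u a) \<omega> - B s \<omega>\<bar>" "\<forall>i<a. \<bar>B (u i) \<omega> - B s \<omega>\<bar> < d"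
      "d \<le> \<bar>B (u b) \<omega> - B s \<omega>\<bar>" "\<forall>i<b. \<bar>B (u i) \<omega> - B s \<omega>\<bar> < d"
    then show "\<omega> \<in> {}" by (metis linorder_neqE_nat not_less)
  qed
  have int: "integrable M (\<lambda>\<omega>. indicat_real D \<omega> * (B r \<omega> - B s \<omega>)\<^sup>2)" if "D \<in> sets M" "s \<le> r" for D r
    using integrable_mult_indicator[OF that(1) integrable_incr_sq[OF s that(2)]] by simp
  have "d\<^sup>2 * prob (E j) \<le> expectation (\<lambda>\<omega>. indicator (E j) \<omega> * (B t \<omega> - B s \<omega>)\<^sup>2)" for j
  proof -
    have "d\<^sup>2 * prob (E j) = expectation (\<lambda>\<omega>. d\<^sup>2 * indicator (E j) \<omega>)" using EM by simp
    also have "\<dots> \<le> expectation (\<lambda>\<omega>. indicator (E j) \<omega> * (B (u j) \<omega> - B s \<omega>)\<^sup>2)"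
    proof (rule integral_mono)
      fix \<omega>
      show "d\<^sup>2 * indicator (E j) \<omega> \<le> indicat_real (E j) \<omega> * (B (u j) \<omega> - B s \<omega>)\<^sup>2"
      proof (cases "\<omega> \<in> E j")
        case True
        then have "d \<le> \<bar>B (u j) \<omega> - B s \<omega>\<bar>" by (simp add: E_def)
        from power_mono[OF this, of 2] d True show ?thesis by simp
      qed simp
    qed (use EM in \<open>auto intro!: int u integrable_mult_right integrable_indicat\<close>)
    also have "\<dots> \<le> expectation (\<lambda>\<omega>. indicator (E j) \<omega> * (B t \<omega> - B s \<omega>)\<^sup>2)"
      by (rule incr_sq_mono[OF s u(1,2) EF])
    finally show ?thesis .
  qed
  then have "d\<^sup>2 * (\<Sum>j\<le>N. prob (E j)) \<le> (\<Sum>j\<le>N. expectation (\<lambda>\<omega>. indicator (E j) \<omega> * (B t \<omega> - B s \<omega>)\<^sup>2))"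
    unfolding sum_distrib_left by (intro sum_mono) simp
  also have "\<dots> = expectation (\<lambda>\<omega>. \<Sum>j\<le>N. indicator (E j) \<omega> * (B t \<omega> - B s \<omega>)\<^sup>2)"
    by (rule Bochner_Integration.integral_sum[symmetric]) (use EM st in \<open>auto intro!: int\<close>)
  also have "\<dots> \<le> expectation (\<lambda>\<omega>. indicator A \<omega> * (B t \<omega> - B s \<omega>)\<^sup>2)"
  proof (rule integral_mono)
    fix \<omega>
    have "(\<Sum>j\<le>N. indicat_real (E j) \<omega>) = indicator (\<Union>j\<in>{..N}. E j) \<omega>"
      using disj by (subst indicator_UN_disjoint) auto
    also have "\<dots> \<le> indicator A \<omega>" by (rule indicator_leI) (auto simp: E_def)
    finally show "(\<Sum>j\<le>N. indicator (E j) \<omega> * (B t \<omega> - B s \<omega>)\<^sup>2) \<le> indicat_real A \<omega> * (B t \<omega> - B s \<omega>)\<^sup>2"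
      unfolding sum_distrib_right[symmetric] by (intro mult_right_mono) auto
  next
    show "integrable M (\<lambda>\<omega>. \<Sum>j\<le>N. indicat_real (E j) \<omega> * (B t \<omega> - B s \<omega>)\<^sup>2)"
      by (intro Bochner_Integration.integrable_sum int EM st)
  qed (intro int AM st)
  also have "\<dots> = (t - s) * prob A" by (rule expectation_incr_sq_indicator[OF s st A])
  also have "(\<Sum>j\<le>N. prob (E j)) = prob (\<Union>j\<in>{..N}. E j)"
    using EM disj by (intro finite_measure_finite_Union[symmetric]) auto
  finally show ?thesis unfolding un .
qed

text \<open>A strict exceedance is seen by nearby grid points, so the discrete bound passes to the
  limit. The bound is stated for any measurable \<open>H\<close> inside the exceedance event, which
  keeps the measurability question with the user of the lemma.\<close>

lemma maximal_ineq:
  assumes s: "0 \<le> s" "s \<le> t" and A: "A \<in> sets (F s)" and d: "0 < d" and H: "H \<in> sets M"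
    and HA: "H \<subseteq> {\<omega>\<in>A. \<exists>u\<in>{s..t}. d < \<bar>B u \<omega> - B s \<omega>\<bar>}"
  shows "d\<^sup>2 * prob H \<le> (t - s) * prob A"
proof -
  have AM: "A \<in> sets M" using sets_F[OF s(1) A] .
  have AsM: "A \<subseteq> space M" using sets.sets_into_space[OF AM] .
  define u where "u n j = min (s + real j / 2 ^ n) t" for n j
  define E where "E n = {\<omega>\<in>A. \<exists>j\<le>nat \<lceil>2^n * (t - s)\<rceil>. d \<le> \<bar>B (u n j) \<omega> - B s \<omega>\<bar>}" for n
  have u: "s \<le> u n j" "u n j \<le> t" "mono (u n)" for n j
    using s unfolding u_def by (auto intro!: monoI min.mono add_mono divide_right_mono)
  have u0: "0 \<le> u n j" for n j using u(1)[of n j] s(1) by linarith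
  have EM: "E n \<in> sets M" for n
  proof -
    have [measurable]: "B s \<in> borel_measurable M" "\<And>j. B (u n j) \<in> borel_measurable M" "A \<in> sets M"
      using B_meas s u0 AM by auto
    have "E n = A \<inter> {\<omega>\<in>space M. \<exists>j\<in>{..nat \<lceil>2^n * (t - s)\<rceil>}. d \<le> \<bar>B (u n j) \<omega> - B s \<omega>\<bar>}"
      using AsM by (auto simp: E_def)
    also have "\<dots> \<in> sets M" by measurable
    finally show ?thesis .
  qed
  have ev: "\<forall>\<^sub>F n in sequentially. \<omega> \<in> E n" if \<omega>: "\<omega> \<in> H" for \<omega>
  proof -
    have \<omega>M: "\<omega> \<in> space M" "\<omega> \<in> A" using HA \<omega> AsM by auto
    obtain v where v: "v \<in> {s..t}" "d < \<bar>B v \<omega> - B s \<omega>\<bar>" using HA \<omega> by auto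
    let ?v = "\<lambda>n. u n (nat \<lceil>2 ^ n * (v - s)\<rceil>)"
    have "?v n = min (s + dyadic_up n (v - s)) t" for n
      using v by (simp add: u_def dyadic_up_nat)
    moreover have "(\<lambda>n. min (s + dyadic_up n (v - s)) t) \<longlonglongrightarrow> min (s + (v - s)) t"
      by (intro tendsto_min tendsto_add tendsto_const dyadic_up_tendsto)
    ultimately have "?v \<longlonglongrightarrow> v" using v by (simp add: min_def)
    then have "(\<lambda>n. B (?v n) \<omega>) \<longlonglongrightarrow> B v \<omega>"
      using u0 s(1) v(1) by (intro continuous_on_LIMSEQ[OF B_cont[OF \<omega>M(1)]]) auto
    then have "(\<lambda>n. \<bar>B (?v n) \<omega> - B s \<omega>\<bar>) \<longlonglongrightarrow> \<bar>B v \<omega> - B s \<omega>\<bar>"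
      by (intro tendsto_intros)
    from order_tendstoD(1)[OF this v(2)] show ?thesis
    proof eventually_elim
      case (elim n)
      have "nat \<lceil>2 ^ n * (v - s)\<rceil> \<le> nat \<lceil>2 ^ n * (t - s)\<rceil>"
        using v(1) by (intro nat_mono ceiling_mono mult_left_mono) auto
      with elim \<omega>M show ?case unfolding E_def by (auto intro!: exI[of _ "nat \<lceil>2 ^ n * (v - s)\<rceil>"])
    qed
  qed
  have "(\<lambda>n. prob (H \<inter> E n)) \<longlonglongrightarrow> prob H"
  proof -
    have "(\<lambda>n. expectation (indicat_real (H \<inter> E n))) \<longlonglongrightarrow> expectation (indicat_real H)"
    proof (rule integral_dominated_convergence[where w="\<lambda>_. 1"])
      show "AE x in M. (\<lambda>n. indicat_real (H \<inter> E n) x) \<longlonglongrightarrow> indicat_real H x"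
      proof (intro AE_I2)
        fix x
        show "(\<lambda>n. indicat_real (H \<inter> E n) x) \<longlonglongrightarrow> indicat_real H x"
        proof (cases "x \<in> H")
          case True
          have "\<forall>\<^sub>F n in sequentially. indicat_real (H \<inter> E n) x = indicat_real H x"
            using ev[OF True] by eventually_elim (simp add: True)
          then show ?thesis by (rule tendsto_eventually)
        qed simp
      qed
    qed (use H EM in \<open>auto simp: indicator_def\<close>)
    then show ?thesis using H EM by (simp add: Int_absorb1 sets.sets_into_space)
  qed
  then have "(\<lambda>n. d\<^sup>2 * prob (H \<inter> E n)) \<longlonglongrightarrow> d\<^sup>2 * prob H" by (intro tendsto_intros)
  moreover have "d\<^sup>2 * prob (H \<inter> E n) \<le> (t - s) * prob A" for n
  proof -
    have "d\<^sup>2 * prob (H \<inter> E n) \<le> d\<^sup>2 * prob (E n)"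
      using EM by (intro mult_left_mono finite_measure_mono) auto
    also have "\<dots> \<le> (t - s) * prob A"
      unfolding E_def by (rule maximal_discrete[OF s(1) u A d])
    finally show ?thesis .
  qed
  ultimately show ?thesis by (intro LIMSEQ_le_const2) auto
qed

text \<open>The level 2^k is reached with probability at most 4T/4^k, so the dyadic levels weighted
  by their size have a convergent sum of expectations. The resulting bound on the running maximum
  dominates the limits taken over a bounded time interval.\<close>

lemma dominating:
  assumes T: "0 \<le> T"
  obtains D where "integrable M D" "\<And>u \<omega>. \<omega> \<in> space M \<Longrightarrow> 0 \<le> u \<Longrightarrow> u \<le> T \<Longrightarrow> \<bar>B u \<omega>\<bar> \<le> D \<omega>"
proof -
  define H where "H k = {\<omega>\<in>space M. \<exists>u\<in>{0..T}. 2 ^ k - \<bar>B u \<omega>\<bar> \<le> 0}" for k :: nat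
  have HM[measurable]: "H k \<in> sets M" for k
    unfolding H_def
    by (rule sets_F[OF T], rule hit_sets) (use B_adapted T in \<open>auto intro!: continuous_intros B_cont\<close>)
  have PH: "prob (H k) \<le> 4 * T / 4 ^ k" for k
  proof -
    \<comment> \<open>\<open>maximal_ineq\<close> asks for a strict exceedance, hence half of the
      level.\<close>
    have "(2 ^ k / 2)\<^sup>2 * prob (H k) \<le> (T - 0) * prob (space M)"
    proof (rule maximal_ineq)
      show "space M \<in> sets (F 0)" using sets.top[of "F 0"] by (simp add: space_F)
      show "H k \<subseteq> {\<omega> \<in> space M. \<exists>u\<in>{0..T}. 2 ^ k / 2 < \<bar>B u \<omega> - B 0 \<omega>\<bar>}"
      proof
        fix \<omega> assume "\<omega> \<in> H k"
        then obtain u where "\<omega> \<in> space M" "u \<in> {0..T}" "2 ^ k \<le> \<bar>B u \<omega>\<bar>" by (auto simp: H_def)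
        moreover from this(3) have "2 ^ k / 2 < \<bar>B u \<omega>\<bar>" using zero_less_power[of "2::real" k] by linarith
        ultimately show "\<omega> \<in> {\<omega> \<in> space M. \<exists>u\<in>{0..T}. 2 ^ k / 2 < \<bar>B u \<omega> - B 0 \<omega>\<bar>}"
          by (auto simp: B_0 simp del: half_gt_zero_iff intro!: bexI[of _ u])
      qed
    qed (use T HM in auto)
    moreover have "((2::real) ^ k / 2)\<^sup>2 = 4 ^ k / 4"
      by (simp add: power2_eq_square power_mult_distrib[symmetric])
    ultimately have "4 ^ k / 4 * prob (H k) \<le> T" by (simp add: prob_space)
    then show ?thesis by (simp add: field_simps)
  qed
  \<comment> \<open>If the absolute value lies between 2^k and 2^(k+1), the k-th summand alone
    dominates it; the summand 1 covers values below 1.\<close>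
  define D where "D \<omega> = 1 + (\<Sum>k. 2 * 2 ^ k * indicat_real (H k) \<omega>)" for \<omega>
  have fin: "\<exists>K. \<forall>k\<ge>K. \<omega> \<notin> H k" if \<omega>: "\<omega> \<in> space M" for \<omega>
  proof -
    have "compact ((\<lambda>u. B u \<omega>) ` {0..T})"
      by (intro compact_continuous_image continuous_on_subset[OF B_cont[OF \<omega>]]) auto
    then obtain b where b: "\<And>u. u \<in> {0..T} \<Longrightarrow> \<bar>B u \<omega>\<bar> \<le> b"
      using compact_imp_bounded bounded_iff by (metis imageI real_norm_def)
    obtain K where K: "b < 2 ^ K" using real_arch_pow[of 2 b] by auto
    have "b < 2 ^ k" if "K \<le> k" for k
      using less_le_trans[OF K, of "2 ^ k"] that by simp
    then have "\<omega> \<notin> H k" if "K \<le> k" for k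
      using b that by (force simp: H_def)
    then show ?thesis by blast
  qed
  have summ: "summable (\<lambda>k. 2 * 2 ^ k * indicat_real (H k) \<omega>)" if \<omega>: "\<omega> \<in> space M" for \<omega>
  proof -
    obtain K where K: "\<forall>k\<ge>K. \<omega> \<notin> H k" using fin[OF \<omega>] by auto
    show ?thesis by (rule summable_finite[of "{..<K}"]) (use K in auto)
  qed
  have "integrable M (\<lambda>\<omega>. \<Sum>k. 2 * 2 ^ k * indicat_real (H k) \<omega>)"
  proof (rule integrable_suminf)
    show "AE x in M. summable (\<lambda>k. norm (2 * 2 ^ k * indicat_real (H k) x))"
      using summ by (intro AE_I2) (simp add: abs_mult)
    have e: "expectation (\<lambda>x. norm (2 * 2 ^ k * indicat_real (H k) x)) = 2 * 2 ^ k * prob (H k)" for k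
      by (simp add: abs_mult)
    have "summable (\<lambda>k. 8 * T * (1 / 2) ^ k)" by (intro summable_mult) (simp add: summable_geometric)
    then show "summable (\<lambda>k. expectation (\<lambda>x. norm (2 * 2 ^ k * indicat_real (H k) x)))"
    proof (rule summable_comparison_test'[where N=0])
      fix k
      have "2 * 2 ^ k * prob (H k) \<le> 2 * 2 ^ k * (4 * T / 4 ^ k)" by (intro mult_left_mono PH) simp
      also have "\<dots> = 8 * T * (2 ^ k / 4 ^ k)" by simp
      also have "(2::real) ^ k / 4 ^ k = (1 / 2) ^ k" by (simp add: power_divide[symmetric])
      finally show "norm (expectation (\<lambda>x. norm (2 * 2 ^ k * indicat_real (H k) x))) \<le> 8 * T * (1 / 2) ^ k"
        unfolding e by simp
    qed
  qed (auto intro!: integrable_mult_right integrable_indicat)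
  then have "integrable M D" unfolding D_def by simp
  moreover have "\<bar>B u \<omega>\<bar> \<le> D \<omega>" if "\<omega> \<in> space M" "0 \<le> u" "u \<le> T" for u \<omega>
  proof (cases "\<bar>B u \<omega>\<bar> < 1")
    case True
    have "0 \<le> (\<Sum>k. 2 * 2 ^ k * indicat_real (H k) \<omega>)" by (intro suminf_nonneg summ that) simp
    with True show ?thesis by (simp add: D_def)
  next
    case False
    define k where "k = nat \<lfloor>log 2 \<bar>B u \<omega>\<bar>\<rfloor>"
    have l: "0 \<le> log 2 \<bar>B u \<omega>\<bar>" using False by simp
    then have k: "real k \<le> log 2 \<bar>B u \<omega>\<bar>" "log 2 \<bar>B u \<omega>\<bar> < real k + 1" by (auto simp: k_def)
    have "2 powr real k \<le> \<bar>B u \<omega>\<bar>" using k(1) False by (subst (asm) le_log_iff) auto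
    then have k1: "2 ^ k \<le> \<bar>B u \<omega>\<bar>" by (simp add: powr_realpow)
    have "\<bar>B u \<omega>\<bar> < 2 powr (real k + 1)" using k(2) False by (subst (asm) log_less_iff) auto
    then have k2: "\<bar>B u \<omega>\<bar> < 2 * 2 ^ k" by (simp add: powr_add powr_realpow)
    have "\<omega> \<in> H k" using that k1 by (auto simp: H_def)
    then have "2 * 2 ^ k \<le> (\<Sum>j\<in>{k}. 2 * 2 ^ j * indicat_real (H j) \<omega>)" by simp
    also have "\<dots> \<le> (\<Sum>j. 2 * 2 ^ j * indicat_real (H j) \<omega>)"
      by (intro sum_le_suminf summ that) auto
    finally show ?thesis using k2 by (simp add: D_def)
  qed
  ultimately show ?thesis by (rule that)
qed

end

section \<open>Optional stopping\<close>

text \<open>A smooth convex substitute for the absolute value; its strict convexity is what identifies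
  stopping times embedding the same law, and large \<open>K\<close> detects the tails.\<close>
definition hyp :: "real \<Rightarrow> real \<Rightarrow> real" where "hyp K y = sqrt (K\<^sup>2 + y\<^sup>2) - K"
definition dhyp :: "real \<Rightarrow> real \<Rightarrow> real" where "dhyp K y = y / sqrt (K\<^sup>2 + y\<^sup>2)"

lemma hyp_measurable[measurable]: "hyp K \<in> borel_measurable borel" "dhyp K \<in> borel_measurable borel"
  unfolding hyp_def[abs_def] dhyp_def[abs_def] by measurable

lemma hyp_continuous: "continuous_on A (hyp K)"
  unfolding hyp_def[abs_def] by (intro continuous_intros)

lemma dhyp_bound: "\<bar>dhyp K y\<bar> \<le> 1"
proof -
  have "\<bar>y\<bar> \<le> sqrt (K\<^sup>2 + y\<^sup>2)" by (rule real_le_rsqrt) simp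
  then show ?thesis
    by (cases "sqrt (K\<^sup>2 + y\<^sup>2) = 0") (simp_all add: dhyp_def abs_divide divide_le_eq_1_pos add_nonneg_nonneg less_le)
qed

lemma hyp_nonneg: "0 < K \<Longrightarrow> 0 \<le> hyp K y"
  unfolding hyp_def using real_le_rsqrt[of K "K\<^sup>2 + y\<^sup>2"] by simp

lemma hyp_le_abs: "0 < K \<Longrightarrow> hyp K y \<le> \<bar>y\<bar>"
  unfolding hyp_def using sqrt_add_le_add_sqrt[of "K\<^sup>2" "y\<^sup>2"] by simp

lemma abs_le_hyp: "\<bar>y\<bar> - K \<le> hyp K y"
  unfolding hyp_def using real_le_rsqrt[of "\<bar>y\<bar>" "K\<^sup>2 + y\<^sup>2"] by simp

lemma abs_tail_le_hyp: "0 < K \<Longrightarrow> 2 * K < \<bar>y\<bar> \<Longrightarrow> \<bar>y\<bar> \<le> 2 * hyp K y"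
  using abs_le_hyp[of y K] by linarith

text \<open>After the denominator is cleared, the gap is the Cauchy-Schwarz defect of the vectors
  (K, x) and (K, y), which vanishes only for x = y.\<close>

lemma hyp_convex:
  assumes K: "0 < K"
  shows "x \<noteq> y \<Longrightarrow> hyp K x + dhyp K x * (y - x) < hyp K y"
    and "hyp K x + dhyp K x * (y - x) \<le> hyp K y"
proof -
  have s: "0 < sqrt (K\<^sup>2 + x\<^sup>2)" using K by (simp add: add_pos_nonneg)
  have eq: "hyp K y - (hyp K x + dhyp K x * (y - x)) =
     (sqrt (K\<^sup>2 + x\<^sup>2) * sqrt (K\<^sup>2 + y\<^sup>2) - (K\<^sup>2 + x * y)) / sqrt (K\<^sup>2 + x\<^sup>2)"
  proof -
    have *: "b - K - (a - K + x / a * (y - x)) = (a * b - (K\<^sup>2 + x * y)) / a"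
      if "0 < a" "a * a = K\<^sup>2 + x\<^sup>2" for a b
    proof -
      have "(b - K - (a - K + c)) * a = a * b - a * a - c * a" for c by (simp add: algebra_simps)
      from this[of "x / a * (y - x)"]
      have "(b - K - (a - K + x / a * (y - x))) * a = a * b - a * a - x * (y - x)"
        using that(1) by simp
      also have "\<dots> = a * b - (K\<^sup>2 + x * y)" unfolding that(2) by (simp add: algebra_simps power2_eq_square)
      finally show ?thesis using that(1) by (simp add: eq_divide_eq)
    qed
    have "sqrt (K\<^sup>2 + x\<^sup>2) * sqrt (K\<^sup>2 + x\<^sup>2) = K\<^sup>2 + x\<^sup>2" by simp
    from *[OF s this] show ?thesis by (simp add: hyp_def dhyp_def)
  qed
  show "hyp K x + dhyp K x * (y - x) < hyp K y" if "x \<noteq> y"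
  proof -
    have "(K\<^sup>2 + x * y)\<^sup>2 < (K\<^sup>2 + x\<^sup>2) * (K\<^sup>2 + y\<^sup>2)"
    proof -
      have "(K\<^sup>2 + x\<^sup>2) * (K\<^sup>2 + y\<^sup>2) - (K\<^sup>2 + x * y)\<^sup>2 = K\<^sup>2 * (x - y)\<^sup>2" by algebra
      moreover have "0 < K\<^sup>2 * (x - y)\<^sup>2" using K that by simp
      ultimately show ?thesis by linarith
    qed
    then have "K\<^sup>2 + x * y < sqrt ((K\<^sup>2 + x\<^sup>2) * (K\<^sup>2 + y\<^sup>2))" by (rule real_less_rsqrt)
    then have "0 < hyp K y - (hyp K x + dhyp K x * (y - x))"
      unfolding eq using s by (simp add: real_sqrt_mult)
    then show ?thesis by simp
  qed
  then show "hyp K x + dhyp K x * (y - x) \<le> hyp K y" by (cases "x = y") auto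
qed

lemma hyp_tendsto_0: "(\<lambda>n. hyp (real (Suc n)) y) \<longlonglongrightarrow> 0"
proof (rule tendsto_sandwich[of "\<lambda>_. 0" _ _ "\<lambda>n. y\<^sup>2 * (1 / real (Suc n))"])
  have "hyp (real (Suc n)) y \<le> y\<^sup>2 * (1 / real (Suc n))" for n
  proof -
    let ?K = "real (Suc n)"
    have "2 * k * (y\<^sup>2 / k) = 2 * y\<^sup>2" if "0 < k" for k :: real using that by simp
    from this[of ?K] have "2 * ?K * (y\<^sup>2 / ?K) = 2 * y\<^sup>2" by linarith
    then have "?K\<^sup>2 + y\<^sup>2 \<le> (?K + y\<^sup>2 / ?K)\<^sup>2" unfolding power2_sum by simp
    then have "sqrt (?K\<^sup>2 + y\<^sup>2) \<le> ?K + y\<^sup>2 / ?K" by (intro real_le_lsqrt) auto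
    then show ?thesis by (simp add: hyp_def)
  qed
  then show "\<forall>\<^sub>F n in sequentially. hyp (real (Suc n)) y \<le> y\<^sup>2 * (1 / real (Suc n))" by simp
  show "(\<lambda>n. y\<^sup>2 * (1 / real (Suc n))) \<longlonglongrightarrow> 0"
    using tendsto_mult_right_zero[OF LIMSEQ_Suc[OF lim_1_over_n]] by simp
qed (auto intro!: always_eventually hyp_nonneg)

lemma gauss_ball_le:
  assumes "0 \<le> a" shows "measure gauss {-a<..<a} \<le> 2 * a"
proof -
  have le1: "std_normal_density x \<le> 1" for x
  proof -
    have "1 / sqrt (2 * pi) \<le> 1" using pi_ge_two by simp
    moreover have "exp (- x\<^sup>2 / 2) \<le> 1" by simp
    ultimately show ?thesis unfolding std_normal_density_def by (intro mult_le_one) auto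
  qed
  have "emeasure gauss {-a<..<a} = (\<integral>\<^sup>+x. ennreal (std_normal_density x) * indicator {-a<..<a} x \<partial>lborel)"
    unfolding gauss_def by (rule emeasure_density) auto
  also have "\<dots> \<le> (\<integral>\<^sup>+x. indicator {-a<..<a} x \<partial>lborel)"
    using le1 by (intro nn_integral_mono) (auto split: split_indicator simp: ennreal_le_1)
  also have "\<dots> = ennreal (2 * a)" using assms by simp
  finally show ?thesis using assms by (simp add: gauss.emeasure_eq_measure)
qed

context brownian begin

text \<open>Used in two regimes: with \<open>K\<close> fixed and \<open>t\<close> large it says that
  the path leaves bounded sets, with \<open>K\<close> small that the values at two times
  differ.\<close>

lemma prob_incr_small:
  assumes "0 \<le> s" "s < t" "0 < K"
  shows "prob {\<omega>\<in>space M. \<bar>B t \<omega> - B s \<omega>\<bar> < K} \<le> 2 * (K / sqrt (t - s))"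
proof -
  have [measurable]: "(\<lambda>\<omega>. B t \<omega> - B s \<omega>) \<in> borel_measurable M" using B_meas assms by simp
  have "prob {\<omega>\<in>space M. \<bar>B t \<omega> - B s \<omega>\<bar> < K} = measure (distr M borel (\<lambda>\<omega>. B t \<omega> - B s \<omega>)) {-K<..<K}"
    by (subst measure_distr) (auto intro!: arg_cong[where f=prob])
  also have "\<dots> = measure gauss {-(K / sqrt (t - s))<..<K / sqrt (t - s)}"
    unfolding distr_incr[OF assms(1,2)] using assms
    by (subst measure_distr) (auto intro!: arg_cong[where f="measure gauss"] simp: field_simps)
  also have "\<dots> \<le> 2 * (K / sqrt (t - s))" using assms by (intro gauss_ball_le) auto
  finally show ?thesis .
qed

lemma AE_incr_nonzero:
  assumes "0 \<le> s" "s < t"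
  shows "AE \<omega> in M. B s \<omega> \<noteq> B t \<omega>"
proof (rule AE_I)
  have [measurable]: "B s \<in> borel_measurable M" "B t \<in> borel_measurable M" using B_meas assms by auto
  show *: "{\<omega>\<in>space M. B s \<omega> = B t \<omega>} \<in> sets M" by measurable
  have "prob {\<omega>\<in>space M. B s \<omega> = B t \<omega>} \<le> 0 + e" if "0 < e" for e
  proof -
    have "prob {\<omega>\<in>space M. B s \<omega> = B t \<omega>} \<le> prob {\<omega>\<in>space M. \<bar>B t \<omega> - B s \<omega>\<bar> < e * sqrt (t - s) / 2}"
      using that assms by (intro finite_measure_mono) auto
    also have "\<dots> \<le> e" using prob_incr_small[OF assms, of "e * sqrt (t - s) / 2"] that assms by simp
    finally show ?thesis by simp
  qed
  then have "prob {\<omega>\<in>space M. B s \<omega> = B t \<omega>} \<le> 0" by (rule field_le_epsilon)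
  then show "emeasure M {\<omega>\<in>space M. B s \<omega> = B t \<omega>} = 0"
    by (simp add: emeasure_eq_measure measure_le_0_iff)
qed auto

text \<open>Rational times suffice: any nondegenerate interval contains two of them, so almost every
  path is constant on no interval.\<close>

lemma AE_not_constant: "AE \<omega> in M. \<forall>s\<in>\<rat>. \<forall>t\<in>\<rat>. 0 \<le> s \<longrightarrow> s < t \<longrightarrow> B s \<omega> \<noteq> B t \<omega>"
  by (intro AE_ball_countable[THEN iffD2] ballI countable_rat)
     (auto intro!: AE_incr_nonzero)

lemma integrable_B_stop:
  assumes "stop_real \<sigma>" "\<And>\<omega>. \<omega> \<in> space M \<Longrightarrow> \<sigma> \<omega> \<le> T"
  shows "integrable M (\<lambda>\<omega>. B (\<sigma> \<omega>) \<omega>)"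
proof -
  have T: "0 \<le> T" using assms(2) stop_real_nonneg[OF assms(1)] not_empty by (meson ex_in_conv order_trans)
  obtain D where D: "integrable M D" "\<And>u \<omega>. \<omega> \<in> space M \<Longrightarrow> 0 \<le> u \<Longrightarrow> u \<le> T \<Longrightarrow> \<bar>B u \<omega>\<bar> \<le> D \<omega>"
    by (rule dominating[OF T]) blast
  show ?thesis
  proof (rule Bochner_Integration.integrable_bound[OF D(1)])
    show "(\<lambda>\<omega>. B (\<sigma> \<omega>) \<omega>) \<in> borel_measurable M"
      using B_at_measurable stop_real_measurable stop_real_nonneg assms by blast
    show "AE \<omega> in M. norm (B (\<sigma> \<omega>) \<omega>) \<le> norm (D \<omega>)"
    proof (rule AE_I2)
      fix \<omega> assume \<omega>: "\<omega> \<in> space M"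
      show "norm (B (\<sigma> \<omega>) \<omega>) \<le> norm (D \<omega>)"
        using D(2)[OF \<omega> stop_real_nonneg[OF assms(1) \<omega>] assms(2)[OF \<omega>]] by simp
    qed
  qed
qed

text \<open>That \<open>Y\<close> is known at time \<rho> is expressed through its products with the
  indicators of {\<rho> \<le> s}. With \<rho> rounded up to a grid, the integrand is a sum of terms
  known at a grid time multiplied by a later increment, each of mean zero; \<open>dominating\<close>
  lets the mesh tend to 0.\<close>

lemma optional_stopping_terminal:
  assumes \<rho>: "stop_real \<rho>" "\<And>\<omega>. \<omega> \<in> space M \<Longrightarrow> \<rho> \<omega> \<le> T" and T: "0 \<le> T"
    and Y: "\<And>s. 0 \<le> s \<Longrightarrow> (\<lambda>\<omega>. Y \<omega> * indicat_real {\<omega>. \<rho> \<omega> \<le> s} \<omega>) \<in> borel_measurable (F s)"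
    and C: "\<And>\<omega>. \<bar>Y \<omega>\<bar> \<le> C"
  shows "expectation (\<lambda>\<omega>. Y \<omega> * (B T \<omega> - B (\<rho> \<omega>) \<omega>)) = 0"
proof -
  obtain D where D: "integrable M D" "\<And>u \<omega>. \<omega> \<in> space M \<Longrightarrow> 0 \<le> u \<Longrightarrow> u \<le> T \<Longrightarrow> \<bar>B u \<omega>\<bar> \<le> D \<omega>"
    by (rule dominating[OF T]) blast
  have \<rho>0: "\<omega> \<in> space M \<Longrightarrow> 0 \<le> \<rho> \<omega>" for \<omega> using stop_real_nonneg[OF \<rho>(1)] .
  have YM: "Y \<in> borel_measurable M"
    using meas_F[OF T Y[OF T]] \<rho>(2) by (subst (asm) measurable_cong[where g=Y]) auto
  have \<rho>M[measurable]: "\<rho> \<in> borel_measurable M" by (rule stop_real_measurable[OF \<rho>(1)])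
  have C0: "0 \<le> C" using C[of undefined] by linarith
  define t where "t n k = min (real k / 2 ^ n) T" for n k :: nat
  have t: "0 \<le> t n k" "t n k \<le> T" for n k using T by (auto simp: t_def)
  define J where "J n \<omega> = nat \<lceil>2 ^ n * \<rho> \<omega>\<rceil>" for n \<omega>
  define I where "I n k \<omega> = indicat_real {\<omega>. J n \<omega> = k} \<omega>" for n k \<omega>
  have le_iff: "J n \<omega> \<le> k \<longleftrightarrow> \<rho> \<omega> \<le> t n k" if "\<omega> \<in> space M" for n k \<omega>
    using \<rho>(2)[OF that] by (simp add: J_def t_def nat_le_iff ceiling_le_iff pos_le_divide_eq mult.commute)
  \<comment> \<open>The event that the rounded time is the k-th grid point is a difference of two
    events of the form {\<rho> \<le> s}; for k = 0 there is nothing to subtract.\<close>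
  have I_eq: "Y \<omega> * I n k \<omega> = Y \<omega> * indicat_real {\<omega>. \<rho> \<omega> \<le> t n k} \<omega>
      - (if k = 0 then 0 else Y \<omega> * indicat_real {\<omega>. \<rho> \<omega> \<le> t n (k - 1)} \<omega>)" if "\<omega> \<in> space M" for n k \<omega>
    using le_iff[OF that, of n k] le_iff[OF that, of n "k - 1"] by (auto simp: I_def indicator_def)
  have YI: "(\<lambda>\<omega>. Y \<omega> * I n k \<omega>) \<in> borel_measurable (F (t n k))" for n k
  proof -
    have "t n (k - 1) \<le> t n k" unfolding t_def by (intro min.mono divide_right_mono) auto
    note Y1 = meas_F_mono[OF t(1) this Y[OF t(1)]]
    have "(\<lambda>\<omega>. Y \<omega> * indicat_real {\<omega>. \<rho> \<omega> \<le> t n k} \<omega>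
      - (if k = 0 then 0 else Y \<omega> * indicat_real {\<omega>. \<rho> \<omega> \<le> t n (k - 1)} \<omega>)) \<in> borel_measurable (F (t n k))"
      using Y[OF t(1)] Y1 by (cases "k = 0") (auto intro!: borel_measurable_diff)
    then show ?thesis
      by (subst measurable_cong[OF I_eq]) (auto simp: space_F t)
  qed
  have YIi: "integrable M (\<lambda>\<omega>. Y \<omega> * I n k \<omega>)" for n k
    by (rule integrable_const_bound[where B=C])
       (use meas_F[OF t(1) YI] C C0 in \<open>auto simp: I_def indicator_def\<close>)
  have "expectation (\<lambda>\<omega>. Y \<omega> * (B T \<omega> - B (min (dyadic_up n (\<rho> \<omega>)) T) \<omega>)) = 0" for n
  proof -
    have "expectation (\<lambda>\<omega>. Y \<omega> * (B T \<omega> - B (min (dyadic_up n (\<rho> \<omega>)) T) \<omega>)) =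
       expectation (\<lambda>\<omega>. \<Sum>k\<le>nat \<lceil>2 ^ n * T\<rceil>. Y \<omega> * I n k \<omega> * (B T \<omega> - B (t n k) \<omega>))"
    proof (intro Bochner_Integration.integral_cong refl)
      fix \<omega> assume \<omega>: "\<omega> \<in> space M"
      let ?k = "J n \<omega>"
      have "?k \<le> nat \<lceil>2 ^ n * T\<rceil>"
        unfolding J_def using \<rho>(2)[OF \<omega>] by (intro nat_mono ceiling_mono mult_left_mono) auto
      then have "(\<Sum>k\<le>nat \<lceil>2 ^ n * T\<rceil>. Y \<omega> * I n k \<omega> * (B T \<omega> - B (t n k) \<omega>))
         = (\<Sum>k\<in>{?k}. Y \<omega> * I n k \<omega> * (B T \<omega> - B (t n k) \<omega>))"
        by (intro sum.mono_neutral_right) (auto simp: I_def indicator_def)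
      also have "\<dots> = Y \<omega> * (B T \<omega> - B (min (dyadic_up n (\<rho> \<omega>)) T) \<omega>)"
        using dyadic_up_nat[OF \<rho>0[OF \<omega>]] by (simp add: I_def t_def J_def)
      finally show "Y \<omega> * (B T \<omega> - B (min (dyadic_up n (\<rho> \<omega>)) T) \<omega>)
        = (\<Sum>k\<le>nat \<lceil>2 ^ n * T\<rceil>. Y \<omega> * I n k \<omega> * (B T \<omega> - B (t n k) \<omega>))" ..
    qed
    also have "\<dots> = (\<Sum>k\<le>nat \<lceil>2 ^ n * T\<rceil>. expectation (\<lambda>\<omega>. Y \<omega> * I n k \<omega> * (B T \<omega> - B (t n k) \<omega>)))"
      by (intro Bochner_Integration.integral_sum integrable_mult_incr[OF t YI YIi])
    also have "\<dots> = 0"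
      by (intro sum.neutral ballI expectation_mult_incr[OF t YI YIi])
    finally show ?thesis .
  qed
  moreover have "(\<lambda>n. expectation (\<lambda>\<omega>. Y \<omega> * (B T \<omega> - B (min (dyadic_up n (\<rho> \<omega>)) T) \<omega>)))
     \<longlonglongrightarrow> expectation (\<lambda>\<omega>. Y \<omega> * (B T \<omega> - B (\<rho> \<omega>) \<omega>))"
  proof (rule integral_dominated_convergence[where w="\<lambda>\<omega>. C * (2 * D \<omega>)"])
    show "(\<lambda>\<omega>. Y \<omega> * (B T \<omega> - B (\<rho> \<omega>) \<omega>)) \<in> borel_measurable M"
      using YM B_meas[OF T] B_at_measurable[OF \<rho>M \<rho>0] by measurable
    show "(\<lambda>\<omega>. Y \<omega> * (B T \<omega> - B (min (dyadic_up n (\<rho> \<omega>)) T) \<omega>)) \<in> borel_measurable M" for n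
    proof -
      have "(\<lambda>\<omega>. min (dyadic_up n (\<rho> \<omega>)) T) \<in> borel_measurable M"
        unfolding dyadic_up_def by measurable
      moreover have "0 \<le> min (dyadic_up n (\<rho> \<omega>)) T" if "\<omega> \<in> space M" for \<omega>
        using \<rho>0[OF that] T order_trans[OF _ dyadic_up_ge] by auto
      ultimately show ?thesis using YM B_meas[OF T] B_at_measurable by measurable
    qed
    show "integrable M (\<lambda>\<omega>. C * (2 * D \<omega>))" using D by simp
    show "AE \<omega> in M. (\<lambda>n. Y \<omega> * (B T \<omega> - B (min (dyadic_up n (\<rho> \<omega>)) T) \<omega>)) \<longlonglongrightarrow> Y \<omega> * (B T \<omega> - B (\<rho> \<omega>) \<omega>)"
    proof (rule AE_I2)
      fix \<omega> assume \<omega>: "\<omega> \<in> space M"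
      have "(\<lambda>n. min (dyadic_up n (\<rho> \<omega>)) T) \<longlonglongrightarrow> min (\<rho> \<omega>) T" by (intro tendsto_min dyadic_up_tendsto tendsto_const)
      moreover have "0 \<le> dyadic_up n (\<rho> \<omega>)" for n using order_trans[OF \<rho>0[OF \<omega>] dyadic_up_ge] .
      ultimately have "(\<lambda>n. B (min (dyadic_up n (\<rho> \<omega>)) T) \<omega>) \<longlonglongrightarrow> B (\<rho> \<omega>) \<omega>"
        using \<rho>0[OF \<omega>] \<rho>(2)[OF \<omega>] T by (intro continuous_on_LIMSEQ[OF B_cont[OF \<omega>]]) (auto simp: min_absorb1)
      then show "(\<lambda>n. Y \<omega> * (B T \<omega> - B (min (dyadic_up n (\<rho> \<omega>)) T) \<omega>)) \<longlonglongrightarrow> Y \<omega> * (B T \<omega> - B (\<rho> \<omega>) \<omega>)"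
        by (intro tendsto_intros)
    qed
    show "AE \<omega> in M. norm (Y \<omega> * (B T \<omega> - B (min (dyadic_up n (\<rho> \<omega>)) T) \<omega>)) \<le> C * (2 * D \<omega>)" for n
    proof (rule AE_I2)
      fix \<omega> assume \<omega>: "\<omega> \<in> space M"
      have "0 \<le> min (dyadic_up n (\<rho> \<omega>)) T" using order_trans[OF \<rho>0[OF \<omega>] dyadic_up_ge] T by simp
      then have "\<bar>B T \<omega> - B (min (dyadic_up n (\<rho> \<omega>)) T) \<omega>\<bar> \<le> 2 * D \<omega>"
        using D(2)[OF \<omega> T order_refl] D(2)[OF \<omega>, of "min (dyadic_up n (\<rho> \<omega>)) T"] by simp
      then show "norm (Y \<omega> * (B T \<omega> - B (min (dyadic_up n (\<rho> \<omega>)) T) \<omega>)) \<le> C * (2 * D \<omega>)"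
        using C[of \<omega>] C0 by (auto simp: abs_mult intro!: mult_mono)
    qed
  qed
  ultimately show ?thesis using LIMSEQ_unique[OF _ tendsto_const] by simp
qed

text \<open>Both times are compared with the constant time \<open>T\<close>: since \<sigma> \<le>
  \<rho>, the factor evaluated at \<sigma> is known at \<rho> as well.\<close>

lemma optional_stopping:
  assumes \<sigma>: "stop_real \<sigma>" and \<rho>: "stop_real \<rho>"
    and le: "\<And>\<omega>. \<omega> \<in> space M \<Longrightarrow> \<sigma> \<omega> \<le> \<rho> \<omega>" "\<And>\<omega>. \<omega> \<in> space M \<Longrightarrow> \<rho> \<omega> \<le> T"
    and g: "g \<in> borel_measurable borel" "\<And>x. \<bar>g x\<bar> \<le> C"
  shows "expectation (\<lambda>\<omega>. g (B (\<sigma> \<omega>) \<omega>) * (B (\<rho> \<omega>) \<omega> - B (\<sigma> \<omega>) \<omega>)) = 0"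
proof -
  have T: "0 \<le> T" using le(2) stop_real_nonneg[OF \<rho>] not_empty by (meson ex_in_conv order_trans)
  note \<sigma>T = order_trans[OF le]
  have m: "(\<lambda>\<omega>. g (B (\<sigma> \<omega>) \<omega>) * indicat_real {\<omega>. \<theta> \<omega> \<le> s} \<omega>) \<in> borel_measurable (F s)"
    if \<theta>: "stop_real \<theta>" "\<And>\<omega>. \<omega> \<in> space M \<Longrightarrow> \<sigma> \<omega> \<le> \<theta> \<omega>" and s: "0 \<le> s" for s \<theta>
  proof -
    have "(\<lambda>\<omega>. g (B (min (\<sigma> \<omega>) s) \<omega>) * indicat_real {\<omega>\<in>space M. \<theta> \<omega> \<le> s} \<omega>) \<in> borel_measurable (F s)"
      using B_stop_measurable[OF \<sigma> s] stop_real_sets[OF \<theta>(1) s] g(1) by measurable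
    moreover have "g (B (\<sigma> \<omega>) \<omega>) * indicat_real {\<omega>. \<theta> \<omega> \<le> s} \<omega>
       = g (B (min (\<sigma> \<omega>) s) \<omega>) * indicat_real {\<omega>\<in>space M. \<theta> \<omega> \<le> s} \<omega>" if "\<omega> \<in> space (F s)" for \<omega>
    proof -
      have \<omega>: "\<omega> \<in> space M" using that space_F[OF s] by simp
      from \<theta>(2)[OF this] show ?thesis using \<omega> by (auto simp: indicator_def min_def)
    qed
    ultimately show ?thesis by (subst measurable_cong) auto
  qed
  have *: "expectation (\<lambda>\<omega>. g (B (\<sigma> \<omega>) \<omega>) * (B T \<omega> - B (\<sigma> \<omega>) \<omega>)) = 0"
    by (rule optional_stopping_terminal[OF \<sigma> \<sigma>T T m[OF \<sigma>] g(2)]) auto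
  have **: "expectation (\<lambda>\<omega>. g (B (\<sigma> \<omega>) \<omega>) * (B T \<omega> - B (\<rho> \<omega>) \<omega>)) = 0"
    by (rule optional_stopping_terminal[OF \<rho> le(2) T m[OF \<rho>] g(2)]) (auto intro: le)
  have C0: "0 \<le> C" using g(2)[of undefined] by linarith
  have gm: "(\<lambda>\<omega>. g (B (\<sigma> \<omega>) \<omega>)) \<in> borel_measurable M"
    using B_at_measurable[OF stop_real_measurable[OF \<sigma>] stop_real_nonneg[OF \<sigma>]] g(1) by measurable
  have i: "integrable M (\<lambda>\<omega>. g (B (\<sigma> \<omega>) \<omega>) * (B T \<omega> - B (\<theta> \<omega>) \<omega>))" if "stop_real \<theta>" "\<And>\<omega>. \<omega> \<in> space M \<Longrightarrow> \<theta> \<omega> \<le> T" for \<theta>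
  proof -
    have "integrable M (\<lambda>\<omega>. C * (B T \<omega> - B (\<theta> \<omega>) \<omega>))"
      using integrable_B[OF T] integrable_B_stop[OF that] by simp
    then show ?thesis
      by (rule Bochner_Integration.integrable_bound)
         (use gm B_meas[OF T] B_at_measurable[OF stop_real_measurable stop_real_nonneg] that g(2) C0
          in \<open>auto simp: abs_mult intro!: mult_right_mono\<close>)
  qed
  have "expectation (\<lambda>\<omega>. g (B (\<sigma> \<omega>) \<omega>) * (B (\<rho> \<omega>) \<omega> - B (\<sigma> \<omega>) \<omega>)) =
    expectation (\<lambda>\<omega>. g (B (\<sigma> \<omega>) \<omega>) * (B T \<omega> - B (\<sigma> \<omega>) \<omega>) - g (B (\<sigma> \<omega>) \<omega>) * (B T \<omega> - B (\<rho> \<omega>) \<omega>))"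
    by (intro Bochner_Integration.integral_cong) (auto simp: algebra_simps)
  also have "\<dots> = 0"
    using * ** by (subst Bochner_Integration.integral_diff[OF i[OF \<sigma> \<sigma>T] i[OF \<rho> le(2)]]) auto
  finally show ?thesis .
qed

lemma expectation_B_stop:
  assumes \<sigma>: "stop_real \<sigma>" "\<And>\<omega>. \<omega> \<in> space M \<Longrightarrow> \<sigma> \<omega> \<le> T"
  shows "expectation (\<lambda>\<omega>. B (\<sigma> \<omega>) \<omega>) = 0"
proof -
  have "expectation (\<lambda>\<omega>. (\<lambda>_. 1) (B 0 \<omega>) * (B (\<sigma> \<omega>) \<omega> - B 0 \<omega>)) = 0"
    by (rule optional_stopping[OF stop_real_const assms(1)]) (use stop_real_nonneg assms in auto)
  then show ?thesis by (subst (asm) Bochner_Integration.integral_cong[OF refl]) (auto simp: B_0)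
qed

lemma integrable_hyp:
  assumes "0 < K" "integrable N X" shows "integrable N (\<lambda>\<omega>. hyp K (X \<omega>))"
proof (rule Bochner_Integration.integrable_bound[OF assms(2)])
  show "AE x in N. norm (hyp K (X x)) \<le> norm (X x)"
    using hyp_nonneg[OF assms(1)] hyp_le_abs[OF assms(1)] by auto
qed (use assms in measurable)

text \<open>\<open>gap\<close> is the tangent defect of the convex function \<open>hyp K\<close>,
  hence nonnegative; its linear part has mean zero by optional stopping because
  \<open>dhyp K\<close> is bounded. Its expectation measures exactly by how much the expectation of
  \<open>hyp K\<close> grows.\<close>

lemma hyp_stopping:
  assumes K: "0 < K" and \<sigma>: "stop_real \<sigma>" and \<rho>: "stop_real \<rho>"
    and le: "\<And>\<omega>. \<omega> \<in> space M \<Longrightarrow> \<sigma> \<omega> \<le> \<rho> \<omega>" "\<And>\<omega>. \<omega> \<in> space M \<Longrightarrow> \<rho> \<omega> \<le> T"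
  defines "gap \<equiv> \<lambda>\<omega>. hyp K (B (\<rho> \<omega>) \<omega>) - hyp K (B (\<sigma> \<omega>) \<omega>) - dhyp K (B (\<sigma> \<omega>) \<omega>) * (B (\<rho> \<omega>) \<omega> - B (\<sigma> \<omega>) \<omega>)"
  shows "integrable M gap"
    and "expectation gap = expectation (\<lambda>\<omega>. hyp K (B (\<rho> \<omega>) \<omega>)) - expectation (\<lambda>\<omega>. hyp K (B (\<sigma> \<omega>) \<omega>))"
    and "expectation (\<lambda>\<omega>. hyp K (B (\<sigma> \<omega>) \<omega>)) \<le> expectation (\<lambda>\<omega>. hyp K (B (\<rho> \<omega>) \<omega>))"
proof -
  note i\<sigma> = integrable_B_stop[OF \<sigma> order_trans[OF le]] and i\<rho> = integrable_B_stop[OF \<rho> le(2)]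
  note h = integrable_hyp[OF K i\<sigma>] integrable_hyp[OF K i\<rho>]
  have i: "integrable M (\<lambda>\<omega>. dhyp K (B (\<sigma> \<omega>) \<omega>) * (B (\<rho> \<omega>) \<omega> - B (\<sigma> \<omega>) \<omega>))"
  proof (rule Bochner_Integration.integrable_bound[OF Bochner_Integration.integrable_diff[OF i\<rho> i\<sigma>]])
    show "(\<lambda>\<omega>. dhyp K (B (\<sigma> \<omega>) \<omega>) * (B (\<rho> \<omega>) \<omega> - B (\<sigma> \<omega>) \<omega>)) \<in> borel_measurable M"
      using i\<sigma> i\<rho> by measurable
    show "AE x in M. norm (dhyp K (B (\<sigma> x) x) * (B (\<rho> x) x - B (\<sigma> x) x)) \<le> norm (B (\<rho> x) x - B (\<sigma> x) x)"
      using dhyp_bound by (auto simp: abs_mult intro!: mult_left_le_one_le)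
  qed
  show "integrable M gap" unfolding gap_def using h i by auto
  show *: "expectation gap = expectation (\<lambda>\<omega>. hyp K (B (\<rho> \<omega>) \<omega>)) - expectation (\<lambda>\<omega>. hyp K (B (\<sigma> \<omega>) \<omega>))"
    unfolding gap_def using h i optional_stopping[OF \<sigma> \<rho> le hyp_measurable(2) dhyp_bound] by simp
  have "0 \<le> gap \<omega>" for \<omega> unfolding gap_def using hyp_convex(2)[OF K, of "B (\<sigma> \<omega>) \<omega>" "B (\<rho> \<omega>) \<omega>"] by simp
  then have "0 \<le> expectation gap" by (intro Bochner_Integration.integral_nonneg) auto
  then show "expectation (\<lambda>\<omega>. hyp K (B (\<sigma> \<omega>) \<omega>)) \<le> expectation (\<lambda>\<omega>. hyp K (B (\<rho> \<omega>) \<omega>))"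
    using * by simp
qed

abbreviation trunc :: "('a \<Rightarrow> ereal) \<Rightarrow> real \<Rightarrow> 'a \<Rightarrow> real" where
  "trunc \<tau> T \<equiv> \<lambda>\<omega>. real_of_ereal (min (\<tau> \<omega>) (ereal T))"

lemma trunc_le: "stop_ext \<tau> \<Longrightarrow> \<omega> \<in> space M \<Longrightarrow> 0 \<le> T \<Longrightarrow> trunc \<tau> T \<omega> \<le> T"
  using stop_ext_nonneg[of \<tau> \<omega>] by (cases "\<tau> \<omega>") (auto simp: min_def)

text \<open>Where \<tau> is infinite the stopped path is the free path, which has left [-K, K] at a
  late time with probability close to 1. Markov's inequality then bounds the event by c/K; first t
  and then K tends to infinity.\<close>

lemma stop_ext_finite_if_bounded:
  assumes \<tau>: "stop_ext \<tau>" and c: "\<And>t. 0 \<le> t \<Longrightarrow> expectation (\<lambda>\<omega>. \<bar>B (trunc \<tau> t \<omega>) \<omega>\<bar>) \<le> c"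
  shows "AE \<omega> in M. \<tau> \<omega> < \<infinity>"
proof -
  let ?N = "{\<omega>\<in>space M. \<tau> \<omega> = \<infinity>}"
  note [measurable] = stop_ext_measurable[OF \<tau>]
  have N: "?N \<in> sets M" by measurable
  have 1: "prob ?N \<le> c / K + 2 * (K / sqrt t)" if "0 < K" "0 < t" for K t
  proof -
    note [measurable] = B_meas[OF less_imp_le[OF that(2)]]
    let ?A = "{\<omega>\<in>space M. \<tau> \<omega> = \<infinity> \<and> K \<le> \<bar>B t \<omega>\<bar>}"
    have "prob ?N \<le> prob (?A \<union> {\<omega>\<in>space M. \<bar>B t \<omega> - B 0 \<omega>\<bar> < K})"
      by (rule finite_measure_mono) (use B_meas[of 0] in \<open>auto simp: B_0\<close>)
    also have "\<dots> \<le> prob ?A + prob {\<omega>\<in>space M. \<bar>B t \<omega> - B 0 \<omega>\<bar> < K}"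
      by (rule measure_Un_le) (use B_meas[of 0] in auto)
    also have "prob {\<omega>\<in>space M. \<bar>B t \<omega> - B 0 \<omega>\<bar> < K} \<le> 2 * (K / sqrt t)"
      using prob_incr_small[of 0 t K] that by simp
    also have "prob ?A \<le> c / K"
    proof -
      have "K * prob ?A = expectation (\<lambda>\<omega>. K * indicator ?A \<omega>)" by simp
      also have "\<dots> \<le> expectation (\<lambda>\<omega>. \<bar>B (trunc \<tau> t \<omega>) \<omega>\<bar>)"
      proof (rule integral_mono)
        show "integrable M (\<lambda>\<omega>. K * indicat_real ?A \<omega>)" by (intro integrable_mult_right integrable_indicat) measurable
        show "integrable M (\<lambda>\<omega>. \<bar>B (trunc \<tau> t \<omega>) \<omega>\<bar>)"
          using that by (intro integrable_abs integrable_B_stop[OF stop_ext_trunc[OF \<tau>] trunc_le[OF \<tau>]]) auto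
      qed (auto simp: indicator_def)
      also have "\<dots> \<le> c" using c that by simp
      finally show ?thesis using that by (simp add: field_simps)
    qed
    finally show ?thesis by simp
  qed
  have 2: "prob ?N \<le> c / K" if "0 < K" for K
  proof (rule LIMSEQ_le_const)
    have "(\<lambda>n. c / K + 2 * (K * (1 / sqrt (real n)))) \<longlonglongrightarrow> c / K + 2 * (K * 0)"
      by (intro tendsto_intros tendsto_divide_0[OF tendsto_const] filterlim_at_top_imp_at_infinity
          filterlim_compose[OF sqrt_at_top filterlim_real_sequentially])
    then show "(\<lambda>n. c / K + 2 * (K / sqrt (real n))) \<longlonglongrightarrow> c / K" by simp
    show "\<exists>N. \<forall>n\<ge>N. prob ?N \<le> c / K + 2 * (K / sqrt (real n))"
      using 1[OF that] by (intro exI[of _ 1]) auto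
  qed
  have "prob ?N \<le> 0"
  proof (rule LIMSEQ_le_const)
    show "(\<lambda>n. c * (1 / real n)) \<longlonglongrightarrow> 0" using tendsto_mult_right_zero[OF lim_1_over_n] by simp
    show "\<exists>N. \<forall>n\<ge>N. prob ?N \<le> c * (1 / real n)" using 2 by (intro exI[of _ 1]) auto
  qed
  then have "prob ?N = 0" by (simp add: measure_le_0_iff)
  then have "emeasure M ?N = 0" by (simp add: emeasure_eq_measure)
  then show ?thesis using N by (intro AE_I[of _ _ ?N]) auto
qed

text \<open>The process \<eta> + c(B - B_\<tau>), run from \<tau> on, is stopped when it reaches 0.
  The result is nonnegative with mean \<eta>, and on the one-sided event it equals \<eta> plus the
  signed increment. Markov's inequality with \<eta> tending to 0 forbids a positive
  increment.\<close>

lemma oscillation_step: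
  assumes \<tau>: "stop_real \<tau>" "\<And>\<omega>. \<omega> \<in> space M \<Longrightarrow> \<tau> \<omega> \<le> T" and u: "0 < u" and c: "c = 1 \<or> c = - 1"
  shows "AE \<omega> in M. (\<forall>v\<in>{0..u}. 0 \<le> c * (B (\<tau> \<omega> + v) \<omega> - B (\<tau> \<omega>) \<omega>)) \<longrightarrow> B (\<tau> \<omega> + u) \<omega> = B (\<tau> \<omega>) \<omega>"
proof -
  have \<tau>0: "\<omega> \<in> space M \<Longrightarrow> 0 \<le> \<tau> \<omega>" for \<omega> using stop_real_nonneg[OF \<tau>(1)] .
  \<comment> \<open>The \<open>min\<close> freezes the process at \<eta> until \<tau>, so that its
    first zero comes after \<tau>.\<close>
  define X where "X \<eta> s \<omega> = \<eta> + c * (B s \<omega> - B (min (\<tau> \<omega>) s) \<omega>)" for \<eta> s \<omega>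
  have Xc: "continuous_on {0..} (\<lambda>s. X \<eta> s \<omega>)" if "\<omega> \<in> space M" for \<eta> \<omega>
    unfolding X_def using \<tau>0[OF that]
    by (intro continuous_intros B_cont[OF that] continuous_on_compose2[OF B_cont[OF that]]) auto
  have Xm: "X \<eta> u \<in> borel_measurable (F s)" if "0 \<le> u" "u \<le> s" for \<eta> u s
    unfolding X_def[abs_def] using B_adapted[OF that] meas_F_mono[OF that B_stop_measurable[OF \<tau>(1) that(1)]]
    by measurable
  define \<rho> where "\<rho> \<eta> \<omega> = first_time (\<lambda>s. X \<eta> s \<omega>)" for \<eta> \<omega>
  have \<rho>: "stop_ext (\<rho> \<eta>)" for \<eta> unfolding \<rho>_def[abs_def] by (rule stop_ext_first_time[OF Xm Xc])
  \<comment> \<open>Truncation at T + u makes the time real-valued and changes nothing, because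
    \<tau> + u \<le> T + u.\<close>
  define \<theta> where "\<theta> \<eta> \<omega> = min (trunc (\<rho> \<eta>) (T + u) \<omega>) (\<tau> \<omega> + u)" for \<eta> \<omega>
  have T0: "0 \<le> T" using \<tau>(2) \<tau>0 not_empty by (meson ex_in_conv order_trans)
  have \<theta>: "stop_real (\<theta> \<eta>)" for \<eta> unfolding \<theta>_def
    using T0 u by (intro stop_real_min stop_ext_trunc \<rho> stop_real_add \<tau>) auto
  have \<theta>_eq: "ereal (\<theta> \<eta> \<omega>) = min (\<rho> \<eta> \<omega>) (ereal (\<tau> \<omega> + u))" if "\<omega> \<in> space M" for \<eta> \<omega>
    using first_time_nonneg[of "\<lambda>s. X \<eta> s \<omega>"] \<tau>(2)[OF that] \<tau>0[OF that] u T0 unfolding \<theta>_def \<rho>_def[symmetric]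
    by (cases "\<rho> \<eta> \<omega>") (auto simp: min_def)
  have ge: "\<tau> \<omega> \<le> \<theta> \<eta> \<omega>" if "\<omega> \<in> space M" "0 < \<eta>" for \<eta> \<omega>
  proof -
    have "\<not> \<rho> \<eta> \<omega> \<le> ereal (\<tau> \<omega>)"
      unfolding \<rho>_def first_time_le_iff[OF Xc[OF that(1)] \<tau>0[OF that(1)]]
      using that by (auto simp: X_def)
    then have "ereal (\<tau> \<omega>) \<le> ereal (\<theta> \<eta> \<omega>)" unfolding \<theta>_eq[OF that(1)] using u by simp
    then show ?thesis by simp
  qed
  define Z where "Z \<eta> \<omega> = \<eta> + c * (B (\<theta> \<eta> \<omega>) \<omega> - B (\<tau> \<omega>) \<omega>)" for \<eta> \<omega>
  have \<theta>T: "\<theta> \<eta> \<omega> \<le> T + u" if "\<omega> \<in> space M" for \<eta> \<omega> using \<tau>(2)[OF that] by (simp add: \<theta>_def)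
  have Zi: "integrable M (Z \<eta>)" for \<eta>
    unfolding Z_def[abs_def] using integrable_B_stop[OF \<theta> \<theta>T] integrable_B_stop[OF \<tau>] by simp
  have ZE: "expectation (Z \<eta>) = \<eta>" for \<eta>
    unfolding Z_def[abs_def] using integrable_B_stop[OF \<theta> \<theta>T, of \<eta>] integrable_B_stop[OF \<tau>]
      expectation_B_stop[OF \<theta> \<theta>T, of \<eta>] expectation_B_stop[OF \<tau>] by (simp add: prob_space)
  \<comment> \<open>A negative stopped value would mean that the continuous process passed 0
    earlier, where it would have been stopped.\<close>
  have Z0: "0 \<le> Z \<eta> \<omega>" if \<omega>: "\<omega> \<in> space M" and \<eta>: "0 < \<eta>" for \<eta> \<omega>
  proof (rule ccontr)
    assume "\<not> ?thesis"
    then have Zneg: "Z \<eta> \<omega> < 0" by simp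
    let ?f = "\<lambda>s. X \<eta> s \<omega>"
    have "?f (\<theta> \<eta> \<omega>) = Z \<eta> \<omega>" using ge[OF \<omega> \<eta>] by (simp add: X_def Z_def min_absorb1)
    moreover have "?f (\<tau> \<omega>) = \<eta>" by (simp add: X_def)
    moreover have "continuous_on {\<tau> \<omega>..\<theta> \<eta> \<omega>} ?f" using \<tau>0[OF \<omega>] by (intro continuous_on_subset[OF Xc[OF \<omega>]]) auto
    ultimately obtain s where s: "\<tau> \<omega> \<le> s" "s \<le> \<theta> \<eta> \<omega>" "?f s = 0"
      using IVT2'[of ?f "\<theta> \<eta> \<omega>" 0 "\<tau> \<omega>"] ge[OF \<omega> \<eta>] Zneg \<open>0 < \<eta>\<close> by auto
    then have "\<rho> \<eta> \<omega> \<le> ereal s"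
      unfolding \<rho>_def using \<tau>0[OF \<omega>] by (subst first_time_le_iff[OF Xc[OF \<omega>]]) (auto intro!: bexI[of _ s])
    then have "ereal (\<theta> \<eta> \<omega>) \<le> ereal s" unfolding \<theta>_eq[OF \<omega>] by (rule min.coboundedI1)
    with s have "s = \<theta> \<eta> \<omega>" by simp
    with s Zneg \<open>?f (\<theta> \<eta> \<omega>) = Z \<eta> \<omega>\<close> show False by simp
  qed
  \<comment> \<open>On the one-sided event the process stays at or above \<eta> during the whole
    interval, so it is not stopped before \<tau> + u.\<close>
  have D: "Z \<eta> \<omega> = \<eta> + c * (B (\<tau> \<omega> + u) \<omega> - B (\<tau> \<omega>) \<omega>)"
    if \<omega>: "\<omega> \<in> space M" and "0 < \<eta>" and v: "\<forall>v\<in>{0..u}. 0 \<le> c * (B (\<tau> \<omega> + v) \<omega> - B (\<tau> \<omega>) \<omega>)" for \<omega> \<eta>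
  proof -
    have "\<not> \<rho> \<eta> \<omega> \<le> ereal (\<tau> \<omega> + u)"
    proof
      assume "\<rho> \<eta> \<omega> \<le> ereal (\<tau> \<omega> + u)"
      then obtain s where s: "s \<in> {0..\<tau> \<omega> + u}" "X \<eta> s \<omega> \<le> 0"
        unfolding \<rho>_def using \<tau>0[OF \<omega>] u by (subst (asm) first_time_le_iff[OF Xc[OF \<omega>]]) auto
      have "0 < X \<eta> s \<omega>"
      proof (cases "s \<le> \<tau> \<omega>")
        case False
        then have "0 \<le> c * (B (\<tau> \<omega> + (s - \<tau> \<omega>)) \<omega> - B (\<tau> \<omega>) \<omega>)" using s by (intro bspec[OF v]) auto
        with False \<open>0 < \<eta>\<close> show ?thesis by (simp add: X_def min_absorb1)
      qed (use \<open>0 < \<eta>\<close> in \<open>simp add: X_def min_absorb2\<close>)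
      with s show False by simp
    qed
    then have "ereal (\<theta> \<eta> \<omega>) = ereal (\<tau> \<omega> + u)" unfolding \<theta>_eq[OF \<omega>] by (simp add: min_absorb2)
    then show ?thesis by (simp add: Z_def)
  qed
  have "AE \<omega> in M. (\<forall>v\<in>{0..u}. 0 \<le> c * (B (\<tau> \<omega> + v) \<omega> - B (\<tau> \<omega>) \<omega>)) \<longrightarrow> c * (B (\<tau> \<omega> + u) \<omega> - B (\<tau> \<omega>) \<omega>) < 1 / real (Suc m)" for m
  proof -
    let ?e = "1 / real (Suc m)"
    let ?N = "\<Inter>n. {\<omega>\<in>space M. ?e \<le> Z (1 / real (Suc n)) \<omega>}"
    have Zm[measurable]: "Z \<eta> \<in> borel_measurable M" for \<eta> using Zi by auto
    have "prob ?N \<le> 0"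
    proof (rule LIMSEQ_le_const)
      have "(\<lambda>n. real (Suc m) * (1 / real (Suc n))) \<longlonglongrightarrow> real (Suc m) * 0"
        by (intro tendsto_mult tendsto_const LIMSEQ_Suc[OF lim_1_over_n])
      then show "(\<lambda>n. real (Suc m) * (1 / real (Suc n))) \<longlonglongrightarrow> 0" by simp
      have "prob ?N \<le> real (Suc m) * (1 / real (Suc n))" for n
      proof -
        have "prob ?N \<le> prob {\<omega>\<in>space M. ?e \<le> Z (1 / real (Suc n)) \<omega>}"
          by (rule finite_measure_mono) (auto, measurable)
        also have "\<dots> \<le> expectation (Z (1 / real (Suc n))) / ?e"
          using Z0 Zi by (intro integral_Markov_inequality_measure[where A="{}"]) auto
        finally show ?thesis unfolding ZE by simp
      qed
      then show "\<exists>N. \<forall>n\<ge>N. prob ?N \<le> real (Suc m) * (1 / real (Suc n))" by blast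
    qed
    then have "emeasure M ?N = 0" by (simp add: measure_le_0_iff emeasure_eq_measure)
    moreover have "?N \<in> sets M" by measurable
    moreover have "\<omega> \<in> ?N" if "\<omega> \<in> space M" "\<forall>v\<in>{0..u}. 0 \<le> c * (B (\<tau> \<omega> + v) \<omega> - B (\<tau> \<omega>) \<omega>)"
      "\<not> c * (B (\<tau> \<omega> + u) \<omega> - B (\<tau> \<omega>) \<omega>) < ?e" for \<omega>
    proof (rule INT_I)
      fix n
      have "0 < 1 / real (Suc n)" by simp
      with D[OF that(1) this that(2)] that(3) have "?e \<le> Z (1 / real (Suc n)) \<omega>" by linarith
      with that(1) show "\<omega> \<in> {\<omega>\<in>space M. ?e \<le> Z (1 / real (Suc n)) \<omega>}" by blast
    qed
    ultimately show ?thesis by (intro AE_I[of _ _ ?N]) blast+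
  qed
  then have "AE \<omega> in M. \<forall>m. (\<forall>v\<in>{0..u}. 0 \<le> c * (B (\<tau> \<omega> + v) \<omega> - B (\<tau> \<omega>) \<omega>)) \<longrightarrow> c * (B (\<tau> \<omega> + u) \<omega> - B (\<tau> \<omega>) \<omega>) < 1 / real (Suc m)"
    unfolding AE_all_countable by blast
  then show ?thesis
  proof eventually_elim
    case (elim \<omega>)
    show ?case
    proof
      assume v: "\<forall>v\<in>{0..u}. 0 \<le> c * (B (\<tau> \<omega> + v) \<omega> - B (\<tau> \<omega>) \<omega>)"
      have "c * (B (\<tau> \<omega> + u) \<omega> - B (\<tau> \<omega>) \<omega>) \<le> 0"
      proof (rule ccontr)
        assume "\<not> ?thesis"
        then obtain m where "1 / real (Suc m) < c * (B (\<tau> \<omega> + u) \<omega> - B (\<tau> \<omega>) \<omega>)"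
          using reals_Archimedean[of "c * (B (\<tau> \<omega> + u) \<omega> - B (\<tau> \<omega>) \<omega>)"] by (auto simp: inverse_eq_divide not_le)
        moreover have "c * (B (\<tau> \<omega> + u) \<omega> - B (\<tau> \<omega>) \<omega>) < 1 / real (Suc m)" using elim v by blast
        ultimately show False by linarith
      qed
      moreover have "0 \<le> c * (B (\<tau> \<omega> + u) \<omega> - B (\<tau> \<omega>) \<omega>)" using u by (intro bspec[OF v]) auto
      ultimately show "B (\<tau> \<omega> + u) \<omega> = B (\<tau> \<omega>) \<omega>" using c by auto
    qed
  qed
qed

end

section \<open>Convergence of barriers and hitting times\<close>

text \<open>Painleve-Kuratowski convergence, sequentially compact for closed sets in a second countable space.\<close>
definition kconv :: "(nat \<Rightarrow> 'a::topological_space set) \<Rightarrow> 'a set \<Rightarrow> bool" where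
  "kconv S R \<longleftrightarrow> (\<forall>z. z \<notin> R \<longrightarrow> (\<exists>U. open U \<and> z \<in> U \<and> (\<forall>\<^sub>F n in sequentially. S n \<inter> U = {}))) \<and>
     (\<forall>z\<in>R. \<forall>U. open U \<longrightarrow> z \<in> U \<longrightarrow> (\<forall>\<^sub>F n in sequentially. S n \<inter> U \<noteq> {}))"

lemma kconv_outside:
  assumes "kconv S R" "z \<notin> R"
  obtains U where "open U" "z \<in> U" "\<forall>\<^sub>F n in sequentially. S n \<inter> U = {}"
  using assms unfolding kconv_def by blast

lemma kconv_inside:
  "kconv S R \<Longrightarrow> z \<in> R \<Longrightarrow> open U \<Longrightarrow> z \<in> U \<Longrightarrow> \<forall>\<^sub>F n in sequentially. S n \<inter> U \<noteq> {}"
  unfolding kconv_def by blast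

lemma kconv_mem:
  assumes "kconv S R" "\<And>n. z \<in> S n" shows "z \<in> R"
proof (rule ccontr)
  assume "z \<notin> R"
  then obtain U where "z \<in> U" "\<forall>\<^sub>F n in sequentially. S n \<inter> U = {}"
    using assms(1) by (elim kconv_outside)
  then obtain n where "S n \<inter> U = {}" using eventually_happens'[OF sequentially_bot] by blast
  with assms(2)[of n] \<open>z \<in> U\<close> show False by blast
qed

lemma kconv_avoid:
  assumes "kconv S R" "open U" "\<And>n. S n \<inter> U = {}" shows "R \<inter> U = {}"
proof (rule ccontr)
  assume "R \<inter> U \<noteq> {}"
  then obtain z where "z \<in> R" "z \<in> U" by blast
  from kconv_inside[OF assms(1) this(1) assms(2) this(2)] assms(3) show False by simp
qed

lemma kconv_closed:
  assumes "kconv S R" shows "closed R"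
  unfolding closed_def
proof (subst open_subopen, intro ballI)
  fix z assume "z \<in> - R"
  then obtain U where U: "open U" "z \<in> U" "\<forall>\<^sub>F n in sequentially. S n \<inter> U = {}"
    using assms by (auto elim!: kconv_outside)
  have "U \<subseteq> - R"
  proof
    fix y assume y: "y \<in> U"
    show "y \<in> - R"
    proof
      assume "y \<in> R"
      from eventually_conj[OF kconv_inside[OF assms this U(1) y] U(3)] show False by (simp add: eventually_False)
    qed
  qed
  with U show "\<exists>T. open T \<and> z \<in> T \<and> T \<subseteq> - R" by blast
qed

lemma eventually_disjoint_compact:
  assumes S: "\<And>z. z \<notin> R \<Longrightarrow> \<exists>U. open U \<and> z \<in> U \<and> (\<forall>\<^sub>F n in sequentially. S n \<inter> U = {})"
    and K: "compact K" "K \<inter> R = {}"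
  shows "\<forall>\<^sub>F n in sequentially. S n \<inter> K = {}"
proof -
  have "\<forall>z\<in>K. \<exists>U. open U \<and> z \<in> U \<and> (\<forall>\<^sub>F n in sequentially. S n \<inter> U = {})" using S K(2) by blast
  then obtain U where U: "\<And>z. z \<in> K \<Longrightarrow> open (U z)" "\<And>z. z \<in> K \<Longrightarrow> z \<in> U z"
      "\<And>z. z \<in> K \<Longrightarrow> \<forall>\<^sub>F n in sequentially. S n \<inter> U z = {}" by metis
  obtain C where C: "C \<subseteq> K" "finite C" "K \<subseteq> (\<Union>c\<in>C. U c)"
    by (rule compactE_image[OF K(1), of K U]) (use U in blast)+
  have "\<forall>\<^sub>F n in sequentially. \<forall>c\<in>C. S n \<inter> U c = {}"
    using C U(3) by (intro eventually_ball_finite) auto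
  then show ?thesis using C(3) by (auto elim!: eventually_mono)
qed

text \<open>A diagonal sequence decides every set of a countable base: it is eventually met or
  eventually missed. The limit consists of the points all of whose basic neighbourhoods are
  eventually met.\<close>

lemma kconv_subseq:
  fixes S :: "nat \<Rightarrow> 'a::second_countable_topology set"
  obtains r R where "strict_mono (r :: nat \<Rightarrow> nat)" "kconv (S \<circ> r) R"
proof -
  obtain C :: "'a set set" where C: "countable C" "topological_basis C"
    using ex_countable_basis by blast
  have Cne: "C \<noteq> {}" using C(2) topological_basisE[OF C(2) open_UNIV, of undefined] by blast
  define U where "U = from_nat_into C"
  have rU: "range U = C" unfolding U_def using C(1) Cne by (rule range_from_nat_into[rotated])
  define P where "P n s \<longleftrightarrow> (\<forall>\<^sub>F k in sequentially. S (s k) \<inter> U n \<noteq> {}) \<or> (\<forall>\<^sub>F k in sequentially. S (s k) \<inter> U n = {})"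
    for n and s :: "nat \<Rightarrow> nat"
  interpret subseqs P
  proof
    fix n and s :: "nat \<Rightarrow> nat" assume "strict_mono s"
    show "\<exists>r'. strict_mono r' \<and> P n (s \<circ> r')"
    proof (cases "\<exists>\<^sub>F k in sequentially. S (s k) \<inter> U n = {}")
      case True
      then have "infinite {k. S (s k) \<inter> U n = {}}"
        by (simp add: cofinite_eq_sequentially[symmetric] frequently_cofinite)
      then obtain r' :: "nat \<Rightarrow> nat" where "strict_mono r'" "\<And>k. r' k \<in> {k. S (s k) \<inter> U n = {}}"
        using infinite_enumerate by blast
      then show ?thesis unfolding P_def by (intro exI[of _ r']) auto
    next
      case False
      then show ?thesis
        unfolding P_def by (intro exI[of _ id]) (auto simp: not_frequently strict_mono_def)
    qed
  qed
  define d where "d = diagseq"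
  have P: "P k d" for k
  proof -
    \<comment> \<open>The diagonal sequence is a subsequence of the k-th chosen one only from some
      index on, so the property is first obtained for a tail.\<close>
    have P1: "P k (d \<circ> ((+) (Suc k)))"
      unfolding d_def
    proof (rule diagseq_holds)
      fix r s :: "nat \<Rightarrow> nat" and n assume r: "strict_mono r" and "P n s"
      then show "P n (s \<circ> r)"
        unfolding P_def using eventually_subseq[OF r] by (auto simp: o_def)
    qed
    have shift: "(\<forall>\<^sub>F i in sequentially. Q ((d \<circ> ((+) (Suc k))) i)) \<longleftrightarrow> (\<forall>\<^sub>F i in sequentially. Q (d i))" for Q
      using eventually_sequentially_seg[of "\<lambda>i. Q (d i)" "Suc k"] by (simp add: o_def add.commute)
    show ?thesis using P1 unfolding P_def
      by (subst (asm) shift[of "\<lambda>i. S i \<inter> U k \<noteq> {}"], subst (asm) shift[of "\<lambda>i. S i \<inter> U k = {}"])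
  qed
  define R where "R = {z. \<forall>n. z \<in> U n \<longrightarrow> (\<forall>\<^sub>F k in sequentially. S (d k) \<inter> U n \<noteq> {})}"
  have "kconv (S \<circ> d) R"
    unfolding kconv_def
  proof (intro conjI allI impI ballI)
    fix z assume "z \<notin> R"
    then obtain n where "z \<in> U n" "\<not> (\<forall>\<^sub>F k in sequentially. S (d k) \<inter> U n \<noteq> {})" by (auto simp: R_def)
    moreover from this P[of n] have "\<forall>\<^sub>F k in sequentially. S (d k) \<inter> U n = {}" by (auto simp: P_def)
    moreover have "open (U n)" using C(2) rU topological_basis_open by blast
    ultimately show "\<exists>U. open U \<and> z \<in> U \<and> (\<forall>\<^sub>F n in sequentially. (S \<circ> d) n \<inter> U = {})"
      by (auto simp: o_def)
  next
    fix z V assume z: "z \<in> R" "open V" "z \<in> V"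
    then obtain n where n: "z \<in> U n" "U n \<subseteq> V" using topological_basisE[OF C(2) z(2,3)] rU by blast
    from z n have "\<forall>\<^sub>F k in sequentially. S (d k) \<inter> U n \<noteq> {}" by (simp add: R_def)
    then show "\<forall>\<^sub>F k in sequentially. (S \<circ> d) k \<inter> V \<noteq> {}"
      using n(2) by (auto elim!: eventually_mono)
  qed
  then show ?thesis using that subseq_diagseq unfolding d_def by blast
qed

lemma root_barrierD:
  assumes "root_barrier R"
  shows root_closed: "closed R" and root_nonneg: "(t, x) \<in> R \<Longrightarrow> 0 \<le> t"
    and root_up: "(t, x) \<in> R \<Longrightarrow> t \<le> s \<Longrightarrow> (s, x) \<in> R" and root_inf: "(\<infinity>, x) \<in> R"
    and root_edge: "0 \<le> t \<Longrightarrow> (t, \<infinity>) \<in> R" "0 \<le> t \<Longrightarrow> (t, -\<infinity>) \<in> R"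
  using assms unfolding root_barrier_def by blast+

lemma kconv_root_barrier:
  assumes k: "kconv S R" and S: "\<And>n. root_barrier (S n)"
  shows "root_barrier R"
  unfolding root_barrier_def
proof (intro conjI allI impI)
  show "closed R" by (rule kconv_closed[OF k])
  have "R \<inter> ({..<0} \<times> UNIV) = {}"
  proof (rule kconv_avoid[OF k])
    show "open ({..<0::ereal} \<times> (UNIV::ereal set))" by (intro open_Times) auto
    show "S n \<inter> ({..<0} \<times> UNIV) = {}" for n using root_nonneg[OF S[of n]] by force
  qed
  then show "R \<subseteq> {0..} \<times> UNIV" by (auto simp: disjoint_iff not_less)
  fix t x s assume R: "(t, x) \<in> R" and "t \<le> s"
  show "(s, x) \<in> R"
  proof (cases "s = t")
    case False
    then have ts: "t < s" using \<open>t \<le> s\<close> by simp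
    show ?thesis
    proof (rule ccontr)
      assume "(s, x) \<notin> R"
      then obtain U where U: "open U" "(s, x) \<in> U" "\<forall>\<^sub>F n in sequentially. S n \<inter> U = {}"
        using k by (elim kconv_outside)
      then obtain A V where AV: "open A" "open V" "(s, x) \<in> A \<times> V" "A \<times> V \<subseteq> U" by (metis open_prod_elim)
      \<comment> \<open>A point of \<open>S n\<close> near (t, x) with time below \<open>s\<close>
        lifts to time \<open>s\<close>, inside the neighbourhood that \<open>S n\<close> is supposed
        to miss.\<close>
      have "\<forall>\<^sub>F n in sequentially. S n \<inter> ({..<s} \<times> V) \<noteq> {}"
        using AV ts by (intro kconv_inside[OF k R]) (auto intro: open_Times)
      with U(3) have "\<forall>\<^sub>F n in sequentially. False"
      proof eventually_elim
        case (elim n)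
        then obtain t' x' where "(t', x') \<in> S n" "t' < s" "x' \<in> V" by auto
        then have "(s, x') \<in> S n \<inter> U" using root_up[OF S[of n], of t' x' s] AV by auto
        with elim show False by blast
      qed
      then show False by simp
    qed
  qed (use R in simp)
qed (auto intro!: kconv_mem[OF k] root_inf[OF S] root_edge[OF S])

text \<open>\<open>infdist\<close> to the empty set is 0, so a barrier without finite points gets
  the constant 1; otherwise nonpositive values would not mean membership.\<close>

definition hit_dist :: "(ereal \<times> ereal) set \<Rightarrow> real \<times> real \<Rightarrow> real" where
  "hit_dist R z = (if \<exists>t x. (ereal t, ereal x) \<in> R then infdist z {(t, x). (ereal t, ereal x) \<in> R} else 1)"

lemma closed_real_section: "closed R \<Longrightarrow> closed {(t, x). (ereal t, ereal x) \<in> R}"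
proof -
  assume "closed R"
  then have "closed ((\<lambda>z. (ereal (fst z), ereal (snd z))) -` R)"
    by (rule closed_vimage) (intro continuous_intros)
  then show ?thesis by (simp add: vimage_def case_prod_unfold)
qed

lemma hit_dist_le_0_iff: "closed R \<Longrightarrow> hit_dist R (t, x) \<le> 0 \<longleftrightarrow> (ereal t, ereal x) \<in> R"
proof -
  assume c: "closed R"
  show ?thesis
  proof (cases "\<exists>t x. (ereal t, ereal x) \<in> R")
    case True
    then have ne: "{(t, x). (ereal t, ereal x) \<in> R} \<noteq> {}" by auto
    have "hit_dist R (t, x) \<le> 0 \<longleftrightarrow> infdist (t, x) {(t, x). (ereal t, ereal x) \<in> R} = 0"
      using True infdist_nonneg[of "(t, x)"] by (auto simp: hit_dist_def intro: antisym)
    also have "\<dots> \<longleftrightarrow> (t, x) \<in> {(t, x). (ereal t, ereal x) \<in> R}"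
      by (rule in_closed_iff_infdist_zero[symmetric, OF closed_real_section[OF c] ne])
    finally show ?thesis by simp
  qed (auto simp: hit_dist_def)
qed

lemma hit_dist_continuous: "continuous_on UNIV (hit_dist R)"
  unfolding hit_dist_def by (cases "\<exists>t x. (ereal t, ereal x) \<in> R") (auto intro!: continuous_intros)

lemma hitting_time_nonneg: "0 \<le> hitting_time B R \<omega>"
  unfolding hitting_time_def by (rule Inf_greatest) auto

lemma hitting_time_le: "0 \<le> s \<Longrightarrow> (ereal s, ereal (B s \<omega>)) \<in> R \<Longrightarrow> hitting_time B R \<omega> \<le> ereal s"
  unfolding hitting_time_def by (rule Inf_lower) auto

lemma hitting_time_eq:
  "closed R \<Longrightarrow> hitting_time B R \<omega> = first_time (\<lambda>s. hit_dist R (s, B s \<omega>))"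
  unfolding hitting_time_def first_time_def by (simp add: hit_dist_le_0_iff)

context brownian begin

lemma hit_dist_path_continuous: "\<omega> \<in> space M \<Longrightarrow> continuous_on {0..} (\<lambda>s. hit_dist R (s, B s \<omega>))"
  by (rule continuous_on_compose2[OF hit_dist_continuous]) (auto intro!: continuous_intros B_cont)

lemma stop_ext_hitting: "closed R \<Longrightarrow> stop_ext (hitting_time B R)"
proof -
  assume c: "closed R"
  have "stop_ext (\<lambda>\<omega>. first_time (\<lambda>s. hit_dist R (s, B s \<omega>)))"
  proof (rule stop_ext_first_time)
    fix u s :: real assume us: "0 \<le> u" "u \<le> s"
    have [measurable]: "hit_dist R \<in> borel_measurable borel"
      by (rule borel_measurable_continuous_onI[OF hit_dist_continuous])
    note [measurable] = B_adapted[OF us]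
    have "(\<lambda>\<omega>. (u, B u \<omega>)) \<in> borel_measurable (F s)" unfolding borel_prod[symmetric] by measurable
    then show "(\<lambda>\<omega>. hit_dist R (u, B u \<omega>)) \<in> borel_measurable (F s)" by measurable
  qed (rule hit_dist_path_continuous)
  then show ?thesis by (simp add: hitting_time_eq[OF c, abs_def])
qed

lemma hitting_attained:
  assumes "closed R" "\<omega> \<in> space M" "hitting_time B R \<omega> = ereal s"
  shows "0 \<le> s" "(ereal s, ereal (B s \<omega>)) \<in> R"
proof -
  show "0 \<le> s" using hitting_time_nonneg[of B R \<omega>] assms(3) by simp
  have "hit_dist R (s, B s \<omega>) \<le> 0"
    by (rule first_time_attained[OF hit_dist_path_continuous[OF assms(2)]])
       (use assms in \<open>simp add: hitting_time_eq\<close>)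
  then show "(ereal s, ereal (B s \<omega>)) \<in> R" using hit_dist_le_0_iff[OF assms(1)] by simp
qed

text \<open>By \<open>oscillation_step\<close> a path that stays on one side for a while is back at
  its starting value at every small rational delay, hence by continuity it is constant there, which
  \<open>AE_not_constant\<close> excludes.\<close>

lemma oscillation:
  assumes \<tau>: "stop_ext \<tau>" and c: "c = 1 \<or> c = - 1"
  shows "AE \<omega> in M. \<forall>r. \<tau> \<omega> = ereal r \<longrightarrow> (\<forall>e>0. \<exists>s. r < s \<and> s < r + e \<and> c * B s \<omega> < c * B r \<omega>)"
proof -
  have "AE \<omega> in M. \<forall>n::nat. \<forall>q\<in>\<rat>. 0 < q \<longrightarrow> (\<forall>v\<in>{0..q}. 0 \<le> c * (B (trunc \<tau> n \<omega> + v) \<omega> - B (trunc \<tau> n \<omega>) \<omega>))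
      \<longrightarrow> B (trunc \<tau> n \<omega> + q) \<omega> = B (trunc \<tau> n \<omega>) \<omega>"
    unfolding AE_all_countable
  proof (intro allI AE_ball_countable[THEN iffD2] ballI countable_rat)
    fix n :: nat and q :: real
    show "AE \<omega> in M. 0 < q \<longrightarrow> (\<forall>v\<in>{0..q}. 0 \<le> c * (B (trunc \<tau> n \<omega> + v) \<omega> - B (trunc \<tau> n \<omega>) \<omega>))
      \<longrightarrow> B (trunc \<tau> n \<omega> + q) \<omega> = B (trunc \<tau> n \<omega>) \<omega>"
    proof (cases "0 < q")
      case True
      have "AE \<omega> in M. (\<forall>v\<in>{0..q}. 0 \<le> c * (B (trunc \<tau> n \<omega> + v) \<omega> - B (trunc \<tau> n \<omega>) \<omega>))
        \<longrightarrow> B (trunc \<tau> n \<omega> + q) \<omega> = B (trunc \<tau> n \<omega>) \<omega>"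
        by (rule oscillation_step[OF stop_ext_trunc[OF \<tau>] trunc_le[OF \<tau>] True c]) auto
      then show ?thesis by simp
    qed simp
  qed
  with AE_not_constant AE_space show ?thesis
  proof eventually_elim
    case (elim \<omega>)
    show ?case
    proof (intro allI impI, rule ccontr)
      fix r e :: real assume r: "\<tau> \<omega> = ereal r" and e: "0 < e"
        and neg: "\<not> (\<exists>s. r < s \<and> s < r + e \<and> c * B s \<omega> < c * B r \<omega>)"
      have r0: "0 \<le> r" using stop_ext_nonneg[OF \<tau> elim(2)] r by simp
      obtain n where n: "r \<le> real n" using real_arch_simple by blast
      have tr: "trunc \<tau> n \<omega> = r" using r n by (simp add: min_def)
      have rat: "B (r + q) \<omega> = B r \<omega>" if "q \<in> \<rat>" "0 < q" "q < e" for q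
      proof -
        have "0 \<le> c * (B (r + v) \<omega> - B r \<omega>)" if "v \<in> {0..q}" for v
        proof (cases "v = 0")
          case False
          with neg that \<open>q < e\<close> have "\<not> c * B (r + v) \<omega> < c * B r \<omega>" by auto
          then show ?thesis by (simp add: algebra_simps)
        qed simp
        then have *: "\<forall>v\<in>{0..q}. 0 \<le> c * (B (trunc \<tau> n \<omega> + v) \<omega> - B (trunc \<tau> n \<omega>) \<omega>)" unfolding tr by blast
        from elim(3)[rule_format, OF that(1,2), of n] * show ?thesis unfolding tr by blast
      qed
      have const: "B s \<omega> = B r \<omega>" if rs: "r < s" "s < r + e" for s
      proof (rule ccontr)
        assume "B s \<omega> \<noteq> B r \<omega>"
        then have pos: "0 < dist (B s \<omega>) (B r \<omega>)" by simp
        then obtain d where d: "0 < d" "\<And>u. 0 \<le> u \<Longrightarrow> dist u s < d \<Longrightarrow> dist (B u \<omega>) (B s \<omega>) < dist (B s \<omega>) (B r \<omega>)"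
          using B_cont[OF elim(2), unfolded continuous_on_iff, rule_format, OF _ pos, of s] r0 rs by auto
        have "max 0 (s - r - d) < s - r" using rs d by simp
        then obtain q where q: "q \<in> \<rat>" "max 0 (s - r - d) < q" "q < s - r" using Rats_dense_in_real by blast
        then have "B (r + q) \<omega> = B r \<omega>" using rs by (intro rat) auto
        moreover have "dist (B (r + q) \<omega>) (B s \<omega>) < dist (B s \<omega>) (B r \<omega>)"
          using q r0 by (intro d(2)) (auto simp: dist_real_def)
        ultimately show False by (simp add: dist_commute)
      qed
      obtain s where s: "s \<in> \<rat>" "r < s" "s < r + e" using Rats_dense_in_real[of r "r + e"] e by auto
      obtain t where t: "t \<in> \<rat>" "s < t" "t < r + e" using Rats_dense_in_real[of s "r + e"] s by auto
      have "B s \<omega> \<noteq> B t \<omega>" using elim(1) s t r0 by auto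
      with const[of s] const[of t] s t show False by simp
    qed
  qed
qed

text \<open>The graph of the path over [0, T] is compact and disjoint from \<open>R\<close>, so
  nearby sets miss it too. This is the lower half of the convergence of hitting times.\<close>

lemma hitting_eventually_greater:
  assumes S: "\<And>z. z \<notin> R \<Longrightarrow> \<exists>U. open U \<and> z \<in> U \<and> (\<forall>\<^sub>F n in sequentially. S n \<inter> U = {})"
    and \<omega>: "\<omega> \<in> space M" and T: "ereal T < hitting_time B R \<omega>"
  shows "\<forall>\<^sub>F n in sequentially. \<forall>s\<in>{0..T}. (ereal s, ereal (B s \<omega>)) \<notin> S n"
proof -
  let ?K = "(\<lambda>s. (ereal s, ereal (B s \<omega>))) ` {0..T}"
  have "compact ?K"
    by (intro compact_continuous_image continuous_intros continuous_on_subset[OF B_cont[OF \<omega>]]) auto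
  moreover have "?K \<inter> R = {}"
  proof (rule ccontr)
    assume "?K \<inter> R \<noteq> {}"
    then obtain s where "0 \<le> s" "s \<le> T" "(ereal s, ereal (B s \<omega>)) \<in> R" by auto
    with hitting_time_le[of s B \<omega> R] have "hitting_time B R \<omega> \<le> ereal T" by (auto intro: order_trans)
    with T show False by simp
  qed
  ultimately have "\<forall>\<^sub>F n in sequentially. S n \<inter> ?K = {}" by (rule eventually_disjoint_compact[rotated]) (rule S)
  then show ?thesis by eventually_elim blast
qed

text \<open>The lower bound is compactness. For the upper bound, right after reaching
  \<open>R\<close> the path takes values strictly above and below its current one, so it crosses the
  level of any nearby barrier point; since barriers are upward closed in time, the crossing is a
  hit.\<close>

lemma hitting_time_kconv:
  assumes k: "kconv S R" and S: "\<And>n. root_barrier (S n)" and R: "root_barrier R"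
  shows "AE \<omega> in M. (\<lambda>n. hitting_time B (S n) \<omega>) \<longlonglongrightarrow> hitting_time B R \<omega>"
proof -
  note st = stop_ext_hitting[OF root_closed[OF R]]
  have c: "(1::real) = 1 \<or> (1::real) = -1" "(-1::real) = 1 \<or> (-1::real) = -1" by simp_all
  show ?thesis
    using oscillation[OF st c(1)] oscillation[OF st c(2)] AE_space
  proof eventually_elim
    case (elim \<omega>)
    note \<omega> = elim(3)
    show ?case
    proof (rule order_tendstoI)
      fix a assume "a < hitting_time B R \<omega>"
      then obtain T where T: "a < ereal T" "ereal T < hitting_time B R \<omega>" using ereal_dense2 by blast
      have out: "\<And>z. z \<notin> R \<Longrightarrow> \<exists>U. open U \<and> z \<in> U \<and> (\<forall>\<^sub>F n in sequentially. S n \<inter> U = {})"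
        using k unfolding kconv_def by blast
      have "\<forall>\<^sub>F n in sequentially. \<forall>s\<in>{0..T}. (ereal s, ereal (B s \<omega>)) \<notin> S n"
        by (rule hitting_eventually_greater[OF _ \<omega> T(2)]) (rule out)
      then show "\<forall>\<^sub>F n in sequentially. a < hitting_time B (S n) \<omega>"
      proof eventually_elim
        case (elim n)
        have "ereal T \<le> hitting_time B (S n) \<omega>"
          unfolding hitting_time_def
        proof (rule Inf_greatest)
          fix z assume "z \<in> {ereal s |s. 0 \<le> s \<and> (ereal s, ereal (B s \<omega>)) \<in> S n}"
          with elim show "ereal T \<le> z" by (auto simp: not_le[symmetric])
        qed
        with T(1) show ?case by simp
      qed
    next
      fix a assume a: "hitting_time B R \<omega> < a"
      then obtain r where r: "hitting_time B R \<omega> = ereal r"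
        using hitting_time_nonneg[of B R \<omega>] by (cases "hitting_time B R \<omega>") auto
      obtain b where b: "ereal r < ereal b" "ereal b < a" using ereal_dense2[OF a[unfolded r]] by blast
      then have e: "0 < b - r" by simp
      note att = hitting_attained[OF root_closed[OF R] \<omega> r]
      obtain s1 where s1: "r < s1" "s1 < b" "B s1 \<omega> < B r \<omega>" using elim(1)[rule_format, OF r e] by auto
      obtain s2 where s2: "r < s2" "s2 < b" "B r \<omega> < B s2 \<omega>" using elim(2)[rule_format, OF r e] by auto
      \<comment> \<open>The time bound makes the nearby barrier point earlier than both oscillation
        times, and hence earlier than the crossing between them.\<close>
      let ?U = "{..<ereal (min s1 s2)} \<times> {ereal (B s1 \<omega>)<..<ereal (B s2 \<omega>)}"
      have "\<forall>\<^sub>F n in sequentially. S n \<inter> ?U \<noteq> {}"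
        using s1 s2 by (intro kconv_inside[OF k att(2)] open_Times) auto
      then show "\<forall>\<^sub>F n in sequentially. hitting_time B (S n) \<omega> < a"
      proof eventually_elim
        case (elim n)
        then obtain t x where "(t, x) \<in> S n \<inter> ?U" by (metis ex_in_conv surj_pair)
        then have tx: "(t, x) \<in> S n" "t < ereal (min s1 s2)" "ereal (B s1 \<omega>) < x" "x < ereal (B s2 \<omega>)"
          by (simp_all only: Int_iff mem_Times_iff fst_conv snd_conv lessThan_iff greaterThanLessThan_iff)
        then obtain y where y: "x = ereal y" by (cases x) auto
        have cont: "continuous_on {u..v} (\<lambda>s. B s \<omega>)" if "0 \<le> u" for u v
          using that by (intro continuous_on_subset[OF B_cont[OF \<omega>]]) auto
        obtain s where s: "min s1 s2 \<le> s" "s \<le> max s1 s2" "B s \<omega> = y"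
        proof (cases "s1 \<le> s2")
          case True
          then show ?thesis
            using IVT'[of "\<lambda>s. B s \<omega>" s1 y s2] cont[of s1 s2] att s1 tx y that by auto
        next
          case False
          then show ?thesis
            using IVT2'[of "\<lambda>s. B s \<omega>" s1 y s2] cont[of s2 s1] att s2 tx y that by auto
        qed
        have "t \<le> ereal s" using tx(2) s(1) by (meson ereal_less_eq(3) less_imp_le order_trans)
        then have "(ereal s, ereal (B s \<omega>)) \<in> S n" using root_up[OF S[of n] tx(1)] y s(3) by simp
        then have "hitting_time B (S n) \<omega> \<le> ereal s" using s(1) s1 s2 att(1) by (intro hitting_time_le) auto
        also have "\<dots> < ereal b" using s(2) s1 s2 by simp
        finally show ?case using b by simp
      qed
    qed
  qed
qed

lemma B_trunc_tendsto:
  assumes \<omega>: "\<omega> \<in> space M" and lim: "(\<lambda>n. \<tau> n \<omega>) \<longlonglongrightarrow> \<tau>' \<omega>" and t: "0 \<le> t" and nn: "\<And>n. 0 \<le> \<tau> n \<omega>"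
  shows "(\<lambda>n. B (trunc (\<tau> n) t \<omega>) \<omega>) \<longlonglongrightarrow> B (trunc \<tau>' t \<omega>) \<omega>"
proof (rule continuous_on_LIMSEQ[OF B_cont[OF \<omega>]])
  have nn': "0 \<le> \<tau>' \<omega>" by (rule LIMSEQ_le_const[OF lim]) (use nn in auto)
  have "(\<lambda>n. min (\<tau> n \<omega>) (ereal t)) \<longlonglongrightarrow> min (\<tau>' \<omega>) (ereal t)" by (intro tendsto_min lim tendsto_const)
  moreover have "\<bar>min (\<tau>' \<omega>) (ereal t)\<bar> \<noteq> \<infinity>" using nn' t by (cases "\<tau>' \<omega>") (auto simp: min_def)
  ultimately show "(\<lambda>n. trunc (\<tau> n) t \<omega>) \<longlonglongrightarrow> trunc \<tau>' t \<omega>"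
    by (metis ereal_real' lim_real_of_ereal)
  show "trunc \<tau>' t \<omega> \<in> {0..}" "trunc (\<tau> n) t \<omega> \<in> {0..}" for n
    using nn nn' t by (auto intro!: real_of_ereal_pos simp: min_def)
qed

lemma B_hit_tendsto:
  assumes \<omega>: "\<omega> \<in> space M" and lim: "(\<lambda>n. \<tau> n \<omega>) \<longlonglongrightarrow> \<tau>' \<omega>" and fin: "\<tau>' \<omega> < \<infinity>" and nn: "\<And>n. 0 \<le> \<tau> n \<omega>"
  shows "(\<lambda>n. B (real_of_ereal (\<tau> n \<omega>)) \<omega>) \<longlonglongrightarrow> B (real_of_ereal (\<tau>' \<omega>)) \<omega>"
proof (rule continuous_on_LIMSEQ[OF B_cont[OF \<omega>]])
  have nn': "0 \<le> \<tau>' \<omega>" by (rule LIMSEQ_le_const[OF lim]) (use nn in auto)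
  then have "\<bar>\<tau>' \<omega>\<bar> \<noteq> \<infinity>" using fin by (cases "\<tau>' \<omega>") auto
  then show "(\<lambda>n. real_of_ereal (\<tau> n \<omega>)) \<longlonglongrightarrow> real_of_ereal (\<tau>' \<omega>)"
    using lim by (metis ereal_real' lim_real_of_ereal)
  show "real_of_ereal (\<tau>' \<omega>) \<in> {0..}" "real_of_ereal (\<tau> n \<omega>) \<in> {0..}" for n
    using nn nn' by (auto intro!: real_of_ereal_pos)
qed

end

section \<open>Paths near a given point\<close>

text \<open>On [-2, 2] the density is at least (9/26)(1/9), from sqrt(2 pi) \<le> 26/9 and exp(-2)
  \<ge> 1/9, and both intervals have length 1.\<close>

lemma gauss_interval_ge: "1 / 26 \<le> measure gauss {1<..<2}" "1 / 26 \<le> measure gauss {-2<..<-1}"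
proof -
  have dens: "1 / 26 \<le> std_normal_density x" if "x\<^sup>2 \<le> 4" for x
  proof -
    have "exp (2::real) = exp 1 * exp 1" by (simp add: exp_add[symmetric])
    also have "\<dots> \<le> 3 * 3" by (intro mult_mono exp_le) auto
    finally have "1 / 9 \<le> exp (- 2 :: real)" by (simp add: exp_minus field_simps)
    also have "\<dots> \<le> exp (- x\<^sup>2 / 2)" using that by simp
    finally have e: "1 / 9 \<le> exp (- x\<^sup>2 / 2)" .
    have "sqrt (2 * pi) \<le> 26 / 9"
      using pi_less_4 by (intro real_le_lsqrt) (auto simp: power2_eq_square)
    then have "9 / 26 \<le> 1 / sqrt (2 * pi)" by (simp add: field_simps)
    from mult_mono[OF this e] show ?thesis by (simp add: std_normal_density_def)
  qed
  have "1 / 26 \<le> measure gauss A" if A: "A \<in> sets borel" "\<And>x. x \<in> A \<Longrightarrow> x\<^sup>2 \<le> 4" "emeasure lborel A = 1" for A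
  proof -
    have "ennreal (1 / 26) = (\<integral>\<^sup>+x. ennreal (1 / 26) * indicator A x \<partial>lborel)"
      using A by (simp add: nn_integral_cmult_indicator)
    also have "\<dots> \<le> (\<integral>\<^sup>+x. ennreal (std_normal_density x) * indicator A x \<partial>lborel)"
      using dens A(2) by (intro nn_integral_mono) (auto split: split_indicator intro!: ennreal_leI)
    also have "\<dots> = emeasure gauss A"
      unfolding gauss_def using A by (intro emeasure_density[symmetric]) auto
    finally show ?thesis by (simp add: gauss.emeasure_eq_measure)
  qed note * = this
  have sq: "x\<^sup>2 \<le> 4" if "\<bar>x\<bar> \<le> 2" for x :: real
    using power_mono[OF that, of 2] by simp
  show "1 / 26 \<le> measure gauss {1<..<2}" "1 / 26 \<le> measure gauss {-2<..<-1}"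
    by (rule *; auto intro!: sq)+
qed

text \<open>A step towards 0 of size between p and 2p either shortens the distance by p or
  overshoots, and then it ends within 2p.\<close>

lemma abs_step_le:
  fixes a b p m :: real
  assumes up: "a < 0 \<Longrightarrow> a + p < b \<and> b < a + 2 * p" and dn: "0 \<le> a \<Longrightarrow> a - 2 * p < b \<and> b < a - p"
    and p: "0 < p" and a: "\<bar>a\<bar> \<le> max m (2 * p)"
  shows "\<bar>b\<bar> \<le> max (m - p) (2 * p)"
proof -
  have "max m (2 * p) - p \<le> max (m - p) (2 * p)" using p by (simp add: max_def)
  moreover have "\<bar>b\<bar> \<le> \<bar>a\<bar> - p \<or> \<bar>b\<bar> \<le> 2 * p"
    using up dn p by (cases "a < 0") (simp_all, linarith+)
  moreover have "2 * p \<le> max (m - p) (2 * p)" by simp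
  ultimately show ?thesis using a by linarith
qed

context brownian begin

lemma oscillation_sets:
  assumes s: "0 \<le> s" and h: "0 \<le> h" and d: "0 < d"
  shows "{\<omega>\<in>space M. \<exists>u\<in>{s..s + h}. d \<le> \<bar>B u \<omega> - B s \<omega>\<bar>} \<in> sets (F (s + h))"
proof -
  \<comment> \<open>With \<open>B (min s u)\<close> the difference vanishes before \<open>s\<close>,
    so an event about [s, s + h] takes the form treated by \<open>hit_sets\<close>, which starts at
    0.\<close>
  have *: "{\<omega>\<in>space M. \<exists>u\<in>{0..s + h}. d - \<bar>B u \<omega> - B (min s u) \<omega>\<bar> \<le> 0} \<in> sets (F (s + h))"
  proof (rule hit_sets)
    fix u r :: real assume u: "0 \<le> u" "u \<le> r"
    have "B (min s u) \<in> borel_measurable (F r)" using u s by (intro B_adapted) auto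
    then show "(\<lambda>\<omega>. d - \<bar>B u \<omega> - B (min s u) \<omega>\<bar>) \<in> borel_measurable (F r)"
      using B_adapted[OF u] by measurable
  next
    fix \<omega> assume "\<omega> \<in> space M"
    then show "continuous_on {0..} (\<lambda>u. d - \<bar>B u \<omega> - B (min s u) \<omega>\<bar>)"
      using s by (intro continuous_intros B_cont continuous_on_compose2[OF B_cont]) auto
  qed (use s h in simp)
  have eq: "(\<exists>u\<in>{0..s + h}. d - \<bar>B u \<omega> - B (min s u) \<omega>\<bar> \<le> 0) \<longleftrightarrow> (\<exists>u\<in>{s..s + h}. d \<le> \<bar>B u \<omega> - B s \<omega>\<bar>)" for \<omega>
  proof
    assume "\<exists>u\<in>{0..s + h}. d - \<bar>B u \<omega> - B (min s u) \<omega>\<bar> \<le> 0"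
    then obtain u where u: "0 \<le> u" "u \<le> s + h" "d - \<bar>B u \<omega> - B (min s u) \<omega>\<bar> \<le> 0" by auto
    have "\<not> u < s"
    proof
      assume "u < s"
      then have "min s u = u" by simp
      with u(3) d show False by simp
    qed
    then have "min s u = s" by simp
    with u \<open>\<not> u < s\<close> show "\<exists>u\<in>{s..s + h}. d \<le> \<bar>B u \<omega> - B s \<omega>\<bar>" by (intro bexI[of _ u]) auto
  next
    assume "\<exists>u\<in>{s..s + h}. d \<le> \<bar>B u \<omega> - B s \<omega>\<bar>"
    then obtain u where u: "s \<le> u" "u \<le> s + h" "d \<le> \<bar>B u \<omega> - B s \<omega>\<bar>" by auto
    then have "min s u = s" by simp
    with u s show "\<exists>u\<in>{0..s + h}. d - \<bar>B u \<omega> - B (min s u) \<omega>\<bar> \<le> 0" by (intro bexI[of _ u]) auto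
  qed
  from * show ?thesis unfolding eq .
qed

text \<open>With h = d^2/36 the increment has standard deviation d/6, so the target is the interval
  from 1 to 2 (or its mirror image) in standard units, of probability at least 1/26. Leaving the
  tube has probability at most (1/36)/(81/100) < 1/29, which is smaller. The factor 9/10 provides
  the strict exceedance asked for by \<open>maximal_ineq\<close>.\<close>

lemma directed_step:
  assumes s: "0 \<le> s" and d: "0 < d" and A: "A \<in> sets (F s)" and c: "c = 1 \<or> c = - 1"
  defines "h \<equiv> d\<^sup>2 / 36"
  shows "(1 / 26 - 1 / 29) * prob A \<le> prob {\<omega>\<in>A. (\<forall>u\<in>{s..s + h}. \<bar>B u \<omega> - B s \<omega>\<bar> < d) \<and> c * (B (s + h) \<omega> - B s \<omega>) \<in> {d/6<..<d/3}}"
proof -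
  have h: "0 < h" using d by (simp add: h_def)
  then have sh: "s < s + h" by simp
  have AM: "A \<in> sets M" using sets_F[OF s A] .
  have AsM: "A \<subseteq> space M" using sets.sets_into_space[OF AM] .
  have [measurable]: "B s \<in> borel_measurable M" "B (s + h) \<in> borel_measurable M" "A \<in> sets M"
    using B_meas s h AM by auto
  let ?I = "(\<lambda>\<omega>. B (s + h) \<omega> - B s \<omega>) -` {y. c * y \<in> {d/6<..<d/3}} \<inter> space M"
  let ?H = "{\<omega>\<in>space M. \<exists>u\<in>{s..s + h}. d \<le> \<bar>B u \<omega> - B s \<omega>\<bar>}"
  have HM[measurable]: "?H \<in> sets M" using sets_F[OF _ oscillation_sets[OF s _ d, of h]] s h by simp
  have 1: "prob (A \<inter> ?H) \<le> 1 / 29 * prob A"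
  proof -
    have "(9 / 10 * d)\<^sup>2 * prob (A \<inter> ?H) \<le> (s + h - s) * prob A"
    proof (rule maximal_ineq[OF s less_imp_le[OF sh] A])
      show "A \<inter> ?H \<subseteq> {\<omega>\<in>A. \<exists>u\<in>{s..s + h}. 9 / 10 * d < \<bar>B u \<omega> - B s \<omega>\<bar>}"
      proof
        fix \<omega> assume \<omega>: "\<omega> \<in> A \<inter> ?H"
        then obtain u where "u \<in> {s..s + h}" "d \<le> \<bar>B u \<omega> - B s \<omega>\<bar>" by blast
        then show "\<omega> \<in> {\<omega>\<in>A. \<exists>u\<in>{s..s + h}. 9 / 10 * d < \<bar>B u \<omega> - B s \<omega>\<bar>}" using \<omega> d by (intro CollectI conjI bexI[of _ u]) auto
      qed
      show "0 < 9 / 10 * d" using d by simp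
    qed measurable
    then have "(81 / 100 * prob (A \<inter> ?H)) * d\<^sup>2 \<le> (prob A / 36) * d\<^sup>2" by (simp add: h_def power_mult_distrib power2_eq_square mult_ac)
    then have "81 / 100 * prob (A \<inter> ?H) \<le> prob A / 36" using d by simp
    then show ?thesis using measure_nonneg[of M A] by linarith
  qed
  have 2: "1 / 26 * prob A \<le> prob (A \<inter> ?I)"
  proof -
    have Ib: "{y. c * y \<in> {d/6<..<d/3}} \<in> sets borel" by measurable
    have split: "prob (A \<inter> ?I) = prob A * prob ?I"
      using bm s sh A Ib unfolding brownian_motion_def by blast
    have "prob ?I = measure (distr M borel (\<lambda>\<omega>. B (s + h) \<omega> - B s \<omega>)) {y. c * y \<in> {d/6<..<d/3}}"
      by (rule measure_distr[symmetric]) (use Ib in measurable)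
    also have "\<dots> = measure gauss {z. c * (d / 6 * z) \<in> {d/6<..<d/3}}"
    proof -
      have sq: "sqrt (s + h - s) = d / 6" using d by (simp add: h_def real_sqrt_divide)
      have "measure (distr gauss borel ((*) (d / 6))) {y. c * y \<in> {d/6<..<d/3}} =
         measure gauss ((*) (d / 6) -` {y. c * y \<in> {d/6<..<d/3}} \<inter> space gauss)"
        by (rule measure_distr[OF _ Ib]) simp
      then show ?thesis unfolding distr_incr[OF s sh] sq
        by (simp only: vimage_def mem_Collect_eq space_gauss Int_UNIV_right)
    qed
    also have "{z. c * (d / 6 * z) \<in> {d/6<..<d/3}} = (if c = 1 then {1<..<2} else {-2<..<-1})"
    proof -
      have f: "d / 6 < d / 6 * z \<longleftrightarrow> 1 < z" "d / 6 * z < d / 3 \<longleftrightarrow> z < 2"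
         "d / 6 < - (d / 6 * z) \<longleftrightarrow> z < - 1" "- (d / 6 * z) < d / 3 \<longleftrightarrow> - 2 < z" for z
      proof -
        have k: "d / 6 * a < d / 6 * b \<longleftrightarrow> a < b" for a b using d by (intro mult_less_cancel_left_pos) simp
        show "d / 6 < d / 6 * z \<longleftrightarrow> 1 < z" using k[of 1 z] by simp
        show "d / 6 * z < d / 3 \<longleftrightarrow> z < 2" using k[of z 2] by simp
        show "d / 6 < - (d / 6 * z) \<longleftrightarrow> z < - 1" using k[of z "-1"] by auto
        show "- (d / 6 * z) < d / 3 \<longleftrightarrow> - 2 < z" using k[of "-2" z] by auto
      qed
      have 1: "{z. 1 * (d / 6 * z) \<in> {d/6<..<d/3}} = {1<..<2}"
        by (auto simp only: mult_1 greaterThanLessThan_iff f mem_Collect_eq)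
      have 2: "{z. - 1 * (d / 6 * z) \<in> {d/6<..<d/3}} = {-2<..<-1}"
        by (auto simp only: mult_minus1 greaterThanLessThan_iff f mem_Collect_eq)
      show ?thesis
      proof (cases "c = 1")
        case True
        show ?thesis unfolding True 1 by simp
      next
        case False
        then have cm: "c = - 1" using c by simp
        show ?thesis unfolding cm 2 by simp
      qed
    qed
    finally have I: "prob ?I = measure gauss (if c = 1 then {1<..<2} else {-2<..<-1})" .
    have "1 / 26 \<le> prob ?I" unfolding I using gauss_interval_ge by (cases "c = 1") simp_all
    from mult_left_mono[OF this measure_nonneg[of M A]] show ?thesis
      unfolding split by (simp add: mult.commute)
  qed
  have "prob (A \<inter> ?I) \<le> prob ((A \<inter> ?I - ?H) \<union> (A \<inter> ?H))" by (rule finite_measure_mono) (auto, measurable)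
  also have "\<dots> \<le> prob (A \<inter> ?I - ?H) + prob (A \<inter> ?H)" by (rule measure_Un_le) measurable
  also have "A \<inter> ?I - ?H = {\<omega>\<in>A. (\<forall>u\<in>{s..s + h}. \<bar>B u \<omega> - B s \<omega>\<bar> < d) \<and> c * (B (s + h) \<omega> - B s \<omega>) \<in> {d/6<..<d/3}}"
  proof (intro set_eqI)
    fix \<omega>
    show "\<omega> \<in> A \<inter> ?I - ?H \<longleftrightarrow> \<omega> \<in> {\<omega>\<in>A. (\<forall>u\<in>{s..s + h}. \<bar>B u \<omega> - B s \<omega>\<bar> < d) \<and> c * (B (s + h) \<omega> - B s \<omega>) \<in> {d/6<..<d/3}}"
    proof (cases "\<omega> \<in> A")
      case True
      then have "\<omega> \<in> space M" using AsM by blast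
      with True show ?thesis by (auto simp: not_le)
    qed simp
  qed
  finally show ?thesis using 1 2 by (simp add: left_diff_distrib)
qed

text \<open>Each step moves the path towards \<open>x\<close> by a definite amount and has probability bounded below given
  the past, so any tube around the segment from \<open>0\<close> to \<open>x\<close> is followed with positive probability.\<close>
definition good_step :: "real \<Rightarrow> real \<Rightarrow> nat \<Rightarrow> 'a \<Rightarrow> bool" where
  "good_step x d j \<omega> \<longleftrightarrow> (let h = d\<^sup>2 / 36; s = real j * h; c = (if B s \<omega> < x then 1 else - 1) in
     (\<forall>u\<in>{s..s + h}. \<bar>B u \<omega> - B s \<omega>\<bar> < d) \<and> c * (B (s + h) \<omega> - B s \<omega>) \<in> {d/6<..<d/3})"

definition good_steps :: "real \<Rightarrow> real \<Rightarrow> nat \<Rightarrow> 'a set" where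
  "good_steps x d k = {\<omega>\<in>space M. \<forall>j<k. good_step x d j \<omega>}"

lemma good_step_iff:
  "good_step x d k \<omega> \<longleftrightarrow> (\<forall>u\<in>{real k * (d\<^sup>2 / 36)..real k * (d\<^sup>2 / 36) + d\<^sup>2 / 36}. \<bar>B u \<omega> - B (real k * (d\<^sup>2 / 36)) \<omega>\<bar> < d) \<and>
     (if B (real k * (d\<^sup>2 / 36)) \<omega> < x then 1 else - 1) * (B (real k * (d\<^sup>2 / 36) + d\<^sup>2 / 36) \<omega> - B (real k * (d\<^sup>2 / 36)) \<omega>) \<in> {d/6<..<d/3}"
  unfolding good_step_def Let_def by (rule refl)

lemma good_steps_Suc: "good_steps x d (Suc k) = {\<omega>\<in>good_steps x d k. good_step x d k \<omega>}"
  by (auto simp: good_steps_def less_Suc_eq)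

lemma good_steps_sets:
  assumes d: "0 < d"
  shows "good_steps x d k \<in> sets (F (real k * (d\<^sup>2 / 36)))"
proof (induction k)
  case 0
  then show ?case using sets.top[of "F 0"] by (simp add: good_steps_def space_F)
next
  case (Suc k)
  let ?h = "d\<^sup>2 / 36"
  let ?s = "real k * ?h"
  have s: "0 \<le> ?s" and h: "0 \<le> ?h" using d by auto
  have Su: "real (Suc k) * ?h = ?s + ?h" by (simp add: algebra_simps)
  let ?H = "{\<omega>\<in>space M. \<exists>u\<in>{?s..?s + ?h}. d \<le> \<bar>B u \<omega> - B ?s \<omega>\<bar>}"
  have H: "?H \<in> sets (F (?s + ?h))" by (rule oscillation_sets[OF s h d])
  have sp: "space (F (?s + ?h)) = space M" using s h by (intro space_F) simp
  have [measurable]: "B ?s \<in> borel_measurable (F (?s + ?h))" "B (?s + ?h) \<in> borel_measurable (F (?s + ?h))"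
    using s h by (auto intro!: B_adapted)
  have [measurable]: "good_steps x d k \<in> sets (F (?s + ?h))"
    using F_mono[OF s _ Suc.IH] h by simp
  note H[measurable]
  let ?Q = "\<lambda>\<omega>. (if B ?s \<omega> < x then 1 else - 1) * (B (?s + ?h) \<omega> - B ?s \<omega>) \<in> {d/6<..<d/3}"
  note g = good_step_iff[of x d k]
  have "good_steps x d (Suc k) = {\<omega>\<in>good_steps x d k. good_step x d k \<omega>}"
    by (rule good_steps_Suc)
  also have "\<dots> = (good_steps x d k - ?H) \<inter> {\<omega>\<in>space (F (?s + ?h)). ?Q \<omega>}"
  proof (intro set_eqI)
    fix \<omega>
    have "\<omega> \<in> space M \<Longrightarrow> \<omega> \<notin> ?H \<longleftrightarrow> (\<forall>u\<in>{?s..?s + ?h}. \<bar>B u \<omega> - B ?s \<omega>\<bar> < d)"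
      by (auto simp: not_le)
    moreover have "\<omega> \<in> good_steps x d k \<Longrightarrow> \<omega> \<in> space M" by (simp add: good_steps_def)
    ultimately show "\<omega> \<in> {\<omega>\<in>good_steps x d k. good_step x d k \<omega>} \<longleftrightarrow>
        \<omega> \<in> (good_steps x d k - ?H) \<inter> {\<omega>\<in>space (F (?s + ?h)). ?Q \<omega>}"
      unfolding sp g by blast
  qed
  also have "\<dots> \<in> sets (F (?s + ?h))" by measurable
  finally show ?case unfolding Su .
qed

text \<open>The direction of the next step depends on the side of \<open>x\<close> on which the path
  is. The past event is split by this side; one piece has positive probability, and
  \<open>directed_step\<close> applies to it.\<close>

lemma good_steps_pos:
  assumes d: "0 < d"
  shows "0 < prob (good_steps x d k)"
proof (induction k)
  case 0
  then show ?case by (simp add: good_steps_def prob_space)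
next
  case (Suc k)
  let ?h = "d\<^sup>2 / 36"
  let ?s = "real k * ?h"
  have s: "0 \<le> ?s" using d by simp
  define G where "G = good_steps x d k"
  have GF: "G \<in> sets (F ?s)" unfolding G_def by (rule good_steps_sets[OF d])
  have GsM: "G \<subseteq> space M" by (auto simp: G_def good_steps_def)
  define A1 where "A1 = G \<inter> {\<omega>\<in>space (F ?s). B ?s \<omega> < x}"
  define A2 where "A2 = G \<inter> {\<omega>\<in>space (F ?s). x \<le> B ?s \<omega>}"
  note [measurable] = GF B_adapted[OF s order_refl]
  have A: "A1 \<in> sets (F ?s)" "A2 \<in> sets (F ?s)" unfolding A1_def A2_def by measurable
  note AM = sets_F[OF s A(1)] sets_F[OF s A(2)]
  let ?E = "\<lambda>A c. {\<omega>\<in>A. (\<forall>u\<in>{?s..?s + ?h}. \<bar>B u \<omega> - B ?s \<omega>\<bar> < d) \<and> c * (B (?s + ?h) \<omega> - B ?s \<omega>) \<in> {d/6<..<d/3}}"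
  have GS: "good_steps x d (Suc k) = ?E A1 1 \<union> ?E A2 (-1)"
  proof (intro set_eqI)
    fix \<omega>
    have "\<omega> \<in> G \<Longrightarrow> \<omega> \<in> A1 \<longleftrightarrow> B ?s \<omega> < x" "\<omega> \<in> G \<Longrightarrow> \<omega> \<in> A2 \<longleftrightarrow> \<not> B ?s \<omega> < x" "\<omega> \<notin> G \<Longrightarrow> \<omega> \<notin> A1 \<and> \<omega> \<notin> A2"
      unfolding A1_def A2_def space_F[OF s] using GsM by auto
    then show "\<omega> \<in> good_steps x d (Suc k) \<longleftrightarrow> \<omega> \<in> ?E A1 1 \<union> ?E A2 (-1)"
      unfolding good_steps_Suc G_def[symmetric] mem_Collect_eq good_step_iff Un_iff
      by (cases "\<omega> \<in> G"; cases "B ?s \<omega> < x") (simp_all only: simp_thms if_True if_False)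
  qed
  have GSM: "good_steps x d (Suc k) \<in> sets M"
    using sets_F[OF _ good_steps_sets[OF d]] d by simp
  have "prob G \<le> prob A1 + prob A2"
  proof -
    have "G \<subseteq> A1 \<union> A2" unfolding A1_def A2_def space_F[OF s] using GsM by auto
    then have "prob G \<le> prob (A1 \<union> A2)" using AM by (intro finite_measure_mono) auto
    also have "\<dots> \<le> prob A1 + prob A2" by (rule measure_Un_le) (rule AM)+
    finally show ?thesis .
  qed
  then have "0 < prob A1 \<or> 0 < prob A2" using Suc.IH unfolding G_def by (smt (verit))
  then show ?case
  proof
    assume "0 < prob A1"
    then have "0 < (1 / 26 - 1 / 29) * prob A1" by simp
    also have "\<dots> \<le> prob (?E A1 1)" by (rule directed_step[OF s d A(1)]) simp
    also have "\<dots> \<le> prob (good_steps x d (Suc k))" using GSM unfolding GS by (intro finite_measure_mono) auto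
    finally show ?thesis .
  next
    assume "0 < prob A2"
    then have "0 < (1 / 26 - 1 / 29) * prob A2" by simp
    also have "\<dots> \<le> prob (?E A2 (-1))" by (rule directed_step[OF s d A(2)]) simp
    also have "\<dots> \<le> prob (good_steps x d (Suc k))" using GSM unfolding GS by (intro finite_measure_mono) auto
    finally show ?thesis .
  qed
qed

text \<open>Each good step lowers the distance to \<open>x\<close> by d/6 until it is at most d/3,
  and overshoots by no more than d/3. For the last claim, a path within d/3 of \<open>x\<close>
  crosses it during two further steps, each longer than d/6 and directed towards it.\<close>

lemma good_steps_path:
  assumes d: "0 < d" and \<omega>: "\<omega> \<in> good_steps x d k"
  defines "h \<equiv> d\<^sup>2 / 36"
  shows "j \<le> k \<Longrightarrow> B (real j * h) \<omega> \<in> {min 0 (x - d / 3)..max 0 (x + d / 3)}"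
    and "j \<le> k \<Longrightarrow> \<bar>B (real j * h) \<omega> - x\<bar> \<le> max (\<bar>x\<bar> - real j * (d / 6)) (d / 3)"
    and "j < k \<Longrightarrow> u \<in> {real j * h..real (Suc j) * h} \<Longrightarrow> \<bar>B u \<omega> - B (real j * h) \<omega>\<bar> < d"
    and "j + 2 \<le> k \<Longrightarrow> \<bar>x\<bar> \<le> real j * (d / 6) \<Longrightarrow> \<exists>u\<in>{real j * h..real (j + 2) * h}. B u \<omega> = x"
proof -
  have \<omega>M: "\<omega> \<in> space M" using \<omega> by (simp add: good_steps_def)
  have h: "0 < h" using d by (simp add: h_def)
  define e where "e j = B (real j * h) \<omega> - x" for j
  have Sh: "real (Suc j) * h = real j * h + h" for j by (simp add: algebra_simps)
  have g: "good_step x d j \<omega>" if "j < k" for j using \<omega> that by (simp add: good_steps_def)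
  have up: "e j < 0 \<Longrightarrow> e j + d/6 < e (Suc j) \<and> e (Suc j) < e j + d/3" if "j < k" for j
    using g[OF that] unfolding good_step_def Let_def h_def[symmetric] e_def Sh by auto
  have dn: "0 \<le> e j \<Longrightarrow> e j - d/3 < e (Suc j) \<and> e (Suc j) < e j - d/6" if "j < k" for j
    using g[OF that] unfolding good_step_def Let_def h_def[symmetric] e_def Sh by auto
  have e0: "e 0 = - x" using B_0[OF \<omega>M] by (simp add: e_def)
  have rng: "e j \<in> {min (-x) (-(d/3))..max (-x) (d/3)}" if "j \<le> k" for j
    using that
  proof (induction j)
    case 0 then show ?case using d by (auto simp: e0)
  next
    case (Suc j) then show ?case using up[of j] dn[of j] d by (cases "e j < 0") auto
  qed
  have "min 0 (x - d / 3) = x + min (-x) (-(d/3))" "max 0 (x + d / 3) = x + max (-x) (d/3)"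
    by (auto simp: min_def max_def)
  with rng show "j \<le> k \<Longrightarrow> B (real j * h) \<omega> \<in> {min 0 (x - d / 3)..max 0 (x + d / 3)}"
    unfolding e_def by (simp add: algebra_simps)
  have absb: "\<bar>e j\<bar> \<le> max (\<bar>x\<bar> - real j * (d / 6)) (d / 3)" if "j \<le> k" for j
    using that
  proof (induction j)
    case 0 then show ?case by (simp add: e0)
  next
    case (Suc j)
    have "real (Suc j) * (d / 6) = real j * (d / 6) + d / 6" by (simp add: field_simps)
    moreover have "\<bar>e j\<bar> \<le> max (\<bar>x\<bar> - real j * (d / 6)) (d / 3)" using Suc by simp
    moreover have "j < k" using Suc.prems by simp
    ultimately show ?case
      using abs_step_le[of "e j" "d / 6" "e (Suc j)" "\<bar>x\<bar> - real j * (d / 6)"] up[of j] dn[of j] d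
      by (simp add: diff_diff_eq add_divide_distrib distrib_right)
  qed
  then show "j \<le> k \<Longrightarrow> \<bar>B (real j * h) \<omega> - x\<bar> \<le> max (\<bar>x\<bar> - real j * (d / 6)) (d / 3)"
    by (simp add: e_def)
  show "j < k \<Longrightarrow> u \<in> {real j * h..real (Suc j) * h} \<Longrightarrow> \<bar>B u \<omega> - B (real j * h) \<omega>\<bar> < d"
    using g[of j] unfolding good_step_def Let_def h_def[symmetric] Sh by blast
  assume j: "j + 2 \<le> k" "\<bar>x\<bar> \<le> real j * (d / 6)"
  have cont: "continuous_on {real j * h..real (j + 2) * h} (\<lambda>u. B u \<omega>)"
    using h by (intro continuous_on_subset[OF B_cont[OF \<omega>M]]) auto
  have le: "real j * h \<le> real (j + 1) * h" "real (j + 1) * h \<le> real (j + 2) * h" using h by auto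
  have ivt: "\<exists>u\<in>{real j * h..real (j + 2) * h}. B u \<omega> = x"
    if "i \<in> {j, j + 1, j + 2}" "l \<in> {j, j + 1, j + 2}" "e i \<le> 0" "0 \<le> e l" for i l
  proof -
    let ?a = "real i * h" and ?b = "real l * h"
    have ab: "?a \<in> {real j * h..real (j + 2) * h}" "?b \<in> {real j * h..real (j + 2) * h}" using that(1,2) le by auto
    have s: "min ?a ?b \<ge> real j * h" "max ?a ?b \<le> real (j + 2) * h" using ab by auto
    have val: "B ?a \<omega> \<le> x" "x \<le> B ?b \<omega>" using that by (auto simp: e_def)
    show ?thesis
    proof (cases "?a \<le> ?b")
      case True
      obtain u where "?a \<le> u" "u \<le> ?b" "B u \<omega> = x"
        using IVT'[of "\<lambda>u. B u \<omega>" ?a x ?b, OF val True continuous_on_subset[OF cont]] ab by auto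
      then show ?thesis using ab by (intro bexI[of _ u]) auto
    next
      case False
      then have "?b \<le> ?a" by simp
      obtain u where "?b \<le> u" "u \<le> ?a" "B u \<omega> = x"
        using IVT2'[of "\<lambda>u. B u \<omega>" ?a x ?b, OF val \<open>?b \<le> ?a\<close> continuous_on_subset[OF cont]] ab by auto
      then show ?thesis using ab by (intro bexI[of _ u]) auto
    qed
  qed
  have ej: "\<bar>e j\<bar> \<le> d / 3" using absb[of j] j d by simp
  have u1: "e j < 0 \<Longrightarrow> e j + d/6 < e (j + 1)" "0 \<le> e j \<Longrightarrow> e (j + 1) < e j - d/6"
    "e (j + 1) < 0 \<Longrightarrow> e (j + 1) + d/6 < e (j + 2)" "0 \<le> e (j + 1) \<Longrightarrow> e (j + 2) < e (j + 1) - d/6"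
    using up[of j] dn[of j] up[of "j + 1"] dn[of "j + 1"] j by auto
  show "\<exists>u\<in>{real j * h..real (j + 2) * h}. B u \<omega> = x"
  proof (cases "e j < 0")
    case True
    show ?thesis
    proof (cases "0 \<le> e (j + 1)")
      case True then show ?thesis using ivt[of j "j + 1"] \<open>e j < 0\<close> by auto
    next
      case False then show ?thesis using ivt[of j "j + 2"] \<open>e j < 0\<close> u1 ej by auto
    qed
  next
    case False
    show ?thesis
    proof (cases "e (j + 1) \<le> 0")
      case True then show ?thesis using ivt[of "j + 1" j] \<open>\<not> e j < 0\<close> by auto
    next
      case False then show ?thesis using ivt[of "j + 2" j] \<open>\<not> e j < 0\<close> u1 ej by auto
    qed
  qed
qed

end

section \<open>Uniqueness of Root embeddings\<close>

context brownian begin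

abbreviation at_time :: "('a \<Rightarrow> ereal) \<Rightarrow> 'a \<Rightarrow> real" where
  "at_time \<tau> \<equiv> \<lambda>\<omega>. B (real_of_ereal (\<tau> \<omega>)) \<omega>"

lemma at_time_measurable: "stop_ext \<tau> \<Longrightarrow> at_time \<tau> \<in> borel_measurable M"
  by (rule B_at_measurable)
     (auto intro!: borel_measurable_real_of_ereal stop_ext_measurable real_of_ereal_pos stop_ext_nonneg)

lemma trunc_measurable: "stop_ext \<tau> \<Longrightarrow> 0 \<le> T \<Longrightarrow> (\<lambda>\<omega>. B (trunc \<tau> T \<omega>) \<omega>) \<in> borel_measurable M"
  by (rule B_at_measurable[OF stop_real_measurable stop_real_nonneg]) (auto intro: stop_ext_trunc)

lemma integrable_trunc: "stop_ext \<tau> \<Longrightarrow> 0 \<le> T \<Longrightarrow> integrable M (\<lambda>\<omega>. B (trunc \<tau> T \<omega>) \<omega>)"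
  by (rule integrable_B_stop[OF stop_ext_trunc trunc_le])

lemma trunc_eventually:
  assumes "\<omega> \<in> space M" "stop_ext \<tau>" "\<tau> \<omega> < \<infinity>"
  shows "\<forall>\<^sub>F n in sequentially. trunc \<tau> (real n) \<omega> = real_of_ereal (\<tau> \<omega>)"
proof -
  obtain r where r: "\<tau> \<omega> = ereal r" using assms stop_ext_nonneg[OF assms(2,1)] by (cases "\<tau> \<omega>") auto
  have "\<forall>\<^sub>F n in sequentially. r \<le> real n"
    using filterlim_real_sequentially unfolding filterlim_at_top by blast
  then show ?thesis by eventually_elim (simp add: r min_def)
qed

lemma AE_trunc_tendsto:
  assumes "stop_ext \<tau>" "AE \<omega> in M. \<tau> \<omega> < \<infinity>"
  shows "AE \<omega> in M. (\<lambda>n. B (trunc \<tau> (real n) \<omega>) \<omega>) \<longlonglongrightarrow> at_time \<tau> \<omega>"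
  using assms(2) AE_space
proof eventually_elim
  case (elim \<omega>)
  from trunc_eventually[OF elim(2) assms(1) elim(1)] show ?case
    by (intro tendsto_eventually) (auto elim: eventually_mono)
qed

lemma trunc_mono_le:
  assumes \<tau>: "stop_ext \<tau>" and "0 \<le> S" "S \<le> T" "\<omega> \<in> space M"
  shows "trunc \<tau> S \<omega> \<le> trunc \<tau> T \<omega>"
  using stop_ext_nonneg[OF \<tau> assms(4)] assms by (cases "\<tau> \<omega>") (auto simp: min_def)

lemma hyp_trunc_mono:
  assumes \<tau>: "stop_ext \<tau>" and "0 < K" "0 \<le> S" "S \<le> T"
  shows "expectation (\<lambda>\<omega>. hyp K (B (trunc \<tau> S \<omega>) \<omega>)) \<le> expectation (\<lambda>\<omega>. hyp K (B (trunc \<tau> T \<omega>) \<omega>))"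
  by (rule hyp_stopping(3)[OF assms(2) stop_ext_trunc[OF \<tau>] stop_ext_trunc[OF \<tau>], where T=T])
     (use assms trunc_mono_le trunc_le in auto)

text \<open>Capping \<open>hyp K\<close> at a level makes dominated convergence available, and
  uniform integrability makes the part cut off smaller than e for all truncation times at
  once.\<close>

lemma hyp_trunc_le:
  assumes \<tau>: "stop_ext \<tau>" and fin: "AE \<omega> in M. \<tau> \<omega> < \<infinity>"
    and ui: "unif_integrable M (\<lambda>t \<omega>. B (trunc \<tau> t \<omega>) \<omega>)"
    and int: "integrable M (at_time \<tau>)" and K: "0 < K" and T: "0 \<le> T"
  shows "expectation (\<lambda>\<omega>. hyp K (B (trunc \<tau> T \<omega>) \<omega>)) \<le> expectation (\<lambda>\<omega>. hyp K (at_time \<tau> \<omega>))"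
proof (rule field_le_epsilon)
  fix e :: real assume e: "0 < e"
  let ?X = "\<lambda>n \<omega>. B (trunc \<tau> (real n) \<omega>) \<omega>"
  have Xi: "integrable M (?X n)" for n
    by (rule integrable_trunc[OF \<tau>]) simp
  obtain L where L: "\<And>t. 0 \<le> t \<Longrightarrow> (\<integral>\<omega>. \<bar>B (trunc \<tau> t \<omega>) \<omega>\<bar> * indicator {\<omega>. L < \<bar>B (trunc \<tau> t \<omega>) \<omega>\<bar>} \<omega> \<partial>M) < e"
    using ui e unfolding unif_integrable_def by blast
  define L' where "L' = max L 0"
  have hX: "integrable M (\<lambda>\<omega>. hyp K (?X n \<omega>))" for n by (rule integrable_hyp[OF K Xi])
  have ui2: "integrable M (\<lambda>\<omega>. \<bar>?X n \<omega>\<bar> * indicator {\<omega>. L < \<bar>?X n \<omega>\<bar>} \<omega>)" for n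
  proof (rule Bochner_Integration.integrable_bound[OF Xi[of n]])
    show "(\<lambda>\<omega>. \<bar>?X n \<omega>\<bar> * indicator {\<omega>. L < \<bar>?X n \<omega>\<bar>} \<omega>) \<in> borel_measurable M"
      using trunc_measurable[OF \<tau>, of "real n"] by measurable
  qed (auto simp: indicator_def)
  have 1: "expectation (\<lambda>\<omega>. hyp K (?X n \<omega>)) \<le> expectation (\<lambda>\<omega>. min (hyp K (?X n \<omega>)) L') + e" for n
  proof -
    have "expectation (\<lambda>\<omega>. hyp K (?X n \<omega>)) \<le> expectation (\<lambda>\<omega>. min (hyp K (?X n \<omega>)) L' + \<bar>?X n \<omega>\<bar> * indicator {\<omega>. L < \<bar>?X n \<omega>\<bar>} \<omega>)"
    proof (rule integral_mono)
      fix \<omega>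
      show "hyp K (?X n \<omega>) \<le> min (hyp K (?X n \<omega>)) L' + \<bar>?X n \<omega>\<bar> * indicator {\<omega>. L < \<bar>?X n \<omega>\<bar>} \<omega>"
        using hyp_le_abs[OF K, of "?X n \<omega>"] hyp_nonneg[OF K, of "?X n \<omega>"] by (auto simp: indicator_def min_def L'_def)
    qed (use hX ui2 in \<open>auto intro!: Bochner_Integration.integrable_min\<close>)
    also have "\<dots> = expectation (\<lambda>\<omega>. min (hyp K (?X n \<omega>)) L') + expectation (\<lambda>\<omega>. \<bar>?X n \<omega>\<bar> * indicator {\<omega>. L < \<bar>?X n \<omega>\<bar>} \<omega>)"
      by (rule Bochner_Integration.integral_add) (use hX ui2 in \<open>auto intro!: Bochner_Integration.integrable_min\<close>)
    finally show ?thesis using L[of "real n"] by simp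
  qed
  have lim: "(\<lambda>n. expectation (\<lambda>\<omega>. min (hyp K (?X n \<omega>)) L')) \<longlonglongrightarrow> expectation (\<lambda>\<omega>. min (hyp K (at_time \<tau> \<omega>)) L')"
  proof (rule integral_dominated_convergence[where w="\<lambda>_. L'"])
    show "AE \<omega> in M. (\<lambda>n. min (hyp K (?X n \<omega>)) L') \<longlonglongrightarrow> min (hyp K (at_time \<tau> \<omega>)) L'"
      using AE_trunc_tendsto[OF \<tau> fin]
    proof eventually_elim
      case (elim \<omega>)
      have "(\<lambda>n. hyp K (?X n \<omega>)) \<longlonglongrightarrow> hyp K (at_time \<tau> \<omega>)"
        by (rule continuous_on_LIMSEQ[OF hyp_continuous[of UNIV]]) (use elim in auto)
      then show ?case by (intro tendsto_min tendsto_const)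
    qed
    show "AE \<omega> in M. norm (min (hyp K (?X n \<omega>)) L') \<le> L'" for n
      using hyp_nonneg[OF K] by (intro AE_I2) (auto simp: L'_def min_def)
  qed (use at_time_measurable[OF \<tau>] trunc_measurable[OF \<tau>] in measurable)
  have 2: "expectation (\<lambda>\<omega>. min (hyp K (at_time \<tau> \<omega>)) L') \<le> expectation (\<lambda>\<omega>. hyp K (at_time \<tau> \<omega>))"
    by (rule integral_mono) (use integrable_hyp[OF K int] in \<open>auto intro!: Bochner_Integration.integrable_min\<close>)
  have "expectation (\<lambda>\<omega>. hyp K (B (trunc \<tau> T \<omega>) \<omega>)) \<le> expectation (\<lambda>\<omega>. min (hyp K (at_time \<tau> \<omega>)) L') + e"
  proof (rule LIMSEQ_le_const)
    show "(\<lambda>n. expectation (\<lambda>\<omega>. min (hyp K (?X n \<omega>)) L') + e) \<longlonglongrightarrow> expectation (\<lambda>\<omega>. min (hyp K (at_time \<tau> \<omega>)) L') + e"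
      by (intro tendsto_add lim tendsto_const)
    obtain N where N: "T \<le> real N" using real_arch_simple by blast
    show "\<exists>N. \<forall>n\<ge>N. expectation (\<lambda>\<omega>. hyp K (B (trunc \<tau> T \<omega>) \<omega>)) \<le> expectation (\<lambda>\<omega>. min (hyp K (?X n \<omega>)) L') + e"
    proof (intro exI allI impI)
      fix n assume "N \<le> n"
      then have "T \<le> real n" using N by linarith
      from hyp_trunc_mono[OF \<tau> K T this] 1[of n]
      show "expectation (\<lambda>\<omega>. hyp K (B (trunc \<tau> T \<omega>) \<omega>)) \<le> expectation (\<lambda>\<omega>. min (hyp K (?X n \<omega>)) L') + e" by linarith
    qed
  qed
  with 2 show "expectation (\<lambda>\<omega>. hyp K (B (trunc \<tau> T \<omega>) \<omega>)) \<le> expectation (\<lambda>\<omega>. hyp K (at_time \<tau> \<omega>)) + e" by linarith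
qed

lemma nn_integral_hyp: "0 < K \<Longrightarrow> integrable M X \<Longrightarrow> (\<integral>\<^sup>+\<omega>. ennreal (hyp K (X \<omega>)) \<partial>M) = ennreal (expectation (\<lambda>\<omega>. hyp K (X \<omega>)))"
  by (rule nn_integral_eq_integral) (auto intro: integrable_hyp hyp_nonneg)

text \<open>For a stopping time \<open>\<rho>\<close> between \<open>\<sigma>\<close> and \<open>\<tau>\<close> the strictly convex function \<open>hyp 1\<close> has the same
  expectation at all three times, so the gap in the tangent inequality vanishes and the path does
  not move between \<open>\<sigma>\<close> and \<open>\<rho>\<close>.\<close>
lemma between_same_law:
  assumes \<sigma>: "stop_ext \<sigma>" and \<tau>: "stop_ext \<tau>" and le: "\<And>\<omega>. \<omega> \<in> space M \<Longrightarrow> \<sigma> \<omega> \<le> \<tau> \<omega>"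
    and fin: "AE \<omega> in M. \<tau> \<omega> < \<infinity>" and ui: "unif_integrable M (\<lambda>t \<omega>. B (trunc \<tau> t \<omega>) \<omega>)"
    and int: "integrable M (at_time \<tau>)" and law: "distr M borel (at_time \<sigma>) = distr M borel (at_time \<tau>)"
    and t: "0 \<le> t"
  shows "AE \<omega> in M. B (min (real_of_ereal (\<tau> \<omega>)) (max (real_of_ereal (\<sigma> \<omega>)) t)) \<omega> = at_time \<sigma> \<omega>"
proof -
  have fin\<sigma>: "AE \<omega> in M. \<sigma> \<omega> < \<infinity>"
    using fin AE_space
  proof eventually_elim
    case (elim \<omega>)
    from le_less_trans[OF le[OF elim(2)] elim(1)] show ?case .
  qed
  define a where "a = expectation (\<lambda>\<omega>. hyp 1 (at_time \<tau> \<omega>))"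
  note m[measurable] = at_time_measurable[OF \<sigma>] at_time_measurable[OF \<tau>]
  have int\<sigma>: "integrable M (at_time \<sigma>)"
  proof -
    have "integrable (distr M borel (at_time \<sigma>)) (\<lambda>x. x)"
      unfolding law by (subst integrable_distr_eq) (use int in auto)
    then show ?thesis by (subst (asm) integrable_distr_eq) auto
  qed
  have a\<sigma>: "expectation (\<lambda>\<omega>. hyp 1 (at_time \<sigma> \<omega>)) = a"
  proof -
    have "expectation (\<lambda>\<omega>. hyp 1 (at_time \<sigma> \<omega>)) = (\<integral>x. hyp 1 x \<partial>distr M borel (at_time \<sigma>))"
      by (rule integral_distr[symmetric]) auto
    also have "\<dots> = a" unfolding law a_def by (rule integral_distr) auto
    finally show ?thesis .
  qed
  \<comment> \<open>For a fixed path and large n this is the minimum of \<tau> and max(\<sigma>, t);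
    the truncations make optional stopping applicable.\<close>
  define \<rho> where "\<rho> n \<omega> = min (trunc \<tau> (real n) \<omega>) (max (trunc \<sigma> (real n) \<omega>) t)" for n :: nat and \<omega>
  have \<rho>: "stop_real (\<rho> n)" for n
    unfolding \<rho>_def by (intro stop_real_min stop_real_max stop_ext_trunc \<tau> \<sigma> stop_real_const t) simp_all
  have tl: "trunc \<sigma> (real n) \<omega> \<le> trunc \<tau> (real n) \<omega>" if "\<omega> \<in> space M" for n \<omega>
    using le[OF that] stop_ext_nonneg[OF \<sigma> that] by (cases "\<sigma> \<omega>"; cases "\<tau> \<omega>") (auto simp: min_def)
  have \<sigma>\<rho>: "trunc \<sigma> (real n) \<omega> \<le> \<rho> n \<omega>" if "\<omega> \<in> space M" for n \<omega> using tl[OF that] by (simp add: \<rho>_def)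
  have \<rho>n: "\<rho> n \<omega> \<le> real n" if "\<omega> \<in> space M" for n \<omega> using trunc_le[OF \<tau> that, of "real n"] by (simp add: \<rho>_def)
  let ?S = "\<lambda>n \<omega>. B (trunc \<sigma> (real n) \<omega>) \<omega>"
  let ?R = "\<lambda>n \<omega>. B (\<rho> n \<omega>) \<omega>"
  let ?R' = "\<lambda>\<omega>. B (min (real_of_ereal (\<tau> \<omega>)) (max (real_of_ereal (\<sigma> \<omega>)) t)) \<omega>"
  define gap where "gap x y = hyp 1 y - hyp 1 x - dhyp 1 x * (y - x)" for x y
  have gapm[measurable]: "(\<lambda>p. gap (fst p) (snd p)) \<in> borel_measurable (borel \<Otimes>\<^sub>M borel)"
    unfolding gap_def by measurable
  have gap0: "0 \<le> gap x y" for x y using hyp_convex(2)[of 1 x y] by (simp add: gap_def)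
  have Si: "integrable M (?S n)" for n
    by (rule integrable_trunc[OF \<sigma>]) simp
  have Ri: "integrable M (?R n)" for n by (rule integrable_B_stop[OF \<rho> \<rho>n])
  have Ti: "integrable M (\<lambda>\<omega>. B (trunc \<tau> (real n) \<omega>) \<omega>)" for n
    by (rule integrable_trunc[OF \<tau>]) simp
  have le_a: "(\<integral>\<^sup>+\<omega>. ennreal (gap (?S n \<omega>) (?R n \<omega>) + hyp 1 (?S n \<omega>)) \<partial>M) \<le> ennreal a" for n
  proof -
    note hs = hyp_stopping[OF _ stop_ext_trunc[OF \<sigma>] \<rho> \<sigma>\<rho> \<rho>n, of 1 n, folded gap_def]
    have gi: "integrable M (\<lambda>\<omega>. gap (?S n \<omega>) (?R n \<omega>))" by (rule hs(1)) auto
    have "(\<integral>\<^sup>+\<omega>. ennreal (gap (?S n \<omega>) (?R n \<omega>) + hyp 1 (?S n \<omega>)) \<partial>M) = ennreal (expectation (\<lambda>\<omega>. gap (?S n \<omega>) (?R n \<omega>) + hyp 1 (?S n \<omega>)))"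
      by (rule nn_integral_eq_integral) (use gi integrable_hyp[OF _ Si] gap0 hyp_nonneg[of 1] in auto)
    also have "expectation (\<lambda>\<omega>. gap (?S n \<omega>) (?R n \<omega>) + hyp 1 (?S n \<omega>)) = expectation (\<lambda>\<omega>. hyp 1 (?R n \<omega>))"
      using hs(2) gi integrable_hyp[OF _ Si[of n], of 1] by simp
    also have "\<dots> \<le> expectation (\<lambda>\<omega>. hyp 1 (B (trunc \<tau> (real n) \<omega>) \<omega>))"
      by (rule hyp_stopping(3)[OF _ \<rho> stop_ext_trunc[OF \<tau>], where T="real n"]) (use trunc_le[OF \<tau>] in \<open>auto simp: \<rho>_def\<close>)
    also have "\<dots> \<le> a" unfolding a_def by (rule hyp_trunc_le[OF \<tau> fin ui int]) auto
    finally show ?thesis by (simp add: ennreal_leI)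
  qed
  have R'm[measurable]: "?R' \<in> borel_measurable M"
  proof (rule B_at_measurable)
    have "(\<lambda>\<omega>. real_of_ereal (\<tau> \<omega>)) \<in> borel_measurable M" "(\<lambda>\<omega>. real_of_ereal (\<sigma> \<omega>)) \<in> borel_measurable M"
      using stop_ext_measurable[OF \<tau>] stop_ext_measurable[OF \<sigma>] by measurable
    then show "(\<lambda>\<omega>. min (real_of_ereal (\<tau> \<omega>)) (max (real_of_ereal (\<sigma> \<omega>)) t)) \<in> borel_measurable M" by measurable
    show "\<omega> \<in> space M \<Longrightarrow> 0 \<le> min (real_of_ereal (\<tau> \<omega>)) (max (real_of_ereal (\<sigma> \<omega>)) t)" for \<omega>
      using stop_ext_nonneg[OF \<tau>] t by (auto intro!: real_of_ereal_pos)
  qed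
  \<comment> \<open>The truncated quantities are eventually constant along each path, which prepares
    Fatou's lemma. In the limit the gap plus \<open>hyp 1\<close> at \<sigma> integrates to at most
    \<open>a\<close>, while the second summand alone already integrates to \<open>a\<close> because
    the laws agree; nothing is left for the gap.\<close>
  have conv: "AE \<omega> in M. ennreal (gap (at_time \<sigma> \<omega>) (?R' \<omega>) + hyp 1 (at_time \<sigma> \<omega>))
      = liminf (\<lambda>n. ennreal (gap (?S n \<omega>) (?R n \<omega>) + hyp 1 (?S n \<omega>)))"
    using fin fin\<sigma> AE_space
  proof eventually_elim
    case (elim \<omega>)
    have "\<forall>\<^sub>F n in sequentially. ennreal (gap (?S n \<omega>) (?R n \<omega>) + hyp 1 (?S n \<omega>)) = ennreal (gap (at_time \<sigma> \<omega>) (?R' \<omega>) + hyp 1 (at_time \<sigma> \<omega>))"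
      using trunc_eventually[OF elim(3) \<tau> elim(1)] trunc_eventually[OF elim(3) \<sigma> elim(2)]
      by eventually_elim (simp add: \<rho>_def)
    then have "(\<lambda>n. ennreal (gap (?S n \<omega>) (?R n \<omega>) + hyp 1 (?S n \<omega>))) \<longlonglongrightarrow> ennreal (gap (at_time \<sigma> \<omega>) (?R' \<omega>) + hyp 1 (at_time \<sigma> \<omega>))"
      by (rule tendsto_eventually)
    then show ?case by (simp add: lim_imp_Liminf)
  qed
  have mS[measurable]: "?S n \<in> borel_measurable M" "?R n \<in> borel_measurable M" for n using Si Ri by auto
  have "(\<integral>\<^sup>+\<omega>. ennreal (gap (at_time \<sigma> \<omega>) (?R' \<omega>) + hyp 1 (at_time \<sigma> \<omega>)) \<partial>M) =
     (\<integral>\<^sup>+\<omega>. liminf (\<lambda>n. ennreal (gap (?S n \<omega>) (?R n \<omega>) + hyp 1 (?S n \<omega>))) \<partial>M)"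
    by (rule nn_integral_cong_AE[OF conv])
  also have "\<dots> \<le> liminf (\<lambda>n. \<integral>\<^sup>+\<omega>. ennreal (gap (?S n \<omega>) (?R n \<omega>) + hyp 1 (?S n \<omega>)) \<partial>M)"
    by (rule nn_integral_liminf) (unfold gap_def, measurable)
  also have "\<dots> \<le> liminf (\<lambda>n. ennreal a)" by (rule Liminf_mono) (simp add: le_a)
  finally have "(\<integral>\<^sup>+\<omega>. ennreal (gap (at_time \<sigma> \<omega>) (?R' \<omega>)) + ennreal (hyp 1 (at_time \<sigma> \<omega>)) \<partial>M) \<le> ennreal a"
    using gap0 hyp_nonneg[of 1] by (simp add: Liminf_const)
  also have "(\<integral>\<^sup>+\<omega>. ennreal (gap (at_time \<sigma> \<omega>) (?R' \<omega>)) + ennreal (hyp 1 (at_time \<sigma> \<omega>)) \<partial>M)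
    = (\<integral>\<^sup>+\<omega>. ennreal (gap (at_time \<sigma> \<omega>) (?R' \<omega>)) \<partial>M) + ennreal a"
    using nn_integral_hyp[OF _ int\<sigma>, of 1] unfolding a\<sigma>
    by (subst nn_integral_add) (unfold gap_def, measurable)
  finally have "ennreal a + (\<integral>\<^sup>+\<omega>. ennreal (gap (at_time \<sigma> \<omega>) (?R' \<omega>)) \<partial>M) \<le> ennreal a + 0"
    by (simp add: add.commute)
  then have "(\<integral>\<^sup>+\<omega>. ennreal (gap (at_time \<sigma> \<omega>) (?R' \<omega>)) \<partial>M) = 0"
    unfolding ennreal_add_left_cancel_le by simp
  then have "AE \<omega> in M. ennreal (gap (at_time \<sigma> \<omega>) (?R' \<omega>)) = 0"
    by (subst (asm) nn_integral_0_iff_AE) (unfold gap_def, measurable)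
  then show ?thesis
  proof eventually_elim
    case (elim \<omega>)
    then have "gap (at_time \<sigma> \<omega>) (?R' \<omega>) \<le> 0" by (simp add: ennreal_eq_0_iff)
    show ?case
    proof (rule ccontr)
      assume "?R' \<omega> \<noteq> at_time \<sigma> \<omega>"
      from hyp_convex(1)[OF zero_less_one this[symmetric]] \<open>gap (at_time \<sigma> \<omega>) (?R' \<omega>) \<le> 0\<close>
      show False unfolding gap_def by linarith
    qed
  qed
qed

text \<open>Applied at all rational t, \<open>between_same_law\<close> freezes the path from
  \<sigma> to \<tau>; if \<sigma> < \<tau>, two rational times in between contradict
  \<open>AE_not_constant\<close>.\<close>

lemma same_law_stop_eq:
  assumes \<sigma>: "stop_ext \<sigma>" and \<tau>: "stop_ext \<tau>" and le: "\<And>\<omega>. \<omega> \<in> space M \<Longrightarrow> \<sigma> \<omega> \<le> \<tau> \<omega>"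
    and fin: "AE \<omega> in M. \<tau> \<omega> < \<infinity>" and ui: "unif_integrable M (\<lambda>t \<omega>. B (trunc \<tau> t \<omega>) \<omega>)"
    and int: "integrable M (at_time \<tau>)" and law: "distr M borel (at_time \<sigma>) = distr M borel (at_time \<tau>)"
  shows "AE \<omega> in M. \<sigma> \<omega> = \<tau> \<omega>"
proof -
  have "AE \<omega> in M. \<forall>t\<in>\<rat>. 0 \<le> t \<longrightarrow> B (min (real_of_ereal (\<tau> \<omega>)) (max (real_of_ereal (\<sigma> \<omega>)) t)) \<omega> = at_time \<sigma> \<omega>"
  proof (intro AE_ball_countable[THEN iffD2] ballI countable_rat)
    fix t :: real
    show "AE \<omega> in M. 0 \<le> t \<longrightarrow> B (min (real_of_ereal (\<tau> \<omega>)) (max (real_of_ereal (\<sigma> \<omega>)) t)) \<omega> = at_time \<sigma> \<omega>"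
      using between_same_law[OF assms, of t] by (cases "0 \<le> t") auto
  qed
  with AE_not_constant fin AE_space show ?thesis
  proof eventually_elim
    case (elim \<omega>)
    obtain r where r: "\<tau> \<omega> = ereal r" using elim(2) stop_ext_nonneg[OF \<tau> elim(3)] by (cases "\<tau> \<omega>") auto
    then obtain s where s: "\<sigma> \<omega> = ereal s" "0 \<le> s" "s \<le> r"
      using stop_ext_nonneg[OF \<sigma> elim(3)] le[OF elim(3)] by (cases "\<sigma> \<omega>") auto
    show ?case
    proof (rule ccontr)
      assume "\<sigma> \<omega> \<noteq> \<tau> \<omega>"
      then have "s < r" using r s by simp
      then obtain p where p: "p \<in> \<rat>" "s < p" "p < r" using Rats_dense_in_real by blast
      then obtain q where q: "q \<in> \<rat>" "p < q" "q < r" using Rats_dense_in_real by blast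
      have "B p \<omega> = at_time \<sigma> \<omega>" using elim(4) p s r by (auto dest!: bspec[of _ _ p] simp: min_def max_def)
      moreover have "B q \<omega> = at_time \<sigma> \<omega>" using elim(4) p q s r by (auto dest!: bspec[of _ _ q] simp: min_def max_def)
      moreover have "B p \<omega> \<noteq> B q \<omega>" using elim(1) p q s(2) by auto
      ultimately show False by simp
    qed
  qed
qed

lemma solves_SEPD:
  assumes "solves_SEP M F B \<nu> \<tau>"
  shows "stop_ext \<tau>" "AE \<omega> in M. \<tau> \<omega> < \<infinity>" "distr M borel (at_time \<tau>) = \<nu>"
    "unif_integrable M (\<lambda>t \<omega>. B (trunc \<tau> t \<omega>) \<omega>)"
  using assms unfolding solves_SEP_def by blast+

lemma integrable_at_time:
  assumes "stop_ext \<tau>" "distr M borel (at_time \<tau>) = \<nu>" "integrable \<nu> (\<lambda>x. x)"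
  shows "integrable M (at_time \<tau>)"
proof -
  have "integrable (distr M borel (at_time \<tau>)) (\<lambda>x. x)" using assms(2,3) by simp
  from integrable_distr[OF at_time_measurable[OF assms(1)] this] show ?thesis .
qed

text \<open>Loynes' argument: the minimum of the two hitting times embeds the same law.\<close>
lemma root_hitting_unique:
  assumes R: "root_barrier R" "solves_SEP M F B \<nu> (hitting_time B R)"
    and S: "root_barrier S" "solves_SEP M F B \<nu> (hitting_time B S)"
    and int: "integrable \<nu> (\<lambda>x. x)"
  shows "AE \<omega> in M. hitting_time B R \<omega> = hitting_time B S \<omega>"
proof -
  let ?r = "hitting_time B R" and ?s = "hitting_time B S"
  note r = solves_SEPD[OF R(2)] and s = solves_SEPD[OF S(2)]
  define \<sigma> where "\<sigma> \<omega> = min (?r \<omega>) (?s \<omega>)" for \<omega>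
  have \<sigma>: "stop_ext \<sigma>" unfolding \<sigma>_def[abs_def] by (rule stop_ext_min[OF r(1) s(1)])
  note m[measurable] = at_time_measurable[OF \<sigma>] at_time_measurable[OF r(1)] at_time_measurable[OF s(1)]
  \<comment> \<open>The levels at which \<open>R\<close> begins before \<open>S\<close>. Stopping at
    the minimum means being stopped by \<open>R\<close> at these levels and by \<open>S\<close> at
    the others; rational times make \<open>A\<close> a countable union of Borel sets.\<close>
  define A where "A = (\<Union>q\<in>\<rat>. {x. (ereal q, ereal x) \<in> R \<and> (ereal q, ereal x) \<notin> S})"
  have sec: "{x. (ereal q, ereal x) \<in> Q} \<in> sets borel" if "root_barrier Q" for q Q
  proof (rule borel_closed)
    have "closed ((\<lambda>x. (ereal q, ereal x)) -` Q)"
      by (rule closed_vimage[OF root_closed[OF that]]) (intro continuous_intros)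
    then show "closed {x. (ereal q, ereal x) \<in> Q}" by (simp add: vimage_def)
  qed
  have A[measurable]: "A \<in> sets borel"
    unfolding A_def
  proof (intro sets.countable_UN'' countable_rat)
    fix q :: real
    have "{x. (ereal q, ereal x) \<in> R} - {x. (ereal q, ereal x) \<in> S} \<in> sets borel"
      using sec[OF R(1)] sec[OF S(1)] by (rule sets.Diff)
    then show "{x. (ereal q, ereal x) \<in> R \<and> (ereal q, ereal x) \<notin> S} \<in> sets borel" by (simp add: set_diff_eq)
  qed
  have key: "AE \<omega> in M. if at_time \<sigma> \<omega> \<in> A then \<sigma> \<omega> = ?r \<omega> else \<sigma> \<omega> = ?s \<omega>"
    using r(2) s(2) AE_space
  proof eventually_elim
    case (elim \<omega>)
    have "\<sigma> \<omega> < \<infinity>" using elim by (simp add: \<sigma>_def min_def)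
    then obtain t where t: "\<sigma> \<omega> = ereal t" using stop_ext_nonneg[OF \<sigma> elim(3)] by (cases "\<sigma> \<omega>") auto
    have t0: "0 \<le> t" using stop_ext_nonneg[OF \<sigma> elim(3)] t by simp
    let ?x = "B t \<omega>"
    have RS: "(ereal t, ereal ?x) \<in> R \<or> (ereal t, ereal ?x) \<in> S"
    proof (cases "?r \<omega> \<le> ?s \<omega>")
      case True
      then have "?r \<omega> = ereal t" using t by (simp add: \<sigma>_def min_def)
      from hitting_attained[OF root_closed[OF R(1)] elim(3) this] show ?thesis by blast
    next
      case False
      then have "?s \<omega> = ereal t" using t by (simp add: \<sigma>_def min_def)
      from hitting_attained[OF root_closed[OF S(1)] elim(3) this] show ?thesis by blast
    qed
    have Rr: "\<sigma> \<omega> = ?r \<omega>" if "(ereal t, ereal ?x) \<in> R"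
      using hitting_time_le[of t B \<omega>, OF t0 that] t by (simp add: \<sigma>_def min_def split: if_splits)
    have Ss: "\<sigma> \<omega> = ?s \<omega>" if "(ereal t, ereal ?x) \<in> S"
      using hitting_time_le[of t B \<omega>, OF t0 that] t by (auto simp: \<sigma>_def min_def split: if_splits)
    have at: "at_time \<sigma> \<omega> = ?x" by (simp add: t)
    show ?case
    proof (cases "?x \<in> A")
      case True
      then obtain q where q: "(ereal q, ereal ?x) \<in> R" "(ereal q, ereal ?x) \<notin> S" by (auto simp: A_def)
      have "(ereal t, ereal ?x) \<in> R"
      proof (rule ccontr)
        assume n: "(ereal t, ereal ?x) \<notin> R"
        then have "(ereal t, ereal ?x) \<in> S" using RS by blast
        moreover have "t \<le> q" using n root_up[OF R(1) q(1), of "ereal t"] by force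
        ultimately show False using root_up[OF S(1), of "ereal t" "ereal ?x" "ereal q"] q(2) by simp
      qed
      then show ?thesis using True Rr at by simp
    next
      case False
      have "(ereal t, ereal ?x) \<in> S"
      proof (rule ccontr)
        assume n: "(ereal t, ereal ?x) \<notin> S"
        then have tR: "(ereal t, ereal ?x) \<in> R" using RS by blast
        have "closed ((\<lambda>u. (ereal u, ereal ?x)) -` S)"
          by (rule closed_vimage[OF root_closed[OF S(1)]]) (intro continuous_intros)
        then have "open (- ((\<lambda>u. (ereal u, ereal ?x)) -` S))" by (simp add: open_Compl)
        moreover have "t \<in> - ((\<lambda>u. (ereal u, ereal ?x)) -` S)" using n by simp
        ultimately obtain e where e: "e > 0" "\<And>u. dist u t < e \<Longrightarrow> u \<in> - ((\<lambda>u. (ereal u, ereal ?x)) -` S)"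
          unfolding open_dist by blast
        obtain q where q: "q \<in> \<rat>" "t < q" "q < t + e" using Rats_dense_in_real[of t "t + e"] e(1) by auto
        have "(ereal q, ereal ?x) \<notin> S" using e(2)[of q] q by (simp add: dist_real_def)
        moreover have "(ereal q, ereal ?x) \<in> R" using root_up[OF R(1) tR, of "ereal q"] q by simp
        ultimately show False using False q(1) by (auto simp: A_def)
      qed
      then show ?thesis using False Ss at by simp
    qed
  qed
  interpret P: prob_space "distr M borel (at_time \<sigma>)" by (rule prob_space_distr) simp
  interpret N: prob_space \<nu> using r(3) m(2) prob_space_distr by metis
  have sets\<nu>: "sets \<nu> = sets borel" using r(3) sets_distr by metis
  \<comment> \<open>The two embeddings contribute the parts of \<nu> on \<open>A\<close> and off
    \<open>A\<close>, so the law at the minimum is dominated by \<nu>. Two probability measures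
    ordered in this way agree, as complements show.\<close>
  have le: "measure (distr M borel (at_time \<sigma>)) C \<le> measure \<nu> C" if C: "C \<in> sets borel" for C
  proof -
    have [measurable]: "C \<in> sets borel" by (rule C)
    have "measure (distr M borel (at_time \<sigma>)) C = prob {\<omega>\<in>space M. at_time \<sigma> \<omega> \<in> C}"
      by (subst measure_distr) (auto intro!: arg_cong[where f=prob])
    also have "\<dots> \<le> prob ({\<omega>\<in>space M. at_time ?r \<omega> \<in> C \<inter> A} \<union> {\<omega>\<in>space M. at_time ?s \<omega> \<in> C - A})"
    proof (rule finite_measure_mono_AE)
      show "AE \<omega> in M. \<omega> \<in> {\<omega>\<in>space M. at_time \<sigma> \<omega> \<in> C} \<longrightarrow>
        \<omega> \<in> {\<omega>\<in>space M. at_time ?r \<omega> \<in> C \<inter> A} \<union> {\<omega>\<in>space M. at_time ?s \<omega> \<in> C - A}"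
        using key
      proof eventually_elim
        case (elim \<omega>)
        then show ?case by (cases "at_time \<sigma> \<omega> \<in> A") auto
      qed
    qed measurable
    also have "\<dots> \<le> prob {\<omega>\<in>space M. at_time ?r \<omega> \<in> C \<inter> A} + prob {\<omega>\<in>space M. at_time ?s \<omega> \<in> C - A}"
      by (rule measure_Un_le) measurable
    also have "prob {\<omega>\<in>space M. at_time ?r \<omega> \<in> C \<inter> A} = measure \<nu> (C \<inter> A)"
      unfolding r(3)[symmetric] by (subst measure_distr) (auto intro!: arg_cong[where f=prob])
    also have "prob {\<omega>\<in>space M. at_time ?s \<omega> \<in> C - A} = measure \<nu> (C - A)"
      unfolding s(3)[symmetric] by (subst measure_distr) (auto intro!: arg_cong[where f=prob])
    also have "measure \<nu> (C \<inter> A) + measure \<nu> (C - A) = measure \<nu> C"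
      using N.finite_measure_Union[of "C \<inter> A" "C - A"] by (simp add: sets\<nu> Int_Diff_Un Int_Diff_disjoint)
    finally show ?thesis .
  qed
  have law: "distr M borel (at_time \<sigma>) = \<nu>"
  proof (rule measure_eqI)
    fix C assume "C \<in> sets (distr M borel (at_time \<sigma>))"
    then have C: "C \<in> sets borel" by simp
    have "measure \<nu> C \<le> measure (distr M borel (at_time \<sigma>)) C"
      using le[of "- C"] C P.prob_compl[of C] N.prob_compl[of C] sets_eq_imp_space_eq[OF sets\<nu>]
      by (simp add: sets\<nu> Compl_eq_Diff_UNIV)
    with le[OF C] show "emeasure (distr M borel (at_time \<sigma>)) C = emeasure \<nu> C"
      by (simp add: P.emeasure_eq_measure N.emeasure_eq_measure)
  qed (simp add: sets\<nu>)
  have i: "integrable M (at_time ?r)" "integrable M (at_time ?s)"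
    by (rule integrable_at_time[OF r(1,3) int], rule integrable_at_time[OF s(1,3) int])
  have "AE \<omega> in M. \<sigma> \<omega> = ?r \<omega>"
    by (rule same_law_stop_eq[OF \<sigma> r(1) _ r(2,4) i(1)], simp add: \<sigma>_def, rule trans[OF law r(3)[symmetric]])
  moreover have "AE \<omega> in M. \<sigma> \<omega> = ?s \<omega>"
    by (rule same_law_stop_eq[OF \<sigma> s(1) _ s(2,4) i(2)], simp add: \<sigma>_def, rule trans[OF law s(3)[symmetric]])
  ultimately show ?thesis by eventually_elim simp
qed

end

section \<open>From equal hitting times to equal barriers\<close>

lemma open_section_right:
  assumes R: "closed R" and "(ereal t, x) \<notin> R"
  obtains t' where "t < t'" "(ereal t', x) \<notin> R"
proof -
  have "closed ((\<lambda>u. (ereal u, x)) -` R)"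
    by (rule closed_vimage[OF R]) (intro continuous_intros)
  then have "open (- ((\<lambda>u. (ereal u, x)) -` R))" by (simp add: open_Compl)
  moreover have "t \<in> - ((\<lambda>u. (ereal u, x)) -` R)" using assms(2) by simp
  ultimately obtain e where e: "e > 0" "\<And>u. dist u t < e \<Longrightarrow> u \<in> - ((\<lambda>u. (ereal u, x)) -` R)"
    unfolding open_dist by blast
  have "(ereal (t + e / 2), x) \<notin> R" using e(2)[of "t + e / 2"] e(1) by (simp add: dist_real_def)
  with e(1) show ?thesis by (intro that[of "t + e / 2"]) auto
qed

lemma barrier_fun_eq_0: "root_barrier R \<Longrightarrow> (0, x) \<in> R \<Longrightarrow> barrier_fun R x = 0"
  unfolding barrier_fun_def by (rule antisym[OF Inf_lower Inf_greatest]) auto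

lemma barrier_fun_0_imp:
  assumes R: "root_barrier R" and "barrier_fun R x = 0" "0 < t"
  shows "(t, x) \<in> R"
proof -
  have "barrier_fun R x < t" using assms by simp
  then obtain s where "(s, x) \<in> R" "s < t" unfolding barrier_fun_def Inf_less_iff by auto
  then show ?thesis using root_up[OF R] by auto
qed

text \<open>A point missed at a positive time has nonzero barrier value, so by regularity it lies
  between the first zeros on the two sides of 0. A zero met earlier on the segment would be closer
  to 0 than the first one, and the end point itself is no zero.\<close>

lemma regular_avoid_initial:
  assumes R: "regular_root_barrier R" and n: "(ereal t, ereal x) \<notin> R" and t: "0 < t"
    and z: "z \<in> {min 0 x..max 0 x}"
  shows "(0, ereal z) \<notin> R"
proof
  assume zR: "(0, ereal z) \<in> R"
  have rR: "root_barrier R" using R by (simp add: regular_root_barrier_def)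
  let ?xm = "Sup {x. x \<le> 0 \<and> barrier_fun R x = 0}" and ?xp = "Inf {x. 0 \<le> x \<and> barrier_fun R x = 0}"
  have reg: "y \<notin> {?xm..?xp} \<Longrightarrow> barrier_fun R y = 0" for y
    using R unfolding regular_root_barrier_def Let_def by blast
  have rx: "barrier_fun R (ereal x) \<noteq> 0" using barrier_fun_0_imp[OF rR, of "ereal x" "ereal t"] n t by auto
  then have xin: "ereal x \<in> {?xm..?xp}" using reg by blast
  have rz: "barrier_fun R (ereal z) = 0" by (rule barrier_fun_eq_0[OF rR zR])
  show False
  proof (cases "0 \<le> x")
    case True
    then have "0 \<le> z" "z \<le> x" using z by auto
    then have "?xp \<le> ereal z" using rz by (intro Inf_lower) auto
    from order_trans[OF _ this, of "ereal x"] have "ereal x \<le> ereal z" using xin by simp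
    then have "z = x" using \<open>z \<le> x\<close> by simp
    with rz rx show False by simp
  next
    case False
    then have "z \<le> 0" "x \<le> z" using z by auto
    then have "ereal z \<le> ?xm" using rz by (intro Sup_upper) auto
    from order_trans[OF this, of "ereal x"] have "ereal z \<le> ereal x" using xin by simp
    then have "z = x" using \<open>x \<le> z\<close> by simp
    with rz rx show False by simp
  qed
qed

context brownian begin

text \<open>Two strips avoid the barrier: one around the segment from 0 to \<open>x\<close> for a
  short initial time and, since barriers only grow in time, one around \<open>x\<close> up to time
  \<open>t2\<close>. Good steps rush through the first strip into the second and wait there until
  after \<open>t1\<close>.\<close>

lemma reach_point:
  assumes R: "regular_root_barrier R" and n: "(ereal t2, ereal x) \<notin> R" and t: "0 \<le> t1" "t1 < t2"
  obtains G where "G \<in> sets M" "0 < prob G"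
    "\<And>\<omega>. \<omega> \<in> G \<Longrightarrow> \<exists>u\<in>{t1..t2}. B u \<omega> = x \<and> (\<forall>v\<in>{0..u}. (ereal v, ereal (B v \<omega>)) \<notin> R)"
proof -
  have rR: "root_barrier R" using R by (simp add: regular_root_barrier_def)
  define C where "C = {(t, x). (ereal t, ereal x) \<in> R}"
  have C: "closed C" unfolding C_def by (rule closed_real_section[OF root_closed[OF rR]])
  define lo where "lo = min 0 x"
  define hi where "hi = max 0 x"
  have "compact ({0::real} \<times> {lo..hi})" by (intro compact_Times) auto
  moreover have "({0} \<times> {lo..hi}) \<inter> C = {}"
    using regular_avoid_initial[OF R n] t by (auto simp: C_def lo_def hi_def zero_ereal_def)
  ultimately obtain \<eta> where \<eta>: "\<eta> > 0" "\<And>a b. a \<in> {0} \<times> {lo..hi} \<Longrightarrow> b \<in> C \<Longrightarrow> \<eta> \<le> dist a b"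
    using separate_compact_closed[OF _ C] by (metis (no_types, lifting))
  have near0: "(ereal v, ereal z) \<notin> R" if "0 \<le> v" "v < \<eta> / 2" "lo - \<eta> / 2 < z" "z < hi + \<eta> / 2" for v z
  proof
    assume "(ereal v, ereal z) \<in> R"
    then have vz: "(v, z) \<in> C" by (simp add: C_def)
    define z0 where "z0 = max lo (min hi z)"
    have lh: "lo \<le> hi" by (simp add: lo_def hi_def)
    have z0: "z0 \<in> {lo..hi}" "\<bar>z0 - z\<bar> < \<eta> / 2" using that lh \<eta>(1) unfolding z0_def by (simp, linarith)
    have "dist (0, z0) (v, z) \<le> dist 0 v + dist z0 z"
      by (simp add: dist_Pair_Pair sqrt_add_le_add_sqrt order_trans[OF sqrt_add_le_add_sqrt])
    also have "\<dots> < \<eta>" using z0(2) that by (simp add: dist_real_def)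
    finally show False using \<eta>(2)[of "(0, z0)" "(v, z)"] z0(1) vz by simp
  qed
  have "open (- C)" using C by (simp add: open_Compl)
  moreover have "(t2, x) \<in> - C" using n by (simp add: C_def)
  ultimately obtain \<kappa> where \<kappa>: "\<kappa> > 0" "\<And>p. dist p (t2, x) < \<kappa> \<Longrightarrow> p \<in> - C"
    unfolding open_dist by blast
  have nearx: "(ereal v, ereal z) \<notin> R" if "\<bar>z - x\<bar> < \<kappa>" "v \<le> t2" for v z
  proof
    assume "(ereal v, ereal z) \<in> R"
    then have "(ereal t2, ereal z) \<in> R" using root_up[OF rR, of "ereal v"] that by simp
    moreover have "(t2, z) \<in> - C" using that by (intro \<kappa>(2)) (simp add: dist_Pair_Pair dist_real_def)
    ultimately show False by (simp add: C_def)
  qed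
  define \<delta> where "\<delta> = min (min (\<eta> / 2) \<kappa>) (t2 - t1)"
  have \<delta>: "0 < \<delta>" "\<delta> \<le> \<eta> / 2" "\<delta> \<le> \<kappa>" "\<delta> \<le> t2 - t1" using \<eta>(1) \<kappa>(1) t unfolding \<delta>_def by linarith+
  \<comment> \<open>About 6|x|/d steps of duration d^2/36 take a time of order d|x|, and the path
    strays from the segment by at most d + d/3. Time and deviation both have to fit into the strips,
    which d(|x| + 4) \<le> \<delta>/2 ensures.\<close>
  define d where "d = min 1 (\<delta> / (2 * (\<bar>x\<bar> + 4)))"
  have d: "0 < d" "d \<le> 1" using \<delta>(1) by (auto simp: d_def add_nonneg_pos)
  have dx: "d * (\<bar>x\<bar> + 4) \<le> \<delta> / 2"
  proof -
    have "d \<le> \<delta> / (2 * (\<bar>x\<bar> + 4))" by (simp add: d_def)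
    then have "d * (\<bar>x\<bar> + 4) \<le> \<delta> / (2 * (\<bar>x\<bar> + 4)) * (\<bar>x\<bar> + 4)" by (rule mult_right_mono) simp
    also have "\<dots> = \<delta> / 2" by (simp add: divide_simps add_nonneg_eq_0_iff)
    finally show ?thesis .
  qed
  then have dx': "d * \<bar>x\<bar> + 4 * d \<le> \<delta> / 2" by (simp add: algebra_simps)
  have dx0: "0 \<le> d * \<bar>x\<bar>" using d by simp
  define h where "h = d\<^sup>2 / 36"
  have h: "0 < h" "h \<le> d / 36" using d by (auto simp: h_def power2_eq_square mult_left_le)
  define n0 where "n0 = nat \<lceil>6 * \<bar>x\<bar> / d\<rceil>"
  have n0: "6 * \<bar>x\<bar> / d \<le> real n0" "real n0 \<le> 6 * \<bar>x\<bar> / d + 1"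
    using d by (auto simp: n0_def of_nat_nat)
  have n0x: "\<bar>x\<bar> \<le> real n0 * (d / 6)" using n0(1) d by (simp add: field_simps)
  have n0h: "real n0 * h \<le> d * \<bar>x\<bar> / 6 + h"
  proof -
    have "real n0 * h \<le> (6 * \<bar>x\<bar> / d + 1) * h" using n0(2) h by (intro mult_right_mono) auto
    also have "\<dots> = d * \<bar>x\<bar> / 6 + h" using d by (simp add: h_def field_simps power2_eq_square)
    finally show ?thesis .
  qed
  \<comment> \<open>Enough steps both to arrive near \<open>x\<close> and to pass time
    \<open>t1\<close>; two more steps produce a visit of \<open>x\<close>, still before
    \<open>t2\<close>.\<close>
  define j0 where "j0 = max n0 (nat \<lceil>t1 / h\<rceil>)"
  have j0: "n0 \<le> j0" "t1 \<le> real j0 * h"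
  proof -
    show "n0 \<le> j0" by (simp add: j0_def)
    have "t1 / h \<le> real (nat \<lceil>t1 / h\<rceil>)" by linarith
    also have "\<dots> \<le> real j0" by (simp add: j0_def)
    finally show "t1 \<le> real j0 * h" using h by (simp add: divide_le_eq)
  qed
  have j0h: "real (j0 + 2) * h \<le> t2"
  proof -
    have "real (nat \<lceil>t1 / h\<rceil>) \<le> t1 / h + 1" using t h by (simp add: of_nat_nat)
    then have "real (nat \<lceil>t1 / h\<rceil>) * h \<le> (t1 / h + 1) * h" using h by (intro mult_right_mono) auto
    also have "\<dots> = t1 + h" using h by (simp add: field_simps)
    finally have 1: "real (nat \<lceil>t1 / h\<rceil>) * h \<le> t1 + h" .
    have "real j0 * h = real n0 * h \<or> real j0 * h = real (nat \<lceil>t1 / h\<rceil>) * h" by (simp add: j0_def max_def)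
    then have "real j0 * h \<le> max (d * \<bar>x\<bar> / 6 + h) (t1 + h)" using 1 n0h by auto
    moreover have "real (j0 + 2) * h = real j0 * h + 2 * h" by (simp add: algebra_simps)
    ultimately show ?thesis using h(2) dx' dx0 \<delta>(1,4) d t by linarith
  qed
  define G where "G = good_steps x d (j0 + 2)"
  have GM: "G \<in> sets M" unfolding G_def using sets_F[OF _ good_steps_sets[OF d(1)]] by simp
  have Gp: "0 < prob G" unfolding G_def by (rule good_steps_pos[OF d(1)])
  have "\<exists>u\<in>{t1..t2}. B u \<omega> = x \<and> (\<forall>v\<in>{0..u}. (ereal v, ereal (B v \<omega>)) \<notin> R)" if \<omega>: "\<omega> \<in> G" for \<omega>
  proof -
    note gs = good_steps_path[OF d(1) \<omega>[unfolded G_def], folded h_def]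
    have "\<bar>x\<bar> \<le> real j0 * (d / 6)"
      using n0x j0(1) d by (meson divide_nonneg_nonneg mult_right_mono of_nat_mono order_trans less_imp_le zero_le_numeral)
    then obtain u where u: "real j0 * h \<le> u" "u \<le> real (j0 + 2) * h" "B u \<omega> = x"
      using gs(4)[of j0] by auto
    have "(ereal v, ereal (B v \<omega>)) \<notin> R" if v: "0 \<le> v" "v \<le> u" for v
    proof -
      obtain j where j: "j < j0 + 2" "real j * h \<le> v" "v \<le> real (Suc j) * h"
      proof (cases "v = real (j0 + 2) * h")
        case True
        show ?thesis using h True by (intro that[of "j0 + 1"]) auto
      next
        case False
        then have lt: "v < real (j0 + 2) * h" using v u by linarith
        have 1: "real (nat \<lfloor>v / h\<rfloor>) \<le> v / h" "v / h \<le> real (Suc (nat \<lfloor>v / h\<rfloor>))"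
          using v h by (auto simp: of_nat_nat) linarith
        have "v / h < real (j0 + 2)" using lt h by (simp add: divide_less_eq)
        then have "real (nat \<lfloor>v / h\<rfloor>) < real (j0 + 2)" using 1(1) by linarith
        then have "nat \<lfloor>v / h\<rfloor> < j0 + 2" by (simp only: of_nat_less_iff)
        then show ?thesis using 1 h by (intro that[of "nat \<lfloor>v / h\<rfloor>"]) (auto simp: field_simps)
      qed
      have Bv: "\<bar>B v \<omega> - B (real j * h) \<omega>\<bar> < d" using gs(3)[OF j(1)] j by simp
      have Bj: "B (real j * h) \<omega> \<in> {min 0 (x - d / 3)..max 0 (x + d / 3)}" using gs(1)[of j] j by simp
      show ?thesis
      \<comment> \<open>Early on, the strip around the segment protects the path; later the path is
        already within d/3 + d of \<open>x\<close>.\<close>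
      proof (cases "v < \<eta> / 2")
        case True
        have "lo - d / 3 \<le> min 0 (x - d / 3)" "max 0 (x + d / 3) \<le> hi + d / 3"
          using d by (auto simp: lo_def hi_def)
        then have "lo - d / 3 - d < B v \<omega>" "B v \<omega> < hi + d / 3 + d" using Bv Bj by auto
        moreover have "d / 3 + d < \<eta> / 2" using dx' dx0 \<delta> d by linarith
        ultimately show ?thesis using v True by (intro near0) auto
      next
        case False
        have "real n0 * h + h < \<eta> / 2" using n0h dx' dx0 \<delta> d h(2) by linarith
        then have "real (Suc n0) * h < real (Suc j) * h" using False j(3) by (simp add: algebra_simps)
        then have "n0 \<le> j" using h(1) by simp
        then have "\<bar>x\<bar> \<le> real j * (d / 6)"
          using n0x d by (meson divide_nonneg_nonneg mult_right_mono of_nat_mono order_trans less_imp_le zero_le_numeral)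
        then have "max (\<bar>x\<bar> - real j * (d / 6)) (d / 3) = d / 3" using d by (intro max_absorb2) linarith
        then have "\<bar>B (real j * h) \<omega> - x\<bar> \<le> d / 3" using gs(2)[of j] j(1) by simp
        then have "\<bar>B v \<omega> - x\<bar> < \<kappa>" using Bv dx' dx0 \<delta> d by linarith
        moreover have "v \<le> t2" using v u j0h by linarith
        ultimately show ?thesis by (intro nearx)
      qed
    qed
    moreover have "u \<in> {t1..t2}" using u j0 j0h by simp
    ultimately show ?thesis using u(3) by auto
  qed
  with GM Gp show ?thesis by (rule that)
qed

text \<open>At a point of \<open>R\<close> outside \<open>S\<close>, \<open>reach_point\<close>
  yields paths that visit this level after the given time without having met \<open>S\<close>. By
  then they have hit \<open>R\<close> but not \<open>S\<close>, and this event has positive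
  probability.\<close>

lemma hitting_eq_imp_subset:
  assumes R: "root_barrier R" and S: "regular_root_barrier S"
    and eq: "AE \<omega> in M. hitting_time B R \<omega> = hitting_time B S \<omega>"
  shows "R \<subseteq> S"
proof (rule ccontr)
  have rS: "root_barrier S" using S by (simp add: regular_root_barrier_def)
  assume "\<not> R \<subseteq> S"
  then obtain t0 x0 where tx: "(t0, x0) \<in> R" "(t0, x0) \<notin> S" by auto
  have "0 \<le> t0" using root_nonneg[OF R tx(1)] .
  moreover have "t0 \<noteq> \<infinity>" using root_inf[OF rS] tx(2) by blast
  ultimately obtain t where t: "t0 = ereal t" "0 \<le> t" by (cases t0) auto
  obtain x where x: "x0 = ereal x" using tx(2) root_edge[OF rS \<open>0 \<le> t0\<close>] by (cases x0) auto
  \<comment> \<open>Sections of \<open>S\<close> are closed, so the point stays outside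
    \<open>S\<close> for a little longer; this gives the time window asked for by
    \<open>reach_point\<close>.\<close>
  obtain t2 where t2: "t < t2" "(ereal t2, ereal x) \<notin> S"
    using open_section_right[OF root_closed[OF rS]] tx(2) t x by metis
  obtain G where G: "G \<in> sets M" "0 < prob G"
    "\<And>\<omega>. \<omega> \<in> G \<Longrightarrow> \<exists>u\<in>{t..t2}. B u \<omega> = x \<and> (\<forall>v\<in>{0..u}. (ereal v, ereal (B v \<omega>)) \<notin> S)"
    using reach_point[OF S t2(2) t(2) t2(1)] by blast
  have ne: "hitting_time B R \<omega> \<noteq> hitting_time B S \<omega>" if \<omega>: "\<omega> \<in> G" for \<omega>
  proof
    assume eq: "hitting_time B R \<omega> = hitting_time B S \<omega>"
    have \<omega>M: "\<omega> \<in> space M" using \<omega> sets.sets_into_space[OF G(1)] by blast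
    obtain u where u: "t \<le> u" "B u \<omega> = x" "\<And>v. v \<in> {0..u} \<Longrightarrow> (ereal v, ereal (B v \<omega>)) \<notin> S"
      using G(3)[OF \<omega>] by auto
    have "(ereal u, ereal (B u \<omega>)) \<in> R" using root_up[OF R, of t0 x0 "ereal u"] tx(1) t x u by simp
    then have "hitting_time B R \<omega> \<le> ereal u" using t u by (intro hitting_time_le) auto
    then have le: "hitting_time B S \<omega> \<le> ereal u" using eq by simp
    then obtain s where s: "hitting_time B S \<omega> = ereal s"
      using hitting_time_nonneg[of B S \<omega>] by (cases "hitting_time B S \<omega>") auto
    from hitting_attained[OF root_closed[OF rS] \<omega>M s] u(3)[of s] le s show False by simp
  qed
  have "AE \<omega> in M. \<omega> \<notin> G" using eq by eventually_elim (use ne in blast)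
  then have "prob G = 0" using G(1) by (subst (asm) AE_iff_measurable[of G]) (auto dest: sets.sets_into_space simp: emeasure_eq_measure)
  with G(2) show False by simp
qed

lemma regular_barrier_unique:
  assumes "regular_root_barrier R" "solves_SEP M F B \<nu> (hitting_time B R)"
    and "regular_root_barrier S" "solves_SEP M F B \<nu> (hitting_time B S)" and "integrable \<nu> (\<lambda>x. x)"
  shows "R = S"
proof -
  have rb: "root_barrier R" "root_barrier S" using assms by (auto simp: regular_root_barrier_def)
  note eq = root_hitting_unique[OF rb(1) assms(2) rb(2) assms(4,5)]
  have "AE \<omega> in M. hitting_time B S \<omega> = hitting_time B R \<omega>" using eq by eventually_elim simp
  from hitting_eq_imp_subset[OF rb(2) assms(1) this] hitting_eq_imp_subset[OF rb(1) assms(3) eq]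
  show ?thesis by blast
qed

end

section \<open>Existence for finite laws\<close>

context brownian begin

text \<open>By the intermediate value theorem, leaving [a, c] requires an earlier visit of a or c,
  where the barrier already stops the path.\<close>

lemma path_between_absorbing:
  assumes \<omega>: "\<omega> \<in> space M" and s: "0 \<le> s" "ereal s \<le> hitting_time B R \<omega>"
    and a: "a < 0" "\<And>u. 0 \<le> u \<Longrightarrow> (ereal u, ereal a) \<in> R" and c: "0 < c" "\<And>u. 0 \<le> u \<Longrightarrow> (ereal u, ereal c) \<in> R"
  shows "a \<le> B s \<omega> \<and> B s \<omega> \<le> c"
proof -
  have cont: "continuous_on {0..s} (\<lambda>u. B u \<omega>)" by (intro continuous_on_subset[OF B_cont[OF \<omega>]]) auto
  have no: False if u: "0 \<le> u" "u < s" "(ereal u, ereal (B u \<omega>)) \<in> R" for u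
  proof -
    have "ereal s \<le> ereal u" using s(2) hitting_time_le[of u B \<omega>, OF u(1,3)] by (rule order_trans)
    then show False using u(2) by simp
  qed
  have "\<not> B s \<omega> < a"
  proof
    assume l: "B s \<omega> < a"
    obtain u where u: "0 \<le> u" "u \<le> s" "B u \<omega> = a"
      using IVT2'[of "\<lambda>u. B u \<omega>" s a 0, OF _ _ s(1) cont] l a(1) B_0[OF \<omega>] by auto
    with l have "u \<noteq> s" by auto
    with u no[of u] a(2)[of u] show False by simp
  qed
  moreover have "\<not> c < B s \<omega>"
  proof
    assume l: "c < B s \<omega>"
    obtain u where u: "0 \<le> u" "u \<le> s" "B u \<omega> = c"
      using IVT'[of "\<lambda>u. B u \<omega>" 0 c s, OF _ _ s(1) cont] l c(1) B_0[OF \<omega>] by auto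
    with l have "u \<noteq> s" by auto
    with u no[of u] c(2)[of u] show False by simp
  qed
  ultimately show ?thesis by simp
qed

end

locale brownian_finite = brownian +
  fixes X :: "real set" and p :: "real \<Rightarrow> real" and lo hi :: real
  assumes X: "finite X" "lo \<in> X" "hi \<in> X" "\<And>x. x \<in> X \<Longrightarrow> lo \<le> x \<and> x \<le> hi"
    and lohi: "lo < 0" "0 < hi"
    and p: "\<And>x. x \<in> X \<Longrightarrow> 0 < p x" "(\<Sum>x\<in>X. p x) = 1" "(\<Sum>x\<in>X. x * p x) = 0"
begin

text \<open>Absorption beyond the extreme atoms keeps the path bounded until it is stopped, and the
  isolated spikes force the stopped value into \<open>X\<close>.\<close>

definition bar :: "(real \<Rightarrow> ereal) \<Rightarrow> (ereal \<times> ereal) set" where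
  "bar b = {(t, x). 0 \<le> t \<and> (x \<le> ereal lo \<or> ereal hi \<le> x \<or> t = \<infinity> \<or> (\<exists>y\<in>X. x = ereal y \<and> b y \<le> t))}"

lemma bar_closed: "closed (bar b)"
proof -
  have "bar b = {0..} \<times> {..ereal lo} \<union> {0..} \<times> {ereal hi..} \<union> {\<infinity>} \<times> UNIV \<union> (\<Union>y\<in>X. {max 0 (b y)..} \<times> {ereal y})"
    by (auto simp: bar_def)
  also have "closed \<dots>" using X(1) by (intro closed_Un closed_Times closed_UN ballI) auto
  finally show ?thesis .
qed

lemma bar_root: "root_barrier (bar b)"
  unfolding root_barrier_def using bar_closed by (auto simp: bar_def intro: order_trans)

definition hit :: "(real \<Rightarrow> ereal) \<Rightarrow> 'a \<Rightarrow> ereal" where "hit b = hitting_time B (bar b)"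

lemma hit_stop: "stop_ext (hit b)"
  unfolding hit_def by (rule stop_ext_hitting[OF bar_closed])

lemma hit_range:
  assumes "\<omega> \<in> space M" "0 \<le> s" "ereal s \<le> hit b \<omega>"
  shows "lo \<le> B s \<omega> \<and> B s \<omega> \<le> hi"
  using assms(3) unfolding hit_def
  by (rule path_between_absorbing[OF assms(1,2)]) (use lohi in \<open>auto simp: bar_def\<close>)

lemma trunc_hit_bounded:
  assumes \<omega>: "\<omega> \<in> space M" and t: "0 \<le> t"
  shows "\<bar>B (trunc (hit b) t \<omega>) \<omega>\<bar> \<le> hi - lo"
proof -
  have "0 \<le> trunc (hit b) t \<omega>" "ereal (trunc (hit b) t \<omega>) \<le> hit b \<omega>"
    using stop_ext_nonneg[OF hit_stop[of b] \<omega>] t by (cases "hit b \<omega>"; simp add: min_def)+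
  from hit_range[OF \<omega> this] show ?thesis using lohi by linarith
qed

lemma hit_finite: "AE \<omega> in M. hit b \<omega> < \<infinity>"
proof (rule stop_ext_finite_if_bounded[OF hit_stop])
  fix t :: real assume t: "0 \<le> t"
  have "expectation (\<lambda>\<omega>. \<bar>B (trunc (hit b) t \<omega>) \<omega>\<bar>) \<le> expectation (\<lambda>\<omega>. hi - lo)"
    by (rule integral_mono) (use integrable_trunc[OF hit_stop t] trunc_hit_bounded t in auto)
  then show "expectation (\<lambda>\<omega>. \<bar>B (trunc (hit b) t \<omega>) \<omega>\<bar>) \<le> hi - lo" by (simp add: prob_space)
qed

lemma hit_attained:
  assumes "\<omega> \<in> space M" "hit b \<omega> < \<infinity>"
  obtains r where "hit b \<omega> = ereal r" "0 \<le> r" "at_time (hit b) \<omega> = B r \<omega>" "B r \<omega> \<in> X"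
    "(ereal r, ereal (B r \<omega>)) \<in> bar b"
proof -
  obtain r where r: "hit b \<omega> = ereal r" using assms stop_ext_nonneg[OF hit_stop[of b] assms(1)] by (cases "hit b \<omega>") auto
  note a = hitting_attained[OF bar_closed assms(1) r[unfolded hit_def]]
  have "lo \<le> B r \<omega> \<and> B r \<omega> \<le> hi" using hit_range[OF assms(1) a(1), of b] r by simp
  then have "B r \<omega> \<in> X" using a(2) X(2,3) by (auto simp: bar_def)
  then show ?thesis using r a by (intro that) auto
qed

lemma at_hit_measurable[measurable]: "at_time (hit b) \<in> borel_measurable M"
  by (rule at_time_measurable[OF hit_stop])

definition mass :: "(real \<Rightarrow> ereal) \<Rightarrow> real \<Rightarrow> real" where
  "mass b x = prob {\<omega>\<in>space M. at_time (hit b) \<omega> = x}"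

lemma AE_hit_X: "AE \<omega> in M. at_time (hit b) \<omega> \<in> X"
  using hit_finite[of b] AE_space
proof eventually_elim
  case (elim \<omega>)
  show ?case by (rule hit_attained[OF elim(2,1)]) simp
qed

lemma expectation_hit:
  fixes f :: "real \<Rightarrow> real"
  assumes [measurable]: "f \<in> borel_measurable borel"
  shows "expectation (\<lambda>\<omega>. f (at_time (hit b) \<omega>)) = (\<Sum>x\<in>X. f x * mass b x)"
proof -
  have s: "{\<omega>\<in>space M. at_time (hit b) \<omega> = x} \<in> sets M" for x by measurable
  have "expectation (\<lambda>\<omega>. f (at_time (hit b) \<omega>)) = expectation (\<lambda>\<omega>. \<Sum>x\<in>X. f x * indicator {\<omega>\<in>space M. at_time (hit b) \<omega> = x} \<omega>)"
  proof (rule integral_cong_AE)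
    show "AE \<omega> in M. f (at_time (hit b) \<omega>) = (\<Sum>x\<in>X. f x * indicator {\<omega>\<in>space M. at_time (hit b) \<omega> = x} \<omega>)"
      using AE_hit_X[of b] AE_space
    proof eventually_elim
      case (elim \<omega>)
      have "(\<Sum>x\<in>X. f x * indicator {\<omega>\<in>space M. at_time (hit b) \<omega> = x} \<omega>) = (\<Sum>x\<in>X. if x = at_time (hit b) \<omega> then f x else 0)"
        using elim(2) by (intro sum.cong) (auto simp: indicator_def)
      then show ?case using elim X(1) by simp
    qed
  qed (use s in measurable)
  also have "\<dots> = (\<Sum>x\<in>X. f x * mass b x)"
    using s by (subst Bochner_Integration.integral_sum) (auto simp: mass_def intro!: integrable_mult_right integrable_indicat)
  finally show ?thesis .
qed

lemma sum_mass: "(\<Sum>x\<in>X. mass b x) = 1"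
  using expectation_hit[of "\<lambda>_. 1" b] by (simp add: prob_space)

text \<open>The path is bounded up to the hitting time, so the zero mean of the truncated values
  passes to the limit. With total mass 1 this is the second linear relation exploited in
  \<open>best_mass_eq\<close>.\<close>

lemma sum_mean: "(\<Sum>x\<in>X. x * mass b x) = 0"
proof -
  have "(\<lambda>n. expectation (\<lambda>\<omega>. B (trunc (hit b) (real n) \<omega>) \<omega>)) \<longlonglongrightarrow> expectation (at_time (hit b))"
    by (rule integral_dominated_convergence[where w="\<lambda>_. hi - lo"])
       (use AE_trunc_tendsto[OF hit_stop hit_finite] trunc_measurable[OF hit_stop] trunc_hit_bounded in auto)
  moreover have "expectation (\<lambda>\<omega>. B (trunc (hit b) (real n) \<omega>) \<omega>) = 0" for n
    by (rule expectation_B_stop[OF stop_ext_trunc[OF hit_stop] trunc_le[OF hit_stop]]) auto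
  ultimately have "expectation (at_time (hit b)) = 0" using LIMSEQ_unique[OF _ tendsto_const] by simp
  then show ?thesis using expectation_hit[of "\<lambda>x. x" b] by simp
qed

lemma mass_nonneg: "0 \<le> mass b x"
  by (simp add: mass_def)

text \<open>A path stopped at \<open>x\<close> under the lower spikes has met none of them before,
  hence none of the higher ones, and it stops at \<open>x\<close> under \<open>c\<close> as well
  because the spike at \<open>x\<close> is the same.\<close>

lemma mass_mono:
  assumes le: "\<And>y. y \<in> X \<Longrightarrow> b y \<le> c y" and eq: "b x = c x"
  shows "mass b x \<le> mass c x"
  unfolding mass_def
proof (rule finite_measure_mono_AE)
  show "AE \<omega> in M. \<omega> \<in> {\<omega> \<in> space M. at_time (hit b) \<omega> = x} \<longrightarrow> \<omega> \<in> {\<omega> \<in> space M. at_time (hit c) \<omega> = x}"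
    using hit_finite[of b] AE_space
  proof eventually_elim
    case (elim \<omega>)
    obtain r where r: "hit b \<omega> = ereal r" "0 \<le> r" "at_time (hit b) \<omega> = B r \<omega>" "B r \<omega> \<in> X" "(ereal r, ereal (B r \<omega>)) \<in> bar b"
      by (rule hit_attained[OF elim(2,1)])
    have sub: "bar c \<subseteq> bar b"
    proof clarify
      fix t x assume tx: "(t, x) \<in> bar c"
      have "\<exists>y\<in>X. x = ereal y \<and> b y \<le> t" if "y \<in> X" "x = ereal y" "c y \<le> t" for y
        using that order_trans[OF le[OF that(1)] that(3)] by blast
      with tx show "(t, x) \<in> bar b" unfolding bar_def by blast
    qed
    have bc: "hit b \<omega> \<le> hit c \<omega>"
      unfolding hit_def hitting_time_def using sub by (intro Inf_superset_mono) auto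
    show ?case
    proof
      assume "\<omega> \<in> {\<omega> \<in> space M. at_time (hit b) \<omega> = x}"
      then have x: "B r \<omega> = x" using r by simp
      then have "(ereal r, ereal (B r \<omega>)) \<in> bar c" using r(5) eq by (auto simp: bar_def)
      then have "hit c \<omega> \<le> ereal r" unfolding hit_def by (rule hitting_time_le[OF r(2)])
      with bc r(1) have "hit c \<omega> = ereal r" by simp
      then show "\<omega> \<in> {\<omega> \<in> space M. at_time (hit c) \<omega> = x}" using elim(2) x by simp
    qed
  qed
qed measurable

text \<open>A finite point off the limit barrier has a neighbourhood containing at most one atom
  level, so only one spike height matters there. Spikes escaping upwards lose nothing, since the
  line at time infinity belongs to every barrier.\<close>

lemma bar_kconv:
  assumes lim: "\<And>x. x \<in> X \<Longrightarrow> (\<lambda>n. b n x) \<longlonglongrightarrow> b' x"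
  shows "kconv (\<lambda>n. bar (b n)) (bar b')"
  unfolding kconv_def
proof (intro conjI allI impI ballI)
  fix z assume z: "z \<notin> bar b'"
  obtain t x where tx: "z = (t, x)" by (cases z)
  show "\<exists>U. open U \<and> z \<in> U \<and> (\<forall>\<^sub>F n in sequentially. bar (b n) \<inter> U = {})"
  proof (cases "t < 0")
    case True
    then show ?thesis
      by (intro exI[of _ "{..<0} \<times> UNIV"] conjI always_eventually allI) (auto simp: tx bar_def open_Times)
  next
    case False
    then have x: "ereal lo < x" "x < ereal hi" "t < \<infinity>" "\<And>y. y \<in> X \<Longrightarrow> x = ereal y \<Longrightarrow> t < b' y"
      using z by (auto simp: tx bar_def not_le not_less)
    then obtain y where y: "x = ereal y" by (cases x) auto
    have fin: "closed (ereal ` (X - {y}))" using X(1) by (intro finite_imp_closed) auto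
    let ?V = "{ereal lo<..<ereal hi} - ereal ` (X - {y})"
    have V: "open ?V" "x \<in> ?V" using fin x y by (auto intro: open_Diff)
    show ?thesis
    proof (cases "y \<in> X")
      case True
      obtain c where c: "t < c" "c < b' y" using dense[OF x(4)[OF True y]] by blast
      have "\<forall>\<^sub>F n in sequentially. c < b n y" by (rule order_tendstoD(1)[OF lim[OF True] c(2)])
      then have "\<forall>\<^sub>F n in sequentially. bar (b n) \<inter> ({..<c} \<times> ?V) = {}"
      proof eventually_elim
        case (elim n)
        show ?case
        proof (rule ccontr)
          assume "bar (b n) \<inter> ({..<c} \<times> ?V) \<noteq> {}"
          then obtain z' where "z' \<in> bar (b n) \<inter> ({..<c} \<times> ?V)" by blast
          then obtain t' x' where *: "(t', x') \<in> bar (b n)" "t' < c" "x' \<in> ?V" by (cases z') blast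
          then obtain w where "w \<in> X" "x' = ereal w" "b n w \<le> t'" by (auto simp: bar_def)
          then have "w = y" using * by auto
          with \<open>b n w \<le> t'\<close> *(2) elim show False by auto
        qed
      qed
      with V c(1) show ?thesis
        by (intro exI[of _ "{..<c} \<times> ?V"]) (auto simp: tx open_Times)
    next
      case False
      have "bar (b n) \<inter> ({..<\<infinity>} \<times> ?V) = {}" for n
      proof (rule ccontr)
        assume "bar (b n) \<inter> ({..<\<infinity>} \<times> ?V) \<noteq> {}"
        then obtain z' where "z' \<in> bar (b n) \<inter> ({..<\<infinity>} \<times> ?V)" by blast
        then obtain t' x' where *: "(t', x') \<in> bar (b n)" "t' < \<infinity>" "x' \<in> ?V" by (cases z') blast
        then obtain w where "w \<in> X" "x' = ereal w" by (auto simp: bar_def)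
        then show False using * False by auto
      qed
      with V x(3) show ?thesis
        by (intro exI[of _ "{..<\<infinity>} \<times> ?V"]) (auto simp: tx open_Times)
    qed
  qed
next
  fix z U assume z: "z \<in> bar b'" "open U" "z \<in> U"
  obtain t x where tx: "z = (t, x)" by (cases z)
  have t0: "0 \<le> t" using z(1) by (auto simp: tx bar_def)
  show "\<forall>\<^sub>F n in sequentially. bar (b n) \<inter> U \<noteq> {}"
  proof (cases "x \<le> ereal lo \<or> ereal hi \<le> x \<or> t = \<infinity>")
    case True
    then have "z \<in> bar (b n)" for n using t0 by (auto simp: tx bar_def)
    then show ?thesis using z(3) by (intro always_eventually) blast
  next
    case False
    then obtain y where y: "y \<in> X" "x = ereal y" "b' y \<le> t" using z(1) by (auto simp: tx bar_def)
    have "(\<lambda>n. (max t (b n y), x)) \<longlonglongrightarrow> (max t (b' y), x)"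
      by (intro tendsto_Pair tendsto_max tendsto_const lim y)
    moreover have "max t (b' y) = t" using y(3) by (rule max_absorb1)
    ultimately have "(\<lambda>n. (max t (b n y), x)) \<longlonglongrightarrow> z" by (simp add: tx)
    from topological_tendstoD[OF this z(2,3)] show ?thesis
    proof eventually_elim
      case (elim n)
      moreover have "(max t (b n y), x) \<in> bar (b n)" using y t0 by (auto simp: bar_def le_max_iff_disj)
      ultimately show ?case by blast
    qed
  qed
qed

text \<open>The stopped values converge and lie in the finite set \<open>X\<close>, so they
  eventually equal the limit and the indicators converge.\<close>

lemma mass_tendsto:
  assumes lim: "\<And>x. x \<in> X \<Longrightarrow> (\<lambda>n. b n x) \<longlonglongrightarrow> b' x"
  shows "(\<lambda>n. mass (b n) x) \<longlonglongrightarrow> mass b' x"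
proof -
  have s: "{\<omega>\<in>space M. at_time (hit c) \<omega> = x} \<in> sets M" for c by measurable
  have "AE \<omega> in M. (\<lambda>n. hit (b n) \<omega>) \<longlonglongrightarrow> hit b' \<omega>"
    unfolding hit_def by (rule hitting_time_kconv[OF bar_kconv[OF lim] bar_root bar_root])
  moreover have "AE \<omega> in M. \<forall>n. at_time (hit (b n)) \<omega> \<in> X"
    unfolding AE_all_countable using AE_hit_X by blast
  ultimately have ae: "AE \<omega> in M. (\<lambda>n. indicat_real {\<omega>\<in>space M. at_time (hit (b n)) \<omega> = x} \<omega>) \<longlonglongrightarrow> indicat_real {\<omega>\<in>space M. at_time (hit b') \<omega> = x} \<omega>"
    using hit_finite[of b'] AE_space
  proof eventually_elim
    case (elim \<omega>)
    let ?z = "at_time (hit b') \<omega>"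
    have "(\<lambda>n. at_time (hit (b n)) \<omega>) \<longlonglongrightarrow> ?z"
      by (rule B_hit_tendsto[where \<tau>="\<lambda>n. hit (b n)" and \<tau>'="hit b'", OF elim(4) elim(1,3)]) (rule stop_ext_nonneg[OF hit_stop elim(4)])
    moreover have "open (- (X - {?z}))" using X(1) by (intro open_Compl finite_imp_closed) auto
    ultimately have "\<forall>\<^sub>F n in sequentially. at_time (hit (b n)) \<omega> \<in> - (X - {?z})"
      by (rule topological_tendstoD) simp
    then have "\<forall>\<^sub>F n in sequentially. indicat_real {\<omega>\<in>space M. at_time (hit (b n)) \<omega> = x} \<omega> = indicat_real {\<omega>\<in>space M. at_time (hit b') \<omega> = x} \<omega>"
    proof eventually_elim
      case (elim n)
      then have "at_time (hit (b n)) \<omega> = ?z" using \<open>\<forall>n. at_time (hit (b n)) \<omega> \<in> X\<close> by auto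
      then show ?case by (simp add: indicator_def)
    qed
    then show ?case by (rule tendsto_eventually)
  qed
  have "(\<lambda>n. expectation (indicat_real {\<omega>\<in>space M. at_time (hit (b n)) \<omega> = x})) \<longlonglongrightarrow> expectation (indicat_real {\<omega>\<in>space M. at_time (hit b') \<omega> = x})"
    by (rule integral_dominated_convergence[where w="\<lambda>_. 1", OF _ _ _ ae]) (use s in \<open>auto simp: indicator_def\<close>)
  then show ?thesis using s by (simp add: mass_def)
qed

text \<open>The wanted barrier is the smallest one that does not put too much mass on an interior atom.\<close>
definition sub :: "(real \<Rightarrow> ereal) set" where
  "sub = {b. (\<forall>x. 0 \<le> b x) \<and> (\<forall>x\<in>X - {lo, hi}. mass b x \<le> p x)}"

text \<open>At each atom one of the two barriers supplies the spike; relative to that barrier only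
  other spikes have been lowered, so by \<open>mass_mono\<close> the mass does not increase.\<close>

lemma sub_min:
  assumes "b \<in> sub" "c \<in> sub" shows "(\<lambda>x. min (b x) (c x)) \<in> sub"
  unfolding sub_def
proof (intro CollectI conjI ballI allI)
  fix x assume x: "x \<in> X - {lo, hi}"
  show "mass (\<lambda>x. min (b x) (c x)) x \<le> p x"
  proof (cases "b x \<le> c x")
    case True
    then have "mass (\<lambda>x. min (b x) (c x)) x \<le> mass b x" by (intro mass_mono) (auto simp: min_absorb1)
    also have "\<dots> \<le> p x" using assms(1) x by (auto simp: sub_def)
    finally show ?thesis .
  next
    case False
    then have "mass (\<lambda>x. min (b x) (c x)) x \<le> mass c x" by (intro mass_mono) (auto simp: min_absorb2)
    also have "\<dots> \<le> p x" using assms(2) x by (auto simp: sub_def)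
    finally show ?thesis .
  qed
qed (use assms in \<open>auto simp: sub_def\<close>)

lemma sub_infinity: "(\<lambda>_. \<infinity>) \<in> sub"
  unfolding sub_def
proof (intro CollectI conjI ballI allI)
  fix x assume x: "x \<in> X - {lo, hi}"
  have "mass (\<lambda>_. \<infinity>) x \<le> prob {}"
    unfolding mass_def
  proof (rule finite_measure_mono_AE)
    show "AE \<omega> in M. \<omega> \<in> {\<omega> \<in> space M. at_time (hit (\<lambda>_. \<infinity>)) \<omega> = x} \<longrightarrow> \<omega> \<in> {}"
      using hit_finite[of "\<lambda>_. \<infinity>"] AE_space
    proof eventually_elim
      case (elim \<omega>)
      obtain r where r: "at_time (hit (\<lambda>_. \<infinity>)) \<omega> = B r \<omega>" "B r \<omega> \<in> X" "(ereal r, ereal (B r \<omega>)) \<in> bar (\<lambda>_. \<infinity>)"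
        by (rule hit_attained[OF elim(2,1)])
      then have "B r \<omega> = lo \<or> B r \<omega> = hi" using X(4) by (fastforce simp: bar_def)
      then show ?case using r(1) x by auto
    qed
  qed simp
  also have "\<dots> \<le> p x" using p(1)[of x] x by simp
  finally show "mass (\<lambda>_. \<infinity>) x \<le> p x" .
qed simp

lemma sub_lower:
  assumes "finite Y" "\<And>x. x \<in> Y \<Longrightarrow> g x \<in> sub"
  shows "\<exists>c\<in>sub. \<forall>x\<in>Y. \<forall>y. c y \<le> g x y"
  using assms
proof (induction Y)
  case empty
  then show ?case using sub_infinity by blast
next
  case (insert a Y)
  then obtain c where c: "c \<in> sub" "\<forall>x\<in>Y. \<forall>y. c y \<le> g x y" by auto
  have "(\<lambda>y. min (g a y) (c y)) \<in> sub" using insert.prems c(1) by (intro sub_min) auto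
  then show ?case using c(2) by (intro bexI[of _ "\<lambda>y. min (g a y) (c y)"]) (auto intro: min.coboundedI2)
qed

definition best :: "real \<Rightarrow> ereal" where "best x = Inf {b x | b. b \<in> sub}"

lemma best_le: "b \<in> sub \<Longrightarrow> best x \<le> b x"
  unfolding best_def by (rule Inf_lower) auto

lemma best_nonneg: "0 \<le> best x"
  unfolding best_def by (rule Inf_greatest) (auto simp: sub_def)

text \<open>The infimum is approached at each atom by a sequence of its own. Minima over the
  finitely many atoms give one sequence in \<open>sub\<close> that approaches it at all atoms, and
  \<open>mass_tendsto\<close> carries the constraint to the limit.\<close>

lemma best_sub: "best \<in> sub"
proof -
  have "\<exists>f. (\<forall>n. f n \<in> sub) \<and> (\<lambda>n. f n x) \<longlonglongrightarrow> best x" for x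
  proof -
    have "{b x | b. b \<in> sub} \<noteq> {}" using sub_infinity by auto
    from Inf_countable_INF[OF this] obtain f :: "nat \<Rightarrow> ereal" where f: "decseq f" "range f \<subseteq> {b x | b. b \<in> sub}" "best x = (INF i. f i)"
      unfolding best_def by blast
    have "\<forall>n. \<exists>b. b \<in> sub \<and> f n = b x" using f(2) by blast
    then obtain b where b: "\<And>n. b n \<in> sub" "\<And>n. f n = b n x" by metis
    have "f \<longlonglongrightarrow> best x" unfolding f(3) by (rule LIMSEQ_INF[OF f(1)])
    then have "(\<lambda>n. b n x) \<longlonglongrightarrow> best x" unfolding b(2)[symmetric] .
    with b(1) show ?thesis by blast
  qed
  then obtain f where f: "\<And>x n. f x n \<in> sub" "\<And>x. (\<lambda>n. f x n x) \<longlonglongrightarrow> best x" by metis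
  have "\<forall>n. \<exists>c\<in>sub. \<forall>x\<in>X. \<forall>y. c y \<le> f x n y"
  proof
    fix n
    show "\<exists>c\<in>sub. \<forall>x\<in>X. \<forall>y. c y \<le> f x n y" by (rule sub_lower[OF X(1)]) (rule f(1))
  qed
  then obtain c where c: "\<And>n. c n \<in> sub" "\<And>n x y. x \<in> X \<Longrightarrow> c n y \<le> f x n y" by metis
  have lim: "(\<lambda>n. c n x) \<longlonglongrightarrow> best x" if "x \<in> X" for x
    by (rule tendsto_sandwich[of "\<lambda>_. best x" _ _ "\<lambda>n. f x n x"])
       (use f(2) c best_le that in auto)
  show ?thesis
    unfolding sub_def
  proof (intro CollectI conjI allI ballI best_nonneg)
    fix x assume x: "x \<in> X - {lo, hi}"
    show "mass best x \<le> p x"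
      by (rule LIMSEQ_le_const2[OF mass_tendsto[OF lim]]) (use c(1) x in \<open>auto simp: sub_def\<close>)
  qed
qed

text \<open>If the atom had too little mass, its spike could be lowered slightly: its own mass
  varies continuously and the other masses only decrease, which contradicts minimality.\<close>

lemma best_mass:
  assumes x: "x \<in> X - {lo, hi}" and pos: "0 < best x"
  shows "mass best x = p x"
proof (rule antisym)
  show le: "mass best x \<le> p x" using best_sub x by (auto simp: sub_def)
  show "p x \<le> mass best x"
  proof (rule ccontr)
    assume "\<not> ?thesis"
    then have l: "mass best x < p x" by simp
    obtain u where u: "\<And>n. u n < best x" "u \<longlonglongrightarrow> best x" using approx_from_below_dense_linorder[OF pos] by blast
    define c where "c n = best(x := max 0 (u n))" for n :: nat
    have "(\<lambda>n. max 0 (u n)) \<longlonglongrightarrow> max 0 (best x)" by (intro tendsto_max tendsto_const u)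
    then have "(\<lambda>n. c n y) \<longlonglongrightarrow> best y" for y using pos by (cases "y = x") (auto simp: c_def max_absorb2)
    then have "(\<lambda>n. mass (c n) x) \<longlonglongrightarrow> mass best x" by (intro mass_tendsto)
    from order_tendstoD(2)[OF this l] obtain n where n: "mass (c n) x < p x" by (auto dest: eventually_happens'[OF sequentially_bot])
    have cx: "c n x < best x" using u(1)[of n] pos by (simp add: c_def)
    have "c n \<in> sub"
      unfolding sub_def
    proof (intro CollectI conjI allI ballI)
      show "0 \<le> c n y" for y using best_nonneg[of y] by (simp add: c_def)
      fix y assume y: "y \<in> X - {lo, hi}"
      show "mass (c n) y \<le> p y"
      proof (cases "y = x")
        case False
        have "mass (c n) y \<le> mass best y"
          by (rule mass_mono) (use cx False in \<open>auto simp: c_def\<close>)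
        also have "\<dots> \<le> p y" using best_sub y by (auto simp: sub_def)
        finally show ?thesis .
      qed (use n in simp)
    qed
    from best_le[OF this, of x] cx show False by simp
  qed
qed

lemma mass_outside:
  assumes a: "a < 0" "\<And>u. 0 \<le> u \<Longrightarrow> (ereal u, ereal a) \<in> bar b"
    and c: "0 < c" "\<And>u. 0 \<le> u \<Longrightarrow> (ereal u, ereal c) \<in> bar b" and y: "y < a \<or> c < y"
  shows "mass b y = 0"
proof -
  have "mass b y \<le> prob {}"
    unfolding mass_def
  proof (rule finite_measure_mono_AE)
    show "AE \<omega> in M. \<omega> \<in> {\<omega> \<in> space M. at_time (hit b) \<omega> = y} \<longrightarrow> \<omega> \<in> {}"
      using hit_finite[of b] AE_space
    proof eventually_elim
      case (elim \<omega>)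
      obtain r where r: "hit b \<omega> = ereal r" "0 \<le> r" "at_time (hit b) \<omega> = B r \<omega>"
        by (rule hit_attained[OF elim(2,1)])
      have "a \<le> B r \<omega> \<and> B r \<omega> \<le> c"
        by (rule path_between_absorbing[OF elim(2) r(2) _ a c]) (use r(1) in \<open>auto simp: hit_def\<close>)
      then show ?case using r(3) y by auto
    qed
  qed simp
  then show ?thesis using mass_nonneg[of b y] by simp
qed

text \<open>A spike at 0 starting at time 0 would stop every path at once and put mass 1 there, more
  than \<open>p 0\<close> allows, since \<open>hi\<close> also has positive mass.\<close>

lemma best_zero_pos: assumes "0 \<in> X" shows "0 < best 0"
proof (rule ccontr)
  assume "\<not> 0 < best 0"
  then have b0: "best 0 = 0" using best_nonneg[of 0] by simp
  have h0: "at_time (hit best) \<omega> = 0" if \<omega>: "\<omega> \<in> space M" for \<omega>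
  proof -
    have "(ereal 0, ereal (B 0 \<omega>)) \<in> bar best" using b0 assms B_0[OF \<omega>] by (auto simp: bar_def zero_ereal_def)
    then have "hit best \<omega> \<le> ereal 0" unfolding hit_def by (rule hitting_time_le[OF order_refl])
    then have "hit best \<omega> = 0" using stop_ext_nonneg[OF hit_stop[of best] \<omega>] by (simp add: zero_ereal_def[symmetric])
    then show ?thesis using B_0[OF \<omega>] by simp
  qed
  have "mass best 0 = prob (space M)" unfolding mass_def using h0 by (intro arg_cong[where f=prob]) auto
  moreover have "mass best 0 \<le> p 0" using best_sub assms lohi unfolding sub_def by blast
  ultimately have "1 \<le> p 0" by (simp add: prob_space)
  moreover have "p 0 + p hi \<le> (\<Sum>x\<in>X. p x)"
  proof -
    have "p 0 + p hi = (\<Sum>x\<in>{0, hi}. p x)" using lohi by simp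
    also have "\<dots> \<le> (\<Sum>x\<in>X. p x)" using assms X p(1) by (intro sum_mono2) (auto simp: less_imp_le)
    finally show ?thesis .
  qed
  ultimately show False using p(1)[OF X(3)] p(2) by simp
qed

text \<open>Let a < 0 < c be the nearest atoms absorbing from time 0. Atoms strictly between carry
  the right mass by minimality, atoms beyond carry none. The defect \<delta> has zero sum and zero
  mean; testing it with affine functions that are nonnegative on \<open>X\<close> rules out atoms
  beyond and then fixes the two extreme masses.\<close>

lemma best_mass_eq: "x \<in> X \<Longrightarrow> mass best x = p x"
proof -
  define Z where "Z = {y\<in>X. y = lo \<or> y = hi \<or> best y = 0}"
  have Z: "finite Z" "lo \<in> Z" "hi \<in> Z" "Z \<subseteq> X" using X by (auto simp: Z_def)
  define a where "a = Max {y\<in>Z. y < 0}"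
  define c where "c = Min {y\<in>Z. 0 < y}"
  have a: "a \<in> Z" "a < 0" "\<And>y. y \<in> Z \<Longrightarrow> y < 0 \<Longrightarrow> y \<le> a"
  proof -
    have "a \<in> {y\<in>Z. y < 0}" unfolding a_def using Z lohi by (intro Max_in) auto
    then show "a \<in> Z" "a < 0" by auto
    show "\<And>y. y \<in> Z \<Longrightarrow> y < 0 \<Longrightarrow> y \<le> a" unfolding a_def using Z by (intro Max_ge) auto
  qed
  have c: "c \<in> Z" "0 < c" "\<And>y. y \<in> Z \<Longrightarrow> 0 < y \<Longrightarrow> c \<le> y"
  proof -
    have "c \<in> {y\<in>Z. 0 < y}" unfolding c_def using Z lohi by (intro Min_in) auto
    then show "c \<in> Z" "0 < c" by auto
    show "\<And>y. y \<in> Z \<Longrightarrow> 0 < y \<Longrightarrow> c \<le> y" unfolding c_def using Z by (intro Min_le) auto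
  qed
  have Zbar: "(ereal u, ereal y) \<in> bar best" if "y \<in> Z" "0 \<le> u" for u y
    using that by (auto simp: Z_def bar_def)
  have out: "mass best y = 0" if "y < a \<or> c < y" for y
    by (rule mass_outside[OF a(2) Zbar[OF a(1)] c(2) Zbar[OF c(1)] that])
  have mid: "mass best y = p y" if "y \<in> X" "a < y" "y < c" for y
  proof -
    have "y \<notin> Z"
    proof
      assume "y \<in> Z"
      moreover have "y \<noteq> 0" using best_zero_pos that(1) \<open>y \<in> Z\<close> lohi by (auto simp: Z_def)
      ultimately show False using a(3)[of y] c(3)[of y] that by (cases "y < 0") auto
    qed
    then have "y \<in> X - {lo, hi}" "best y \<noteq> 0" using that(1) by (auto simp: Z_def)
    then show ?thesis using best_nonneg[of y] by (intro best_mass) (auto simp: less_le)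
  qed
  define \<delta> where "\<delta> y = mass best y - p y" for y
  have \<delta>s: "(\<Sum>x\<in>X. \<delta> x) = 0" "(\<Sum>x\<in>X. x * \<delta> x) = 0"
    unfolding \<delta>_def using sum_mass[of best] sum_mean[of best] p by (simp_all add: sum_subtractf right_diff_distrib)
  have \<delta>lin: "(\<Sum>x\<in>X. (k + m * x) * \<delta> x) = 0" for k m
  proof -
    have "(\<Sum>x\<in>X. (k + m * x) * \<delta> x) = k * (\<Sum>x\<in>X. \<delta> x) + m * (\<Sum>x\<in>X. x * \<delta> x)"
      by (simp add: sum_distrib_left distrib_right sum.distrib mult.assoc)
    then show ?thesis using \<delta>s by simp
  qed
  have \<delta>out: "\<delta> y < 0" if "y \<in> X" "y < a \<or> c < y" for y using out[OF that(2)] p(1)[OF that(1)] by (simp add: \<delta>_def)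
  have \<delta>mid: "\<delta> y = 0" if "y \<in> X" "a < y" "y < c" for y using mid[OF that] by (simp add: \<delta>_def)
  have \<delta>in: "\<delta> y \<le> 0" if "y \<in> X - {lo, hi}" for y using best_sub that by (auto simp: sub_def \<delta>_def)
  have neg: False if "\<And>y. y \<in> X \<Longrightarrow> (k + m * y) * \<delta> y \<le> 0" "y0 \<in> X" "(k + m * y0) * \<delta> y0 < 0" for k m y0
  proof -
    have "(\<Sum>x\<in>X. (k + m * x) * \<delta> x) < (\<Sum>x\<in>X. 0)"
      using that X(1) by (intro sum_strict_mono_ex1) auto
    then show False using \<delta>lin by simp
  qed
  have aX: "a \<in> X" "c \<in> X" using a c Z by auto
  have ac: "a < c" using a(2) c(2) by simp
  have alo: "a = lo"
  proof (rule ccontr)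
    assume "a \<noteq> lo"
    then have al: "lo < a" using X(4)[OF aX(1)] by simp
    have da: "\<delta> a \<le> 0" using \<delta>in[of a] aX al a(2) lohi by auto
    have dl: "\<delta> lo < 0" using \<delta>out[of lo] X al by auto
    show False
    proof (cases "c = hi")
      case True
      show False
      \<comment> \<open>The weight c - y vanishes at c, the one atom where \<delta> might be
        positive.\<close>
      proof (rule neg[of c "-1" lo])
        show "(c + - 1 * lo) * \<delta> lo < 0" using dl al ac by (simp add: mult_pos_neg)
        fix y assume y: "y \<in> X"
        have "y \<le> c" using X(4)[OF y] True by simp
        moreover have "\<delta> y \<le> 0 \<or> y = c" using \<delta>out[OF y] \<delta>mid[OF y] da \<open>y \<le> c\<close> by (cases "y < a"; cases "y = a"; cases "y = c") auto
        ultimately show "(c + - 1 * y) * \<delta> y \<le> 0" by (auto simp: mult_nonneg_nonpos)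
      qed (rule X)
    next
      case False
      then have dc: "\<delta> c \<le> 0" using \<delta>in[of c] aX c(2) lohi by auto
      show False
      \<comment> \<open>Both a and c are now interior atoms and obey the upper constraint, so
        \<delta> is nonpositive everywhere and negative at \<open>lo\<close>.\<close>
      proof (rule neg[of 1 0 lo])
        show "(1 + 0 * lo) * \<delta> lo < 0" using dl by simp
        fix y assume y: "y \<in> X"
        show "(1 + 0 * y) * \<delta> y \<le> 0"
          using \<delta>out[OF y] \<delta>mid[OF y] da dc by (cases "y < a"; cases "y = a"; cases "y = c"; cases "c < y") auto
      qed (rule X)
    qed
  qed
  have chi: "c = hi"
  proof (rule ccontr)
    assume "c \<noteq> hi"
    then have ch: "c < hi" using X(4)[OF aX(2)] by simp
    have dc: "\<delta> c \<le> 0" using \<delta>in[of c] aX ch c(2) lohi by auto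
    have dh: "\<delta> hi < 0" using \<delta>out[of hi] X ch by auto
    show False
    \<comment> \<open>As a = lo, the weight y - a is nonnegative on \<open>X\<close>, and it
      vanishes where \<delta> might be positive.\<close>
    proof (rule neg[of "-a" 1 hi])
      show "(- a + 1 * hi) * \<delta> hi < 0" using dh ac ch by (simp add: mult_pos_neg)
      fix y assume y: "y \<in> X"
      have "a \<le> y" using X(4)[OF y] alo by simp
      moreover have "\<delta> y \<le> 0 \<or> y = a" using \<delta>out[OF y] \<delta>mid[OF y] dc \<open>a \<le> y\<close> by (cases "y = a"; cases "y = c"; cases "c < y") auto
      ultimately show "(- a + 1 * y) * \<delta> y \<le> 0" by (auto simp: mult_nonneg_nonpos)
    qed (rule X)
  qed
  have lh: "lo < hi" using lohi by simp
  have ends: "\<delta> lo = 0 \<and> \<delta> hi = 0"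
  proof -
    \<comment> \<open>Only the two extreme atoms remain; the weights hi - x and x - lo isolate
      them.\<close>
    have e: "(\<Sum>x\<in>X. (k + m * x) * \<delta> x) = (k + m * lo) * \<delta> lo + (k + m * hi) * \<delta> hi" for k m
    proof -
      have "(\<Sum>x\<in>X. (k + m * x) * \<delta> x) = (\<Sum>x\<in>{lo, hi}. (k + m * x) * \<delta> x)"
        using X \<delta>mid alo chi by (intro sum.mono_neutral_right) (force simp: less_le)+
      then show ?thesis using lh by simp
    qed
    have "(hi - lo) * \<delta> lo = 0" using e[of hi "-1"] \<delta>lin[of hi "-1"] by simp
    moreover have "(hi - lo) * \<delta> hi = 0" using e[of "-lo" 1] \<delta>lin[of "-lo" 1] by simp
    ultimately show ?thesis using lh by simp
  qed
  assume x: "x \<in> X"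
  show "mass best x = p x"
  proof (cases "x = lo \<or> x = hi")
    case True
    then show ?thesis using ends by (auto simp: \<delta>_def)
  next
    case False
    then show ?thesis using mid[OF x] X(4)[OF x] alo chi by simp
  qed
qed

end

section \<open>Existence for integrable laws\<close>

text \<open>\<open>Q\<close> gives \<open>X\<close> full mass, and so does \<open>P\<close> because
  the point masses agree; both measures are then determined by the points of
  \<open>X\<close>.\<close>

lemma finite_law_eqI:
  fixes P Q :: "real measure"
  assumes "prob_space P" "prob_space Q" and sets: "sets P = sets borel" "sets Q = sets borel"
    and X: "finite X" "\<And>x. x \<in> X \<Longrightarrow> measure P {x} = measure Q {x}" "(\<Sum>x\<in>X. measure Q {x}) = 1"
  shows "P = Q"
proof -
  interpret P: prob_space P by fact
  interpret Q: prob_space Q by fact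
  have *: "measure N C = (\<Sum>x\<in>X \<inter> C. measure N {x})"
    if N: "prob_space N" "sets N = sets borel" "(\<Sum>x\<in>X. measure N {x}) = 1" and C: "C \<in> sets borel" for N :: "real measure" and C
  proof -
    interpret N: prob_space N by fact
    have s: "A \<in> sets borel \<Longrightarrow> A \<in> sets N" for A by (simp add: N(2))
    have Xs: "X \<in> sets borel" "X \<inter> C \<in> sets borel" using X(1) C by (auto intro: finite_imp_closed borel_closed)
    have fs: "measure N Y = (\<Sum>x\<in>Y. measure N {x})" if "finite Y" for Y
      using that s by (intro N.finite_measure_eq_sum_singleton) auto
    have sp: "space N = UNIV" using sets_eq_imp_space_eq[OF N(2)] by simp
    have "measure N (C - X) \<le> measure N (space N - X)"
      unfolding sp using Xs C s by (intro N.finite_measure_mono) auto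
    also have "\<dots> = 0" using N.prob_compl[OF s[OF Xs(1)]] fs[OF X(1)] N(3) by simp
    finally have "measure N (C - X) = 0" by (simp add: measure_le_0_iff)
    moreover have "measure N C = measure N (X \<inter> C) + measure N (C - X)"
    proof -
      have "C = (X \<inter> C) \<union> (C - X)" by auto
      then show ?thesis using N.finite_measure_Union[of "X \<inter> C" "C - X"] Xs C s by (metis Diff_disjoint Int_Diff inf_commute sets.Diff)
    qed
    ultimately show ?thesis using fs[of "X \<inter> C"] X(1) by simp
  qed
  show ?thesis
  proof (rule measure_eqI)
    fix C assume "C \<in> sets P"
    then have C: "C \<in> sets borel" using sets by simp
    have "measure P C = (\<Sum>x\<in>X \<inter> C. measure P {x})" by (rule *[OF assms(1) sets(1) _ C]) (use X in simp)
    also have "\<dots> = (\<Sum>x\<in>X \<inter> C. measure Q {x})" by (rule sum.cong) (use X in auto)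
    also have "\<dots> = measure Q C" by (rule *[OF assms(2) sets(2) X(3) C, symmetric])
    finally show "emeasure P C = emeasure Q C" by (simp add: P.emeasure_eq_measure Q.emeasure_eq_measure)
  qed (simp add: sets)
qed

section \<open>Discretising an integrable law by conditional means\<close>

locale integrable_law = prob_space \<mu> for \<mu> :: "real measure" +
  assumes sets_law[measurable_cong]: "sets \<mu> = sets borel" and integrable_law: "integrable \<mu> (\<lambda>y. y)"
begin

text \<open>The conditional mean on the cell {k = j}; for a null cell division by 0 gives the
  default value 0.\<close>

definition barycentre :: "(real \<Rightarrow> int) \<Rightarrow> int \<Rightarrow> real" where
  "barycentre k j = (\<integral>y. indicator {y. k y = j} y * y \<partial>\<mu>) / measure \<mu> {y. k y = j}"

lemma space_law: "space \<mu> = UNIV"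
  using sets_eq_imp_space_eq[OF sets_law] by simp

lemma cell_sets:
  assumes "k \<in> measurable borel (count_space UNIV)" shows "{y. k y = (j::int)} \<in> sets \<mu>"
proof -
  have "k -` {j} \<inter> space borel \<in> sets borel" by (rule measurable_sets[OF assms]) simp
  then show ?thesis by (simp add: sets_law vimage_def)
qed

lemma integrable_cell: "k \<in> measurable borel (count_space UNIV) \<Longrightarrow> integrable \<mu> (\<lambda>y. indicator {y. k y = (j::int)} y * y)"
  using integrable_mult_indicator[OF cell_sets integrable_law] by simp

lemma cell_mean:
  assumes k: "k \<in> measurable borel (count_space UNIV)"
  shows "integrable \<mu> (\<lambda>y. indicator {y. k y = j} y * (y - barycentre k j))"
    and "(\<integral>y. indicator {y. k y = j} y * (y - barycentre k j) \<partial>\<mu>) = 0"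
proof -
  note c = cell_sets[OF k, of j] and i = integrable_cell[OF k, of j]
  have ii: "integrable \<mu> (\<lambda>y. indicator {y. k y = j} y * barycentre k j)"
    using c by (intro integrable_mult_left integrable_real_indicator) (simp_all add: emeasure_eq_measure)
  show "integrable \<mu> (\<lambda>y. indicator {y. k y = j} y * (y - barycentre k j))"
    using i ii by (simp add: right_diff_distrib)
  have "(\<integral>y. indicator {y. k y = j} y * (y - barycentre k j) \<partial>\<mu>)
      = (\<integral>y. indicator {y. k y = j} y * y \<partial>\<mu>) - measure \<mu> {y. k y = j} * barycentre k j"
    using i ii c by (simp add: right_diff_distrib)
  also have "\<dots> = 0"
  proof (cases "measure \<mu> {y. k y = j} = 0")
    case True
    then have "{y. k y = j} \<in> null_sets \<mu>" using c by (auto simp: null_sets_def emeasure_eq_measure)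
    then have "AE y in \<mu>. indicator {y. k y = j} y * y = 0"
      by (rule AE_mp[OF AE_not_in]) (auto simp: indicator_def)
    then have "(\<integral>y. indicator {y. k y = j} y * y \<partial>\<mu>) = 0" by (rule integral_eq_zero_AE)
    then show ?thesis using True by simp
  qed (simp add: barycentre_def)
  finally show "(\<integral>y. indicator {y. k y = j} y * (y - barycentre k j) \<partial>\<mu>) = 0" .
qed

text \<open>The deviation from the cell mean integrates to zero over each cell, so it is orthogonal
  to every function of the cell index. The tangent slopes in \<open>barycentre_hyp_le\<close> are
  such functions.\<close>

lemma barycentre_orthogonal:
  assumes k: "k \<in> measurable borel (count_space UNIV)" and J: "finite J" "\<And>y. k y \<in> J"
  shows "integrable \<mu> (\<lambda>y. \<psi> (k y) * (y - barycentre k (k y)))"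
    and "(\<integral>y. \<psi> (k y) * (y - barycentre k (k y)) \<partial>\<mu>) = 0"
proof -
  have eq: "\<psi> (k y) * (y - barycentre k (k y)) = (\<Sum>j\<in>J. \<psi> j * (indicator {y. k y = j} y * (y - barycentre k j)))" for y
  proof -
    have "(\<Sum>j\<in>J. \<psi> j * (indicator {y. k y = j} y * (y - barycentre k j))) = (\<Sum>j\<in>J. if j = k y then \<psi> j * (y - barycentre k j) else 0)"
      by (intro sum.cong) (auto simp: indicator_def)
    then show ?thesis using J by simp
  qed
  show "integrable \<mu> (\<lambda>y. \<psi> (k y) * (y - barycentre k (k y)))"
    unfolding eq by (intro Bochner_Integration.integrable_sum integrable_mult_right cell_mean[OF k])
  show "(\<integral>y. \<psi> (k y) * (y - barycentre k (k y)) \<partial>\<mu>) = 0"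
    unfolding eq by (subst Bochner_Integration.integral_sum) (auto intro!: integrable_mult_right cell_mean[OF k] sum.neutral simp: cell_mean[OF k])
qed

lemma barycentre_measurable:
  assumes k: "k \<in> measurable borel (count_space UNIV)"
  shows "(\<lambda>y. barycentre k (k y)) \<in> borel_measurable borel"
  by (rule measurable_compose[OF k]) simp

lemma barycentre_mean:
  assumes k: "k \<in> measurable borel (count_space UNIV)" and J: "finite J" "\<And>y. k y \<in> J"
  shows "integrable \<mu> (\<lambda>y. barycentre k (k y))" and "(\<integral>y. barycentre k (k y) \<partial>\<mu>) = (\<integral>y. y \<partial>\<mu>)"
proof -
  note o = barycentre_orthogonal[OF k J, of "\<lambda>_. 1"]
  have "integrable \<mu> (\<lambda>y. y - (1 * (y - barycentre k (k y))))" using integrable_law o(1) by (rule Bochner_Integration.integrable_diff)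
  then show i: "integrable \<mu> (\<lambda>y. barycentre k (k y))" by simp
  have "(\<integral>y. y - barycentre k (k y) \<partial>\<mu>) = 0" using o(2) by simp
  then show "(\<integral>y. barycentre k (k y) \<partial>\<mu>) = (\<integral>y. y \<partial>\<mu>)"
    using i integrable_law by (subst (asm) Bochner_Integration.integral_diff) auto
qed

lemma integrable_hyp_law: "0 < K \<Longrightarrow> integrable \<mu> f \<Longrightarrow> integrable \<mu> (\<lambda>y. hyp K (f y))"
  by (rule Bochner_Integration.integrable_bound[of \<mu> f]) (auto simp: hyp_nonneg hyp_le_abs)

text \<open>Jensen's inequality for the conditional expectation, from the tangent line at the
  barycentre.\<close>

lemma barycentre_hyp_le:
  assumes k: "k \<in> measurable borel (count_space UNIV)" and J: "finite J" "\<And>y. k y \<in> J" and K: "0 < K"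
  shows "(\<integral>y. hyp K (barycentre k (k y)) \<partial>\<mu>) \<le> (\<integral>y. hyp K y \<partial>\<mu>)"
proof -
  note o = barycentre_orthogonal[OF k J, of "\<lambda>j. dhyp K (barycentre k j)"]
  note i = integrable_hyp_law[OF K barycentre_mean(1)[OF k J]] integrable_hyp_law[OF K integrable_law]
  have "(\<integral>y. hyp K (barycentre k (k y)) \<partial>\<mu>) = (\<integral>y. hyp K (barycentre k (k y)) + dhyp K (barycentre k (k y)) * (y - barycentre k (k y)) \<partial>\<mu>)"
    using i o by simp
  also have "\<dots> \<le> (\<integral>y. hyp K y \<partial>\<mu>)"
    by (rule integral_mono) (use i o hyp_convex(2)[OF K] in auto)
  finally show ?thesis .
qed

lemma barycentre_between:
  assumes k: "k \<in> measurable borel (count_space UNIV)" and pos: "0 < measure \<mu> {y. k y = j}"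
    and uv: "\<And>y. k y = j \<Longrightarrow> u \<le> y \<and> y \<le> v"
  shows "u \<le> barycentre k j \<and> barycentre k j \<le> v"
proof -
  note c = cell_sets[OF k, of j] and i = integrable_cell[OF k, of j]
  have ii: "integrable \<mu> (\<lambda>y. indicator {y. k y = j} y * (w::real))" for w
    using c by (intro integrable_mult_left integrable_real_indicator) (simp_all add: emeasure_eq_measure)
  have "(\<integral>y. indicator {y. k y = j} y * u \<partial>\<mu>) \<le> (\<integral>y. indicator {y. k y = j} y * y \<partial>\<mu>)"
    by (rule integral_mono[OF ii i]) (use uv in \<open>auto simp: indicator_def\<close>)
  then have 1: "u * measure \<mu> {y. k y = j} \<le> (\<integral>y. indicator {y. k y = j} y * y \<partial>\<mu>)" using c by (simp add: mult.commute)
  have "(\<integral>y. indicator {y. k y = j} y * y \<partial>\<mu>) \<le> (\<integral>y. indicator {y. k y = j} y * v \<partial>\<mu>)"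
    by (rule integral_mono[OF i ii]) (use uv in \<open>auto simp: indicator_def\<close>)
  then have 2: "(\<integral>y. indicator {y. k y = j} y * y \<partial>\<mu>) \<le> v * measure \<mu> {y. k y = j}" using c by (simp add: mult.commute)
  show ?thesis using 1 2 pos by (simp add: barycentre_def pos_le_divide_eq pos_divide_le_eq)
qed

text \<open>Dyadic intervals of length 2^-n; clamping merges everything far out into two end cells,
  so that only finitely many cells remain.\<close>

definition cell :: "nat \<Rightarrow> real \<Rightarrow> int" where
  "cell n y = max (- (int n * 2 ^ n)) (min (int n * 2 ^ n) \<lfloor>2 ^ n * y\<rfloor>)"

lemma cell_measurable[measurable]: "cell n \<in> measurable borel (count_space UNIV)"
  unfolding cell_def[abs_def] by measurable

lemma cell_range: "cell n y \<in> {- (int n * 2 ^ n)..int n * 2 ^ n}"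
  by (auto simp: cell_def)

text \<open>The bound on |y| keeps y out of the end cells, whose barycentres need not be close to
  their points.\<close>

lemma cell_approx:
  assumes "\<bar>y\<bar> + 1 < real n" and pos: "0 < measure \<mu> {z. cell n z = cell n y}"
  shows "\<bar>barycentre (cell n) (cell n y) - y\<bar> \<le> 1 / 2 ^ n"
proof -
  let ?N = "int n * 2 ^ n" and ?j = "\<lfloor>2 ^ n * y\<rfloor>"
  have p: "1 \<le> (2::real) ^ n" by simp
  have "2 ^ n * \<bar>y\<bar> < 2 ^ n * (real n - 1)" using assms(1) by (intro mult_strict_left_mono) auto
  also have "2 ^ n * (real n - 1) = real n * 2 ^ n - 2 ^ n" by (simp add: algebra_simps)
  also have "2 ^ n * \<bar>y\<bar> = \<bar>2 ^ n * y\<bar>" by (simp add: abs_mult)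
  finally have b: "2 ^ n * y < real n * 2 ^ n - 1" "- (real n * 2 ^ n) + 1 < 2 ^ n * y"
    using p by linarith+
  have rN: "real_of_int ?N = real n * 2 ^ n" by simp
  have j: "- ?N < ?j" "?j < ?N"
    using b unfolding less_floor_iff floor_less_iff of_int_minus rN by linarith+
  have cy: "cell n y = ?j" using j by (simp add: cell_def)
  have "?j / 2 ^ n \<le> z \<and> z \<le> (?j + 1) / 2 ^ n" if "cell n z = cell n y" for z
  proof -
    have "\<lfloor>2 ^ n * z\<rfloor> = ?j" using that j unfolding cy by (auto simp: cell_def max_def min_def split: if_splits)
    then have "real_of_int ?j \<le> 2 ^ n * z" "2 ^ n * z \<le> real_of_int ?j + 1" by linarith+
    then show ?thesis by (simp add: divide_le_eq le_divide_eq mult.commute)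
  qed
  from barycentre_between[OF cell_measurable pos this]
  have "?j / 2 ^ n \<le> barycentre (cell n) (cell n y)" "barycentre (cell n) (cell n y) \<le> (?j + 1) / 2 ^ n" by auto
  moreover have "?j / 2 ^ n \<le> y" "y \<le> (?j + 1) / 2 ^ n"
  proof -
    have "real_of_int ?j \<le> 2 ^ n * y" "2 ^ n * y \<le> real_of_int ?j + 1" by linarith+
    then show "?j / 2 ^ n \<le> y" "y \<le> (?j + 1) / 2 ^ n" by (simp_all add: divide_le_eq le_divide_eq mult.commute)
  qed
  moreover have "(?j + 1) / 2 ^ n = ?j / 2 ^ n + 1 / 2 ^ n" by (simp add: add_divide_distrib)
  ultimately show ?thesis by linarith
qed

text \<open>For each n only finitely many cells can be null, and their points can be discarded
  together.\<close>

lemma AE_cell_pos: "AE y in \<mu>. \<forall>n. 0 < measure \<mu> {z. cell n z = cell n y}"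
  unfolding AE_all_countable
proof
  fix n
  have "AE y in \<mu>. \<forall>j\<in>{- (int n * 2 ^ n)..int n * 2 ^ n}. measure \<mu> {z. cell n z = j} = 0 \<longrightarrow> cell n y \<noteq> j"
  proof (rule AE_finite_allI)
    fix j
    show "AE y in \<mu>. measure \<mu> {z. cell n z = j} = 0 \<longrightarrow> cell n y \<noteq> j"
    proof (cases "measure \<mu> {z. cell n z = j} = 0")
      case True
      then have "{z. cell n z = j} \<in> null_sets \<mu>"
        using cell_sets[OF cell_measurable] by (auto simp: null_sets_def emeasure_eq_measure)
      from AE_not_in[OF this] show ?thesis by eventually_elim simp
    qed simp
  qed simp
  then show "AE y in \<mu>. 0 < measure \<mu> {z. cell n z = cell n y}"
  proof eventually_elim
    case (elim y)
    then have "measure \<mu> {z. cell n z = cell n y} \<noteq> 0" using cell_range[of n y] by blast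
    then show ?case using measure_nonneg[of \<mu> "{z. cell n z = cell n y}"] by linarith
  qed
qed

lemma AE_barycentre_tendsto: "AE y in \<mu>. (\<lambda>n. barycentre (cell n) (cell n y)) \<longlonglongrightarrow> y"
  using AE_cell_pos
proof eventually_elim
  case (elim y)
  have "(\<lambda>n. barycentre (cell n) (cell n y) - y) \<longlonglongrightarrow> 0"
  proof (rule Lim_null_comparison)
    have "\<forall>\<^sub>F n in sequentially. \<bar>y\<bar> + 1 < real n"
      using filterlim_real_sequentially unfolding filterlim_at_top_dense by blast
    then show "\<forall>\<^sub>F n in sequentially. norm (barycentre (cell n) (cell n y) - y) \<le> 1 / 2 ^ n"
    proof eventually_elim
      case (elim n)
      from cell_approx[OF elim] \<open>\<forall>n. 0 < measure \<mu> {z. cell n z = cell n y}\<close> show ?case by simp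
    qed
    show "(\<lambda>n. 1 / 2 ^ n :: real) \<longlonglongrightarrow> 0" using LIMSEQ_divide_realpow_zero[of 2 1] by simp
  qed
  then show ?case by (simp add: LIM_zero_iff)
qed

text \<open>Integrability in the form needed for tails: through \<open>abs_tail_le_hyp\<close>, a
  small integral of \<open>hyp K\<close> becomes uniform integrability of the stopped path.\<close>

lemma hyp_law_tendsto_0: "(\<lambda>n. \<integral>y. hyp (real (Suc n)) y \<partial>\<mu>) \<longlonglongrightarrow> 0"
proof -
  have "(\<lambda>n. \<integral>y. hyp (real (Suc n)) y \<partial>\<mu>) \<longlonglongrightarrow> (\<integral>y. 0 \<partial>\<mu>)"
  proof (rule integral_dominated_convergence[where w="\<lambda>y. \<bar>y\<bar>"])
    show "AE y in \<mu>. norm (hyp (real (Suc n)) y) \<le> \<bar>y\<bar>" for n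
    proof (rule AE_I2)
      fix y
      have "0 < real (Suc n)" by simp
      from hyp_nonneg[OF this] hyp_le_abs[OF this] show "norm (hyp (real (Suc n)) y) \<le> \<bar>y\<bar>"
        by (simp only: real_norm_def abs_of_nonneg)
    qed
    show "AE y in \<mu>. (\<lambda>n. hyp (real (Suc n)) y) \<longlonglongrightarrow> 0" by (rule AE_I2) (rule hyp_tendsto_0)
    show "integrable \<mu> (\<lambda>y. \<bar>y\<bar>)" using integrable_law by simp
    show "(\<lambda>y. hyp (real (Suc n)) y) \<in> borel_measurable \<mu>" for n by measurable
  qed simp
  then show ?thesis by simp
qed

end

section \<open>From finite laws to integrable laws\<close>

context brownian begin

lemma unif_integrable_bounded:
  assumes \<tau>: "stop_ext \<tau>" and b: "\<And>t \<omega>. 0 \<le> t \<Longrightarrow> \<omega> \<in> space M \<Longrightarrow> \<bar>B (trunc \<tau> t \<omega>) \<omega>\<bar> \<le> L"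
  shows "unif_integrable M (\<lambda>t \<omega>. B (trunc \<tau> t \<omega>) \<omega>)"
  unfolding unif_integrable_def
proof (intro conjI allI impI exI[of _ L])
  fix e t :: real assume "0 < e" "0 \<le> t"
  have "(\<integral>\<omega>. \<bar>B (trunc \<tau> t \<omega>) \<omega>\<bar> * indicator {\<omega>. L < \<bar>B (trunc \<tau> t \<omega>) \<omega>\<bar>} \<omega> \<partial>M) = (\<integral>\<omega>. 0 \<partial>M)"
    using b[OF \<open>0 \<le> t\<close>] by (intro Bochner_Integration.integral_cong) (auto simp: indicator_def not_less[symmetric])
  then show "(\<integral>\<omega>. \<bar>B (trunc \<tau> t \<omega>) \<omega>\<bar> * indicator {\<omega>. L < \<bar>B (trunc \<tau> t \<omega>) \<omega>\<bar>} \<omega> \<partial>M) < e"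
    using \<open>0 < e\<close> by simp
qed (rule integrable_trunc[OF \<tau>])

lemma hitting_everything: "\<omega> \<in> space M \<Longrightarrow> hitting_time B ({0..} \<times> UNIV) \<omega> = 0"
  using hitting_time_le[of 0 B \<omega> "{0..} \<times> UNIV"] hitting_time_nonneg[of B "{0..} \<times> UNIV" \<omega>]
  by (auto simp: zero_ereal_def[symmetric])

text \<open>The bound on \<open>hyp K\<close> refers to \<mu> itself and not to its discretisation:
  it comes from Jensen's inequality, is uniform in the choice of cells and therefore survives the
  limit in \<open>root_barrier_exists\<close>.\<close>

lemma root_barrier_finite_range:
  assumes "integrable_law \<mu>" and mean: "(\<integral>y. y \<partial>\<mu>) = 0"
    and k: "k \<in> measurable borel (count_space UNIV)" and J: "finite (J :: int set)" "\<And>y. k y \<in> J"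
  defines "g \<equiv> \<lambda>y. integrable_law.barycentre \<mu> k (k y)"
  shows "\<exists>R. root_barrier R \<and> (AE \<omega> in M. hitting_time B R \<omega> < \<infinity>) \<and>
    distr M borel (at_time (hitting_time B R)) = distr \<mu> borel g \<and>
    (\<forall>K>0. \<forall>t\<ge>0. expectation (\<lambda>\<omega>. hyp K (B (trunc (hitting_time B R) t \<omega>) \<omega>)) \<le> (\<integral>y. hyp K y \<partial>\<mu>))"
proof -
  interpret L: integrable_law \<mu> by fact
  have g[measurable]: "g \<in> borel_measurable borel" unfolding g_def by (rule L.barycentre_measurable[OF k])
  have g\<mu>[measurable]: "g \<in> borel_measurable \<mu>" using g by (simp add: measurable_cong_sets[OF L.sets_law refl])
  have gi: "integrable \<mu> g" "(\<integral>y. g y \<partial>\<mu>) = 0"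
    unfolding g_def using L.barycentre_mean[OF k J] mean by auto
  define p where "p x = measure \<mu> {y. g y = x}" for x
  have ps: "{y. g y = x} \<in> sets \<mu>" for x
  proof -
    have "{y\<in>space \<mu>. g y = x} \<in> sets \<mu>" by measurable
    then show ?thesis by (simp add: L.space_law)
  qed
  define G where "G = L.barycentre k ` J"
  have G: "finite G" "\<And>y. g y \<in> G" using J by (auto simp: G_def g_def)
  \<comment> \<open>Values taken with probability 0 are dropped, as \<open>brownian_finite\<close>
    asks for positive masses.\<close>
  define X where "X = {x\<in>G. 0 < p x}"
  have Xf: "finite X" using G by (simp add: X_def)
  have sumG: "(\<integral>y. f (g y) \<partial>\<mu>) = (\<Sum>x\<in>X. f x * p x)" for f :: "real \<Rightarrow> real"
  proof -
    have "f (g y) = (\<Sum>x\<in>G. f x * indicator {y. g y = x} y)" for y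
    proof -
      have "(\<Sum>x\<in>G. f x * indicator {y. g y = x} y) = (\<Sum>x\<in>G. if x = g y then f x else 0)"
        by (intro sum.cong) (auto simp: indicator_def)
      then show ?thesis using G by simp
    qed
    then have "(\<integral>y. f (g y) \<partial>\<mu>) = (\<integral>y. (\<Sum>x\<in>G. f x * indicator {y. g y = x} y) \<partial>\<mu>)" by simp
    also have "\<dots> = (\<Sum>x\<in>G. f x * p x)"
      using ps by (subst Bochner_Integration.integral_sum)
        (auto simp: p_def L.emeasure_eq_measure intro!: integrable_mult_right integrable_real_indicator)
    also have "\<dots> = (\<Sum>x\<in>X. f x * p x)"
      using G(1) by (intro sum.mono_neutral_right) (auto simp: X_def p_def not_less measure_le_0_iff)
    finally show ?thesis .
  qed
  have sum1: "(\<Sum>x\<in>X. p x) = 1" using sumG[of "\<lambda>_. 1"] by (simp add: L.prob_space)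
  have sum0: "(\<Sum>x\<in>X. x * p x) = 0" using sumG[of "\<lambda>x. x"] gi by simp
  have ppos: "\<And>x. x \<in> X \<Longrightarrow> 0 < p x" by (simp add: X_def)
  have Xne: "X \<noteq> {}" using sum1 by auto
  interpret GP: prob_space "distr \<mu> borel g" by (rule L.prob_space_distr) simp
  have law: "distr M borel (at_time \<tau>) = distr \<mu> borel g"
    if \<tau>: "stop_ext \<tau>" and m: "\<And>x. x \<in> X \<Longrightarrow> prob {\<omega>\<in>space M. at_time \<tau> \<omega> = x} = p x" for \<tau>
  proof (rule finite_law_eqI[OF _ GP.prob_space_axioms])
    note [measurable] = at_time_measurable[OF \<tau>]
    show "prob_space (distr M borel (at_time \<tau>))" by (rule prob_space_distr) simp
    have gx: "measure (distr \<mu> borel g) {x} = p x" for x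
      by (subst measure_distr) (auto simp: p_def L.space_law vimage_def)
    show "measure (distr M borel (at_time \<tau>)) {x} = measure (distr \<mu> borel g) {x}" if "x \<in> X" for x
      unfolding gx m[OF that, symmetric] by (subst measure_distr) (auto intro!: arg_cong[where f=prob])
    show "(\<Sum>x\<in>X. measure (distr \<mu> borel g) {x}) = 1" unfolding gx by (rule sum1)
  qed (auto simp: Xf)
  have hypb: "expectation (\<lambda>\<omega>. hyp K (B (trunc \<tau> t \<omega>) \<omega>)) \<le> (\<integral>y. hyp K y \<partial>\<mu>)"
    if \<tau>: "stop_ext \<tau>" "AE \<omega> in M. \<tau> \<omega> < \<infinity>" and m: "distr M borel (at_time \<tau>) = distr \<mu> borel g"
      and b: "\<And>t \<omega>. 0 \<le> t \<Longrightarrow> \<omega> \<in> space M \<Longrightarrow> \<bar>B (trunc \<tau> t \<omega>) \<omega>\<bar> \<le> C" and K: "0 < K" and t: "0 \<le> t" for \<tau> C K t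
  proof -
    have "integrable (distr \<mu> borel g) (\<lambda>x. x)" using gi by (subst integrable_distr_eq) auto
    then have i: "integrable M (at_time \<tau>)" by (rule integrable_at_time[OF \<tau>(1) m])
    have "expectation (\<lambda>\<omega>. hyp K (B (trunc \<tau> t \<omega>) \<omega>)) \<le> expectation (\<lambda>\<omega>. hyp K (at_time \<tau> \<omega>))"
      by (rule hyp_trunc_le[OF \<tau> unif_integrable_bounded[OF \<tau>(1) b] i K t])
    also have "\<dots> = (\<integral>x. hyp K x \<partial>distr M borel (at_time \<tau>))"
      by (rule integral_distr[symmetric]) (auto intro: at_time_measurable \<tau>)
    also have "\<dots> = (\<integral>y. hyp K (g y) \<partial>\<mu>)" unfolding m by (rule integral_distr) auto
    also have "\<dots> \<le> (\<integral>y. hyp K y \<partial>\<mu>)" unfolding g_def by (rule L.barycentre_hyp_le[OF k J K])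
    finally show ?thesis .
  qed
  show ?thesis
  \<comment> \<open>A point mass at 0 has no atoms on the two sides of 0; it is embedded by stopping
    at once.\<close>
  proof (cases "X = {0}")
    case True
    let ?R = "{0..} \<times> UNIV :: (ereal \<times> ereal) set"
    have R: "root_barrier ?R" unfolding root_barrier_def by (auto intro: closed_Times)
    note st = stop_ext_hitting[OF root_closed[OF R]]
    have fin: "AE \<omega> in M. hitting_time B ?R \<omega> < \<infinity>" by (intro AE_I2) (simp add: hitting_everything)
    have at: "at_time (hitting_time B ?R) \<omega> = 0" if "\<omega> \<in> space M" for \<omega>
      using hitting_everything[OF that] B_0[OF that] by simp
    have l: "distr M borel (at_time (hitting_time B ?R)) = distr \<mu> borel g"
    proof (rule law[OF st])
      fix x assume "x \<in> X"
      then have x: "x = 0" using True by simp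
      have "{\<omega> \<in> space M. at_time (hitting_time B ?R) \<omega> = x} = space M" using at x by auto
      then show "prob {\<omega> \<in> space M. at_time (hitting_time B ?R) \<omega> = x} = p x"
        using sum1 True x by (simp add: prob_space)
    qed
    have b: "\<bar>B (trunc (hitting_time B ?R) t \<omega>) \<omega>\<bar> \<le> 0" if "0 \<le> t" "\<omega> \<in> space M" for t \<omega>
      using hitting_everything[OF that(2)] B_0[OF that(2)] that(1) by (simp add: min_def)
    show ?thesis using R fin l hypb[OF st fin l b] by blast
  next
    case False
    define lo where "lo = Min X"
    define hi where "hi = Max X"
    have lh: "lo \<in> X" "hi \<in> X" "\<And>x. x \<in> X \<Longrightarrow> lo \<le> x \<and> x \<le> hi"
      using Xf Xne by (auto simp: lo_def hi_def)
    obtain x0 where x0: "x0 \<in> X" "x0 \<noteq> 0" using False Xne by auto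
    have lo: "lo < 0"
    proof (rule ccontr)
      assume "\<not> lo < 0"
      then have nn: "x \<in> X \<Longrightarrow> 0 \<le> x" for x using lh(3)[of x] by auto
      have "0 < (\<Sum>x\<in>X. x * p x)"
      proof (rule sum_pos2[OF Xf x0(1)])
        show "0 < x0 * p x0" using nn[OF x0(1)] x0 ppos[OF x0(1)] by simp
        show "0 \<le> x * p x" if "x \<in> X" for x using nn[OF that] ppos[OF that] by simp
      qed
      then show False using sum0 by simp
    qed
    have hi: "0 < hi"
    proof (rule ccontr)
      assume "\<not> 0 < hi"
      then have nn: "x \<in> X \<Longrightarrow> x \<le> 0" for x using lh(3)[of x] by auto
      have "0 < (\<Sum>x\<in>X. - (x * p x))"
      proof (rule sum_pos2[OF Xf x0(1)])
        show "0 < - (x0 * p x0)" using nn[OF x0(1)] x0 ppos[OF x0(1)] by (simp add: mult_less_0_iff)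
        show "0 \<le> - (x * p x)" if "x \<in> X" for x
          using nn[OF that] ppos[OF that] by (simp add: mult_nonpos_nonneg)
      qed
      then show False using sum0 by (simp add: sum_negf)
    qed
    interpret D: brownian_finite M F B X p lo hi
      by unfold_locales (use Xf lh lo hi ppos sum1 sum0 in auto)
    have l: "distr M borel (at_time (D.hit D.best)) = distr \<mu> borel g"
      by (rule law[OF D.hit_stop]) (use D.best_mass_eq in \<open>simp add: D.mass_def\<close>)
    show ?thesis
      using D.bar_root[of D.best] D.hit_finite[of D.best] l
        hypb[OF D.hit_stop D.hit_finite l D.trunc_hit_bounded] unfolding D.hit_def by blast
  qed
qed

text \<open>Barriers for the discretised laws have a convergent subsequence, and the hitting times
  converge with them. The uniform bounds on \<open>hyp K\<close> pass to the limit by Fatou's lemma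
  and give finiteness and uniform integrability; characteristic functions identify the law.\<close>

lemma root_barrier_exists:
  assumes "integrable_law \<mu>" and mean: "(\<integral>y. y \<partial>\<mu>) = 0"
  obtains R where "root_barrier R" "solves_SEP M F B \<mu> (hitting_time B R)"
proof -
  interpret L: integrable_law \<mu> by fact
  define g where "g n y = L.barycentre (L.cell n) (L.cell n y)" for n y
  have "\<forall>n. \<exists>R. root_barrier R \<and> (AE \<omega> in M. hitting_time B R \<omega> < \<infinity>) \<and>
    distr M borel (at_time (hitting_time B R)) = distr \<mu> borel (g n) \<and>
    (\<forall>K>0. \<forall>t\<ge>0. expectation (\<lambda>\<omega>. hyp K (B (trunc (hitting_time B R) t \<omega>) \<omega>)) \<le> (\<integral>y. hyp K y \<partial>\<mu>))"
    unfolding g_def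
    by (intro allI root_barrier_finite_range[OF assms L.cell_measurable _ L.cell_range]) simp
  from choice[OF this] obtain S where S': "\<forall>n. root_barrier (S n) \<and> (AE \<omega> in M. hitting_time B (S n) \<omega> < \<infinity>) \<and>
    distr M borel (at_time (hitting_time B (S n))) = distr \<mu> borel (g n) \<and>
    (\<forall>K>0. \<forall>t\<ge>0. expectation (\<lambda>\<omega>. hyp K (B (trunc (hitting_time B (S n)) t \<omega>) \<omega>)) \<le> (\<integral>y. hyp K y \<partial>\<mu>))" ..
  have S: "\<And>n. root_barrier (S n)" "\<And>n. AE \<omega> in M. hitting_time B (S n) \<omega> < \<infinity>"
    "\<And>n. distr M borel (at_time (hitting_time B (S n))) = distr \<mu> borel (g n)"
    "\<And>n K t. 0 < K \<Longrightarrow> 0 \<le> t \<Longrightarrow> expectation (\<lambda>\<omega>. hyp K (B (trunc (hitting_time B (S n)) t \<omega>) \<omega>)) \<le> (\<integral>y. hyp K y \<partial>\<mu>)"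
    using S' by simp_all
  obtain r R where r: "strict_mono (r :: nat \<Rightarrow> nat)" and kc: "kconv (S \<circ> r) R" by (rule kconv_subseq)
  have R: "root_barrier R" by (rule kconv_root_barrier[OF kc]) (simp add: S)
  let ?\<tau> = "hitting_time B R" and ?s = "\<lambda>n. hitting_time B (S (r n))"
  note \<tau> = stop_ext_hitting[OF root_closed[OF R]] and s = stop_ext_hitting[OF root_closed[OF S(1)]]
  have conv: "AE \<omega> in M. (\<lambda>n. ?s n \<omega>) \<longlonglongrightarrow> ?\<tau> \<omega>"
    using hitting_time_kconv[OF kc _ R] S(1) by (simp add: o_def)
  have hypb: "expectation (\<lambda>\<omega>. hyp K (B (trunc ?\<tau> t \<omega>) \<omega>)) \<le> (\<integral>y. hyp K y \<partial>\<mu>)" if K: "0 < K" and t: "0 \<le> t" for K t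
  proof -
    have hnn: "0 \<le> (\<integral>y. hyp K y \<partial>\<mu>)" by (intro Bochner_Integration.integral_nonneg) (simp add: hyp_nonneg[OF K])
    have "(\<integral>\<^sup>+\<omega>. ennreal (hyp K (B (trunc ?\<tau> t \<omega>) \<omega>)) \<partial>M) = (\<integral>\<^sup>+\<omega>. liminf (\<lambda>n. ennreal (hyp K (B (trunc (?s n) t \<omega>) \<omega>))) \<partial>M)"
    proof (rule nn_integral_cong_AE)
      show "AE \<omega> in M. ennreal (hyp K (B (trunc ?\<tau> t \<omega>) \<omega>)) = liminf (\<lambda>n. ennreal (hyp K (B (trunc (?s n) t \<omega>) \<omega>)))"
        using conv AE_space
      proof eventually_elim
        case (elim \<omega>)
        have "(\<lambda>n. B (trunc (?s n) t \<omega>) \<omega>) \<longlonglongrightarrow> B (trunc ?\<tau> t \<omega>) \<omega>"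
          by (rule B_trunc_tendsto[where \<tau>="?s" and \<tau>'="?\<tau>", OF elim(2,1) t]) (rule hitting_time_nonneg)
        then have "(\<lambda>n. hyp K (B (trunc (?s n) t \<omega>) \<omega>)) \<longlonglongrightarrow> hyp K (B (trunc ?\<tau> t \<omega>) \<omega>)"
          by (intro continuous_on_LIMSEQ[OF hyp_continuous[of UNIV]]) auto
        then have "(\<lambda>n. ennreal (hyp K (B (trunc (?s n) t \<omega>) \<omega>))) \<longlonglongrightarrow> ennreal (hyp K (B (trunc ?\<tau> t \<omega>) \<omega>))"
          by (rule tendsto_ennrealI)
        then show ?case by (simp add: lim_imp_Liminf)
      qed
    qed
    also have "\<dots> \<le> liminf (\<lambda>n. \<integral>\<^sup>+\<omega>. ennreal (hyp K (B (trunc (?s n) t \<omega>) \<omega>)) \<partial>M)"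
      by (rule nn_integral_liminf) (use trunc_measurable[OF s t] in measurable)
    also have "\<dots> \<le> liminf (\<lambda>n. ennreal (\<integral>y. hyp K y \<partial>\<mu>))"
    proof (rule Liminf_mono, rule always_eventually, rule allI)
      fix n
      show "(\<integral>\<^sup>+\<omega>. ennreal (hyp K (B (trunc (?s n) t \<omega>) \<omega>)) \<partial>M) \<le> ennreal (\<integral>y. hyp K y \<partial>\<mu>)"
        unfolding nn_integral_hyp[OF K integrable_trunc[OF s t]] by (rule ennreal_leI[OF S(4)[OF K t]])
    qed
    also have "\<dots> = ennreal (\<integral>y. hyp K y \<partial>\<mu>)" by (simp add: Liminf_const)
    finally show ?thesis
      unfolding nn_integral_hyp[OF K integrable_trunc[OF \<tau> t]] using hnn by (simp add: ennreal_le_iff)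
  qed
  have fin: "AE \<omega> in M. ?\<tau> \<omega> < \<infinity>"
  proof (rule stop_ext_finite_if_bounded[OF \<tau>])
    fix t :: real assume t: "0 \<le> t"
    have "expectation (\<lambda>\<omega>. \<bar>B (trunc ?\<tau> t \<omega>) \<omega>\<bar>) \<le> expectation (\<lambda>\<omega>. hyp 1 (B (trunc ?\<tau> t \<omega>) \<omega>) + 1)"
    proof (rule integral_mono)
      fix \<omega> show "\<bar>B (trunc ?\<tau> t \<omega>) \<omega>\<bar> \<le> hyp 1 (B (trunc ?\<tau> t \<omega>) \<omega>) + 1"
        using abs_le_hyp[of "B (trunc ?\<tau> t \<omega>) \<omega>" 1] by simp
    qed (use integrable_trunc[OF \<tau> t] integrable_hyp[OF _ integrable_trunc[OF \<tau> t], of 1] in auto)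
    also have "\<dots> = expectation (\<lambda>\<omega>. hyp 1 (B (trunc ?\<tau> t \<omega>) \<omega>)) + 1"
      using integrable_hyp[OF _ integrable_trunc[OF \<tau> t], of 1] by (simp add: prob_space)
    also have "\<dots> \<le> (\<integral>y. hyp 1 y \<partial>\<mu>) + 1" using hypb[OF _ t, of 1] by simp
    finally show "expectation (\<lambda>\<omega>. \<bar>B (trunc ?\<tau> t \<omega>) \<omega>\<bar>) \<le> (\<integral>y. hyp 1 y \<partial>\<mu>) + 1" .
  qed
  have ui: "unif_integrable M (\<lambda>t \<omega>. B (trunc ?\<tau> t \<omega>) \<omega>)"
    unfolding unif_integrable_def
  proof (intro conjI allI impI)
    fix e :: real assume "0 < e"
    then have "\<forall>\<^sub>F n in sequentially. (\<integral>y. hyp (real (Suc n)) y \<partial>\<mu>) < e / 2"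
      by (intro order_tendstoD(2)[OF L.hyp_law_tendsto_0]) simp
    then obtain n where n: "(\<integral>y. hyp (real (Suc n)) y \<partial>\<mu>) < e / 2" by (auto dest: eventually_happens'[OF sequentially_bot])
    \<comment> \<open>For this \<open>K\<close> the integral of 2 \<open>hyp K\<close> under \<mu>
      is below e, and beyond 2K the absolute value is at most 2 \<open>hyp K\<close>.\<close>
    define K where "K = real (Suc n)"
    have K: "0 < K" by (simp add: K_def)
    have "(\<integral>\<omega>. \<bar>B (trunc ?\<tau> t \<omega>) \<omega>\<bar> * indicator {\<omega>. 2 * K < \<bar>B (trunc ?\<tau> t \<omega>) \<omega>\<bar>} \<omega> \<partial>M) < e" if t: "0 \<le> t" for t
    proof -
      note i = integrable_trunc[OF \<tau> t]
      have "(\<integral>\<omega>. \<bar>B (trunc ?\<tau> t \<omega>) \<omega>\<bar> * indicator {\<omega>. 2 * K < \<bar>B (trunc ?\<tau> t \<omega>) \<omega>\<bar>} \<omega> \<partial>M) \<le> expectation (\<lambda>\<omega>. 2 * hyp K (B (trunc ?\<tau> t \<omega>) \<omega>))"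
      proof (rule integral_mono)
        show "integrable M (\<lambda>\<omega>. \<bar>B (trunc ?\<tau> t \<omega>) \<omega>\<bar> * indicator {\<omega>. 2 * K < \<bar>B (trunc ?\<tau> t \<omega>) \<omega>\<bar>} \<omega>)"
        proof (rule Bochner_Integration.integrable_bound[OF i])
          show "(\<lambda>\<omega>. \<bar>B (trunc ?\<tau> t \<omega>) \<omega>\<bar> * indicator {\<omega>. 2 * K < \<bar>B (trunc ?\<tau> t \<omega>) \<omega>\<bar>} \<omega>) \<in> borel_measurable M"
            using trunc_measurable[OF \<tau> t] by measurable
        qed (auto simp: indicator_def)
        show "\<bar>B (trunc ?\<tau> t \<omega>) \<omega>\<bar> * indicator {\<omega>. 2 * K < \<bar>B (trunc ?\<tau> t \<omega>) \<omega>\<bar>} \<omega> \<le> 2 * hyp K (B (trunc ?\<tau> t \<omega>) \<omega>)" for \<omega>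
          using abs_tail_le_hyp[OF K] hyp_nonneg[OF K] by (auto simp: indicator_def)
      qed (use integrable_hyp[OF K i] in auto)
      also have "\<dots> \<le> 2 * (\<integral>y. hyp K y \<partial>\<mu>)" using hypb[OF K t] by simp
      also have "\<dots> < e" using n by (simp add: K_def)
      finally show ?thesis .
    qed
    then show "\<exists>K. \<forall>t\<ge>0. (\<integral>\<omega>. \<bar>B (trunc ?\<tau> t \<omega>) \<omega>\<bar> * indicator {\<omega>. K < \<bar>B (trunc ?\<tau> t \<omega>) \<omega>\<bar>} \<omega> \<partial>M) < e" by blast
  qed (rule integrable_trunc[OF \<tau>])
  note m[measurable] = at_time_measurable[OF \<tau>] at_time_measurable[OF s]
  have gm[measurable]: "g n \<in> borel_measurable \<mu>" for n
  proof -
    have "g n \<in> borel_measurable borel" unfolding g_def[abs_def] by (rule L.barycentre_measurable[OF L.cell_measurable])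
    then show ?thesis by (simp add: measurable_cong_sets[OF L.sets_law refl])
  qed
  have conv_at: "AE \<omega> in M. (\<lambda>n. at_time (?s n) \<omega>) \<longlonglongrightarrow> at_time ?\<tau> \<omega>"
    using conv fin AE_space
  proof eventually_elim
    case (elim \<omega>)
    show ?case by (rule B_hit_tendsto[where \<tau>="?s" and \<tau>'="?\<tau>", OF elim(3,1,2)]) (rule hitting_time_nonneg)
  qed
  have law: "distr M borel (at_time ?\<tau>) = \<mu>"
  proof (rule Levy_uniqueness)
    show "real_distribution (distr M borel (at_time ?\<tau>))" by (rule real_distribution_distr) simp
    show "real_distribution \<mu>"
      by (simp add: real_distribution_def real_distribution_axioms_def L.prob_space_axioms L.sets_law L.space_law)
    show "char (distr M borel (at_time ?\<tau>)) = char \<mu>"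
    proof
      fix t
      have c: "isCont (\<lambda>x. iexp (t * x)) x" for x by (intro continuous_intros)
      have "(\<lambda>n. \<integral>\<omega>. iexp (t * at_time (?s n) \<omega>) \<partial>M) \<longlonglongrightarrow> (\<integral>\<omega>. iexp (t * at_time ?\<tau> \<omega>) \<partial>M)"
      proof (rule integral_dominated_convergence[where w="\<lambda>_. 1"])
        show "AE \<omega> in M. (\<lambda>n. iexp (t * at_time (?s n) \<omega>)) \<longlonglongrightarrow> iexp (t * at_time ?\<tau> \<omega>)"
          using conv_at by eventually_elim (rule isCont_tendsto_compose[OF c])
      qed auto
      moreover have "(\<integral>\<omega>. iexp (t * at_time (?s n) \<omega>) \<partial>M) = (\<integral>y. iexp (t * g (r n) y) \<partial>\<mu>)" for n
      proof -
        have "(\<integral>\<omega>. iexp (t * at_time (?s n) \<omega>) \<partial>M) = (\<integral>x. iexp (t * x) \<partial>distr M borel (at_time (?s n)))"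
          by (rule integral_distr[symmetric]) auto
        also have "\<dots> = (\<integral>y. iexp (t * g (r n) y) \<partial>\<mu>)" unfolding S(3) by (rule integral_distr) auto
        finally show ?thesis .
      qed
      moreover have "(\<lambda>n. \<integral>y. iexp (t * g (r n) y) \<partial>\<mu>) \<longlonglongrightarrow> (\<integral>y. iexp (t * y) \<partial>\<mu>)"
      proof (rule integral_dominated_convergence[where w="\<lambda>_. 1"])
        show "AE y in \<mu>. (\<lambda>n. iexp (t * g (r n) y)) \<longlonglongrightarrow> iexp (t * y)"
          using L.AE_barycentre_tendsto
        proof eventually_elim
          case (elim y)
          then have "(\<lambda>n. g (r n) y) \<longlonglongrightarrow> y" unfolding g_def by (rule LIMSEQ_subseq_LIMSEQ[OF _ r, unfolded o_def])
          then show ?case by (rule isCont_tendsto_compose[OF c])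
        qed
      qed auto
      ultimately have "(\<integral>\<omega>. iexp (t * at_time ?\<tau> \<omega>) \<partial>M) = (\<integral>y. iexp (t * y) \<partial>\<mu>)" by (simp add: LIMSEQ_unique)
      moreover have "(\<integral>\<omega>. iexp (t * at_time ?\<tau> \<omega>) \<partial>M) = char (distr M borel (at_time ?\<tau>)) t"
        unfolding char_def by (rule integral_distr[symmetric]) auto
      ultimately show "char (distr M borel (at_time ?\<tau>)) t = char \<mu> t" by (simp add: char_def)
    qed
  qed
  have "solves_SEP M F B \<mu> ?\<tau>" unfolding solves_SEP_def using \<tau> fin law ui by blast
  with R show ?thesis by (rule that)
qed

end

section \<open>Hitting laws as Gaussian recursions\<close>

definition heat :: "real \<Rightarrow> (real \<Rightarrow> ennreal) \<Rightarrow> real \<Rightarrow> ennreal" where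
  "heat h f y = (\<integral>\<^sup>+z. f (y + sqrt h * z) \<partial>gauss)"

lemma heat_measurable[measurable]:
  assumes [measurable]: "f \<in> borel_measurable borel" shows "heat h f \<in> borel_measurable borel"
proof -
  have "(\<lambda>p. f (fst p + sqrt h * snd p)) \<in> borel_measurable (borel \<Otimes>\<^sub>M gauss)" by measurable
  then show ?thesis
    unfolding heat_def[abs_def] using gauss.borel_measurable_nn_integral[of "\<lambda>y z. f (y + sqrt h * z)" borel]
    by (simp add: case_prod_unfold)
qed

text \<open>The place where Brownian scaling enters: a Gaussian step of variance lh, divided by sqrt
  l, is a step of variance h.\<close>

lemma heat_scale:
  assumes "0 < l" shows "heat (l * h) (\<lambda>y. f (y / sqrt l)) y = heat h f (y / sqrt l)"
proof -
  have "(y + sqrt (l * h) * z) / sqrt l = y / sqrt l + sqrt h * z" for z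
    using assms by (simp add: add_divide_distrib real_sqrt_mult)
  then show ?thesis by (simp add: heat_def)
qed

context brownian begin

text \<open>The Markov property restricted to an event of the past; the indicator of the event is
  made a component of the past variable.\<close>

lemma nn_integral_heat:
  assumes "0 \<le> s" "s \<le> t" and A: "A \<in> sets (F s)" and f[measurable]: "f \<in> borel_measurable borel"
  shows "(\<integral>\<^sup>+\<omega>. indicator A \<omega> * f (x + B t \<omega>) \<partial>M) = (\<integral>\<^sup>+\<omega>. indicator A \<omega> * heat (t - s) f (x + B s \<omega>) \<partial>M)"
proof -
  let ?X = "\<lambda>\<omega>. (indicator A \<omega> :: ennreal, B s \<omega>)"
  have X: "?X \<in> measurable (F s) (borel \<Otimes>\<^sub>M borel)"
    using A B_adapted[OF assms(1) order_refl] by measurable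
  let ?g = "\<lambda>p. fst (fst p) * f (x + snd (fst p) + snd p)"
  have g: "?g \<in> borel_measurable ((borel \<Otimes>\<^sub>M borel) \<Otimes>\<^sub>M borel)" by measurable
  have "(\<integral>\<^sup>+\<omega>. indicator A \<omega> * f (x + B t \<omega>) \<partial>M) = (\<integral>\<^sup>+\<omega>. ?g (?X \<omega>, B t \<omega> - B s \<omega>) \<partial>M)" by simp
  also have "\<dots> = (\<integral>\<^sup>+\<omega>. (\<integral>\<^sup>+z. ?g (?X \<omega>, sqrt (t - s) * z) \<partial>gauss) \<partial>M)"
    by (rule nn_integral_incr[OF assms(1,2) X g])
  also have "\<dots> = (\<integral>\<^sup>+\<omega>. indicator A \<omega> * heat (t - s) f (x + B s \<omega>) \<partial>M)"
    unfolding heat_def by (intro nn_integral_cong) (simp add: nn_integral_cmult)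
  finally show ?thesis .
qed

text \<open>Backward induction over a time grid, for both directions of the inequality at once; the index
  of \<open>c\<close> and \<open>W\<close> is the number of remaining steps.\<close>
lemma dp_compare:
  fixes \<kappa> :: "'a \<Rightarrow> nat" and c W :: "nat \<Rightarrow> real \<Rightarrow> ennreal"
  assumes rel: "rel = (\<le>) \<or> rel = (\<ge>)" and h: "0 \<le> h"
    and \<kappa>: "\<And>\<omega>. \<omega> \<in> space M \<Longrightarrow> \<kappa> \<omega> \<le> N" "\<And>k. k < N \<Longrightarrow> {\<omega>\<in>space M. k < \<kappa> \<omega>} \<in> sets (F (real k * h))"
    and c[measurable]: "\<And>i. c i \<in> borel_measurable borel" and W[measurable]: "\<And>i. W i \<in> borel_measurable borel"
    and stop: "\<And>k \<omega>. k < N \<Longrightarrow> \<omega> \<in> space M \<Longrightarrow> \<kappa> \<omega> = k \<Longrightarrow> rel (W (N - k) (x + B (real k * h) \<omega>)) (c (N - k) (x + B (real k * h) \<omega>))"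
    and cont: "\<And>k \<omega>. k < N \<Longrightarrow> \<omega> \<in> space M \<Longrightarrow> k < \<kappa> \<omega> \<Longrightarrow> rel (W (N - k) (x + B (real k * h) \<omega>)) (heat h (W (N - Suc k)) (x + B (real k * h) \<omega>))"
    and last: "\<And>y. W 0 y = c 0 y"
  shows "rel (W N x) (\<integral>\<^sup>+\<omega>. c (N - \<kappa> \<omega>) (x + B (real (\<kappa> \<omega>) * h) \<omega>) \<partial>M)"
proof -
  have refl: "rel a a" for a using rel by auto
  have trans: "rel a b \<Longrightarrow> rel b d \<Longrightarrow> rel a d" for a b d using rel by auto
  have add: "rel a b \<Longrightarrow> rel a' b' \<Longrightarrow> rel (a + a') (b + b')" for a b a' b' using rel by (auto intro: add_mono)
  have int: "(\<And>\<omega>. \<omega> \<in> space M \<Longrightarrow> rel (f \<omega>) (g \<omega>)) \<Longrightarrow> rel (\<integral>\<^sup>+\<omega>. f \<omega> \<partial>M) (\<integral>\<^sup>+\<omega>. g \<omega> \<partial>M)" for f g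
    using rel by (auto intro: nn_integral_mono)
  have t0: "0 \<le> real k * h" for k using h by simp
  have [measurable]: "B (real k * h) \<in> borel_measurable M" for k by (rule B_meas[OF t0])
  have gt: "{\<omega>\<in>space M. k < \<kappa> \<omega>} \<in> sets M" for k
  proof (cases "k < N")
    case True then show ?thesis using sets_F[OF t0 \<kappa>(2)] by blast
  next
    case False
    then have "{\<omega>\<in>space M. k < \<kappa> \<omega>} = {}" using \<kappa>(1) by fastforce
    then show ?thesis by (simp only: sets.empty_sets)
  qed
  have \<kappa>m[measurable]: "\<kappa> \<in> measurable M (count_space UNIV)"
  proof (subst measurable_count_space_eq2_countable, intro conjI ballI)
    fix k :: nat
    have "{\<omega>\<in>space M. k \<le> \<kappa> \<omega>} \<in> sets M"
    proof (cases k)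
      case (Suc j) then show ?thesis using gt[of j] by (simp add: Suc_le_eq)
    qed simp
    then have "{\<omega>\<in>space M. k \<le> \<kappa> \<omega>} - {\<omega>\<in>space M. k < \<kappa> \<omega>} \<in> sets M" using gt by (rule sets.Diff)
    also have "{\<omega>\<in>space M. k \<le> \<kappa> \<omega>} - {\<omega>\<in>space M. k < \<kappa> \<omega>} = \<kappa> -` {k} \<inter> space M" by auto
    finally show "\<kappa> -` {k} \<inter> space M \<in> sets M" .
  qed auto
  let ?C = "\<lambda>\<omega>. c (N - \<kappa> \<omega>) (x + B (real (\<kappa> \<omega>) * h) \<omega>)"
  have Cm[measurable]: "?C \<in> borel_measurable M"
    by (rule measurable_compose_countable[where f="\<lambda>k \<omega>. c (N - k) (x + B (real k * h) \<omega>)"]) measurable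
  have "rel (\<integral>\<^sup>+\<omega>. indicator {\<omega>\<in>space M. k \<le> \<kappa> \<omega>} \<omega> * W i (x + B (real k * h) \<omega>) \<partial>M) (\<integral>\<^sup>+\<omega>. indicator {\<omega>\<in>space M. k \<le> \<kappa> \<omega>} \<omega> * ?C \<omega> \<partial>M)"
    if "k + i = N" for i k
    using that
  proof (induction i arbitrary: k)
    case 0
    then have k: "k = N" by simp
    have "(\<integral>\<^sup>+\<omega>. indicator {\<omega>\<in>space M. k \<le> \<kappa> \<omega>} \<omega> * W 0 (x + B (real k * h) \<omega>) \<partial>M) = (\<integral>\<^sup>+\<omega>. indicator {\<omega>\<in>space M. k \<le> \<kappa> \<omega>} \<omega> * ?C \<omega> \<partial>M)"
    proof (rule nn_integral_cong)
      fix \<omega> assume "\<omega> \<in> space M"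
      from \<kappa>(1)[OF this] k have "k \<le> \<kappa> \<omega> \<Longrightarrow> \<kappa> \<omega> = N" by simp
      then show "indicator {\<omega>\<in>space M. k \<le> \<kappa> \<omega>} \<omega> * W 0 (x + B (real k * h) \<omega>) = indicator {\<omega>\<in>space M. k \<le> \<kappa> \<omega>} \<omega> * ?C \<omega>"
        using k last by (auto simp: indicator_def)
    qed
    then show ?case using refl by simp
  next
    case (Suc i)
    then have kN: "k < N" and i: "N - k = Suc i" "N - Suc k = i" "Suc k + i = N" by auto
    let ?E = "indicator {\<omega>\<in>space M. \<kappa> \<omega> = k} :: 'a \<Rightarrow> ennreal" and ?G = "indicator {\<omega>\<in>space M. Suc k \<le> \<kappa> \<omega>} :: 'a \<Rightarrow> ennreal"
    have Gs: "{\<omega>\<in>space M. Suc k \<le> \<kappa> \<omega>} \<in> sets (F (real k * h))" using \<kappa>(2)[OF kN] by (simp add: Suc_le_eq)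
    have split: "(\<integral>\<^sup>+\<omega>. indicator {\<omega>\<in>space M. k \<le> \<kappa> \<omega>} \<omega> * f \<omega> \<partial>M) = (\<integral>\<^sup>+\<omega>. ?E \<omega> * f \<omega> \<partial>M) + (\<integral>\<^sup>+\<omega>. ?G \<omega> * f \<omega> \<partial>M)"
      if [measurable]: "f \<in> borel_measurable M" for f
    proof -
      have "indicator {\<omega>\<in>space M. k \<le> \<kappa> \<omega>} \<omega> * f \<omega> = ?E \<omega> * f \<omega> + ?G \<omega> * f \<omega>" for \<omega> by (auto simp: indicator_def)
      then show ?thesis by (simp add: nn_integral_add)
    qed
    have e: "rel (\<integral>\<^sup>+\<omega>. ?E \<omega> * W (Suc i) (x + B (real k * h) \<omega>) \<partial>M) (\<integral>\<^sup>+\<omega>. ?E \<omega> * ?C \<omega> \<partial>M)"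
    proof (rule int)
      fix \<omega> assume \<omega>: "\<omega> \<in> space M"
      show "rel (?E \<omega> * W (Suc i) (x + B (real k * h) \<omega>)) (?E \<omega> * ?C \<omega>)"
        using stop[OF kN \<omega>] refl \<omega> by (cases "\<kappa> \<omega> = k") (auto simp: i)
    qed
    have "rel (\<integral>\<^sup>+\<omega>. ?G \<omega> * W (Suc i) (x + B (real k * h) \<omega>) \<partial>M) (\<integral>\<^sup>+\<omega>. ?G \<omega> * heat h (W i) (x + B (real k * h) \<omega>) \<partial>M)"
    proof (rule int)
      fix \<omega> assume \<omega>: "\<omega> \<in> space M"
      show "rel (?G \<omega> * W (Suc i) (x + B (real k * h) \<omega>)) (?G \<omega> * heat h (W i) (x + B (real k * h) \<omega>))"
        using cont[OF kN \<omega>] refl \<omega> by (cases "k < \<kappa> \<omega>") (auto simp: i Suc_le_eq)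
    qed
    also have "(\<integral>\<^sup>+\<omega>. ?G \<omega> * heat h (W i) (x + B (real k * h) \<omega>) \<partial>M) = (\<integral>\<^sup>+\<omega>. ?G \<omega> * W i (x + B (real (Suc k) * h) \<omega>) \<partial>M)"
    proof -
      have "real (Suc k) * h - real k * h = h" "real k * h \<le> real (Suc k) * h" using h by (simp_all add: algebra_simps)
      then show ?thesis using nn_integral_heat[OF t0 _ Gs W[of i], where t="real (Suc k) * h" and x=x] by simp
    qed
    finally have "rel (\<integral>\<^sup>+\<omega>. ?G \<omega> * W (Suc i) (x + B (real k * h) \<omega>) \<partial>M) (\<integral>\<^sup>+\<omega>. ?G \<omega> * ?C \<omega> \<partial>M)"
      using trans Suc.IH[OF i(3)] by blast
    from add[OF e this] show ?case by (simp add: split)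
  qed
  from this[of 0 N]
  have "rel (\<integral>\<^sup>+\<omega>. W N x * indicator (space M) \<omega> \<partial>M) (\<integral>\<^sup>+\<omega>. ?C \<omega> * indicator (space M) \<omega> \<partial>M)"
    using B_0 by (simp add: mult.commute cong: nn_integral_cong)
  then show ?thesis by (simp add: emeasure_space_1 cong: nn_integral_cong)
qed

end

text \<open>Expected payoff \<open>f\<close> with \<open>i\<close> of \<open>N\<close> steps left
  when stopping at the first grid point in \<open>G\<close>, or at the end; \<open>N - Suc i\<close>
  is the number of steps already made.\<close>

primrec hit_value :: "real \<Rightarrow> nat \<Rightarrow> (real \<times> real) set \<Rightarrow> (real \<Rightarrow> ennreal) \<Rightarrow> nat \<Rightarrow> real \<Rightarrow> ennreal" where
  "hit_value h N G f 0 = f"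
| "hit_value h N G f (Suc i) = (\<lambda>y. if (real (N - Suc i) * h, y) \<in> G then f y else heat h (hit_value h N G f i) y)"

lemma hit_value_scale:
  assumes l: "0 < l"
  shows "hit_value (l * h) N {(t, x). (t / l, x / sqrt l) \<in> G} (\<lambda>y. f (y / sqrt l)) i = (\<lambda>y. hit_value h N G f i (y / sqrt l))"
proof (induction i)
  case (Suc i)
  have "real (N - Suc i) * (l * h) / l = real (N - Suc i) * h" using l by simp
  then show ?case unfolding hit_value.simps Suc.IH heat_scale[OF l] by simp
qed simp

lemma hit_value_measurable:
  assumes f[measurable]: "f \<in> borel_measurable borel" and G: "open G"
  shows "hit_value h N G f i \<in> borel_measurable borel"
proof (induction i)
  case (Suc i)
  note [measurable] = Suc
  have "open ((\<lambda>y. (real (N - Suc i) * h, y)) -` G)" by (rule open_vimage[OF G]) (intro continuous_intros)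
  then have [measurable]: "Measurable.pred borel (\<lambda>y. (real (N - Suc i) * h, y) \<in> G)" by (simp add: pred_def vimage_def)
  show ?case by simp measurable
qed simp

context brownian begin

definition grid_hit :: "real \<Rightarrow> nat \<Rightarrow> (real \<times> real) set \<Rightarrow> 'a \<Rightarrow> nat" where
  "grid_hit h N G \<omega> = (LEAST k. k = N \<or> (real k * h, B (real k * h) \<omega>) \<in> G)"

lemma grid_hit_le: "grid_hit h N G \<omega> \<le> N"
  unfolding grid_hit_def by (rule Least_le) simp

lemma grid_hit_cases: "grid_hit h N G \<omega> = N \<or> (real (grid_hit h N G \<omega>) * h, B (real (grid_hit h N G \<omega>) * h) \<omega>) \<in> G"
  unfolding grid_hit_def by (rule LeastI[of _ N]) simp

lemma grid_hit_le_hit: "(real k * h, B (real k * h) \<omega>) \<in> G \<Longrightarrow> grid_hit h N G \<omega> \<le> k"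
  unfolding grid_hit_def by (rule Least_le) simp

text \<open>Stopping and continuing are equalities here, so \<open>dp_compare\<close> applies with
  both relations and the two bounds coincide.\<close>

lemma nn_integral_grid_hit:
  assumes h: "0 \<le> h" and G: "open G" and f: "f \<in> borel_measurable borel"
  shows "(\<integral>\<^sup>+\<omega>. f (B (real (grid_hit h N G \<omega>) * h) \<omega>) \<partial>M) = hit_value h N G f N 0"
proof -
  let ?\<kappa> = "grid_hit h N G"
  have gt: "{\<omega>\<in>space M. k < ?\<kappa> \<omega>} \<in> sets (F (real k * h))" if k: "k < N" for k
  proof -
    have [measurable]: "i \<in> {..k} \<Longrightarrow> B (real i * h) \<in> borel_measurable (F (real k * h))" for i
      using h by (intro B_adapted) (auto intro: mult_right_mono)
    have o: "{y. (real i * h, y) \<in> G} \<in> sets borel" for i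
    proof -
      have "open ((\<lambda>y. (real i * h, y)) -` G)" by (rule open_vimage[OF G]) (intro continuous_intros)
      then show ?thesis by (simp add: vimage_def)
    qed
    have "{\<omega>\<in>space M. k < ?\<kappa> \<omega>} = {\<omega>\<in>space (F (real k * h)). \<forall>i\<in>{..k}. B (real i * h) \<omega> \<notin> {y. (real i * h, y) \<in> G}}"
    proof (intro Collect_cong conj_cong)
      show "\<omega> \<in> space M \<longleftrightarrow> \<omega> \<in> space (F (real k * h))" for \<omega> using space_F[of "real k * h"] h by simp
      fix \<omega>
      show "k < ?\<kappa> \<omega> \<longleftrightarrow> (\<forall>i\<in>{..k}. B (real i * h) \<omega> \<notin> {y. (real i * h, y) \<in> G})"
      proof
        assume l: "k < ?\<kappa> \<omega>"
        show "\<forall>i\<in>{..k}. B (real i * h) \<omega> \<notin> {y. (real i * h, y) \<in> G}"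
        proof
          fix i assume "i \<in> {..k}"
          with l have "\<not> ?\<kappa> \<omega> \<le> i" by simp
          then show "B (real i * h) \<omega> \<notin> {y. (real i * h, y) \<in> G}" using grid_hit_le_hit[of i h \<omega> G N] by blast
        qed
      next
        assume a: "\<forall>i\<in>{..k}. B (real i * h) \<omega> \<notin> {y. (real i * h, y) \<in> G}"
        show "k < ?\<kappa> \<omega>"
        proof (rule ccontr)
          assume "\<not> k < ?\<kappa> \<omega>"
          then have "?\<kappa> \<omega> \<le> k" by simp
          with a k grid_hit_cases[of h N G \<omega>] show False by auto
        qed
      qed
    qed
    also have "\<dots> \<in> sets (F (real k * h))" using o by measurable
    finally show ?thesis .
  qed
  have eq: "rel (hit_value h N G f N 0) (\<integral>\<^sup>+\<omega>. (\<lambda>_. f) (N - ?\<kappa> \<omega>) (0 + B (real (?\<kappa> \<omega>) * h) \<omega>) \<partial>M)"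
    if rel: "rel = (\<le>) \<or> rel = (\<ge>)" for rel
  proof (rule dp_compare[OF rel h grid_hit_le gt, where W="hit_value h N G f"])
    have refl: "rel a a" for a using rel by auto
    fix k \<omega> assume k: "k < N"
    have Nk: "N - k = Suc (N - Suc k)" "N - Suc (N - Suc k) = k" using k by auto
    {
      assume "?\<kappa> \<omega> = k"
      then have "(real k * h, B (real k * h) \<omega>) \<in> G" using grid_hit_cases[of h N G \<omega>] k by auto
      then show "rel (hit_value h N G f (N - k) (0 + B (real k * h) \<omega>)) ((\<lambda>_. f) (N - k) (0 + B (real k * h) \<omega>))"
        using refl unfolding Nk(1) by (simp add: Nk(2))
    next
      assume "k < ?\<kappa> \<omega>"
      then have "(real k * h, B (real k * h) \<omega>) \<notin> G" using grid_hit_le_hit[of k h \<omega> G N] by auto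
      then show "rel (hit_value h N G f (N - k) (0 + B (real k * h) \<omega>)) (heat h (hit_value h N G f (N - Suc k)) (0 + B (real k * h) \<omega>))"
        using refl unfolding Nk(1) by (simp add: Nk(2))
    }
  qed (use f hit_value_measurable[OF f G] in auto)
  show ?thesis using eq[of "(\<le>)"] eq[of "(\<ge>)"] by (auto intro: antisym)
qed

lemma open_path_eventually:
  assumes \<omega>: "\<omega> \<in> space M" and G: "open G" and s: "0 \<le> s" "(s, B s \<omega>) \<in> G"
  obtains d where "0 < d" "\<And>u. s \<le> u \<Longrightarrow> u < s + d \<Longrightarrow> (u, B u \<omega>) \<in> G"
proof -
  have c: "continuous_on {0..} (\<lambda>u. (u, B u \<omega>))" by (intro continuous_intros B_cont[OF \<omega>])
  from c[unfolded continuous_on_open_invariant, rule_format, OF G]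
  obtain A where A: "open A" "A \<inter> {0..} = (\<lambda>u. (u, B u \<omega>)) -` G \<inter> {0..}" by blast
  then have "s \<in> A" using s by auto
  then obtain d where d: "d > 0" "\<And>u. dist u s < d \<Longrightarrow> u \<in> A" using A(1) unfolding open_dist by blast
  show ?thesis
  proof (rule that[OF d(1)])
    fix u assume u: "s \<le> u" "u < s + d"
    then have "u \<in> A \<inter> {0..}" using d(2)[of u] s(1) by (simp add: dist_real_def)
    then show "(u, B u \<omega>) \<in> G" unfolding A(2) by simp
  qed
qed

lemma dyadic_grid_between:
  assumes "0 \<le> s" "s < v" "0 < T"
  shows "\<forall>\<^sub>F n in sequentially. \<exists>k. s \<le> real k * (T / 2 ^ n) \<and> real k * (T / 2 ^ n) < v"
proof -
  have "(\<lambda>n. T / 2 ^ n) \<longlonglongrightarrow> 0" using LIMSEQ_divide_realpow_zero[of 2 T] by simp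
  then have "\<forall>\<^sub>F n in sequentially. T / 2 ^ n < v - s" using assms by (intro order_tendstoD(2)) auto
  then show ?thesis
  proof eventually_elim
    case (elim n)
    let ?h = "T / 2 ^ n" and ?k = "nat \<lceil>s / (T / 2 ^ n)\<rceil>"
    have h: "0 < ?h" using assms by simp
    have "0 \<le> s / ?h" using assms h by (intro divide_nonneg_pos)
    then have "s / ?h \<le> real ?k" "real ?k \<le> s / ?h + 1" by linarith+
    then have "s \<le> real ?k * ?h" "real ?k * ?h \<le> s + ?h" using h by (simp_all add: field_simps)
    with elim show ?case by (intro exI[of _ ?k]) linarith
  qed
qed

text \<open>Openness of \<open>G\<close> is what makes this work: a path that enters it stays for a
  short while, during which a fine grid has a point. The element \<open>T\<close> of the infimum
  stands for stopping at the end of the grid.\<close>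

lemma grid_hit_tendsto:
  assumes \<omega>: "\<omega> \<in> space M" and G: "open G" and T: "0 < T"
  defines "\<sigma> \<equiv> Inf (insert T {s. 0 \<le> s \<and> (s, B s \<omega>) \<in> G})"
  shows "(\<lambda>n. real (grid_hit (T / 2 ^ n) (2 ^ n) G \<omega>) * (T / 2 ^ n)) \<longlonglongrightarrow> \<sigma>" and "0 \<le> \<sigma>"
proof -
  let ?S = "insert T {s. 0 \<le> s \<and> (s, B s \<omega>) \<in> G}"
  let ?\<theta> = "\<lambda>n. real (grid_hit (T / 2 ^ n) (2 ^ n) G \<omega>) * (T / 2 ^ n)"
  have bdd: "bdd_below ?S" using T by (intro bdd_belowI[of _ 0]) auto
  have mem: "?\<theta> n \<in> ?S" for n
  proof -
    have "0 \<le> ?\<theta> n" using T by simp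
    then show ?thesis using grid_hit_cases[of "T / 2 ^ n" "2 ^ n" G \<omega>] by auto
  qed
  have ge: "\<sigma> \<le> ?\<theta> n" for n unfolding \<sigma>_def by (rule cInf_lower[OF mem bdd])
  show "0 \<le> \<sigma>" unfolding \<sigma>_def by (rule cInf_greatest) (use T in auto)
  show "?\<theta> \<longlonglongrightarrow> \<sigma>"
  proof (rule order_tendstoI)
    fix a assume "a < \<sigma>"
    then show "\<forall>\<^sub>F n in sequentially. a < ?\<theta> n" using ge by (intro always_eventually) (auto intro: less_le_trans)
  next
    fix a assume a: "\<sigma> < a"
    have leT: "?\<theta> n \<le> T" for n
    proof -
      have "real (grid_hit (T / 2 ^ n) (2 ^ n) G \<omega>) \<le> 2 ^ n"
        using grid_hit_le[of "T / 2 ^ n" "2 ^ n" G \<omega>] by (metis of_nat_le_iff of_nat_numeral of_nat_power)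
      then have "?\<theta> n \<le> 2 ^ n * (T / 2 ^ n)" using T by (intro mult_right_mono) auto
      then show ?thesis by simp
    qed
    obtain s where s: "s \<in> ?S" "s < a" using a cInf_lessD[of ?S a] unfolding \<sigma>_def by blast
    show "\<forall>\<^sub>F n in sequentially. ?\<theta> n < a"
    proof (cases "s = T")
      case True
      then show ?thesis using leT s by (intro always_eventually) (auto intro: le_less_trans)
    next
      case False
      then have s': "0 \<le> s" "(s, B s \<omega>) \<in> G" using s by auto
      obtain d where d: "0 < d" "\<And>u. s \<le> u \<Longrightarrow> u < s + d \<Longrightarrow> (u, B u \<omega>) \<in> G"
        using open_path_eventually[OF \<omega> G s'] by blast
      have "s < min (s + d) a" using d s by simp
      from dyadic_grid_between[OF s'(1) this T] show ?thesis
      proof eventually_elim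
        case (elim n)
        then obtain k where k: "s \<le> real k * (T / 2 ^ n)" "real k * (T / 2 ^ n) < min (s + d) a" by blast
        then have "(real k * (T / 2 ^ n), B (real k * (T / 2 ^ n)) \<omega>) \<in> G" by (intro d(2)) auto
        then have "grid_hit (T / 2 ^ n) (2 ^ n) G \<omega> \<le> k" by (rule grid_hit_le_hit)
        then have "?\<theta> n \<le> real k * (T / 2 ^ n)" using T by (intro mult_right_mono) auto
        with k(2) show ?case by linarith
      qed
    qed
  qed
qed

text \<open>The law of the stopped value is a limit of Gaussian recursions, hence the same on every
  probability space; we only need its behaviour under scaling.\<close>
lemma first_time_hit_value:
  fixes D :: "real \<times> real \<Rightarrow> real" and f :: "real \<Rightarrow> real"
  assumes D: "continuous_on UNIV D" and T: "0 < T"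
    and f: "continuous_on UNIV f" "\<And>y. 0 \<le> f y" "\<And>y. f y \<le> C"
  defines "V \<equiv> \<lambda>m n. hit_value (T / 2 ^ n) (2 ^ n) {z. D z < 1 / real (Suc m)} (\<lambda>y. ennreal (f y)) (2 ^ n) 0"
  shows "\<exists>L. (\<forall>m. (\<lambda>n. V m n) \<longlonglongrightarrow> L m) \<and> L \<longlonglongrightarrow> (\<integral>\<^sup>+\<omega>. ennreal (f (B (trunc (\<lambda>\<omega>. first_time (\<lambda>s. D (s, B s \<omega>))) T \<omega>) \<omega>)) \<partial>M)"
proof -
  have fm[measurable]: "f \<in> borel_measurable borel" by (rule borel_measurable_continuous_onI[OF f(1)])
  have C0: "0 \<le> C" using f(2,3) order_trans by blast
  \<comment> \<open>Grids detect open sets, so the closed target {D \<le> 0} is replaced by the open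
    neighbourhoods {D < 1/(m+1)}; first the mesh goes to 0, then m to infinity.\<close>
  define G where "G m = {z. D z < 1 / real (Suc m)}" for m
  have G: "open (G m)" for m unfolding G_def using D by (intro open_Collect_less continuous_on_const)
  define \<sigma> where "\<sigma> m \<omega> = Inf (insert T {s. 0 \<le> s \<and> (s, B s \<omega>) \<in> G m})" for m \<omega>
  define \<theta> where "\<theta> m n \<omega> = real (grid_hit (T / 2 ^ n) (2 ^ n) (G m) \<omega>) * (T / 2 ^ n)" for m n \<omega>
  have \<theta>lim: "(\<lambda>n. \<theta> m n \<omega>) \<longlonglongrightarrow> \<sigma> m \<omega>" and \<sigma>0: "0 \<le> \<sigma> m \<omega>" if "\<omega> \<in> space M" for m \<omega>
    unfolding \<theta>_def \<sigma>_def using grid_hit_tendsto[OF that G T] by auto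
  have \<theta>0: "0 \<le> \<theta> m n \<omega>" for m n \<omega> using T by (simp add: \<theta>_def)
  have Bm[measurable]: "(\<lambda>\<omega>. B (\<theta> m n \<omega>) \<omega>) \<in> borel_measurable M" for m n
  proof -
    have [measurable]: "B (real k * (T / 2 ^ n)) \<in> borel_measurable M" for k using T by (intro B_meas) simp
    have gm: "grid_hit (T / 2 ^ n) (2 ^ n) (G m) \<in> measurable M (count_space UNIV)"
      unfolding grid_hit_def
    proof (rule measurable_Least)
      fix k
      have "open ((\<lambda>y. (real k * (T / 2 ^ n), y)) -` G m)" by (rule open_vimage[OF G]) (intro continuous_intros)
      then have [measurable]: "Measurable.pred borel (\<lambda>y. (real k * (T / 2 ^ n), y) \<in> G m)" by (simp add: pred_def vimage_def)
      show "Measurable.pred M (\<lambda>\<omega>. k = 2 ^ n \<or> (real k * (T / 2 ^ n), B (real k * (T / 2 ^ n)) \<omega>) \<in> G m)"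
        by measurable
    qed
    show ?thesis unfolding \<theta>_def
      by (rule measurable_compose_countable[where f="\<lambda>k. B (real k * (T / 2 ^ n))", OF _ gm]) measurable
  qed
  have lim1: "(\<lambda>n. V m n) \<longlonglongrightarrow> (\<integral>\<^sup>+\<omega>. ennreal (f (B (\<sigma> m \<omega>) \<omega>)) \<partial>M)" and Bs[measurable]: "(\<lambda>\<omega>. B (\<sigma> m \<omega>) \<omega>) \<in> borel_measurable M" for m
  proof -
    have c: "(\<lambda>n. B (\<theta> m n \<omega>) \<omega>) \<longlonglongrightarrow> B (\<sigma> m \<omega>) \<omega>" if "\<omega> \<in> space M" for \<omega>
      by (rule continuous_on_LIMSEQ[OF B_cont[OF that]]) (use \<theta>lim[OF that] \<sigma>0[OF that] \<theta>0 in auto)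
    show [measurable]: "(\<lambda>\<omega>. B (\<sigma> m \<omega>) \<omega>) \<in> borel_measurable M"
      by (rule borel_measurable_LIMSEQ_real[OF c Bm])
    have "V m n = (\<integral>\<^sup>+\<omega>. ennreal (f (B (\<theta> m n \<omega>) \<omega>)) \<partial>M)" for n
      unfolding V_def \<theta>_def G_def[symmetric] using T by (intro nn_integral_grid_hit[symmetric] G) auto
    moreover have "(\<lambda>n. \<integral>\<^sup>+\<omega>. ennreal (f (B (\<theta> m n \<omega>) \<omega>)) \<partial>M) \<longlonglongrightarrow> (\<integral>\<^sup>+\<omega>. ennreal (f (B (\<sigma> m \<omega>) \<omega>)) \<partial>M)"
    proof (rule nn_integral_dominated_convergence[where w="\<lambda>_. ennreal C"])
      show "AE \<omega> in M. (\<lambda>n. ennreal (f (B (\<theta> m n \<omega>) \<omega>))) \<longlonglongrightarrow> ennreal (f (B (\<sigma> m \<omega>) \<omega>))"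
        by (intro AE_I2 tendsto_ennrealI continuous_on_LIMSEQ[OF f(1)] c) auto
    qed (use f(3) in \<open>auto simp: emeasure_space_1 intro: ennreal_leI\<close>)
    ultimately show "(\<lambda>n. V m n) \<longlonglongrightarrow> (\<integral>\<^sup>+\<omega>. ennreal (f (B (\<sigma> m \<omega>) \<omega>)) \<partial>M)" by simp
  qed
  let ?\<tau> = "\<lambda>\<omega>. first_time (\<lambda>s. D (s, B s \<omega>))"
  have \<sigma>lim: "(\<lambda>m. \<sigma> m \<omega>) \<longlonglongrightarrow> trunc ?\<tau> T \<omega>" if \<omega>: "\<omega> \<in> space M" for \<omega>
  proof -
    have yc: "continuous_on {0..} (\<lambda>s. D (s, B s \<omega>))"
      by (rule continuous_on_compose2[OF D]) (auto intro!: continuous_intros B_cont[OF \<omega>])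
    have bdd: "bdd_below (insert T {s. 0 \<le> s \<and> (s, B s \<omega>) \<in> G m})" for m using T by (intro bdd_belowI[of _ 0]) auto
    have t0: "0 \<le> ?\<tau> \<omega>" by (rule first_time_nonneg)
    have tr: "ereal (trunc ?\<tau> T \<omega>) = min (?\<tau> \<omega>) (ereal T)" using t0 T by (cases "?\<tau> \<omega>") (auto simp: min_def)
    have le: "\<sigma> m \<omega> \<le> trunc ?\<tau> T \<omega>" for m
    proof (cases "?\<tau> \<omega> \<le> ereal T")
      case True
      then obtain r where r: "?\<tau> \<omega> = ereal r" using t0 by (cases "?\<tau> \<omega>") auto
      have "D (r, B r \<omega>) \<le> 0" by (rule first_time_attained[OF yc r])
      moreover have "(0::real) < 1 / real (Suc m)" by simp
      ultimately have "(r, B r \<omega>) \<in> G m" unfolding G_def by (simp only: mem_Collect_eq)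
      moreover have "trunc ?\<tau> T \<omega> = r" "0 \<le> r" using r True t0 by (auto simp: min_def)
      ultimately show ?thesis unfolding \<sigma>_def by (intro cInf_lower bdd) auto
    next
      case False
      then have "trunc ?\<tau> T \<omega> = T" by (simp add: min_def)
      then show ?thesis unfolding \<sigma>_def by (intro cInf_lower bdd) auto
    qed
    show ?thesis
    proof (rule order_tendstoI)
      fix a assume a: "trunc ?\<tau> T \<omega> < a"
      then show "\<forall>\<^sub>F m in sequentially. \<sigma> m \<omega> < a" using le by (intro always_eventually) (auto intro: le_less_trans)
    next
      fix a assume a: "a < trunc ?\<tau> T \<omega>"
      obtain b where b: "a < b" "b < trunc ?\<tau> T \<omega>" using dense[OF a] by blast
      show "\<forall>\<^sub>F m in sequentially. a < \<sigma> m \<omega>"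
      proof (cases "0 \<le> b")
        case False
        have "a < \<sigma> m \<omega>" for m using \<sigma>0[OF \<omega>, of m] b(1) False by linarith
        then show ?thesis by simp
      next
        case True
        have "ereal b < ereal (trunc ?\<tau> T \<omega>)" using b(2) by (simp only: less_ereal.simps(1))
        from this[THEN less_le_trans, OF eq_refl[OF tr]] have bt: "ereal b < ?\<tau> \<omega>" "b < T" by simp_all
        have pos: "0 < D (s, B s \<omega>)" if "s \<in> {0..b}" for s
        proof (rule before_first_time[where y="\<lambda>s. D (s, B s \<omega>)" and u=s])
          have "ereal s \<le> ereal b" using that by simp
          from this bt(1) show "ereal s < ?\<tau> \<omega>" by (rule le_less_trans)
        qed (use that in simp)
        \<comment> \<open>The minimum of \<open>D\<close> along the compact piece of path up to
          \<open>b\<close> is positive, so all small neighbourhoods of the target are avoided up to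
          \<open>b\<close>.\<close>
        have "\<exists>s0\<in>{0..b}. \<forall>s\<in>{0..b}. D (s0, B s0 \<omega>) \<le> D (s, B s \<omega>)"
          using True by (intro continuous_attains_inf continuous_on_subset[OF yc]) auto
        then obtain s0 where s0: "s0 \<in> {0..b}" "\<And>s. s \<in> {0..b} \<Longrightarrow> D (s0, B s0 \<omega>) \<le> D (s, B s \<omega>)" by blast
        have "(\<lambda>m. 1 / real (Suc m)) \<longlonglongrightarrow> 0" by (rule LIMSEQ_Suc[OF lim_1_over_n])
        from order_tendstoD(2)[OF this pos[OF s0(1)]] show ?thesis
        proof eventually_elim
          case (elim m)
          have "b \<le> \<sigma> m \<omega>"
            unfolding \<sigma>_def
          proof (rule cInf_greatest)
            fix s assume s: "s \<in> insert T {s. 0 \<le> s \<and> (s, B s \<omega>) \<in> G m}"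
            show "b \<le> s"
            proof (rule ccontr)
              assume "\<not> b \<le> s"
              then have "s \<in> {0..b}" "(s, B s \<omega>) \<in> G m" using s bt(2) by auto
              with s0(2)[of s] elim show False by (simp add: G_def)
            qed
          qed simp
          with b show ?case by linarith
        qed
      qed
    qed
  qed
  have tr0: "0 \<le> trunc ?\<tau> T \<omega>" for \<omega> using first_time_nonneg[of "\<lambda>s. D (s, B s \<omega>)"] T by (auto intro!: real_of_ereal_pos simp: min_def)
  have c2: "(\<lambda>m. B (\<sigma> m \<omega>) \<omega>) \<longlonglongrightarrow> B (trunc ?\<tau> T \<omega>) \<omega>" if "\<omega> \<in> space M" for \<omega>
    by (rule continuous_on_LIMSEQ[OF B_cont[OF that]]) (use \<sigma>lim[OF that] \<sigma>0[OF that] tr0 in auto)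
  have "(\<lambda>\<omega>. B (trunc ?\<tau> T \<omega>) \<omega>) \<in> borel_measurable M"
    by (rule borel_measurable_LIMSEQ_real[OF c2 Bs])
  note [measurable] = this
  have "(\<lambda>m. \<integral>\<^sup>+\<omega>. ennreal (f (B (\<sigma> m \<omega>) \<omega>)) \<partial>M) \<longlonglongrightarrow> (\<integral>\<^sup>+\<omega>. ennreal (f (B (trunc ?\<tau> T \<omega>) \<omega>)) \<partial>M)"
  proof (rule nn_integral_dominated_convergence[where w="\<lambda>_. ennreal C"])
    show "AE \<omega> in M. (\<lambda>m. ennreal (f (B (\<sigma> m \<omega>) \<omega>))) \<longlonglongrightarrow> ennreal (f (B (trunc ?\<tau> T \<omega>) \<omega>))"
      by (intro AE_I2 tendsto_ennrealI continuous_on_LIMSEQ[OF f(1)] c2) auto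
  qed (use f(3) in \<open>auto simp: emeasure_space_1 intro: ennreal_leI\<close>)
  with lim1 show ?thesis by (intro exI[of _ "\<lambda>m. \<integral>\<^sup>+\<omega>. ennreal (f (B (\<sigma> m \<omega>) \<omega>)) \<partial>M"]) simp
qed

text \<open>The two recursions agree term by term by \<open>hit_value_scale\<close>, hence so do
  their double limits, although both expectations refer to the same path \<open>B\<close>.\<close>

lemma first_time_scaled:
  fixes D :: "real \<times> real \<Rightarrow> real" and f :: "real \<Rightarrow> real"
  assumes D: "continuous_on UNIV D" and T: "0 < T" and l: "0 < l"
    and f: "continuous_on UNIV f" "\<And>y. 0 \<le> f y" "\<And>y. f y \<le> C"
  shows "(\<integral>\<^sup>+\<omega>. ennreal (f (B (trunc (\<lambda>\<omega>. first_time (\<lambda>s. D (s / l, B s \<omega> / sqrt l))) (l * T) \<omega>) \<omega> / sqrt l)) \<partial>M)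
     = (\<integral>\<^sup>+\<omega>. ennreal (f (B (trunc (\<lambda>\<omega>. first_time (\<lambda>s. D (s, B s \<omega>))) T \<omega>) \<omega>)) \<partial>M)"
proof -
  let ?D = "\<lambda>z. D (fst z / l, snd z / sqrt l)" and ?f = "\<lambda>y. f (y / sqrt l)"
  have D': "continuous_on UNIV ?D"
    using l by (intro continuous_on_compose2[OF D] continuous_intros) auto
  have f': "continuous_on UNIV ?f" using l by (intro continuous_on_compose2[OF f(1)] continuous_intros) auto
  have lT: "0 < l * T" using l T by simp
  obtain L where L: "\<And>m. (\<lambda>n. hit_value (T / 2 ^ n) (2 ^ n) {z. D z < 1 / real (Suc m)} (\<lambda>y. ennreal (f y)) (2 ^ n) 0) \<longlonglongrightarrow> L m"
    "L \<longlonglongrightarrow> (\<integral>\<^sup>+\<omega>. ennreal (f (B (trunc (\<lambda>\<omega>. first_time (\<lambda>s. D (s, B s \<omega>))) T \<omega>) \<omega>)) \<partial>M)"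
    using first_time_hit_value[OF D T f] by blast
  obtain L' where L': "\<And>m. (\<lambda>n. hit_value (l * T / 2 ^ n) (2 ^ n) {z. ?D z < 1 / real (Suc m)} (\<lambda>y. ennreal (?f y)) (2 ^ n) 0) \<longlonglongrightarrow> L' m"
    "L' \<longlonglongrightarrow> (\<integral>\<^sup>+\<omega>. ennreal (?f (B (trunc (\<lambda>\<omega>. first_time (\<lambda>s. ?D (s, B s \<omega>))) (l * T) \<omega>) \<omega>)) \<partial>M)"
    using first_time_hit_value[OF D' lT f', of C] f by blast
  have "hit_value (l * T / 2 ^ n) (2 ^ n) {z. ?D z < 1 / real (Suc m)} (\<lambda>y. ennreal (?f y)) (2 ^ n) 0
     = hit_value (T / 2 ^ n) (2 ^ n) {z. D z < 1 / real (Suc m)} (\<lambda>y. ennreal (f y)) (2 ^ n) 0" for m n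
    using hit_value_scale[OF l, of "T / 2 ^ n" "2 ^ n" "{z. D z < 1 / real (Suc m)}" "\<lambda>y. ennreal (f y)" "2 ^ n"]
    by (simp add: case_prod_unfold)
  then have "L' m = L m" for m using LIMSEQ_unique[OF L(1)[of m]] L'(1)[of m] by simp
  then have "L' = L" by auto
  then show ?thesis using LIMSEQ_unique[OF L(2)] L'(2) by simp
qed

end

section \<open>Scaling of Root barriers\<close>

text \<open>Value 0 puts all positive times of the section into \<open>R\<close>, and closedness
  adds time 0.\<close>

lemma barrier_fun_eq_0_iff: "root_barrier R \<Longrightarrow> barrier_fun R x = 0 \<longleftrightarrow> (0, x) \<in> R"
proof
  assume R: "root_barrier R" and "barrier_fun R x = 0"
  then have *: "(t, x) \<in> R" if "0 < t" for t using barrier_fun_0_imp that by blast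
  have "closed ((\<lambda>t. (t, x)) -` R)" by (rule closed_vimage[OF root_closed[OF R]]) (intro continuous_intros)
  moreover have "(\<lambda>n. ereal (1 / real (Suc n))) \<longlonglongrightarrow> ereal 0"
    by (intro tendsto_ereal LIMSEQ_Suc[OF lim_1_over_n])
  ultimately have "ereal 0 \<in> (\<lambda>t. (t, x)) -` R"
    using closed_sequentially[of "(\<lambda>t. (t, x)) -` R" "\<lambda>n. ereal (1 / real (Suc n))" "ereal 0"] * by simp
  then show "(0, x) \<in> R" by (simp add: zero_ereal_def)
qed (rule barrier_fun_eq_0)

text \<open>Parabolic scaling of the set, written as a preimage so that closedness follows from
  continuity.\<close>

definition scale_barrier :: "real \<Rightarrow> (ereal \<times> ereal) set \<Rightarrow> (ereal \<times> ereal) set" where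
  "scale_barrier l R = {(t, x). (t / ereal l, x / ereal (sqrt l)) \<in> R}"

lemma ereal_divide_real: "0 < l \<Longrightarrow> x / ereal l = ereal (1 / l) * x"
  by (cases x) auto

lemma ereal_divide_less: "0 < l \<Longrightarrow> x < y \<Longrightarrow> x / ereal l < y / ereal l"
  by (cases x; cases y) (auto simp: divide_strict_right_mono)

lemma ereal_divide_le: "0 < l \<Longrightarrow> x \<le> y \<Longrightarrow> x / ereal l \<le> y / ereal l"
  using ereal_divide_less[of l x y] by (cases "x = y") (auto simp: less_le)

lemma ereal_divide_0_le_iff: "0 < l \<Longrightarrow> 0 \<le> x / ereal l \<longleftrightarrow> 0 \<le> x"
  and ereal_divide_le_0_iff: "0 < l \<Longrightarrow> x / ereal l \<le> 0 \<longleftrightarrow> x \<le> 0"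
  by (cases x; simp add: zero_le_divide_iff divide_le_0_iff)+

lemma scale_barrier_root:
  assumes R: "root_barrier R" and l: "0 < l" shows "root_barrier (scale_barrier l R)"
proof -
  have s: "0 < sqrt l" using l by simp
  have c: "continuous_on UNIV (\<lambda>x. x / ereal a)" if "0 < a" for a
    unfolding ereal_divide_real[OF that] continuous_on_def by (intro ballI tendsto_cmult_ereal tendsto_ident_at) simp
  have "closed ((\<lambda>z. (fst z / ereal l, snd z / ereal (sqrt l))) -` R)"
    by (rule closed_vimage[OF root_closed[OF R]], rule continuous_on_Pair;
        rule continuous_on_compose2[OF c]; (intro continuous_intros)?; (rule l s subset_UNIV)?)
  then have cl: "closed (scale_barrier l R)" by (simp add: scale_barrier_def vimage_def case_prod_unfold)
  have inf: "\<infinity> / ereal a = \<infinity>" "-\<infinity> / ereal a = -\<infinity>" if "0 < a" for a using that by auto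
  show ?thesis
    unfolding root_barrier_def
  proof (intro conjI allI impI cl)
    show "scale_barrier l R \<subseteq> {0..} \<times> UNIV"
      using root_nonneg[OF R] ereal_divide_0_le_iff[OF l] by (auto simp: scale_barrier_def)
    show "(s, x) \<in> scale_barrier l R" if "(t, x) \<in> scale_barrier l R" "t \<le> s" for t x s
      using root_up[OF R _ ereal_divide_le[OF l that(2)]] that(1) by (simp add: scale_barrier_def)
    show "(\<infinity>, x) \<in> scale_barrier l R" for x
      using root_inf[OF R] inf[OF l] by (simp add: scale_barrier_def)
    fix t :: ereal assume "0 \<le> t"
    then have "0 \<le> t / ereal l" using ereal_divide_0_le_iff[OF l] by simp
    then show "(t, \<infinity>) \<in> scale_barrier l R" "(t, -\<infinity>) \<in> scale_barrier l R"
      using root_edge[OF R] inf[OF s] by (simp_all add: scale_barrier_def)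
  qed
qed

lemma barrier_fun_scale:
  assumes l: "0 < l"
  shows "barrier_fun (scale_barrier l R) x = ereal l * barrier_fun R (x / ereal (sqrt l))"
proof -
  have "{t. 0 \<le> t \<and> (t, x) \<in> scale_barrier l R} = {ereal l * s |s. 0 \<le> s \<and> (s, x / ereal (sqrt l)) \<in> R}"
  proof (intro set_eqI iffI)
    fix t assume t: "t \<in> {t. 0 \<le> t \<and> (t, x) \<in> scale_barrier l R}"
    have "t = ereal l * (t / ereal l)" using l by (cases t) auto
    moreover have "0 \<le> t / ereal l" "(t / ereal l, x / ereal (sqrt l)) \<in> R"
      using t ereal_divide_0_le_iff[OF l] by (auto simp: scale_barrier_def)
    ultimately show "t \<in> {ereal l * s |s. 0 \<le> s \<and> (s, x / ereal (sqrt l)) \<in> R}" by blast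
  next
    fix t assume "t \<in> {ereal l * s |s. 0 \<le> s \<and> (s, x / ereal (sqrt l)) \<in> R}"
    then obtain s where s: "t = ereal l * s" "0 \<le> s" "(s, x / ereal (sqrt l)) \<in> R" by blast
    have "t / ereal l = s" "0 \<le> t" using s l by (cases s; auto)+
    then show "t \<in> {t. 0 \<le> t \<and> (t, x) \<in> scale_barrier l R}" using s by (simp add: scale_barrier_def)
  qed
  then show ?thesis unfolding barrier_fun_def by (simp only: ereal_Inf_cmult[OF l])
qed

lemma scale_barrier_regular:
  assumes R: "regular_root_barrier R" and l: "0 < l" shows "regular_root_barrier (scale_barrier l R)"
proof -
  have rR: "root_barrier R" using R by (simp add: regular_root_barrier_def)
  have s: "0 < sqrt l" using l by simp
  have r0: "barrier_fun (scale_barrier l R) x = 0 \<longleftrightarrow> barrier_fun R (x / ereal (sqrt l)) = 0" for x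
    unfolding barrier_fun_scale[OF l] using l by simp
  let ?S = "scale_barrier l R"
  let ?xm = "Sup {x. x \<le> 0 \<and> barrier_fun R x = 0}" and ?xp = "Inf {x. 0 \<le> x \<and> barrier_fun R x = 0}"
  have reg: "y \<notin> {?xm..?xp} \<Longrightarrow> barrier_fun R y = 0" for y
    using R unfolding regular_root_barrier_def Let_def by blast
  have "barrier_fun ?S x = 0" if x: "x \<notin> {Sup {x. x \<le> 0 \<and> barrier_fun ?S x = 0}..Inf {x. 0 \<le> x \<and> barrier_fun ?S x = 0}}" for x
  proof -
    have "x < Sup {x. x \<le> 0 \<and> barrier_fun ?S x = 0} \<or> Inf {x. 0 \<le> x \<and> barrier_fun ?S x = 0} < x"
      using x by (auto simp: not_le)
    then have "x / ereal (sqrt l) \<notin> {?xm..?xp}"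
    proof
      assume "x < Sup {x. x \<le> 0 \<and> barrier_fun ?S x = 0}"
      then obtain z where z: "z \<le> 0" "barrier_fun ?S z = 0" "x < z" unfolding less_Sup_iff by blast
      have "x / ereal (sqrt l) < z / ereal (sqrt l)" by (rule ereal_divide_less[OF s z(3)])
      also have "\<dots> \<le> ?xm" using z r0 ereal_divide_le_0_iff[OF s] by (intro Sup_upper) auto
      finally show ?thesis by auto
    next
      assume "Inf {x. 0 \<le> x \<and> barrier_fun ?S x = 0} < x"
      then obtain z where z: "0 \<le> z" "barrier_fun ?S z = 0" "z < x" unfolding Inf_less_iff by blast
      have "?xp \<le> z / ereal (sqrt l)" using z r0 ereal_divide_0_le_iff[OF s] by (intro Inf_lower) auto
      also have "\<dots> < x / ereal (sqrt l)" by (rule ereal_divide_less[OF s z(3)])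
      finally show ?thesis by auto
    qed
    from reg[OF this] show ?thesis using r0 by simp
  qed
  then show ?thesis
    using scale_barrier_root[OF rR l] unfolding regular_root_barrier_def Let_def by blast
qed

definition regularise :: "(ereal \<times> ereal) set \<Rightarrow> (ereal \<times> ereal) set" where
  "regularise R = R \<union> {0..} \<times> {..Sup {x. x \<le> 0 \<and> (0, x) \<in> R}} \<union> {0..} \<times> {Inf {x. 0 \<le> x \<and> (0, x) \<in> R}..}"

text \<open>The two sets are closed, and they are nonempty because a barrier contains the edges at
  minus and plus infinity; so the extreme zeros are attained, possibly at infinity.\<close>

lemma initial_zeros:
  assumes R: "root_barrier R"
  shows "Sup {x. x \<le> 0 \<and> (0, x) \<in> R} \<le> 0" "(0, Sup {x. x \<le> 0 \<and> (0, x) \<in> R}) \<in> R"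
    and "0 \<le> Inf {x. 0 \<le> x \<and> (0, x) \<in> R}" "(0, Inf {x. 0 \<le> x \<and> (0, x) \<in> R}) \<in> R"
proof -
  have c: "closed {x. (0, x) \<in> R}"
  proof -
    have "closed ((\<lambda>x. (0, x)) -` R)" by (rule closed_vimage[OF root_closed[OF R]]) (intro continuous_intros)
    then show ?thesis by (simp add: vimage_def)
  qed
  have "closed ({..0} \<inter> {x. (0, x) \<in> R})" by (intro closed_Int c) auto
  then have "closed {x. x \<le> 0 \<and> (0, x) \<in> R}" by (simp add: Int_def)
  moreover have "{x. x \<le> 0 \<and> (0, x) \<in> R} \<noteq> {}" using root_edge(2)[OF R, of 0] by force
  ultimately have "Sup {x. x \<le> 0 \<and> (0, x) \<in> R} \<in> {x. x \<le> 0 \<and> (0, x) \<in> R}" by (rule closed_contains_Sup_cl)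
  then show "Sup {x. x \<le> 0 \<and> (0, x) \<in> R} \<le> 0" "(0, Sup {x. x \<le> 0 \<and> (0, x) \<in> R}) \<in> R" by auto
  have "closed ({0..} \<inter> {x. (0, x) \<in> R})" by (intro closed_Int c) auto
  then have "closed {x. 0 \<le> x \<and> (0, x) \<in> R}" by (simp add: Int_def)
  moreover have "{x. 0 \<le> x \<and> (0, x) \<in> R} \<noteq> {}" using root_edge(1)[OF R, of 0] by force
  ultimately have "Inf {x. 0 \<le> x \<and> (0, x) \<in> R} \<in> {x. 0 \<le> x \<and> (0, x) \<in> R}" by (rule closed_contains_Inf_cl)
  then show "0 \<le> Inf {x. 0 \<le> x \<and> (0, x) \<in> R}" "(0, Inf {x. 0 \<le> x \<and> (0, x) \<in> R}) \<in> R" by auto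
qed

lemma regularise_regular:
  assumes R: "root_barrier R" shows "regular_root_barrier (regularise R)"
proof -
  define xm where "xm = Sup {x. x \<le> 0 \<and> (0, x) \<in> R}"
  define xp where "xp = Inf {x. 0 \<le> x \<and> (0, x) \<in> R}"
  note z = initial_zeros[OF R, folded xm_def xp_def]
  have eq: "regularise R = R \<union> {0..} \<times> {..xm} \<union> {0..} \<times> {xp..}" by (simp add: regularise_def xm_def xp_def)
  have "closed (regularise R)" unfolding eq by (intro closed_Un closed_Times root_closed[OF R]) auto
  then have rR: "root_barrier (regularise R)"
    using root_nonneg[OF R] root_up[OF R] root_inf[OF R] root_edge[OF R]
    unfolding root_barrier_def eq by (auto intro: order_trans)
  have 0: "barrier_fun (regularise R) x = 0 \<longleftrightarrow> (0, x) \<in> R \<or> x \<le> xm \<or> xp \<le> x" for x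
  proof -
    have "(0, x) \<in> regularise R \<longleftrightarrow> (0, x) \<in> R \<or> x \<le> xm \<or> xp \<le> x" by (auto simp: eq)
    then show ?thesis using barrier_fun_eq_0_iff[OF rR, of x] by simp
  qed
  \<comment> \<open>Filling in leaves the first zeros in place: a point at or below 0 that is filled
    from the right side must be \<open>xp\<close> itself, which was a zero before.\<close>
  have m: "{x. x \<le> 0 \<and> barrier_fun (regularise R) x = 0} = {..xm}"
  proof (intro set_eqI iffI)
    fix x assume "x \<in> {x. x \<le> 0 \<and> barrier_fun (regularise R) x = 0}"
    then have x: "x \<le> 0" "(0, x) \<in> R \<or> x \<le> xm \<or> xp \<le> x" unfolding 0 by auto
    have "x = xp" if "xp \<le> x" using that x(1) z(3) by simp
    then have "(0, x) \<in> R \<or> x \<le> xm" using x(2) z(4) by auto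
    then show "x \<in> {..xm}" using x(1) unfolding xm_def by (auto intro: Sup_upper)
  next
    fix x assume "x \<in> {..xm}"
    then show "x \<in> {x. x \<le> 0 \<and> barrier_fun (regularise R) x = 0}" unfolding 0 using z(1) by auto
  qed
  have p: "{x. 0 \<le> x \<and> barrier_fun (regularise R) x = 0} = {xp..}"
  proof (intro set_eqI iffI)
    fix x assume "x \<in> {x. 0 \<le> x \<and> barrier_fun (regularise R) x = 0}"
    then have x: "0 \<le> x" "(0, x) \<in> R \<or> x \<le> xm \<or> xp \<le> x" unfolding 0 by auto
    have "x = xm" if "x \<le> xm" using that x(1) z(1) by simp
    then have "(0, x) \<in> R \<or> xp \<le> x" using x(2) z(2) by auto
    then show "x \<in> {xp..}" using x(1) unfolding xp_def by (auto intro: Inf_lower)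
  next
    fix x assume "x \<in> {xp..}"
    then show "x \<in> {x. 0 \<le> x \<and> barrier_fun (regularise R) x = 0}" unfolding 0 using z(3) by auto
  qed
  show ?thesis
    unfolding regular_root_barrier_def Let_def m p
  proof (intro conjI rR allI impI)
    fix x assume "x \<notin> {Sup {..xm}..Inf {xp..}}"
    then have "\<not> xm \<le> x \<or> \<not> x \<le> xp" by simp
    then show "barrier_fun (regularise R) x = 0" unfolding 0 by auto
  qed
qed

text \<open>The functions 1 + cos and 1 + sin take values in [0, 2] and determine the characteristic
  function. The restriction to nonnegative bounded test functions matches
  \<open>first_time_scaled\<close>.\<close>

lemma law_eqI:
  fixes P Q :: "real measure"
  assumes "prob_space P" "prob_space Q" and sets: "sets P = sets borel" "sets Q = sets borel"
    and eq: "\<And>f :: real \<Rightarrow> real. continuous_on UNIV f \<Longrightarrow> (\<And>y. 0 \<le> f y) \<Longrightarrow> (\<And>y. f y \<le> 2) \<Longrightarrow>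
       (\<integral>\<^sup>+y. ennreal (f y) \<partial>P) = (\<integral>\<^sup>+y. ennreal (f y) \<partial>Q)"
  shows "P = Q"
proof (rule Levy_uniqueness)
  have rd: "real_distribution N" if "prob_space N" "sets N = sets borel" for N :: "real measure"
    using that sets_eq_imp_space_eq[OF that(2)] by (simp add: real_distribution_def real_distribution_axioms_def)
  show "real_distribution P" "real_distribution Q" using rd assms by auto
  show "char P = char Q"
  proof
    fix t
    have parts: "integrable N (\<lambda>x. g (t * x))" "(\<integral>x. g (t * x) \<partial>N) = enn2real (\<integral>\<^sup>+x. ennreal (1 + g (t * x)) \<partial>N) - 1"
      if N: "prob_space N" "sets N = sets borel" and g: "continuous_on UNIV g" "\<And>x. \<bar>g x\<bar> \<le> 1" for N :: "real measure" and g :: "real \<Rightarrow> real"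
    proof -
      interpret N: prob_space N by fact
      have [measurable]: "g \<in> borel_measurable borel" by (rule borel_measurable_continuous_onI[OF g(1)])
      have [measurable_cong]: "sets N = sets borel" by fact
      show i: "integrable N (\<lambda>x. g (t * x))" by (rule N.integrable_const_bound[where B=1]) (use g(2) in auto)
      have "(\<integral>\<^sup>+x. ennreal (1 + g (t * x)) \<partial>N) = ennreal (\<integral>x. 1 + g (t * x) \<partial>N)"
      proof (intro nn_integral_eq_integral AE_I2)
        show "0 \<le> 1 + g (t * x)" for x using g(2)[of "t * x"] by linarith
      qed (use i in simp)
      also have "(\<integral>x. 1 + g (t * x) \<partial>N) = 1 + (\<integral>x. g (t * x) \<partial>N)" using i by (simp add: N.prob_space)
      finally have e: "(\<integral>\<^sup>+x. ennreal (1 + g (t * x)) \<partial>N) = ennreal (1 + (\<integral>x. g (t * x) \<partial>N))" .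
      have "0 \<le> (\<integral>x. 1 + g (t * x) \<partial>N)"
      proof (rule Bochner_Integration.integral_nonneg)
        fix x show "0 \<le> 1 + g (t * x)" using g(2)[of "t * x"] by linarith
      qed
      also have "\<dots> = 1 + (\<integral>x. g (t * x) \<partial>N)" using i by (simp add: N.prob_space)
      finally show "(\<integral>x. g (t * x) \<partial>N) = enn2real (\<integral>\<^sup>+x. ennreal (1 + g (t * x)) \<partial>N) - 1"
        unfolding e by simp
    qed
    have gg: "(\<integral>x. g (t * x) \<partial>P) = (\<integral>x. g (t * x) \<partial>Q)"
      if g: "continuous_on UNIV g" "\<And>x. \<bar>g x\<bar> \<le> 1" for g :: "real \<Rightarrow> real"
    proof -
      have "(\<integral>\<^sup>+x. ennreal (1 + g (t * x)) \<partial>P) = (\<integral>\<^sup>+x. ennreal (1 + g (t * x)) \<partial>Q)"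
      proof (rule eq)
        show "continuous_on UNIV (\<lambda>x. 1 + g (t * x))"
          by (intro continuous_intros continuous_on_compose2[OF g(1)]) auto
        fix y show "0 \<le> 1 + g (t * y)" "1 + g (t * y) \<le> 2" using g(2)[of "t * y"] by linarith+
      qed
      then show ?thesis using parts[OF assms(1) sets(1) g] parts[OF assms(2) sets(2) g] by simp
    qed
    have ch: "char N t = Complex (\<integral>x. cos (t * x) \<partial>N) (\<integral>x. sin (t * x) \<partial>N)" if N: "prob_space N" "sets N = sets borel" for N :: "real measure"
    proof -
      interpret N: prob_space N by fact
      have [measurable_cong]: "sets N = sets borel" by fact
      have i: "integrable N (\<lambda>x. iexp (t * x))" by (rule N.integrable_const_bound[where B=1]) auto
      show ?thesis unfolding char_def using integral_Re[OF i] integral_Im[OF i]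
        by (intro complex_eqI) (simp_all add: Re_exp Im_exp)
    qed
    show "char P t = char Q t"
      unfolding ch[OF assms(1) sets(1)] ch[OF assms(2) sets(2)]
      using gg[of cos] gg[of sin] by (simp add: continuous_on_cos continuous_on_sin continuous_on_id)
  qed
qed

context brownian begin

text \<open>A path starting at 0 has to pass x_- or x_+ before it enters an added region, and at
  these levels the original barrier begins at time 0.\<close>

lemma regularise_hitting:
  assumes R: "root_barrier R" and \<omega>: "\<omega> \<in> space M"
  shows "hitting_time B (regularise R) \<omega> = hitting_time B R \<omega>"
proof (rule antisym)
  show "hitting_time B (regularise R) \<omega> \<le> hitting_time B R \<omega>"
    unfolding hitting_time_def by (rule Inf_superset_mono) (auto simp: regularise_def)
  define xm where "xm = Sup {x. x \<le> 0 \<and> (0, x) \<in> R}"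
  define xp where "xp = Inf {x. 0 \<le> x \<and> (0, x) \<in> R}"
  note z = initial_zeros[OF R, folded xm_def xp_def]
  have eq: "regularise R = R \<union> {0..} \<times> {..xm} \<union> {0..} \<times> {xp..}" by (simp add: regularise_def xm_def xp_def)
  show "hitting_time B R \<omega> \<le> hitting_time B (regularise R) \<omega>"
    unfolding hitting_time_def[of B "regularise R"]
  proof (rule Inf_greatest)
    fix w assume "w \<in> {ereal s |s. 0 \<le> s \<and> (ereal s, ereal (B s \<omega>)) \<in> regularise R}"
    then obtain s where s: "w = ereal s" "0 \<le> s" "(ereal s, ereal (B s \<omega>)) \<in> regularise R" by blast
    have cont: "continuous_on {0..s} (\<lambda>u. B u \<omega>)" by (intro continuous_on_subset[OF B_cont[OF \<omega>]]) auto
    have "\<exists>u\<in>{0..s}. (ereal u, ereal (B u \<omega>)) \<in> R"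
    proof -
      consider "(ereal s, ereal (B s \<omega>)) \<in> R" | "ereal (B s \<omega>) \<le> xm" | "xp \<le> ereal (B s \<omega>)" using s(3) unfolding eq by auto
      then show ?thesis
      proof cases
        case 1 then show ?thesis using s(2) by auto
      next
        case 2
        then obtain a where a: "xm = ereal a" using z(1) by (cases xm) auto
        obtain u where u: "0 \<le> u" "u \<le> s" "B u \<omega> = a"
          using IVT2'[of "\<lambda>u. B u \<omega>" s a 0, OF _ _ s(2) cont] 2 a z(1) B_0[OF \<omega>] by auto
        then show ?thesis using root_up[OF R z(2), of "ereal u"] a by auto
      next
        case 3
        then obtain a where a: "xp = ereal a" using z(3) by (cases xp) auto
        obtain u where u: "0 \<le> u" "u \<le> s" "B u \<omega> = a"
          using IVT'[of "\<lambda>u. B u \<omega>" 0 a s, OF _ _ s(2) cont] 3 a z(3) B_0[OF \<omega>] by auto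
        then show ?thesis using root_up[OF R z(4), of "ereal u"] a by auto
      qed
    qed
    then obtain u where u: "0 \<le> u" "u \<le> s" "(ereal u, ereal (B u \<omega>)) \<in> R" by auto
    have "hitting_time B R \<omega> \<le> ereal u" by (rule hitting_time_le[of u B \<omega>, OF u(1,3)])
    also have "\<dots> \<le> w" using s u by simp
    finally show "hitting_time B R \<omega> \<le> w" .
  qed
qed

lemma solves_SEP_cong:
  assumes "\<And>\<omega>. \<omega> \<in> space M \<Longrightarrow> \<tau> \<omega> = \<tau>' \<omega>" and "solves_SEP M F B \<nu> \<tau>"
  shows "solves_SEP M F B \<nu> \<tau>'"
proof -
  note s = solves_SEPD[OF assms(2)]
  have "stop_ext \<tau>'" using s(1) assms(1) unfolding stopping_time_ext_def by (simp cong: conj_cong)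
  moreover have "AE \<omega> in M. \<tau>' \<omega> < \<infinity>" using s(2) AE_space by eventually_elim (simp add: assms(1))
  moreover have "distr M borel (at_time \<tau>') = \<nu>"
    unfolding s(3)[symmetric] by (rule distr_cong) (simp_all add: assms(1))
  moreover have "unif_integrable M (\<lambda>t \<omega>. B (trunc \<tau>' t \<omega>) \<omega>)"
    using s(4) unfolding unif_integrable_def
    by (simp add: assms(1)[symmetric] indicator_def cong: Bochner_Integration.integral_cong Bochner_Integration.integrable_cong)
  ultimately show ?thesis unfolding solves_SEP_def by blast
qed

lemma regular_barrier_exists:
  assumes "integrable_law \<mu>" "(\<integral>y. y \<partial>\<mu>) = 0"
  obtains R where "regular_root_barrier R" "solves_SEP M F B \<mu> (hitting_time B R)"
proof -
  obtain R where R: "root_barrier R" "solves_SEP M F B \<mu> (hitting_time B R)" by (rule root_barrier_exists[OF assms])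
  have "solves_SEP M F B \<mu> (hitting_time B (regularise R))"
    by (rule solves_SEP_cong[OF _ R(2)]) (simp add: regularise_hitting[OF R(1)])
  with regularise_regular[OF R(1)] show ?thesis by (rule that)
qed

text \<open>Both hitting times are written with the same function \<open>hit_dist R\<close>, once
  evaluated at rescaled coordinates; this is the form compared in
  \<open>first_time_scaled\<close>.\<close>

lemma scaled_trunc_law:
  assumes R: "root_barrier R" and l: "0 < l" and t: "0 < t"
  shows "distr M borel (\<lambda>\<omega>. B (trunc (hitting_time B (scale_barrier l R)) (l * t) \<omega>) \<omega>)
     = distr M borel (\<lambda>\<omega>. sqrt l * B (trunc (hitting_time B R) t \<omega>) \<omega>)"
proof -
  let ?\<tau> = "hitting_time B R" and ?\<tau>' = "hitting_time B (scale_barrier l R)"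
  note cR = root_closed[OF R]
  have \<tau>: "?\<tau> \<omega> = first_time (\<lambda>s. hit_dist R (s, B s \<omega>))" for \<omega> by (rule hitting_time_eq[OF cR])
  have \<tau>': "?\<tau>' \<omega> = first_time (\<lambda>s. hit_dist R (s / l, B s \<omega> / sqrt l))" for \<omega>
    unfolding hitting_time_def first_time_def using l by (simp add: scale_barrier_def hit_dist_le_0_iff[OF cR])
  note st = stop_ext_hitting[OF cR] stop_ext_hitting[OF root_closed[OF scale_barrier_root[OF R l]]]
  have m[measurable]: "(\<lambda>\<omega>. B (trunc ?\<tau> t \<omega>) \<omega>) \<in> borel_measurable M" "(\<lambda>\<omega>. B (trunc ?\<tau>' (l * t) \<omega>) \<omega>) \<in> borel_measurable M"
    using trunc_measurable[OF st(1)] trunc_measurable[OF st(2)] t l by auto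
  let ?P = "distr M borel (\<lambda>\<omega>. B (trunc ?\<tau>' (l * t) \<omega>) \<omega> / sqrt l)" and ?Q = "distr M borel (\<lambda>\<omega>. B (trunc ?\<tau> t \<omega>) \<omega>)"
  have "?P = ?Q"
  proof (rule law_eqI)
    fix f :: "real \<Rightarrow> real" assume f: "continuous_on UNIV f" "\<And>y. 0 \<le> f y" "\<And>y. f y \<le> 2"
    have [measurable]: "f \<in> borel_measurable borel" by (rule borel_measurable_continuous_onI[OF f(1)])
    have "(\<integral>\<^sup>+y. ennreal (f y) \<partial>?P) = (\<integral>\<^sup>+\<omega>. ennreal (f (B (trunc ?\<tau>' (l * t) \<omega>) \<omega> / sqrt l)) \<partial>M)"
      by (rule nn_integral_distr) auto
    also have "\<dots> = (\<integral>\<^sup>+\<omega>. ennreal (f (B (trunc ?\<tau> t \<omega>) \<omega>)) \<partial>M)"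
      unfolding \<tau> \<tau>' by (rule first_time_scaled[OF hit_dist_continuous t l f])
    also have "\<dots> = (\<integral>\<^sup>+y. ennreal (f y) \<partial>?Q)"
      by (rule nn_integral_distr[symmetric]) auto
    finally show "(\<integral>\<^sup>+y. ennreal (f y) \<partial>?P) = (\<integral>\<^sup>+y. ennreal (f y) \<partial>?Q)" .
  qed (auto intro: prob_space_distr)
  then have "distr ?P borel (\<lambda>y. sqrt l * y) = distr ?Q borel (\<lambda>y. sqrt l * y)" by simp
  then show ?thesis using l by (simp add: distr_distr o_def)
qed

lemma trunc_eventually_at_top:
  assumes "\<omega> \<in> space M" "stop_ext \<tau>" "\<tau> \<omega> < \<infinity>" and a: "filterlim a at_top sequentially"
  shows "\<forall>\<^sub>F n in sequentially. trunc \<tau> (a n) \<omega> = real_of_ereal (\<tau> \<omega>)"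
proof -
  obtain r where r: "\<tau> \<omega> = ereal r" using assms stop_ext_nonneg[OF assms(2,1)] by (cases "\<tau> \<omega>") auto
  have "\<forall>\<^sub>F n in sequentially. r \<le> a n" using a unfolding filterlim_at_top by blast
  then show ?thesis by eventually_elim (simp add: r min_def)
qed

lemma char_at_time_tendsto:
  assumes \<tau>: "stop_ext \<tau>" "AE \<omega> in M. \<tau> \<omega> < \<infinity>" and a: "filterlim a at_top sequentially" "\<And>n. 0 \<le> a n"
  shows "(\<lambda>n. \<integral>\<omega>. iexp (u * B (trunc \<tau> (a n) \<omega>) \<omega>) \<partial>M) \<longlonglongrightarrow> (\<integral>\<omega>. iexp (u * at_time \<tau> \<omega>) \<partial>M)"
proof (rule integral_dominated_convergence[where w="\<lambda>_. 1"])
  show "AE \<omega> in M. (\<lambda>n. iexp (u * B (trunc \<tau> (a n) \<omega>) \<omega>)) \<longlonglongrightarrow> iexp (u * at_time \<tau> \<omega>)"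
    using \<tau>(2) AE_space
  proof eventually_elim
    case (elim \<omega>)
    from trunc_eventually_at_top[OF elim(2) \<tau>(1) elim(1) a(1)] show ?case
      by (intro tendsto_eventually) (auto elim: eventually_mono)
  qed
qed (use at_time_measurable[OF \<tau>(1)] trunc_measurable[OF \<tau>(1) a(2)] in measurable)

text \<open>Only the laws at truncated times are transferred, as the two hitting times are not
  compared path by path. These laws decide uniform integrability, which gives finiteness, and the
  terminal law follows by letting the truncation time grow.\<close>

lemma solves_SEP_scaled:
  assumes R: "root_barrier R" and l: "0 < l" and sep: "solves_SEP M F B \<mu> (hitting_time B R)" and sets: "sets \<mu> = sets borel"
  shows "solves_SEP M F B (scaled_measure \<mu> l) (hitting_time B (scale_barrier l R))"
proof -
  let ?\<tau> = "hitting_time B R" and ?\<tau>' = "hitting_time B (scale_barrier l R)"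
  let ?X = "\<lambda>t \<omega>. B (trunc ?\<tau> t \<omega>) \<omega>" and ?X' = "\<lambda>t \<omega>. B (trunc ?\<tau>' t \<omega>) \<omega>"
  note s = solves_SEPD[OF sep]
  have st': "stop_ext ?\<tau>'" by (rule stop_ext_hitting[OF root_closed[OF scale_barrier_root[OF R l]]])
  have sl: "0 < sqrt l" using l by simp
  note m = trunc_measurable[OF s(1)] and m' = trunc_measurable[OF st']
  have tr: "(\<integral>\<omega>. f (?X' t \<omega>) \<partial>M) = (\<integral>\<omega>. f (sqrt l * ?X (t / l) \<omega>) \<partial>M)"
    if t: "0 < t" and f[measurable]: "f \<in> borel_measurable borel" for t and f :: "real \<Rightarrow> 'b :: {banach, second_countable_topology}"
  proof -
    have tl: "0 < t / l" "l * (t / l) = t" using t l by auto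
    note [measurable] = m[OF less_imp_le[OF tl(1)]] m'[OF less_imp_le[OF t]]
    have "(\<integral>\<omega>. f (?X' t \<omega>) \<partial>M) = (\<integral>y. f y \<partial>distr M borel (?X' t))" by (rule integral_distr[symmetric]) auto
    also have "distr M borel (?X' t) = distr M borel (\<lambda>\<omega>. sqrt l * ?X (t / l) \<omega>)"
      using scaled_trunc_law[OF R l tl(1)] unfolding tl(2) .
    also have "(\<integral>y. f y \<partial>\<dots>) = (\<integral>\<omega>. f (sqrt l * ?X (t / l) \<omega>) \<partial>M)" by (rule integral_distr) auto
    finally show ?thesis .
  qed
  \<comment> \<open>Time 0 is treated apart, as \<open>scaled_trunc_law\<close> is about positive
    times.\<close>
  have X0: "trunc ?\<tau>' 0 \<omega> = 0" for \<omega> using hitting_time_nonneg[of B "scale_barrier l R" \<omega>] by (simp add: min_def zero_ereal_def[symmetric])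
  have tail: "\<exists>K. \<forall>t\<ge>0. (\<integral>\<omega>. \<bar>?X' t \<omega>\<bar> * indicator {\<omega>. K < \<bar>?X' t \<omega>\<bar>} \<omega> \<partial>M) < e" if e: "0 < e" for e
  proof -
    have "0 < e / sqrt l" using e sl by simp
    then obtain K where K: "\<And>t. 0 \<le> t \<Longrightarrow> (\<integral>\<omega>. \<bar>?X t \<omega>\<bar> * indicator {\<omega>. K < \<bar>?X t \<omega>\<bar>} \<omega> \<partial>M) < e / sqrt l"
      using s(4) unfolding unif_integrable_def by blast
    have "(\<integral>\<omega>. \<bar>?X' t \<omega>\<bar> * indicator {\<omega>. sqrt l * K < \<bar>?X' t \<omega>\<bar>} \<omega> \<partial>M) < e" if t: "0 \<le> t" for t
    proof (cases "t = 0")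
      case True
      have "(\<integral>\<omega>. \<bar>?X' t \<omega>\<bar> * indicator {\<omega>. sqrt l * K < \<bar>?X' t \<omega>\<bar>} \<omega> \<partial>M) = (\<integral>\<omega>. 0 \<partial>M)"
        by (intro Bochner_Integration.integral_cong) (auto simp: True X0 B_0)
      then show ?thesis using e by simp
    next
      case False
      then have t: "0 < t" using t by simp
      let ?f = "\<lambda>y::real. \<bar>y\<bar> * indicator {y. sqrt l * K < \<bar>y\<bar>} y"
      have "(\<integral>\<omega>. \<bar>?X' t \<omega>\<bar> * indicator {\<omega>. sqrt l * K < \<bar>?X' t \<omega>\<bar>} \<omega> \<partial>M) = (\<integral>\<omega>. ?f (?X' t \<omega>) \<partial>M)" by (simp add: indicator_def)
      also have "\<dots> = (\<integral>\<omega>. ?f (sqrt l * ?X (t / l) \<omega>) \<partial>M)" by (rule tr[OF t]) measurable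
      also have "\<dots> = (\<integral>\<omega>. sqrt l * (\<bar>?X (t / l) \<omega>\<bar> * indicator {\<omega>. K < \<bar>?X (t / l) \<omega>\<bar>} \<omega>) \<partial>M)"
        using sl by (intro Bochner_Integration.integral_cong) (auto simp: indicator_def abs_mult)
      also have "\<dots> = sqrt l * (\<integral>\<omega>. \<bar>?X (t / l) \<omega>\<bar> * indicator {\<omega>. K < \<bar>?X (t / l) \<omega>\<bar>} \<omega> \<partial>M)" by simp
      also have "\<dots> < sqrt l * (e / sqrt l)" using K[of "t / l"] t l sl by (intro mult_strict_left_mono) auto
      also have "\<dots> = e" using l by simp
      finally show ?thesis .
    qed
    then show ?thesis by blast
  qed
  have ui: "unif_integrable M ?X'"
    unfolding unif_integrable_def using integrable_trunc[OF st'] tail by blast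
  have fin: "AE \<omega> in M. ?\<tau>' \<omega> < \<infinity>"
  proof -
    obtain K where K: "\<And>t. 0 \<le> t \<Longrightarrow> (\<integral>\<omega>. \<bar>?X' t \<omega>\<bar> * indicator {\<omega>. K < \<bar>?X' t \<omega>\<bar>} \<omega> \<partial>M) < 1"
      using tail[of 1] by auto
    show ?thesis
    proof (rule stop_ext_finite_if_bounded[OF st'])
      fix t :: real assume t: "0 \<le> t"
      note i = integrable_trunc[OF st' t]
      have i2: "integrable M (\<lambda>\<omega>. \<bar>?X' t \<omega>\<bar> * indicator {\<omega>. K < \<bar>?X' t \<omega>\<bar>} \<omega>)"
      proof (rule Bochner_Integration.integrable_bound[OF i])
        show "(\<lambda>\<omega>. \<bar>?X' t \<omega>\<bar> * indicator {\<omega>. K < \<bar>?X' t \<omega>\<bar>} \<omega>) \<in> borel_measurable M"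
          using m'[OF t] by measurable
      qed (auto simp: indicator_def)
      have "expectation (\<lambda>\<omega>. \<bar>?X' t \<omega>\<bar>) \<le> expectation (\<lambda>\<omega>. \<bar>?X' t \<omega>\<bar> * indicator {\<omega>. K < \<bar>?X' t \<omega>\<bar>} \<omega> + max K 0)"
        by (rule integral_mono) (use i i2 in \<open>auto simp: indicator_def\<close>)
      also have "\<dots> = expectation (\<lambda>\<omega>. \<bar>?X' t \<omega>\<bar> * indicator {\<omega>. K < \<bar>?X' t \<omega>\<bar>} \<omega>) + max K 0"
        using i2 by (simp add: prob_space)
      also have "\<dots> \<le> 1 + max K 0" using K[OF t] by simp
      finally show "expectation (\<lambda>\<omega>. \<bar>?X' t \<omega>\<bar>) \<le> 1 + max K 0" .
    qed
  qed
  have law: "distr M borel (at_time ?\<tau>') = scaled_measure \<mu> l"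
  proof (rule Levy_uniqueness)
    interpret \<mu>: prob_space \<mu> using s(3) prob_space_distr[OF at_time_measurable[OF s(1)]] by simp
    have [measurable_cong]: "sets \<mu> = sets borel" by fact
    show "real_distribution (distr M borel (at_time ?\<tau>'))" by (rule real_distribution_distr[OF at_time_measurable[OF st']])
    show "real_distribution (scaled_measure \<mu> l)" unfolding scaled_measure_def by (rule \<mu>.real_distribution_distr) simp
    show "char (distr M borel (at_time ?\<tau>')) = char (scaled_measure \<mu> l)"
    proof
      fix u
      have a: "filterlim (\<lambda>n. real (Suc n)) at_top sequentially"
        by (rule filterlim_compose[OF filterlim_real_sequentially filterlim_Suc])
      have a': "filterlim (\<lambda>n. l * real (Suc n)) at_top sequentially"
        by (rule filterlim_tendsto_pos_mult_at_top[OF tendsto_const l a])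
      have 1: "(\<lambda>n. \<integral>\<omega>. iexp (u * ?X' (l * real (Suc n)) \<omega>) \<partial>M) \<longlonglongrightarrow> (\<integral>\<omega>. iexp (u * at_time ?\<tau>' \<omega>) \<partial>M)"
        by (rule char_at_time_tendsto[OF st' fin a']) (use l in simp)
      have 2: "(\<lambda>n. \<integral>\<omega>. iexp (u * sqrt l * ?X (real (Suc n)) \<omega>) \<partial>M) \<longlonglongrightarrow> (\<integral>\<omega>. iexp (u * sqrt l * at_time ?\<tau> \<omega>) \<partial>M)"
        by (rule char_at_time_tendsto[OF s(1,2) a]) simp
      have "(\<integral>\<omega>. iexp (u * ?X' (l * real (Suc n)) \<omega>) \<partial>M) = (\<integral>\<omega>. iexp (u * sqrt l * ?X (real (Suc n)) \<omega>) \<partial>M)" for n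
      proof -
        have "0 < l * real (Suc n)" using l by simp
        from tr[OF this, of "\<lambda>y. iexp (u * y)"] l show ?thesis by (simp add: mult.assoc)
      qed
      then have "(\<integral>\<omega>. iexp (u * at_time ?\<tau>' \<omega>) \<partial>M) = (\<integral>\<omega>. iexp (u * sqrt l * at_time ?\<tau> \<omega>) \<partial>M)"
        using LIMSEQ_unique[OF 1] 2 by simp
      moreover have "char (distr M borel (at_time ?\<tau>')) u = (\<integral>\<omega>. iexp (u * at_time ?\<tau>' \<omega>) \<partial>M)"
        unfolding char_def by (rule integral_distr[OF at_time_measurable[OF st']]) auto
      moreover have "char (scaled_measure \<mu> l) u = (\<integral>\<omega>. iexp (u * sqrt l * at_time ?\<tau> \<omega>) \<partial>M)"
      proof -
        have "char (scaled_measure \<mu> l) u = (\<integral>y. iexp (u * (sqrt l * y)) \<partial>\<mu>)"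
          unfolding char_def scaled_measure_def by (rule integral_distr) auto
        also have "\<dots> = (\<integral>y. iexp (u * (sqrt l * y)) \<partial>distr M borel (at_time ?\<tau>))" unfolding s(3) ..
        also have "\<dots> = (\<integral>\<omega>. iexp (u * (sqrt l * at_time ?\<tau> \<omega>)) \<partial>M)"
          by (rule integral_distr[OF at_time_measurable[OF s(1)]]) auto
        finally show ?thesis by (simp only: mult.assoc)
      qed
      ultimately show "char (distr M borel (at_time ?\<tau>')) u = char (scaled_measure \<mu> l) u" by simp
    qed
  qed
  show ?thesis unfolding solves_SEP_def using st' fin law ui by blast
qed

end

lemma scaled_measure_1: "sets \<mu> = sets borel \<Longrightarrow> scaled_measure \<mu> 1 = \<mu>"
  unfolding scaled_measure_def real_sqrt_one mult_1 by (rule distr_id2) simp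

context brownian begin

lemma root_barrier_fun_scaled:
  assumes \<mu>: "integrable_law \<mu>" and mean: "(\<integral>y. y \<partial>\<mu>) = 0" and l: "0 < l"
  shows "root_barrier_fun M F B \<mu> l x = ereal l * root_barrier_fun M F B \<mu> 1 (x / ereal (sqrt l))"
proof -
  interpret L: integrable_law \<mu> by fact
  obtain R where R: "regular_root_barrier R" "solves_SEP M F B \<mu> (hitting_time B R)"
    by (rule regular_barrier_exists[OF \<mu> mean])
  have rR: "root_barrier R" using R(1) by (simp add: regular_root_barrier_def)
  have 1: "(THE R. regular_root_barrier R \<and> solves_SEP M F B (scaled_measure \<mu> 1) (hitting_time B R)) = R"
    unfolding scaled_measure_1[OF L.sets_law]
  proof (rule the_equality)
    show "S = R" if "regular_root_barrier S \<and> solves_SEP M F B \<mu> (hitting_time B S)" for S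
      by (rule regular_barrier_unique[OF conjunct1[OF that] conjunct2[OF that] R L.integrable_law])
  qed (intro conjI R)
  have int: "integrable (scaled_measure \<mu> l) (\<lambda>x. x)"
  proof -
    have "(\<lambda>y. sqrt l * y) \<in> measurable \<mu> borel"
      unfolding measurable_cong_sets[OF L.sets_law refl] by measurable
    from integrable_distr_eq[OF this, of "\<lambda>x. x"] show ?thesis
      unfolding scaled_measure_def using integrable_mult_right[OF L.integrable_law, of "sqrt l"] by simp
  qed
  note S = scale_barrier_regular[OF R(1) l] solves_SEP_scaled[OF rR l R(2) L.sets_law]
  have 2: "(THE R. regular_root_barrier R \<and> solves_SEP M F B (scaled_measure \<mu> l) (hitting_time B R)) = scale_barrier l R"
  proof (rule the_equality)
    show "R' = scale_barrier l R"
      if "regular_root_barrier R' \<and> solves_SEP M F B (scaled_measure \<mu> l) (hitting_time B R')" for R'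
      by (rule regular_barrier_unique[OF conjunct1[OF that] conjunct2[OF that] S int])
  qed (intro conjI S)
  show ?thesis unfolding root_barrier_fun_def 1 2 by (rule barrier_fun_scale[OF l])
qed

end

section \<open>Scaling of the stopping problem\<close>

text \<open>Multiplication by a positive finite constant is invertible, so it commutes with
  infima.\<close>

lemma ennreal_INF_mult_left:
  fixes f :: "'b \<Rightarrow> ennreal" assumes "0 < c"
  shows "(INF i\<in>I. ennreal c * f i) = ennreal c * (INF i\<in>I. f i)"
proof (rule antisym)
  have c: "ennreal c * (ennreal (1 / c) * a) = a" for a
    using assms by (simp add: mult.assoc[symmetric] ennreal_mult[symmetric])
  have c': "ennreal (1 / c) * (ennreal c * a) = a" for a
    using assms by (simp add: mult.assoc[symmetric] ennreal_mult[symmetric])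
  have "ennreal (1 / c) * (INF i\<in>I. ennreal c * f i) \<le> (INF i\<in>I. f i)"
  proof (rule INF_greatest)
    fix i assume "i \<in> I"
    then have "ennreal (1 / c) * (INF i\<in>I. ennreal c * f i) \<le> ennreal (1 / c) * (ennreal c * f i)"
      by (intro mult_left_mono INF_lower) auto
    then show "ennreal (1 / c) * (INF i\<in>I. ennreal c * f i) \<le> f i" unfolding c' .
  qed
  from mult_left_mono[OF this, of "ennreal c"]
  show "(INF i\<in>I. ennreal c * f i) \<le> ennreal c * (INF i\<in>I. f i)" unfolding c by simp
  show "ennreal c * (INF i\<in>I. f i) \<le> (INF i\<in>I. ennreal c * f i)"
    by (intro INF_greatest mult_left_mono INF_lower) auto
qed

text \<open>The Snell envelope of the discretised problem with the sign reversed, so that suprema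
  become minima and all values are nonnegative.\<close>

fun grid_value :: "(real \<Rightarrow> real) \<Rightarrow> real \<Rightarrow> nat \<Rightarrow> real \<Rightarrow> ennreal" where
  "grid_value w h 0 y = ennreal \<bar>y\<bar>"
| "grid_value w h (Suc i) y = min (ennreal (w y)) (heat h (grid_value w h i) y)"

lemma grid_value_measurable:
  assumes [measurable]: "w \<in> borel_measurable borel" shows "grid_value w h i \<in> borel_measurable borel"
proof (induction i)
  case 0
  then show ?case unfolding grid_value.simps(1)[abs_def] by measurable
next
  case (Suc i)
  note [measurable] = Suc.IH
  show ?case unfolding grid_value.simps(2)[abs_def] by measurable
qed

lemma grid_value_scale:
  assumes l: "0 < l" and w: "w \<in> borel_measurable borel"
  shows "grid_value (\<lambda>y. sqrt l * w (y / sqrt l)) (l * h) i y = ennreal (sqrt l) * grid_value w h i (y / sqrt l)"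
proof (induction i arbitrary: y)
  case 0
  then show ?case using l by (simp add: ennreal_mult[symmetric])
next
  case (Suc i)
  note [measurable] = grid_value_measurable[OF w]
  have "grid_value (\<lambda>y. sqrt l * w (y / sqrt l)) (l * h) i = (\<lambda>y. ennreal (sqrt l) * grid_value w h i (y / sqrt l))"
    using Suc by (intro ext)
  then have "heat (l * h) (grid_value (\<lambda>y. sqrt l * w (y / sqrt l)) (l * h) i) y
    = heat h (\<lambda>y. ennreal (sqrt l) * grid_value w h i y) (y / sqrt l)"
    using heat_scale[OF l, of h "\<lambda>y. ennreal (sqrt l) * grid_value w h i y" y] by simp
  also have "\<dots> = ennreal (sqrt l) * heat h (grid_value w h i) (y / sqrt l)"
    unfolding heat_def by (rule nn_integral_cmult) measurable
  finally have e: "heat (l * h) (grid_value (\<lambda>y. sqrt l * w (y / sqrt l)) (l * h) i) y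
    = ennreal (sqrt l) * heat h (grid_value w h i) (y / sqrt l)" .
  have m: "min (ennreal (sqrt l) * a) (ennreal (sqrt l) * b) = ennreal (sqrt l) * min a b" for a b
    by (cases "a \<le> b") (simp_all add: min_absorb1 min_absorb2 mult_left_mono)
  show ?case unfolding grid_value.simps e ennreal_mult''[OF real_sqrt_ge_zero[OF less_imp_le[OF l]]]
    by (cases "0 \<le> w (y / sqrt l)") (use l m[of "ennreal (w (y / sqrt l))"] in
      \<open>simp_all add: ennreal_mult' ennreal_neg mult_nonneg_nonpos\<close>)
qed

lemma potential_return: "potential (return borel 0) y = - \<bar>y\<bar>"
  unfolding potential_def by (subst integral_return) auto

context integrable_law begin

lemma potential_scaled: "potential (scaled_measure \<mu> l) y = - (\<integral>z. \<bar>y - sqrt l * z\<bar> \<partial>\<mu>)"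
proof -
  have "(\<lambda>z. sqrt l * z) \<in> measurable \<mu> borel" by measurable
  then show ?thesis unfolding potential_def scaled_measure_def by (subst integral_distr) auto
qed

lemma integrable_abs_diff: "integrable \<mu> (\<lambda>z. \<bar>y - sqrt l * z\<bar>)"
  by (intro integrable_abs Bochner_Integration.integrable_diff integrable_mult_right integrable_law integrable_const)

lemma potential_scaled_scale:
  assumes "0 < l"
  shows "potential (scaled_measure \<mu> l) y = sqrt l * potential (scaled_measure \<mu> 1) (y / sqrt l)"
proof -
  have "\<bar>y - sqrt l * z\<bar> = sqrt l * \<bar>y / sqrt l - z\<bar>" for z
  proof -
    have "y - sqrt l * z = sqrt l * (y / sqrt l - z)" using assms by (simp add: right_diff_distrib)
    then show ?thesis using assms by (simp add: abs_mult)
  qed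
  then show ?thesis by (simp add: potential_scaled)
qed

text \<open>Jensen's inequality for a centred law. In the cost formulation it says that, at a given
  position, stopping at the horizon costs no more than stopping before it.\<close>

lemma abs_le_potential:
  assumes "(\<integral>y. y \<partial>\<mu>) = 0" shows "\<bar>y\<bar> \<le> - potential (scaled_measure \<mu> l) y"
proof -
  have "(\<integral>z. y - sqrt l * z \<partial>\<mu>) = y"
    using assms integrable_law by (simp add: prob_space)
  then have "\<bar>y\<bar> = \<bar>\<integral>z. y - sqrt l * z \<partial>\<mu>\<bar>" by simp
  also have "\<dots> \<le> (\<integral>z. \<bar>y - sqrt l * z\<bar> \<partial>\<mu>)" by (rule integral_abs_bound)
  finally show ?thesis by (simp add: potential_scaled)
qed

lemma potential_lipschitz:
  "potential (scaled_measure \<mu> l) y - potential (scaled_measure \<mu> l) y' \<le> \<bar>y - y'\<bar>"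
proof -
  have "(\<integral>z. \<bar>y' - sqrt l * z\<bar> \<partial>\<mu>) \<le> (\<integral>z. \<bar>y - sqrt l * z\<bar> + \<bar>y - y'\<bar> \<partial>\<mu>)"
    by (intro integral_mono integrable_abs_diff Bochner_Integration.integrable_add integrable_const) auto
  also have "\<dots> = (\<integral>z. \<bar>y - sqrt l * z\<bar> \<partial>\<mu>) + \<bar>y - y'\<bar>"
    using integrable_abs_diff[of y l] by (simp add: prob_space)
  finally show ?thesis by (simp add: potential_scaled)
qed

end

section \<open>The value function as a limit of grid values\<close>

context brownian begin

definition cost :: "(real \<Rightarrow> real) \<Rightarrow> ereal \<Rightarrow> real \<Rightarrow> ('a \<Rightarrow> real) \<Rightarrow> 'a \<Rightarrow> real" where
  "cost w t x \<sigma> \<omega> = (if ereal (\<sigma> \<omega>) < t then w (x + B (\<sigma> \<omega>) \<omega>) else \<bar>x + B (\<sigma> \<omega>) \<omega>\<bar>)"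

text \<open>The negative of u. The nonnegative integral is defined whether or not the stopped value
  is integrable, which matters for an infinite horizon.\<close>

definition stop_value :: "(real \<Rightarrow> real) \<Rightarrow> ereal \<Rightarrow> real \<Rightarrow> ennreal" where
  "stop_value w t x = (INF \<sigma>\<in>{\<sigma>. stop_real \<sigma> \<and> (\<forall>\<omega>\<in>space M. ereal (\<sigma> \<omega>) \<le> t)}. \<integral>\<^sup>+\<omega>. ennreal (cost w t x \<sigma> \<omega>) \<partial>M)"

lemma u_real_eq_stop_value:
  "u_real M F B \<mu> l t x = - enn2ereal (stop_value (\<lambda>y. - potential (scaled_measure \<mu> l) y) t x)"
proof -
  have "expect_nonpos M (\<lambda>\<omega>. ereal (
           potential (return borel 0) (x + B (\<sigma> \<omega>) \<omega>)
           + (potential (scaled_measure \<mu> l) (x + B (\<sigma> \<omega>) \<omega>)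
              - potential (return borel 0) (x + B (\<sigma> \<omega>) \<omega>))
             * indicator {\<omega>. ereal (\<sigma> \<omega>) < t} \<omega>))
    = - enn2ereal (\<integral>\<^sup>+\<omega>. ennreal (cost (\<lambda>y. - potential (scaled_measure \<mu> l) y) t x \<sigma> \<omega>) \<partial>M)" for \<sigma>
    unfolding expect_nonpos_def potential_return cost_def
    by (intro arg_cong[where f="\<lambda>v. - enn2ereal v"] nn_integral_cong) simp
  then show ?thesis
    unfolding u_real_def stop_value_def by (simp only: ereal_SUP_uminus_eq Inf_ennreal.rep_eq image_image)
qed

lemma stop_value_0: "stop_value w 0 x = ennreal \<bar>x\<bar>"
proof -
  have "(\<integral>\<^sup>+\<omega>. ennreal (cost w 0 x \<sigma> \<omega>) \<partial>M) = ennreal \<bar>x\<bar>"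
    if \<sigma>: "stop_real \<sigma>" "\<forall>\<omega>\<in>space M. ereal (\<sigma> \<omega>) \<le> 0" for \<sigma>
  proof -
    have "\<sigma> \<omega> = 0" if "\<omega> \<in> space M" for \<omega>
      using \<sigma>(2) stop_real_nonneg[OF \<sigma>(1) that] that by (force simp: zero_ereal_def)
    then have "(\<integral>\<^sup>+\<omega>. ennreal (cost w 0 x \<sigma> \<omega>) \<partial>M) = (\<integral>\<^sup>+\<omega>. ennreal \<bar>x\<bar> \<partial>M)"
      by (intro nn_integral_cong) (simp add: cost_def B_0 zero_ereal_def)
    then show ?thesis by (simp add: emeasure_space_1)
  qed
  then have "(\<lambda>\<sigma>. \<integral>\<^sup>+\<omega>. ennreal (cost w 0 x \<sigma> \<omega>) \<partial>M) ` {\<sigma>. stop_real \<sigma> \<and> (\<forall>\<omega>\<in>space M. ereal (\<sigma> \<omega>) \<le> 0)}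
    = {ennreal \<bar>x\<bar>}"
    using stop_real_const[of 0] by (auto simp: zero_ereal_def intro!: image_eqI[where x="\<lambda>_. 0"])
  then show ?thesis unfolding stop_value_def by simp
qed

text \<open>The index counts the steps left, so 0 is the horizon.\<close>

definition grid_cost :: "(real \<Rightarrow> real) \<Rightarrow> nat \<Rightarrow> real \<Rightarrow> ennreal" where
  "grid_cost w i y = ennreal (if i = 0 then \<bar>y\<bar> else w y)"

text \<open>The recursion takes a minimum, so at each step it lies below the option chosen by any
  strategy.\<close>

lemma grid_value_le:
  fixes \<kappa> :: "'a \<Rightarrow> nat"
  assumes w: "w \<in> borel_measurable borel" and h: "0 \<le> h"
    and \<kappa>: "\<And>\<omega>. \<omega> \<in> space M \<Longrightarrow> \<kappa> \<omega> \<le> N" "\<And>k. k < N \<Longrightarrow> {\<omega>\<in>space M. k < \<kappa> \<omega>} \<in> sets (F (real k * h))"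
  shows "grid_value w h N x \<le> (\<integral>\<^sup>+\<omega>. grid_cost w (N - \<kappa> \<omega>) (x + B (real (\<kappa> \<omega>) * h) \<omega>) \<partial>M)"
proof (rule dp_compare[where rel="(\<le>)" and W="grid_value w h" and c="grid_cost w"])
  show "grid_cost w i \<in> borel_measurable borel" for i
    unfolding grid_cost_def[abs_def] using w by measurable
  show "grid_value w h (N - k) y \<le> grid_cost w (N - k) y" if "k < N" for k y
    unfolding Suc_diff_Suc[OF that, symmetric] by (simp add: grid_cost_def)
  show "grid_value w h (N - k) y \<le> heat h (grid_value w h (N - Suc k)) y" if "k < N" for k y
    unfolding Suc_diff_Suc[OF that, symmetric] by simp
  show "grid_value w h i \<in> borel_measurable borel" for i by (rule grid_value_measurable[OF w])
qed (use h \<kappa> in \<open>simp_all add: grid_cost_def\<close>)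

text \<open>The first grid time at which paying \<open>w\<close> costs no more than continuing has
  expected cost at most the grid value, and it is admissible in the continuous problem.\<close>

lemma stop_value_le_grid:
  assumes w: "w \<in> borel_measurable borel" and t: "0 < t"
  shows "stop_value w (ereal t) x \<le> grid_value w (t / 2 ^ n) (2 ^ n) x"
proof -
  define N :: nat where "N = 2 ^ n"
  define h where "h = t / 2 ^ n"
  have h: "0 < h" and Nh: "real N * h = t" using t by (simp_all add: h_def N_def)
  define Y where "Y k \<omega> = x + B (real k * h) \<omega>" for k \<omega>
  define P where "P k \<omega> \<longleftrightarrow> ennreal (w (Y k \<omega>)) \<le> heat h (grid_value w h (N - Suc k)) (Y k \<omega>)" for k \<omega>
  define \<kappa> where "\<kappa> \<omega> = (LEAST k. k = N \<or> P k \<omega>)" for \<omega>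
  have \<kappa>_le: "\<kappa> \<omega> \<le> N" for \<omega> unfolding \<kappa>_def by (rule Least_le) simp
  have \<kappa>P: "P (\<kappa> \<omega>) \<omega>" if "\<kappa> \<omega> < N" for \<omega>
    using LeastI[of "\<lambda>k. k = N \<or> P k \<omega>" N] that unfolding \<kappa>_def by auto
  have before: "\<not> P k \<omega>" if "k < \<kappa> \<omega>" for k \<omega>
    using not_less_Least[of k "\<lambda>k. k = N \<or> P k \<omega>"] that unfolding \<kappa>_def by auto
  have less_iff: "k < \<kappa> \<omega> \<longleftrightarrow> (\<forall>j\<in>{..k}. \<not> P j \<omega>)" if "k < N" for k \<omega>
  proof
    assume "k < \<kappa> \<omega>" then show "\<forall>j\<in>{..k}. \<not> P j \<omega>" using before by simp
  next
    assume *: "\<forall>j\<in>{..k}. \<not> P j \<omega>"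
    show "k < \<kappa> \<omega>"
    proof (rule ccontr)
      assume "\<not> k < \<kappa> \<omega>"
      then have "\<kappa> \<omega> \<le> k" "\<kappa> \<omega> < N" using that by simp_all
      then show False using bspec[OF *, of "\<kappa> \<omega>"] \<kappa>P[of \<omega>] by simp
    qed
  qed
  have sets: "{\<omega>\<in>space M. k < \<kappa> \<omega>} \<in> sets (F (real k * h))" if "k < N" for k
  proof -
    have "{\<omega>\<in>space (F (real k * h)). \<forall>j\<in>{..k}. \<not> P j \<omega>} \<in> sets (F (real k * h))"
    proof (intro sets.sets_Collect_finite_All sets.sets_Collect_neg)
      fix j assume "j \<in> {..k}"
      then have "real j * h \<le> real k * h" using h by simp
      then have [measurable]: "B (real j * h) \<in> borel_measurable (F (real k * h))" using h by (intro B_adapted) auto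
      note [measurable] = w grid_value_measurable[OF w]
      show "{\<omega>\<in>space (F (real k * h)). P j \<omega>} \<in> sets (F (real k * h))" unfolding P_def Y_def by measurable
    qed simp
    then show ?thesis using less_iff[OF that] h by (simp add: space_F)
  qed
  have "grid_value w h N x \<ge> (\<integral>\<^sup>+\<omega>. grid_cost w (N - \<kappa> \<omega>) (x + B (real (\<kappa> \<omega>) * h) \<omega>) \<partial>M)"
  proof (rule dp_compare[where rel="(\<ge>)" and W="grid_value w h" and c="grid_cost w"])
    show "grid_cost w i \<in> borel_measurable borel" for i
      unfolding grid_cost_def[abs_def] using w by measurable
    show "grid_cost w (N - k) (x + B (real k * h) \<omega>) \<le> grid_value w h (N - k) (x + B (real k * h) \<omega>)"
      if "k < N" "\<kappa> \<omega> = k" for k \<omega>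
      using \<kappa>P[of \<omega>] that unfolding Suc_diff_Suc[OF that(1), symmetric] by (simp add: grid_cost_def P_def Y_def)
    show "heat h (grid_value w h (N - Suc k)) (x + B (real k * h) \<omega>) \<le> grid_value w h (N - k) (x + B (real k * h) \<omega>)"
      if "k < N" "k < \<kappa> \<omega>" for k \<omega>
      using before[OF that(2)] unfolding Suc_diff_Suc[OF that(1), symmetric] by (simp add: P_def Y_def)
    show "grid_value w h i \<in> borel_measurable borel" for i by (rule grid_value_measurable[OF w])
  qed (use h \<kappa>_le sets in \<open>simp_all add: grid_cost_def\<close>)
  moreover have "stop_value w (ereal t) x \<le> (\<integral>\<^sup>+\<omega>. ennreal (cost w (ereal t) x (\<lambda>\<omega>. real (\<kappa> \<omega>) * h) \<omega>) \<partial>M)"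
    unfolding stop_value_def
  proof (intro INF_lower CollectI conjI ballI)
    show "ereal (real (\<kappa> \<omega>) * h) \<le> ereal t" for \<omega>
      using mult_right_mono[of "real (\<kappa> \<omega>)" "real N" h] \<kappa>_le[of \<omega>] h Nh by simp
    show "stop_real (\<lambda>\<omega>. real (\<kappa> \<omega>) * h)"
      unfolding stopping_time_real_def
    proof (intro conjI ballI allI impI)
      show "0 \<le> real (\<kappa> \<omega>) * h" for \<omega> using h by simp
      fix s :: real assume s: "0 \<le> s"
      \<comment> \<open>Whether the grid strategy has stopped by time \<open>s\<close> is decided at
        the last grid point up to \<open>s\<close>, which has index \<open>m\<close>.\<close>
      define m where "m = nat \<lfloor>s / h\<rfloor>"
      have m: "real k * h \<le> s \<longleftrightarrow> k \<le> m" for k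
      proof -
        have "real k * h \<le> s \<longleftrightarrow> real k \<le> s / h" using h by (simp add: pos_le_divide_eq)
        also have "\<dots> \<longleftrightarrow> k \<le> m" unfolding m_def using s h by (simp add: le_nat_iff le_floor_iff)
        finally show ?thesis .
      qed
      show "{\<omega>\<in>space M. real (\<kappa> \<omega>) * h \<le> s} \<in> sets (F s)"
      proof (cases "m < N")
        case True
        have "space M - {\<omega>\<in>space M. m < \<kappa> \<omega>} \<in> sets (F (real m * h))"
          using sets.compl_sets[OF sets[OF True]] space_F[of "real m * h"] h by simp
        moreover have "space M - {\<omega>\<in>space M. m < \<kappa> \<omega>} = {\<omega>\<in>space M. real (\<kappa> \<omega>) * h \<le> s}"
          unfolding m by auto
        moreover have "real m * h \<le> s" using m[of m] by simp
        ultimately show ?thesis using F_mono[of "real m * h" s] h by (metis less_imp_le mult_nonneg_nonneg of_nat_0_le_iff)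
      next
        case False
        then have "{\<omega>\<in>space M. real (\<kappa> \<omega>) * h \<le> s} = space (F s)"
          unfolding m using \<kappa>_le[THEN le_trans, of m] space_F[OF s] by simp
        then show ?thesis by simp
      qed
    qed
  qed
  moreover have "ennreal (cost w (ereal t) x (\<lambda>\<omega>. real (\<kappa> \<omega>) * h) \<omega>) = grid_cost w (N - \<kappa> \<omega>) (x + B (real (\<kappa> \<omega>) * h) \<omega>)" for \<omega>
  proof -
    have "real (\<kappa> \<omega>) * h < t \<longleftrightarrow> \<kappa> \<omega> < N" using h unfolding Nh[symmetric] by simp
    then show ?thesis unfolding cost_def grid_cost_def by simp
  qed
  ultimately show ?thesis unfolding N_def[symmetric] h_def[symmetric] by simp
qed

text \<open>Rounding \<sigma> up to the grid gives a grid strategy. This may turn an early stop into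
  one at the horizon, but there the cost is only the absolute value; otherwise the costs, being
  1-Lipschitz, change by at most the displacement of the path.\<close>

lemma grid_value_approx:
  assumes w: "\<And>y. \<bar>y\<bar> \<le> w y" "\<And>y z. w y - w z \<le> \<bar>y - z\<bar>" "w \<in> borel_measurable borel" and t: "0 < t"
    and \<sigma>: "stop_real \<sigma>" "\<And>\<omega>. \<omega> \<in> space M \<Longrightarrow> \<sigma> \<omega> \<le> t"
  shows "grid_value w (t / 2 ^ n) (2 ^ n) x
    \<le> (\<integral>\<^sup>+\<omega>. ennreal (cost w (ereal t) x \<sigma> \<omega>) \<partial>M)
      + (\<integral>\<^sup>+\<omega>. ennreal (norm (B (\<sigma> \<omega>) \<omega> - B (t * dyadic_up n (\<sigma> \<omega> / t)) \<omega>)) \<partial>M)"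
proof -
  define N :: nat where "N = 2 ^ n"
  define h where "h = t / 2 ^ n"
  have h: "0 < h" and Nh: "real N * h = t" using t by (simp_all add: h_def N_def)
  define \<kappa> where "\<kappa> \<omega> = nat \<lceil>2 ^ n * (\<sigma> \<omega> / t)\<rceil>" for \<omega>
  have scale: "2 ^ n * (\<sigma> \<omega> / t) = \<sigma> \<omega> / h" for \<omega> by (simp add: h_def)
  have less: "k < \<kappa> \<omega> \<longleftrightarrow> real k * h < \<sigma> \<omega>" for k \<omega>
  proof -
    have "k < \<kappa> \<omega> \<longleftrightarrow> real k < \<sigma> \<omega> / h" unfolding \<kappa>_def scale by (simp add: zless_nat_eq_int_zless less_ceiling_iff)
    then show ?thesis using h by (simp add: pos_less_divide_eq)
  qed
  have \<kappa>_le: "\<kappa> \<omega> \<le> N" if "\<omega> \<in> space M" for \<omega>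
    using less[of N \<omega>] \<sigma>(2)[OF that] Nh by simp
  have up: "real (\<kappa> \<omega>) * h = t * dyadic_up n (\<sigma> \<omega> / t)" if "\<omega> \<in> space M" for \<omega>
    using dyadic_up_nat[of "\<sigma> \<omega> / t" n] stop_real_nonneg[OF \<sigma>(1) that] t by (simp add: \<kappa>_def h_def)
  note meas_\<sigma> = stop_real_measurable[OF \<sigma>(1)]
  note [measurable] = meas_\<sigma> B_at_measurable[OF meas_\<sigma> stop_real_nonneg[OF \<sigma>(1)]] w(3)
  have [measurable]: "(\<lambda>\<omega>. B (t * dyadic_up n (\<sigma> \<omega> / t)) \<omega>) \<in> borel_measurable M"
  proof (rule B_at_measurable)
    show "(\<lambda>\<omega>. t * dyadic_up n (\<sigma> \<omega> / t)) \<in> borel_measurable M" unfolding dyadic_up_def by measurable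
    show "0 \<le> t * dyadic_up n (\<sigma> \<omega> / t)" if "\<omega> \<in> space M" for \<omega>
      using up[OF that] h by (metis of_nat_0_le_iff less_imp_le mult_nonneg_nonneg)
  qed
  have "grid_value w h N x \<le> (\<integral>\<^sup>+\<omega>. grid_cost w (N - \<kappa> \<omega>) (x + B (real (\<kappa> \<omega>) * h) \<omega>) \<partial>M)"
  proof (rule grid_value_le[OF w(3) less_imp_le[OF h] \<kappa>_le])
    fix k
    have "space M - {\<omega>\<in>space M. \<sigma> \<omega> \<le> real k * h} \<in> sets (F (real k * h))"
      using sets.compl_sets[OF stop_real_sets[OF \<sigma>(1), of "real k * h"]] h by (simp add: space_F)
    moreover have "space M - {\<omega>\<in>space M. \<sigma> \<omega> \<le> real k * h} = {\<omega>\<in>space M. k < \<kappa> \<omega>}" unfolding less by auto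
    ultimately show "{\<omega>\<in>space M. k < \<kappa> \<omega>} \<in> sets (F (real k * h))" by simp
  qed
  also have "\<dots> \<le> (\<integral>\<^sup>+\<omega>. ennreal (cost w (ereal t) x \<sigma> \<omega>) + ennreal (norm (B (\<sigma> \<omega>) \<omega> - B (t * dyadic_up n (\<sigma> \<omega> / t)) \<omega>)) \<partial>M)"
  proof (rule nn_integral_mono)
    fix \<omega> assume \<omega>: "\<omega> \<in> space M"
    let ?y = "x + B (\<sigma> \<omega>) \<omega>" and ?z = "x + B (real (\<kappa> \<omega>) * h) \<omega>"
    have lt: "\<sigma> \<omega> < t" if "\<kappa> \<omega> < N"
    proof -
      have "\<sigma> \<omega> \<le> real (\<kappa> \<omega>) * h" using less[of "\<kappa> \<omega>" \<omega>] by simp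
      also have "\<dots> < real N * h" using that h by simp
      finally show ?thesis unfolding Nh .
    qed
    have c: "\<bar>?y\<bar> \<le> cost w (ereal t) x \<sigma> \<omega>" using w(1) by (simp add: cost_def)
    have "(if N - \<kappa> \<omega> = 0 then \<bar>?z\<bar> else w ?z) \<le> cost w (ereal t) x \<sigma> \<omega> + \<bar>?y - ?z\<bar>"
    proof (cases "\<kappa> \<omega> < N")
      case True
      then have "cost w (ereal t) x \<sigma> \<omega> = w ?y" using lt by (simp add: cost_def)
      then show ?thesis using True w(2)[of ?z ?y] by (simp add: abs_minus_commute)
    next
      case False
      then show ?thesis using c by simp
    qed
    moreover have "0 \<le> cost w (ereal t) x \<sigma> \<omega>" using c by simp
    ultimately show "grid_cost w (N - \<kappa> \<omega>) ?z
      \<le> ennreal (cost w (ereal t) x \<sigma> \<omega>) + ennreal (norm (B (\<sigma> \<omega>) \<omega> - B (t * dyadic_up n (\<sigma> \<omega> / t)) \<omega>))"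
      unfolding grid_cost_def up[OF \<omega>, symmetric] by (simp add: ennreal_plus[symmetric] ennreal_leI del: ennreal_plus)
  qed
  also have "\<dots> = (\<integral>\<^sup>+\<omega>. ennreal (cost w (ereal t) x \<sigma> \<omega>) \<partial>M)
      + (\<integral>\<^sup>+\<omega>. ennreal (norm (B (\<sigma> \<omega>) \<omega> - B (t * dyadic_up n (\<sigma> \<omega> / t)) \<omega>)) \<partial>M)"
    unfolding cost_def by (rule nn_integral_add) measurable
  finally show ?thesis unfolding N_def h_def .
qed

text \<open>Grid strategies give one inequality. For the other, the rounding error tends to 0 in
  mean by dominated convergence, for which the crude bound 2t on the rounded time is enough.\<close>

lemma stop_value_finite:
  assumes w: "\<And>y. \<bar>y\<bar> \<le> w y" "\<And>y z. w y - w z \<le> \<bar>y - z\<bar>" "w \<in> borel_measurable borel" and t: "0 < t"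
  shows "stop_value w (ereal t) x = (INF n. grid_value w (t / 2 ^ n) (2 ^ n) x)"
proof (rule antisym)
  show "stop_value w (ereal t) x \<le> (INF n. grid_value w (t / 2 ^ n) (2 ^ n) x)"
    by (intro INF_greatest stop_value_le_grid w t)
  show "(INF n. grid_value w (t / 2 ^ n) (2 ^ n) x) \<le> stop_value w (ereal t) x"
    unfolding stop_value_def
  proof (rule INF_greatest)
    fix \<sigma> assume "\<sigma> \<in> {\<sigma>. stop_real \<sigma> \<and> (\<forall>\<omega>\<in>space M. ereal (\<sigma> \<omega>) \<le> ereal t)}"
    then have \<sigma>: "stop_real \<sigma>" "\<And>\<omega>. \<omega> \<in> space M \<Longrightarrow> \<sigma> \<omega> \<le> t" by simp_all
    note nn = stop_real_nonneg[OF \<sigma>(1)]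
    define \<sigma>' where "\<sigma>' n \<omega> = t * dyadic_up n (\<sigma> \<omega> / t)" for n \<omega>
    have \<sigma>'_nn: "0 \<le> \<sigma>' n \<omega>" if "\<omega> \<in> space M" for n \<omega>
      using order_trans[OF divide_nonneg_pos[OF nn[OF that] t] dyadic_up_ge] t by (simp add: \<sigma>'_def)
    have \<sigma>'_le: "\<sigma>' n \<omega> \<le> 2 * t" if "\<omega> \<in> space M" for n \<omega>
    proof -
      have "dyadic_up n (\<sigma> \<omega> / t) \<le> \<sigma> \<omega> / t + 1 / 2 ^ n" by (rule dyadic_up_le)
      also have "\<dots> \<le> 1 + 1" using \<sigma>(2)[OF that] t by (intro add_mono) (simp_all add: divide_le_eq)
      finally show ?thesis unfolding \<sigma>'_def using t by simp
    qed
    obtain D where D: "integrable M D" "\<And>u \<omega>. \<omega> \<in> space M \<Longrightarrow> 0 \<le> u \<Longrightarrow> u \<le> 2 * t \<Longrightarrow> \<bar>B u \<omega>\<bar> \<le> D \<omega>"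
      by (rule dominating[of "2 * t"]) (use t in auto)
    note ms = stop_real_measurable[OF \<sigma>(1)]
    have lim: "(\<lambda>n. \<integral>\<^sup>+\<omega>. ennreal (norm (B (\<sigma> \<omega>) \<omega> - B (\<sigma>' n \<omega>) \<omega>)) \<partial>M) \<longlonglongrightarrow> 0"
    proof (rule nn_integral_dominated_convergence_norm[where w=D])
      show "(\<lambda>\<omega>. B (\<sigma>' n \<omega>) \<omega>) \<in> borel_measurable M" for n
        by (rule B_at_measurable) (use ms \<sigma>'_nn in \<open>simp_all add: \<sigma>'_def dyadic_up_def\<close>)
      show "(\<lambda>\<omega>. B (\<sigma> \<omega>) \<omega>) \<in> borel_measurable M" by (rule B_at_measurable[OF ms nn])
      show "AE \<omega> in M. norm (B (\<sigma>' n \<omega>) \<omega>) \<le> D \<omega>" for n using D(2) \<sigma>'_nn \<sigma>'_le by (intro AE_I2) simp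
      show "D \<in> borel_measurable M" using D(1) by (rule borel_measurable_integrable)
      show "(\<integral>\<^sup>+\<omega>. ennreal (D \<omega>) \<partial>M) < \<infinity>"
      proof (rule le_less_trans)
        show "(\<integral>\<^sup>+\<omega>. ennreal (D \<omega>) \<partial>M) \<le> (\<integral>\<^sup>+\<omega>. ennreal (norm (D \<omega>)) \<partial>M)"
          by (intro nn_integral_mono ennreal_leI) simp
        show "(\<integral>\<^sup>+\<omega>. ennreal (norm (D \<omega>)) \<partial>M) < \<infinity>" using D(1) by (simp add: integrable_iff_bounded)
      qed
      show "AE \<omega> in M. (\<lambda>n. B (\<sigma>' n \<omega>) \<omega>) \<longlonglongrightarrow> B (\<sigma> \<omega>) \<omega>"
      proof (rule AE_I2)
        fix \<omega> assume \<omega>: "\<omega> \<in> space M"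
        have "(\<lambda>n. \<sigma>' n \<omega>) \<longlonglongrightarrow> t * (\<sigma> \<omega> / t)" unfolding \<sigma>'_def by (intro tendsto_intros dyadic_up_tendsto)
        then have "(\<lambda>n. \<sigma>' n \<omega>) \<longlonglongrightarrow> \<sigma> \<omega>" using t by simp
        then show "(\<lambda>n. B (\<sigma>' n \<omega>) \<omega>) \<longlonglongrightarrow> B (\<sigma> \<omega>) \<omega>"
          using \<sigma>'_nn[OF \<omega>] nn[OF \<omega>] by (intro continuous_on_LIMSEQ[OF B_cont[OF \<omega>]]) auto
      qed
    qed
    show "(INF n. grid_value w (t / 2 ^ n) (2 ^ n) x) \<le> (\<integral>\<^sup>+\<omega>. ennreal (cost w (ereal t) x \<sigma> \<omega>) \<partial>M)"
    proof (rule LIMSEQ_le_const)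
      show "(\<lambda>n. (\<integral>\<^sup>+\<omega>. ennreal (cost w (ereal t) x \<sigma> \<omega>) \<partial>M) + (\<integral>\<^sup>+\<omega>. ennreal (norm (B (\<sigma> \<omega>) \<omega> - B (\<sigma>' n \<omega>) \<omega>)) \<partial>M))
        \<longlonglongrightarrow> (\<integral>\<^sup>+\<omega>. ennreal (cost w (ereal t) x \<sigma> \<omega>) \<partial>M)"
        using tendsto_add[OF tendsto_const lim] by simp
      show "\<exists>n0. \<forall>n\<ge>n0. (INF n. grid_value w (t / 2 ^ n) (2 ^ n) x)
        \<le> (\<integral>\<^sup>+\<omega>. ennreal (cost w (ereal t) x \<sigma> \<omega>) \<partial>M) + (\<integral>\<^sup>+\<omega>. ennreal (norm (B (\<sigma> \<omega>) \<omega> - B (\<sigma>' n \<omega>) \<omega>)) \<partial>M)"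
        (is "\<exists>n0. \<forall>n\<ge>n0. _ \<le> ?R n")
      proof (intro exI allI impI)
        fix n :: nat
        have "(INF n. grid_value w (t / 2 ^ n) (2 ^ n) x) \<le> grid_value w (t / 2 ^ n) (2 ^ n) x" by (rule INF_lower) simp
        also have "\<dots> \<le> ?R n" unfolding \<sigma>'_def by (rule grid_value_approx[OF w t \<sigma>])
        finally show "(INF n. grid_value w (t / 2 ^ n) (2 ^ n) x) \<le> ?R n" .
      qed
    qed
  qed
qed

text \<open>Until the hit the path stays on one side of \<open>a\<close>; having mean zero, it then
  has first absolute moment at most 2|a|, and \<open>stop_ext_finite_if_bounded\<close>
  applies.\<close>

lemma level_hit:
  obtains \<sigma> where "stop_real \<sigma>" "AE \<omega> in M. B (\<sigma> \<omega>) \<omega> = a"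
proof -
  define \<tau> where "\<tau> \<omega> = first_time (\<lambda>s. \<bar>B s \<omega> - a\<bar>)" for \<omega>
  have cont: "continuous_on {0..} (\<lambda>s. \<bar>B s \<omega> - a\<bar>)" if "\<omega> \<in> space M" for \<omega>
    by (intro continuous_intros B_cont[OF that])
  have st: "stop_ext \<tau>"
    unfolding \<tau>_def
  proof (rule stop_ext_first_time)
    fix u s :: real assume "0 \<le> u" "u \<le> s"
    note [measurable] = B_adapted[OF this]
    show "(\<lambda>\<omega>. \<bar>B u \<omega> - a\<bar>) \<in> borel_measurable (F s)" by measurable
  qed (rule cont)
  \<comment> \<open>The sign of \<open>a\<close>, which turns both positions of the level into an
    upper bound.\<close>
  define e :: real where "e = (if 0 \<le> a then 1 else -1)"
  have ea: "e * a = \<bar>a\<bar>" and ee: "e * e = 1" by (simp_all add: e_def)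
  have side: "e * B (trunc \<tau> t \<omega>) \<omega> \<le> \<bar>a\<bar>" if \<omega>: "\<omega> \<in> space M" and t: "0 \<le> t" for t \<omega>
  proof (rule ccontr)
    let ?u = "trunc \<tau> t \<omega>"
    assume "\<not> ?thesis"
    then have gt: "\<bar>a\<bar> < e * B ?u \<omega>" by simp
    have u: "0 \<le> ?u" using stop_real_nonneg[OF stop_ext_trunc[OF st t] \<omega>] .
    have c: "continuous_on {0..?u} (\<lambda>s. e * B s \<omega>)"
      by (intro continuous_intros continuous_on_subset[OF B_cont[OF \<omega>]]) auto
    obtain v where v: "0 \<le> v" "v \<le> ?u" "e * B v \<omega> = \<bar>a\<bar>"
      using IVT'[of "\<lambda>s. e * B s \<omega>" 0 "\<bar>a\<bar>" ?u, OF _ _ u c] gt B_0[OF \<omega>] by auto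
    have "e * (e * B v \<omega>) = e * (e * a)" using v(3) ea by simp
    then have va: "B v \<omega> = a" unfolding mult.assoc[symmetric] ee by simp
    have "\<tau> \<omega> \<le> ereal v" unfolding \<tau>_def first_time_le_iff[OF cont[OF \<omega>] v(1)] using va v(1) by auto
    then have "?u \<le> v" using stop_ext_nonneg[OF st \<omega>] by (cases "\<tau> \<omega>") (auto simp: min_def)
    then have "?u = v" using v(2) by simp
    then show False using gt v(3) by simp
  qed
  have "expectation (\<lambda>\<omega>. \<bar>B (trunc \<tau> t \<omega>) \<omega>\<bar>) \<le> 2 * \<bar>a\<bar>" if t: "0 \<le> t" for t
  proof -
    have i: "integrable M (\<lambda>\<omega>. B (trunc \<tau> t \<omega>) \<omega>)" by (rule integrable_trunc[OF st t])
    have "expectation (\<lambda>\<omega>. \<bar>B (trunc \<tau> t \<omega>) \<omega>\<bar>) \<le> expectation (\<lambda>\<omega>. 2 * \<bar>a\<bar> - e * B (trunc \<tau> t \<omega>) \<omega>)"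
    proof (rule integral_mono)
      fix \<omega> assume "\<omega> \<in> space M"
      note side[OF this t]
      then show "\<bar>B (trunc \<tau> t \<omega>) \<omega>\<bar> \<le> 2 * \<bar>a\<bar> - e * B (trunc \<tau> t \<omega>) \<omega>"
        unfolding e_def by (cases "0 \<le> a") auto
    qed (use i in auto)
    also have "\<dots> = 2 * \<bar>a\<bar>"
      using i expectation_B_stop[OF stop_ext_trunc[OF st t] trunc_le[OF st _ t]] by (simp add: prob_space)
    finally show ?thesis .
  qed
  then have fin: "AE \<omega> in M. \<tau> \<omega> < \<infinity>" by (rule stop_ext_finite_if_bounded[OF st])
  show thesis
  proof (rule that)
    show "stop_real (\<lambda>\<omega>. real_of_ereal (\<tau> \<omega>))"
      unfolding stopping_time_real_def
    proof (intro conjI ballI allI impI)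
      show "0 \<le> real_of_ereal (\<tau> \<omega>)" if "\<omega> \<in> space M" for \<omega>
        using stop_ext_nonneg[OF st that] by (rule real_of_ereal_pos)
      fix s :: real assume s: "0 \<le> s"
      \<comment> \<open>\<open>real_of_ereal\<close> sends infinity to 0, so the null set where the
        level is never hit enters every event {\<sigma> \<le> s}; completeness of the filtration
        puts it into \<open>F 0\<close>.\<close>
      let ?N = "{\<omega>\<in>space M. \<tau> \<omega> = \<infinity>}"
      have "AE \<omega> in M. \<omega> \<notin> ?N" using fin by eventually_elim auto
      moreover note [measurable] = stop_ext_measurable[OF st]
      have "?N \<in> sets M" by measurable
      ultimately have N: "?N \<in> null_sets M" by (simp add: AE_iff_null_sets)
      have "\<forall>N\<in>null_sets M. \<forall>A. A \<subseteq> N \<longrightarrow> A \<in> sets (F 0)"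
        using usual unfolding filtration_usual_def by (elim conjE)
      from spec[OF bspec[OF this N], of ?N] have "?N \<in> sets (F 0)" by simp
      then have "?N \<in> sets (F s)" by (rule F_mono[OF order_refl s])
      then have "{\<omega>\<in>space M. \<tau> \<omega> \<le> ereal s} \<union> ?N \<in> sets (F s)" by (rule sets.Un[OF stop_ext_sets[OF st s]])
      moreover have "{\<omega>\<in>space M. real_of_ereal (\<tau> \<omega>) \<le> s} = {\<omega>\<in>space M. \<tau> \<omega> \<le> ereal s} \<union> ?N"
      proof (intro set_eqI)
        fix \<omega> show "\<omega> \<in> {\<omega>\<in>space M. real_of_ereal (\<tau> \<omega>) \<le> s} \<longleftrightarrow> \<omega> \<in> {\<omega>\<in>space M. \<tau> \<omega> \<le> ereal s} \<union> ?N"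
          using stop_ext_nonneg[OF st, of \<omega>] s by (cases "\<tau> \<omega>") auto
      qed
      ultimately show "{\<omega>\<in>space M. real_of_ereal (\<tau> \<omega>) \<le> s} \<in> sets (F s)" by simp
    qed
    show "AE \<omega> in M. B (real_of_ereal (\<tau> \<omega>)) \<omega> = a"
      using fin AE_space
    proof eventually_elim
      case (elim \<omega>)
      then obtain r where r: "\<tau> \<omega> = ereal r" using stop_ext_nonneg[OF st elim(2)] by (cases "\<tau> \<omega>") auto
      have "\<bar>B r \<omega> - a\<bar> \<le> 0" using first_time_attained[OF cont[OF elim(2)] r[unfolded \<tau>_def]] .
      then show ?case by (simp add: r)
    qed
  qed
qed

text \<open>With infinite horizon every finite stopping time pays \<open>w\<close>, and since every
  level is hit, the cost can be made \<open>w y\<close> for any y from any starting point.\<close>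

lemma stop_value_infinity: "stop_value w \<infinity> x = (INF y. ennreal (w y))"
proof (rule antisym)
  show "(INF y. ennreal (w y)) \<le> stop_value w \<infinity> x"
    unfolding stop_value_def
  proof (rule INF_greatest)
    fix \<sigma>
    have "(INF y. ennreal (w y)) = (\<integral>\<^sup>+\<omega>. (INF y. ennreal (w y)) \<partial>M)" by (simp add: emeasure_space_1)
    also have "\<dots> \<le> (\<integral>\<^sup>+\<omega>. ennreal (cost w \<infinity> x \<sigma> \<omega>) \<partial>M)"
      unfolding cost_def by (intro nn_integral_mono) (auto intro: INF_lower)
    finally show "(INF y. ennreal (w y)) \<le> (\<integral>\<^sup>+\<omega>. ennreal (cost w \<infinity> x \<sigma> \<omega>) \<partial>M)" .
  qed
  show "stop_value w \<infinity> x \<le> (INF y. ennreal (w y))"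
  proof (rule INF_greatest)
    fix y
    obtain \<sigma> where \<sigma>: "stop_real \<sigma>" "AE \<omega> in M. B (\<sigma> \<omega>) \<omega> = y - x" by (rule level_hit)
    have "stop_value w \<infinity> x \<le> (\<integral>\<^sup>+\<omega>. ennreal (cost w \<infinity> x \<sigma> \<omega>) \<partial>M)"
      unfolding stop_value_def using \<sigma>(1) by (intro INF_lower) simp
    also have "\<dots> = (\<integral>\<^sup>+\<omega>. ennreal (w y) \<partial>M)"
      by (rule nn_integral_cong_AE) (use \<sigma>(2) in \<open>eventually_elim, simp add: cost_def\<close>)
    also have "\<dots> = ennreal (w y)" by (simp add: emeasure_space_1)
    finally show "stop_value w \<infinity> x \<le> ennreal (w y)" .
  qed
qed

text \<open>Three horizons: at 0 only immediate stopping is possible; for a positive finite one the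
  grid values scale exactly; for an infinite one the substitution y / sqrt l runs through all
  levels.\<close>

lemma stop_value_scaled:
  assumes w: "\<And>y. \<bar>y\<bar> \<le> w y" "\<And>y z. w y - w z \<le> \<bar>y - z\<bar>" "w \<in> borel_measurable borel" and l: "0 < l" and t: "0 \<le> t"
  shows "stop_value (\<lambda>y. sqrt l * w (y / sqrt l)) t x = ennreal (sqrt l) * stop_value w (t / ereal l) (x / sqrt l)"
proof -
  let ?w = "\<lambda>y. sqrt l * w (y / sqrt l)"
  have s: "0 < sqrt l" using l by simp
  consider "t = 0" | r where "t = ereal r" "0 < r" | "t = \<infinity>" using t by (cases t) (auto simp: less_le zero_ereal_def)
  then show ?thesis
  proof cases
    case 1
    then show ?thesis using l by (simp add: stop_value_0 ennreal_mult[symmetric])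
  next
    case (2 r)
    have w': "\<bar>y\<bar> \<le> ?w y" "?w y - ?w z \<le> \<bar>y - z\<bar>" for y z
    proof -
      show "\<bar>y\<bar> \<le> ?w y" using mult_left_mono[OF w(1)[of "y / sqrt l"], of "sqrt l"] s by simp
      have "sqrt l * (w (y / sqrt l) - w (z / sqrt l)) \<le> sqrt l * \<bar>y / sqrt l - z / sqrt l\<bar>"
        using w(2) s by (intro mult_left_mono) simp_all
      also have "\<dots> = \<bar>y - z\<bar>" using s by (simp add: diff_divide_distrib[symmetric])
      finally show "?w y - ?w z \<le> \<bar>y - z\<bar>" by (simp add: right_diff_distrib)
    qed
    have m: "?w \<in> borel_measurable borel" using w(3) by measurable
    have g: "grid_value ?w (r / 2 ^ n) (2 ^ n) x = ennreal (sqrt l) * grid_value w (r / l / 2 ^ n) (2 ^ n) (x / sqrt l)" for n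
      using grid_value_scale[OF l w(3), of "r / l / 2 ^ n" "2 ^ n" x] l by simp
    have "stop_value ?w (ereal r) x = (INF n. grid_value ?w (r / 2 ^ n) (2 ^ n) x)"
      by (rule stop_value_finite[OF w' m 2(2)])
    also have "\<dots> = ennreal (sqrt l) * (INF n. grid_value w (r / l / 2 ^ n) (2 ^ n) (x / sqrt l))"
      unfolding g by (rule ennreal_INF_mult_left[OF s])
    also have "(INF n. grid_value w (r / l / 2 ^ n) (2 ^ n) (x / sqrt l)) = stop_value w (ereal (r / l)) (x / sqrt l)"
      by (rule stop_value_finite[OF w, symmetric]) (use 2 l in simp)
    finally show ?thesis using 2 l by simp
  next
    case 3
    have r: "range (\<lambda>y. y / sqrt l) = UNIV"
    proof (intro set_eqI iffI UNIV_I)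
      fix z show "z \<in> range (\<lambda>y. y / sqrt l)" using s by (intro image_eqI[where x="z * sqrt l"]) simp_all
    qed
    have "(INF y. ennreal (?w y)) = (INF y. ennreal (sqrt l) * ennreal (w (y / sqrt l)))"
      using s by (simp add: ennreal_mult')
    also have "\<dots> = ennreal (sqrt l) * (INF y. ennreal (w (y / sqrt l)))" by (rule ennreal_INF_mult_left[OF s])
    also have "(INF y. ennreal (w (y / sqrt l))) = (INF y\<in>range (\<lambda>y. y / sqrt l). ennreal (w y))"
      by (simp add: image_image)
    finally show ?thesis using 3 l unfolding r by (simp add: stop_value_infinity)
  qed
qed

lemma u_fun_scaled:
  assumes \<mu>: "integrable_law \<mu>" and mean: "(\<integral>y. y \<partial>\<mu>) = 0" and l: "0 < l" and t: "0 \<le> t"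
  shows "u_fun M F B \<mu> l t x = ereal (sqrt l) * u_fun M F B \<mu> 1 (t / ereal l) (x / ereal (sqrt l))"
proof (cases x)
  case (real y)
  interpret L: integrable_law \<mu> by fact
  let ?w = "\<lambda>y. - potential (scaled_measure \<mu> 1) y"
  have lip: "?w y - ?w z \<le> \<bar>y - z\<bar>" for y z using L.potential_lipschitz[of 1 z y] by (simp add: abs_minus_commute)
  have "\<bar>?w y - ?w z\<bar> \<le> \<bar>y - z\<bar>" for y z using lip[of y z] lip[of z y] by linarith
  then have "continuous_on UNIV ?w"
    unfolding continuous_on_iff dist_real_def by (meson le_less_trans)
  then have m: "?w \<in> borel_measurable borel" by (rule borel_measurable_continuous_onI)
  have "(\<lambda>y. - potential (scaled_measure \<mu> l) y) = (\<lambda>y. sqrt l * ?w (y / sqrt l))"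
    using L.potential_scaled_scale[OF l] by (intro ext) simp
  then have "u_real M F B \<mu> l t y = - enn2ereal (ennreal (sqrt l) * stop_value ?w (t / ereal l) (y / sqrt l))"
    unfolding u_real_eq_stop_value
    using stop_value_scaled[of ?w, OF L.abs_le_potential[OF mean] lip m l t] by simp
  also have "\<dots> = ereal (sqrt l) * u_real M F B \<mu> 1 (t / ereal l) (y / sqrt l)"
    unfolding u_real_eq_stop_value using l by (simp add: times_ennreal.rep_eq enn2ereal_ennreal)
  finally show ?thesis using real l by (simp add: u_fun_def)
\<comment> \<open>For infinite \<open>x\<close> both sides are minus infinity, since positive
  scaling preserves infinities.\<close>
qed (use l in \<open>simp_all add: u_fun_def\<close>)

end

theorem theorem2p4:
  fixes M :: "'a measure" and F :: "real \<Rightarrow> 'a measure" and B :: "real \<Rightarrow> 'a \<Rightarrow> real"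
    and \<mu> :: "real measure"
  assumes "filtration_usual M F"
    and "brownian_motion M F B"
    and "prob_space \<mu>" and "sets \<mu> = sets borel"
    and "integrable \<mu> (\<lambda>y. y)" and "(\<integral>y. y \<partial>\<mu>) = 0"
  shows "(\<forall>lam>0. \<forall>t\<ge>0. \<forall>x.
            u_fun M F B \<mu> lam t x
            = ereal (sqrt lam) * u_fun M F B \<mu> 1 (t / ereal lam) (x / ereal (sqrt lam)))
       \<and> (\<forall>lam>0. \<forall>x.
            root_barrier_fun M F B \<mu> lam x
            = ereal lam * root_barrier_fun M F B \<mu> 1 (x / ereal (sqrt lam)))"
proof -
  interpret brownian M F B using assms(1,2) by unfold_locales
  have "integrable_law \<mu>"
    using assms(3,4,5) by (simp add: integrable_law_def integrable_law_axioms_def)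
  then show ?thesis using u_fun_scaled root_barrier_fun_scaled assms(6) by blast
qed

end
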